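(* Let $R$ be a commutative Noetherian ring, let $I$ be a (proper) FKH ideal of $R$, and let $\boldsymbol{x}=x_1,\dots,x_e$ be a system of generators of $I$ such that the Koszul complex $K(\boldsymbol{x})$ of $R$ on $\boldsymbol{x}$ is a quasi-projective resolution of $R/I$. Let $M$ be an $R$-module and $n\ge1$ an integer. Set $g=\min\{\operatorname{grade} I,\operatorname{grade}(I,M)\}$. (1) One has $\operatorname{qpd}_R(R/I)=\operatorname{grade} I$. (2) If $\operatorname{Tor}^R_i(R/I,M)=0$ for all $n\leq i \leq e-g+n$, then $\operatorname{Tor}^R_i(R/I,M)=0$ for all $i\geq n$.
   Context: For a complex $X$ of $R$-modules put $\sup X=\sup\{i: X_i\neq 0\}$, $\inf X=\inf\{i: X_i\neq0\}$ and $\operatorname{hsup}X=\sup\{i: H_i(X)\neq0\}$. A quasi-projective resolution of an $R$-module $M$ is a bounded below complex $P$ of projective $R$-modules such that for all $i\ge\inf P$ there are integers $a_i\ge0$, not all zero, with $H_i(P)\cong M^{\oplus a_i}$; it is finite if $P$ is bounded. For $M\neq0$, $\operatorname{qpd}_RM=\inf\{\sup P-\operatorname{hsup}P : P \text{ a finite quasi-projective resolution of } M\}$ (which is $\infty$ if no such $P$ exists), and $\operatorname{qpd}_R0=-\infty$. A proper ideal $I$ is an FKH ideal (ideal with free Koszul homology) if the Koszul complex of $R$ on some system of generators of $I$ is a quasi-projective resolution of $R/I$, i.e. all its homologies are free $R/I$-modules. $\operatorname{grade}(I,M)=\inf\{i:\operatorname{Ext}^i_R(R/I,M)\ne0\}$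 (possibly $\infty$), and $\operatorname{grade}I=\operatorname{grade}(I,R)$. *)

theory Defs
  imports "HOL-Algebra.Algebra" "HOL-Library.Extended_Real"
begin

section \<open>Modules\<close>

text \<open>
  Modules are the records of HOL-Algebra.  Such a record extends a ring record; its
  multiplicative fields carry no meaning for modules and are left \<open>undefined\<close> below.
\<close>

definition zero_mod :: "('a, 'm, 'x) module_scheme \<Rightarrow> bool" where
  "zero_mod M \<longleftrightarrow> carrier M = {\<zero>\<^bsub>M\<^esub>}"

definition mod_hom ::
  "('a, 'r) ring_scheme \<Rightarrow> ('a, 'm, 'x) module_scheme \<Rightarrow> ('a, 'n, 'y) module_scheme \<Rightarrow> ('m \<Rightarrow> 'n) set"
where
  "mod_hom R M N = {f \<in> carrier M \<rightarrow> carrier N.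
     (\<forall>x\<in>carrier M. \<forall>y\<in>carrier M. f (x \<oplus>\<^bsub>M\<^esub> y) = f x \<oplus>\<^bsub>N\<^esub> f y) \<and>
     (\<forall>r\<in>carrier R. \<forall>x\<in>carrier M. f (r \<odot>\<^bsub>M\<^esub> x) = r \<odot>\<^bsub>N\<^esub> f x)}"

definition mod_iso ::
  "('a, 'r) ring_scheme \<Rightarrow> ('a, 'm, 'x) module_scheme \<Rightarrow> ('a, 'n, 'y) module_scheme \<Rightarrow> bool"
where
  "mod_iso R M N \<longleftrightarrow> (\<exists>f\<in>mod_hom R M N. bij_betw f (carrier M) (carrier N))"

definition regular_mod :: "('a, 'r) ring_scheme \<Rightarrow> ('a, 'a) module" where
  "regular_mod R = \<lparr>carrier = carrier R, monoid.mult = undefined, monoid.one = undefined,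
     ring.zero = \<zero>\<^bsub>R\<^esub>, ring.add = (\<oplus>\<^bsub>R\<^esub>), smult = (\<otimes>\<^bsub>R\<^esub>)\<rparr>"

definition quot_mod :: "('a, 'm, 'x) module_scheme \<Rightarrow> 'm set \<Rightarrow> ('a, 'm set) module" where
  "quot_mod M H = \<lparr>carrier = a_rcosets\<^bsub>M\<^esub> H, monoid.mult = undefined, monoid.one = undefined,
     ring.zero = H, ring.add = set_add M, smult = (\<lambda>r C. \<Union>x\<in>C. H +>\<^bsub>M\<^esub> (r \<odot>\<^bsub>M\<^esub> x))\<rparr>"

definition cyclic_mod :: "('a, 'r) ring_scheme \<Rightarrow> 'a set \<Rightarrow> ('a, 'a set) module" where
  "cyclic_mod R I = quot_mod (regular_mod R) I"

definition dsum_mod :: "('a, 'm, 'x) module_scheme \<Rightarrow> nat \<Rightarrow> ('a, nat \<Rightarrow> 'm) module" where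
  "dsum_mod M n = \<lparr>carrier = (\<Pi>\<^sub>E i\<in>{..<n}. carrier M), monoid.mult = undefined, monoid.one = undefined,
     ring.zero = (\<lambda>i\<in>{..<n}. \<zero>\<^bsub>M\<^esub>),
     ring.add = (\<lambda>f g. \<lambda>i\<in>{..<n}. f i \<oplus>\<^bsub>M\<^esub> g i),
     smult = (\<lambda>r f. \<lambda>i\<in>{..<n}. r \<odot>\<^bsub>M\<^esub> f i)\<rparr>"

text \<open>The free module on a set \<open>B\<close>: finitely supported functions, zero outside \<open>B\<close>.\<close>

definition free_mod :: "('a, 'r) ring_scheme \<Rightarrow> 'b set \<Rightarrow> ('a, 'b \<Rightarrow> 'a) module" where
  "free_mod R B = \<lparr>carrier = {f. (\<forall>x. f x \<in> carrier R) \<and> (\<forall>x. x \<notin> B \<longrightarrow> f x = \<zero>\<^bsub>R\<^esub>) \<and>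
       finite {x. f x \<noteq> \<zero>\<^bsub>R\<^esub>}},
     monoid.mult = undefined, monoid.one = undefined, ring.zero = (\<lambda>_. \<zero>\<^bsub>R\<^esub>),
     ring.add = (\<lambda>f g x. f x \<oplus>\<^bsub>R\<^esub> g x), smult = (\<lambda>r f x. r \<otimes>\<^bsub>R\<^esub> f x)\<rparr>"

definition free_gen :: "('a, 'r) ring_scheme \<Rightarrow> 'b \<Rightarrow> 'b \<Rightarrow> 'a" where
  "free_gen R b = (\<lambda>x. if x = b then \<one>\<^bsub>R\<^esub> else \<zero>\<^bsub>R\<^esub>)"

definition free_map :: "('a, 'r) ring_scheme \<Rightarrow> ('b \<Rightarrow> 'c) \<Rightarrow> ('b \<Rightarrow> 'a) \<Rightarrow> 'c \<Rightarrow> 'a" where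
  "free_map R h \<phi> = (\<lambda>y. finsum R \<phi> {x. \<phi> x \<noteq> \<zero>\<^bsub>R\<^esub> \<and> h x = y})"

definition mod_span ::
  "('a, 'r) ring_scheme \<Rightarrow> ('a, 'm) module \<Rightarrow> 'm set \<Rightarrow> 'm set"
where
  "mod_span R M S = \<Inter>{H. submodule H R M \<and> S \<subseteq> H}"

text \<open>
  Projectivity is the lifting property.  HOL cannot quantify over the carrier types of the test
  modules, but a surjection \<open>A \<rightarrow> B\<close> with \<open>A\<close> carried by \<open>'p \<Rightarrow> 'a\<close> and \<open>B\<close> by \<open>'p\<close> may be the
  canonical one from the free module on the set \<open>P\<close> onto \<open>P\<close>; hence lifting against these
  surjections already gives lifting against all surjections.
\<close>

definition projective_mod :: "('a, 'r) ring_scheme \<Rightarrow> ('a, 'p) module \<Rightarrow> bool" where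
  "projective_mod R P \<longleftrightarrow> module R P \<and>
     (\<forall>(A :: ('a, 'p \<Rightarrow> 'a) module) (B :: ('a, 'p) module) p f.
        module R A \<and> module R B \<and> p \<in> mod_hom R A B \<and> p ` carrier A = carrier B \<and>
        f \<in> mod_hom R P B \<longrightarrow>
        (\<exists>g\<in>mod_hom R P A. \<forall>x\<in>carrier P. p (g x) = f x))"


section \<open>Complexes\<close>

text \<open>Homological grading: \<open>diff K i\<close> maps \<open>obj K i\<close> to \<open>obj K (i - 1)\<close>.\<close>

record ('a, 'u) mod_complex =
  obj :: "int \<Rightarrow> ('a, 'u) module"
  diff :: "int \<Rightarrow> 'u \<Rightarrow> 'u"

definition chain_complex :: "('a, 'r) ring_scheme \<Rightarrow> ('a, 'u) mod_complex \<Rightarrow> bool" where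
  "chain_complex R K \<longleftrightarrow> (\<forall>i. module R (obj K i) \<and>
     diff K i \<in> mod_hom R (obj K i) (obj K (i - 1)) \<and>
     (\<forall>x\<in>carrier (obj K i). diff K (i - 1) (diff K i x) = \<zero>\<^bsub>obj K (i - 1 - 1)\<^esub>))"

definition cycles :: "('a, 'u) mod_complex \<Rightarrow> int \<Rightarrow> 'u set" where
  "cycles K i = {x \<in> carrier (obj K i). diff K i x = \<zero>\<^bsub>obj K (i - 1)\<^esub>}"

definition boundaries :: "('a, 'u) mod_complex \<Rightarrow> int \<Rightarrow> 'u set" where
  "boundaries K i = diff K (i + 1) ` carrier (obj K (i + 1))"

definition homology :: "('a, 'u) mod_complex \<Rightarrow> int \<Rightarrow> ('a, 'u set) module" where
  "homology K i = quot_mod ((obj K i)\<lparr>carrier := cycles K i\<rparr>) (boundaries K i)"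

definition csup :: "('a, 'u) mod_complex \<Rightarrow> ereal" where
  "csup K = Sup ((\<lambda>i. ereal (of_int i)) ` {i. \<not> zero_mod (obj K i)})"

definition cinf :: "('a, 'u) mod_complex \<Rightarrow> ereal" where
  "cinf K = Inf ((\<lambda>i. ereal (of_int i)) ` {i. \<not> zero_mod (obj K i)})"

definition hsup :: "('a, 'u) mod_complex \<Rightarrow> ereal" where
  "hsup K = Sup ((\<lambda>i. ereal (of_int i)) ` {i. \<not> zero_mod (homology K i)})"

definition bounded_below :: "('a, 'u) mod_complex \<Rightarrow> bool" where
  "bounded_below K \<longleftrightarrow> (\<exists>b. \<forall>i<b. zero_mod (obj K i))"

definition bounded_above :: "('a, 'u) mod_complex \<Rightarrow> bool" where
  "bounded_above K \<longleftrightarrow> (\<exists>b. \<forall>i>b. zero_mod (obj K i))"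


section \<open>Quasi-projective resolutions and dimension\<close>

definition quasi_projective_resolution ::
  "('a, 'r) ring_scheme \<Rightarrow> ('a, 'm) module \<Rightarrow> ('a, 'u) mod_complex \<Rightarrow> bool"
where
  "quasi_projective_resolution R M P \<longleftrightarrow>
     chain_complex R P \<and> bounded_below P \<and> (\<forall>i. projective_mod R (obj P i)) \<and>
     (\<exists>a :: int \<Rightarrow> nat.
        (\<forall>i. cinf P \<le> ereal (of_int i) \<longrightarrow> mod_iso R (homology P i) (dsum_mod M (a i))) \<and>
        (\<exists>i. cinf P \<le> ereal (of_int i) \<and> a i \<noteq> 0))"

definition finite_quasi_projective_resolution ::
  "('a, 'r) ring_scheme \<Rightarrow> ('a, 'm) module \<Rightarrow> ('a, 'u) mod_complex \<Rightarrow> bool"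
where
  "finite_quasi_projective_resolution R M P \<longleftrightarrow>
     quasi_projective_resolution R M P \<and> bounded_above P"

text \<open>
  The infimum ranges over complexes of modules carried by the type \<open>'u + ('a + 'm) list\<close>.  The
  summand \<open>('a + 'm) list\<close> has cardinality \<open>max |'a| |'m| \<aleph>\<^sub>0\<close>, and complexes of that size
  already realise the infimum over all complexes: given a finite quasi-projective resolution
  \<open>P\<close>, resolve it by free modules of rank at most that cardinal and truncate at \<open>sup P\<close>.  The
  parameter \<open>'u\<close> is there so that a result polymorphic in \<open>'u\<close> speaks about complexes of
  arbitrarily large modules.
\<close>

definition qpd :: "'u itself \<Rightarrow> ('a, 'r) ring_scheme \<Rightarrow> ('a, 'm) module \<Rightarrow> ereal" where
  "qpd _ R M = (if zero_mod M then - \<infinity>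
     else Inf {csup P - hsup P | P :: ('a, 'u + ('a + 'm) list) mod_complex.
                 finite_quasi_projective_resolution R M P})"


section \<open>The Koszul complex\<close>

text \<open>
  The degree \<open>i\<close> part is the \<open>i\<close>-th exterior power of \<open>R\<^sup>e\<close>, with basis \<open>e\<^sub>S\<close> indexed by the
  subsets \<open>S\<close> of \<open>{..<e}\<close> with \<open>i\<close> elements.  If \<open>S = {s\<^sub>0 < s\<^sub>1 < \<dots>}\<close> then the differential
  sends \<open>e\<^sub>S\<close> to \<open>\<Sum>\<^sub>k (-1)\<^sup>k x\<^bsub>s\<^sub>k\<^esub> e\<^bsub>S - {s\<^sub>k}\<^esub>\<close>; the definition below is the coefficient of
  \<open>e\<^sub>T\<close> in the image of \<open>f = \<Sum>\<^sub>S f(S) e\<^sub>S\<close>.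
\<close>

definition koszul :: "('a, 'r) ring_scheme \<Rightarrow> 'a list \<Rightarrow> ('a, nat set \<Rightarrow> 'a) mod_complex" where
  "koszul R xs = \<lparr>
     obj = (\<lambda>i. free_mod R {S. S \<subseteq> {..<length xs} \<and> int (card S) = i}),
     diff = (\<lambda>i f T. finsum R
       (\<lambda>j. ((\<ominus>\<^bsub>R\<^esub> \<one>\<^bsub>R\<^esub>) [^]\<^bsub>R\<^esub> card {k \<in> T. k < j}) \<otimes>\<^bsub>R\<^esub> (xs ! j \<otimes>\<^bsub>R\<^esub> f (insert j T)))
       ({..<length xs} - T))\<rparr>"

definition generates_ideal :: "('a, 'r) ring_scheme \<Rightarrow> 'a list \<Rightarrow> 'a set \<Rightarrow> bool" where
  "generates_ideal R xs I \<longleftrightarrow> set xs \<subseteq> carrier R \<and> genideal R (set xs) = I"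

definition FKH_ideal :: "('a, 'r) ring_scheme \<Rightarrow> 'a set \<Rightarrow> bool" where
  "FKH_ideal R I \<longleftrightarrow> ideal I R \<and> I \<noteq> carrier R \<and>
     (\<exists>xs. generates_ideal R xs I \<and>
        quasi_projective_resolution R (cyclic_mod R I) (koszul R xs))"


section \<open>Tor, Ext and grade\<close>

definition projective_resolution ::
  "('a, 'r) ring_scheme \<Rightarrow> ('a, 'n) module \<Rightarrow> ('a, 'u) mod_complex \<Rightarrow> bool"
where
  "projective_resolution R N P \<longleftrightarrow>
     chain_complex R P \<and> (\<forall>i. projective_mod R (obj P i)) \<and>
     (\<forall>i<0. zero_mod (obj P i)) \<and> (\<forall>i>0. zero_mod (homology P i)) \<and>
     mod_iso R (homology P 0) N"

text \<open>
  A fixed projective resolution of \<open>N\<close>.  One exists in the type \<open>('a + 'n) list\<close>, whose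
  cardinality is \<open>max |'a| |'n| \<aleph>\<^sub>0\<close>: all modules in a free resolution can be given at most
  that many generators.
\<close>

definition chosen_resolution ::
  "('a, 'r) ring_scheme \<Rightarrow> ('a, 'n) module \<Rightarrow> ('a, ('a + 'n) list) mod_complex"
where
  "chosen_resolution R N = (SOME P. projective_resolution R N P)"

text \<open>
  \<open>M \<otimes> N\<close> is the free module on the set of pairs, modulo the submodule \<open>tensor_rel\<close> generated
  by the bilinearity relations; \<open>tensor_map\<close> is the map \<open>f \<otimes> id\<close>, on cosets, for \<open>f : M \<rightarrow> M'\<close>.
\<close>

definition tensor_rel ::
  "('a, 'r) ring_scheme \<Rightarrow> ('a, 'm) module \<Rightarrow> ('a, 'n) module \<Rightarrow> ('m \<times> 'n \<Rightarrow> 'a) set"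
where
  "tensor_rel R M N = (let F = free_mod R (carrier M \<times> carrier N); g = free_gen R in
     mod_span R F
      ({g (x \<oplus>\<^bsub>M\<^esub> x', y) \<ominus>\<^bsub>F\<^esub> (g (x, y) \<oplus>\<^bsub>F\<^esub> g (x', y)) | x x' y.
          x \<in> carrier M \<and> x' \<in> carrier M \<and> y \<in> carrier N} \<union>
       {g (x, y \<oplus>\<^bsub>N\<^esub> y') \<ominus>\<^bsub>F\<^esub> (g (x, y) \<oplus>\<^bsub>F\<^esub> g (x, y')) | x y y'.
          x \<in> carrier M \<and> y \<in> carrier N \<and> y' \<in> carrier N} \<union>
       {g (r \<odot>\<^bsub>M\<^esub> x, y) \<ominus>\<^bsub>F\<^esub> (r \<odot>\<^bsub>F\<^esub> g (x, y)) | r x y.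
          r \<in> carrier R \<and> x \<in> carrier M \<and> y \<in> carrier N} \<union>
       {g (x, r \<odot>\<^bsub>N\<^esub> y) \<ominus>\<^bsub>F\<^esub> (r \<odot>\<^bsub>F\<^esub> g (x, y)) | r x y.
          r \<in> carrier R \<and> x \<in> carrier M \<and> y \<in> carrier N}))"

definition tensor_mod ::
  "('a, 'r) ring_scheme \<Rightarrow> ('a, 'm) module \<Rightarrow> ('a, 'n) module \<Rightarrow> ('a, ('m \<times> 'n \<Rightarrow> 'a) set) module"
where
  "tensor_mod R M N = quot_mod (free_mod R (carrier M \<times> carrier N)) (tensor_rel R M N)"

definition tensor_map ::
  "('a, 'r) ring_scheme \<Rightarrow> ('a, 'm') module \<Rightarrow> ('a, 'n) module \<Rightarrow> ('m \<Rightarrow> 'm') \<Rightarrow>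
     ('m \<times> 'n \<Rightarrow> 'a) set \<Rightarrow> ('m' \<times> 'n \<Rightarrow> 'a) set"
where
  "tensor_map R M' N f C =
     (\<Union>\<phi>\<in>C. tensor_rel R M' N +>\<^bsub>free_mod R (carrier M' \<times> carrier N)\<^esub> free_map R (map_prod f id) \<phi>)"

definition tensor_complex ::
  "('a, 'r) ring_scheme \<Rightarrow> ('a, 'u) mod_complex \<Rightarrow> ('a, 'm) module \<Rightarrow>
     ('a, ('u \<times> 'm \<Rightarrow> 'a) set) mod_complex"
where
  "tensor_complex R P M = \<lparr>
     obj = (\<lambda>i. tensor_mod R (obj P i) M),
     diff = (\<lambda>i. tensor_map R (obj P (i - 1)) M (diff P i))\<rparr>"

definition Tor ::
  "('a, 'r) ring_scheme \<Rightarrow> nat \<Rightarrow> ('a, 'n) module \<Rightarrow> ('a, 'm) module \<Rightarrow>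
     ('a, ((('a + 'n) list \<times> 'm \<Rightarrow> 'a) set) set) module"
where
  "Tor R i N M = homology (tensor_complex R (chosen_resolution R N) M) (int i)"

definition hom_mod ::
  "('a, 'r) ring_scheme \<Rightarrow> ('a, 'n) module \<Rightarrow> ('a, 'm) module \<Rightarrow> ('a, 'n \<Rightarrow> 'm) module"
where
  "hom_mod R N M = \<lparr>carrier = mod_hom R N M \<inter> extensional (carrier N),
     monoid.mult = undefined, monoid.one = undefined, ring.zero = (\<lambda>x\<in>carrier N. \<zero>\<^bsub>M\<^esub>),
     ring.add = (\<lambda>f g. \<lambda>x\<in>carrier N. f x \<oplus>\<^bsub>M\<^esub> g x),
     smult = (\<lambda>r f. \<lambda>x\<in>carrier N. r \<odot>\<^bsub>M\<^esub> f x)\<rparr>"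

text \<open>\<open>Hom(P, M)\<close> in homological grading: \<open>Hom(P\<^sub>j, M)\<close> sits in degree \<open>-j\<close>.\<close>

definition hom_complex ::
  "('a, 'r) ring_scheme \<Rightarrow> ('a, 'u) mod_complex \<Rightarrow> ('a, 'm) module \<Rightarrow> ('a, 'u \<Rightarrow> 'm) mod_complex"
where
  "hom_complex R P M = \<lparr>
     obj = (\<lambda>i. hom_mod R (obj P (- i)) M),
     diff = (\<lambda>i f. \<lambda>x\<in>carrier (obj P (- i + 1)). f (diff P (- i + 1) x))\<rparr>"

definition Ext ::
  "('a, 'r) ring_scheme \<Rightarrow> nat \<Rightarrow> ('a, 'n) module \<Rightarrow> ('a, 'm) module \<Rightarrow>
     ('a, (('a + 'n) list \<Rightarrow> 'm) set) module"
where
  "Ext R i N M = homology (hom_complex R (chosen_resolution R N) M) (- int i)"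

definition grade :: "('a, 'r) ring_scheme \<Rightarrow> 'a set \<Rightarrow> ('a, 'm) module \<Rightarrow> enat" where
  "grade R I M = Inf (enat ` {i. \<not> zero_mod (Ext R i (cyclic_mod R I) M)})"

end

theory Submission
  imports Defs
begin

text \<open>
  Let \<open>K\<close> be the Koszul complex, \<open>N = R/I\<close>, and \<open>F\<close> a projective resolution of \<open>N\<close>.  A copy of \<open>N\<close>
  in the lowest homology of \<open>K\<close>, in degree \<open>q\<close>, is realised by a chain map \<open>K \<rightarrow> F[q]\<close>, and passing to its
  (desuspended) cone removes this copy and leaves the other homology unchanged.  After finitely
  many steps the complex is contractible.  The long exact sequences of these cones relate the
  vanishing of the (co)homology of \<open>K \<otimes> M\<close> and \<open>Hom(K, M)\<close> to that of \<open>Tor(N, M)\<close> and \<open>Ext(N, M)\<close>.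

  By the self-duality of \<open>K\<close>, applied to \<open>Hom(K, M)\<close>, this shows that \<open>K \<otimes> M\<close> is exact above degree
  \<open>e - grade(I, M)\<close>, and for \<open>M = R\<close> that \<open>e - grade I\<close> is exactly the top degree of homology.  So \<open>K\<close>
  itself gives \<open>qpd N \<le> grade I\<close>.  Conversely, let \<open>P\<close> be a finite quasi-projective resolution with
  \<open>s = sup P\<close> and \<open>h = hsup P\<close>.  Its part in degrees \<open>h\<close> to \<open>s\<close> resolves the cokernel of \<open>P\<close> in degree \<open>h\<close>,
  which contains a nonzero element killed by \<open>I\<close>; counting depths along this resolution gives
  \<open>grade I \<le> s - h\<close>.

  For part (2), \<open>K \<otimes> M\<close> is exact in degree \<open>i > e - g + n\<close>, and the homology of \<open>K\<close> sits in degrees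
  \<open>0\<close> to \<open>e - g\<close>.  The vanishing of \<open>Tor\<^sub>i(N, M)\<close> thus follows from that of \<open>Tor\<^sub>k(N, M)\<close> for
  \<open>i - 1 - (e - g) \<le> k < i\<close>, that is, by induction on \<open>i\<close>.
\<close>

section \<open>Homomorphisms and quotients\<close>

text \<open>Why the lowest degree: a chain map K \<rightarrow> F[q] is to induce a chosen projection
  of homology onto N, and this projection is defined on cycles only. Below q the complex is exact,
  projective and bounded below, hence contractible there. So the cycles in degree q are a direct
  summand, the map extends to the whole module, and projectivity together with the exactness of F
  carries it upwards.

  For the cone C of V \<rightarrow> G the segments used are H_j(C) \<rightarrow> H_j(V)
  \<rightarrow> H_j(G) and H_j(V) \<rightarrow> H_j(G) \<rightarrow> H_(j-1)(C). In cohomology the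
  arrows turn round but the same degrees meet, so Tor and Ext share one induction.

  The obstacle is typing: the induction forms cones of cones, and each cone is carried by a new
  type. It is therefore run on complexes carried by lists, into which every cone is encoded again.

  The ring is not local and the projective modules may have infinite rank. Depth is therefore
  measured by the highest nonvanishing Koszul homology, and projective coefficients are treated as
  retracts of free ones.\<close>

lemma mod_homI:
  assumes "\<And>x. x \<in> carrier M \<Longrightarrow> f x \<in> carrier N"
    and "\<And>x y. x \<in> carrier M \<Longrightarrow> y \<in> carrier M \<Longrightarrow> f (x \<oplus>\<^bsub>M\<^esub> y) = f x \<oplus>\<^bsub>N\<^esub> f y"
    and "\<And>r x. r \<in> carrier R \<Longrightarrow> x \<in> carrier M \<Longrightarrow> f (r \<odot>\<^bsub>M\<^esub> x) = r \<odot>\<^bsub>N\<^esub> f x"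
  shows "f \<in> mod_hom R M N"
  using assms by (auto simp: mod_hom_def)

context
  fixes R :: "('a, 'r) ring_scheme" and M :: "('a, 'm, 'x) module_scheme"
    and N :: "('a, 'n, 'y) module_scheme" and f :: "'m \<Rightarrow> 'n"
  assumes MM: "module R M" and NN: "module R N" and f: "f \<in> mod_hom R M N"
begin

interpretation M: module R M by (rule MM)
interpretation N: module R N by (rule NN)

lemma mod_hom_closed: "x \<in> carrier M \<Longrightarrow> f x \<in> carrier N"
  using f by (auto simp: mod_hom_def)

lemma mod_hom_add: "x \<in> carrier M \<Longrightarrow> y \<in> carrier M \<Longrightarrow> f (x \<oplus>\<^bsub>M\<^esub> y) = f x \<oplus>\<^bsub>N\<^esub> f y"
  using f by (auto simp: mod_hom_def)

lemma mod_hom_smult: "r \<in> carrier R \<Longrightarrow> x \<in> carrier M \<Longrightarrow> f (r \<odot>\<^bsub>M\<^esub> x) = r \<odot>\<^bsub>N\<^esub> f x"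
  using f by (auto simp: mod_hom_def)

lemma mod_hom_zero: "f \<zero>\<^bsub>M\<^esub> = \<zero>\<^bsub>N\<^esub>"
  using mod_hom_smult[of "\<zero>\<^bsub>R\<^esub>" "\<zero>\<^bsub>M\<^esub>"] mod_hom_closed[of "\<zero>\<^bsub>M\<^esub>"] by simp

lemma mod_hom_inv: "x \<in> carrier M \<Longrightarrow> f (\<ominus>\<^bsub>M\<^esub> x) = \<ominus>\<^bsub>N\<^esub> f x"
  by (metis M.M.l_neg M.M.add.inv_closed N.M.minus_equality mod_hom_add mod_hom_closed mod_hom_zero)

lemma mod_hom_minus: "x \<in> carrier M \<Longrightarrow> y \<in> carrier M \<Longrightarrow> f (x \<ominus>\<^bsub>M\<^esub> y) = f x \<ominus>\<^bsub>N\<^esub> f y"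
  by (simp add: a_minus_def mod_hom_add mod_hom_inv)

lemma mod_hom_finsum:
  "finite A \<Longrightarrow> g \<in> A \<rightarrow> carrier M \<Longrightarrow> f (finsum M g A) = finsum N (\<lambda>i. f (g i)) A"
proof (induction A rule: finite_induct)
  case (insert x A)
  then have g: "g \<in> A \<rightarrow> carrier M" "g x \<in> carrier M" by auto
  then have "(\<lambda>i. f (g i)) \<in> A \<rightarrow> carrier N" "f (g x) \<in> carrier N"
    by (auto intro: mod_hom_closed)
  then show ?case
    using insert g by (simp add: mod_hom_add M.M.finsum_closed)
qed (simp add: mod_hom_zero)

lemma mod_hom_image_submodule:
  assumes "submodule H R M" shows "submodule (f ` H) R N"
proof (rule N.submoduleI)
  note H = M.submoduleE[OF assms]
  show "f ` H \<subseteq> carrier N" using H(1) by (auto intro: mod_hom_closed)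
  show "\<zero>\<^bsub>N\<^esub> \<in> f ` H"
    using mod_hom_zero subgroup.one_closed[OF submodule.axioms(1)[OF assms]] by force
  show "\<ominus>\<^bsub>N\<^esub> a \<in> f ` H" if "a \<in> f ` H" for a
    using that H(1,3) by (force simp flip: mod_hom_inv)
  show "a \<oplus>\<^bsub>N\<^esub> b \<in> f ` H" if "a \<in> f ` H" "b \<in> f ` H" for a b
    using that H(1,5) by (auto simp: subset_iff simp flip: mod_hom_add)
  show "a \<odot>\<^bsub>N\<^esub> b \<in> f ` H" if "a \<in> carrier R" "b \<in> f ` H" for a b
    using that H(1,4) by (auto simp: subset_iff simp flip: mod_hom_smult)
qed

lemma mod_hom_kernel_submodule: "submodule {x \<in> carrier M. f x = \<zero>\<^bsub>N\<^esub>} R M"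
  by (rule M.submoduleI) (auto simp: mod_hom_add mod_hom_inv mod_hom_smult mod_hom_zero)

end

lemmas mod_hom_simps =
  mod_hom_closed mod_hom_add mod_hom_smult mod_hom_zero mod_hom_inv mod_hom_minus

lemma mod_hom_comp:
  assumes "f \<in> mod_hom R M N" "g \<in> mod_hom R N P"
  shows "(\<lambda>x. g (f x)) \<in> mod_hom R M P"
  using assms by (auto simp: mod_hom_def Pi_iff)

lemma mod_hom_id: "(\<lambda>x. x) \<in> mod_hom R M M"
  by (auto simp: mod_hom_def)

lemma mod_hom_zero_map:
  assumes "module R N" shows "(\<lambda>x. \<zero>\<^bsub>N\<^esub>) \<in> mod_hom R M N"
proof -
  interpret module R N by fact
  show ?thesis by (auto simp: mod_hom_def)
qed

lemma mod_hom_add_map: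
  assumes "module R M" "module R N" "f \<in> mod_hom R M N" "g \<in> mod_hom R M N"
  shows "(\<lambda>x. f x \<oplus>\<^bsub>N\<^esub> g x) \<in> mod_hom R M N"
proof -
  interpret M: module R M by fact
  interpret N: module R N by fact
  note [simp] = mod_hom_simps[OF assms(1,2,3)] mod_hom_simps[OF assms(1,2,4)]
  show ?thesis by (rule mod_homI) (auto simp: N.smult_r_distr N.M.a_ac)
qed

lemma mod_hom_inv_map:
  assumes "module R M" "module R N" "f \<in> mod_hom R M N"
  shows "(\<lambda>x. \<ominus>\<^bsub>N\<^esub> f x) \<in> mod_hom R M N"
proof -
  interpret M: module R M by fact
  interpret N: module R N by fact
  note [simp] = mod_hom_simps[OF assms(1,2,3)]
  show ?thesis by (rule mod_homI) (auto simp: N.smult_r_minus N.M.minus_add)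
qed

lemma mod_hom_minus_map:
  assumes "module R M" "module R N" "f \<in> mod_hom R M N" "g \<in> mod_hom R M N"
  shows "(\<lambda>x. f x \<ominus>\<^bsub>N\<^esub> g x) \<in> mod_hom R M N"
  unfolding a_minus_def by (intro mod_hom_add_map mod_hom_inv_map assms)

lemma mod_hom_restrict_dom:
  "f \<in> mod_hom R M N \<Longrightarrow> H \<subseteq> carrier M \<Longrightarrow> f \<in> mod_hom R (M\<lparr>carrier := H\<rparr>) N"
  by (auto simp: mod_hom_def subset_iff)

lemma mod_hom_restrict_cod:
  "f \<in> mod_hom R M N \<Longrightarrow> f ` carrier M \<subseteq> H \<Longrightarrow> f \<in> mod_hom R M (N\<lparr>carrier := H\<rparr>)"
  by (auto simp: mod_hom_def)

lemma (in abelian_group) minus_solve: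
  "x \<in> carrier G \<Longrightarrow> y \<in> carrier G \<Longrightarrow> z \<in> carrier G \<Longrightarrow> x \<ominus> y = z \<longleftrightarrow> x = z \<oplus> y"
  by (metis a_assoc add.inv_closed add.r_inv_ex l_neg minus_eq r_neg r_zero)

lemma (in abelian_group) add_minus_cancel:
  "x \<in> carrier G \<Longrightarrow> y \<in> carrier G \<Longrightarrow> x \<ominus> y \<oplus> y = x"
  "x \<in> carrier G \<Longrightarrow> y \<in> carrier G \<Longrightarrow> y \<oplus> (x \<ominus> y) = x"
  "x \<in> carrier G \<Longrightarrow> y \<in> carrier G \<Longrightarrow> x \<oplus> y \<ominus> y = x"
  "x \<in> carrier G \<Longrightarrow> y \<in> carrier G \<Longrightarrow> x \<ominus> (x \<ominus> y) = y"
     apply (metis add.inv_closed a_closed minus_eq minus_solve)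
    apply (metis a_comm add.inv_closed a_closed minus_eq minus_solve)
   apply (metis a_closed minus_solve)
  by (metis a_comm add.inv_closed a_closed minus_eq minus_solve)

lemma submodule_abelian_subgroup:
  assumes "module R M" "submodule H R M" shows "abelian_subgroup H M"
proof -
  interpret module R M by fact
  show ?thesis
    using assms(2) by (intro abelian_subgroupI3 additive_subgroupI M.abelian_group_axioms)
      (simp_all add: submodule_def)
qed

lemma module_restrict: "module R M \<Longrightarrow> submodule H R M \<Longrightarrow> module R (M\<lparr>carrier := H\<rparr>)"
  by (rule submodule.submodule_is_module)

section \<open>Cosets and quotient modules\<close>

context
  fixes R :: "('a, 'r) ring_scheme" and M :: "('a, 'm, 'x) module_scheme" and H :: "'m set"
  assumes MM: "module R M" and HH: "submodule H R M"
begin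

interpretation M: module R M by (rule MM)
interpretation H: submodule H R M by (rule HH)
interpretation A: abelian_subgroup H M by (rule submodule_abelian_subgroup[OF MM HH])

lemma quot_carrier: "carrier (quot_mod M H) = (\<lambda>x. H +>\<^bsub>M\<^esub> x) ` carrier M"
  by (auto simp: quot_mod_def A_RCOSETS_def')

lemma coset_eq_iff:
  assumes "x \<in> carrier M" "y \<in> carrier M"
  shows "H +>\<^bsub>M\<^esub> x = H +>\<^bsub>M\<^esub> y \<longleftrightarrow> x \<ominus>\<^bsub>M\<^esub> y \<in> H"
  using assms A.a_rcos_module[of y x] A.a_repr_independence'[of x y] A.a_rcos_self[of x]
  by (auto simp: a_minus_def)

lemma coset_zero_iff: "x \<in> carrier M \<Longrightarrow> H +>\<^bsub>M\<^esub> x = H \<longleftrightarrow> x \<in> H"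
  using A.a_rcos_const A.a_rcos_self by auto

lemma quot_add:
  "x \<in> carrier M \<Longrightarrow> y \<in> carrier M \<Longrightarrow>
     (H +>\<^bsub>M\<^esub> x) \<oplus>\<^bsub>quot_mod M H\<^esub> (H +>\<^bsub>M\<^esub> y) = H +>\<^bsub>M\<^esub> (x \<oplus>\<^bsub>M\<^esub> y)"
  by (simp add: quot_mod_def A.a_rcos_sum)

text \<open>The scalar action of \<open>quot_mod\<close>, like \<open>tensor_map\<close>, is a union
  over all representatives of a coset. The union collapses to one set as soon as congruent
  representatives contribute the same.\<close>

lemma coset_UN_eqI:
  assumes x: "x \<in> carrier M" and g: "\<And>y. y \<in> carrier M \<Longrightarrow> x \<ominus>\<^bsub>M\<^esub> y \<in> H \<Longrightarrow> g y = g x"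
  shows "(\<Union>y\<in>H +>\<^bsub>M\<^esub> x. g y) = g x"
proof -
  have "g y = g x" if "y \<in> H +>\<^bsub>M\<^esub> x" for y
    using that x A.a_elemrcos_carrier[OF x that] A.a_repr_independence'[OF that x]
    by (intro g) (auto simp: coset_eq_iff)
  moreover have "x \<in> H +>\<^bsub>M\<^esub> x" by (rule A.a_rcos_self[OF x])
  ultimately show ?thesis by blast
qed

lemma quot_smult:
  assumes "r \<in> carrier R" "x \<in> carrier M"
  shows "r \<odot>\<^bsub>quot_mod M H\<^esub> (H +>\<^bsub>M\<^esub> x) = H +>\<^bsub>M\<^esub> (r \<odot>\<^bsub>M\<^esub> x)"
proof -
  have "(\<Union>y\<in>H +>\<^bsub>M\<^esub> x. H +>\<^bsub>M\<^esub> (r \<odot>\<^bsub>M\<^esub> y)) = H +>\<^bsub>M\<^esub> (r \<odot>\<^bsub>M\<^esub> x)"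
  proof (rule coset_UN_eqI)
    fix y assume y: "y \<in> carrier M" "x \<ominus>\<^bsub>M\<^esub> y \<in> H"
    then have "r \<odot>\<^bsub>M\<^esub> (x \<ominus>\<^bsub>M\<^esub> y) \<in> H" using assms by blast
    then have "r \<odot>\<^bsub>M\<^esub> x \<ominus>\<^bsub>M\<^esub> r \<odot>\<^bsub>M\<^esub> y \<in> H"
      using assms y by (simp add: a_minus_def M.smult_r_distr M.smult_r_minus)
    then show "H +>\<^bsub>M\<^esub> (r \<odot>\<^bsub>M\<^esub> y) = H +>\<^bsub>M\<^esub> (r \<odot>\<^bsub>M\<^esub> x)"
      using assms y by (simp flip: coset_eq_iff)
  qed (use assms in auto)
  then show ?thesis by (simp add: quot_mod_def)
qed

lemma quot_zero: "\<zero>\<^bsub>quot_mod M H\<^esub> = H +>\<^bsub>M\<^esub> \<zero>\<^bsub>M\<^esub>"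
proof -
  have "H +>\<^bsub>M\<^esub> \<zero>\<^bsub>M\<^esub> = H" by (subst coset_zero_iff) auto
  then show ?thesis by (simp add: quot_mod_def)
qed

lemma quot_module: "module R (quot_mod M H)"
proof (rule moduleI)
  note [simp] = quot_carrier quot_add quot_smult quot_zero
  show "cring R" by (rule M.R.is_cring)
  show "abelian_group (quot_mod M H)"
  proof (rule abelian_groupI)
    fix x assume "x \<in> carrier (quot_mod M H)"
    then obtain a where a: "a \<in> carrier M" "x = H +>\<^bsub>M\<^esub> a" by auto
    then show "\<exists>y\<in>carrier (quot_mod M H). y \<oplus>\<^bsub>quot_mod M H\<^esub> x = \<zero>\<^bsub>quot_mod M H\<^esub>"
      by (intro bexI[of _ "H +>\<^bsub>M\<^esub> (\<ominus>\<^bsub>M\<^esub> a)"]) (auto simp: M.M.l_neg)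
  qed (auto simp: M.M.a_ac)
qed (auto simp: quot_carrier quot_add quot_smult quot_zero M.smult_l_distr M.smult_r_distr M.smult_assoc1)

lemma quot_map_hom: "(\<lambda>x. H +>\<^bsub>M\<^esub> x) \<in> mod_hom R M (quot_mod M H)"
  by (auto simp: mod_hom_def quot_carrier quot_add quot_smult)

lemma zero_quot_iff: "zero_mod (quot_mod M H) \<longleftrightarrow> carrier M \<subseteq> H"
proof -
  have "zero_mod (quot_mod M H) \<longleftrightarrow> (\<forall>x\<in>carrier M. H +>\<^bsub>M\<^esub> x = H)"
    unfolding zero_mod_def quot_carrier quot_zero using coset_zero_iff[of "\<zero>\<^bsub>M\<^esub>"] by auto
  then show ?thesis by (auto simp: coset_zero_iff)
qed

end

section \<open>Complexes\<close>

text \<open>The differential is offered both as leaving degree \<open>i\<close> and as leaving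
  degree \<open>i + 1\<close>. The modules depend on an integer index, and \<open>i + 1 - 1\<close>
  would otherwise have to be identified with \<open>i\<close> at every step.\<close>

lemma chain_complexD:
  assumes "chain_complex R K"
  shows "module R (obj K i)"
    and "diff K i \<in> mod_hom R (obj K i) (obj K (i - 1))"
    and "diff K (i + 1) \<in> mod_hom R (obj K (i + 1)) (obj K i)"
    and "x \<in> carrier (obj K (i + 1)) \<Longrightarrow> diff K i (diff K (i + 1) x) = \<zero>\<^bsub>obj K (i - 1)\<^esub>"
  using assms unfolding chain_complex_def
  by (auto, metis add_diff_cancel_right', metis add_diff_cancel_right')

lemma chain_complexI:
  assumes "\<And>i. module R (obj K i)"
    and "\<And>i. diff K (i + 1) \<in> mod_hom R (obj K (i + 1)) (obj K i)"
    and "\<And>i x. x \<in> carrier (obj K (i + 1)) \<Longrightarrow> diff K i (diff K (i + 1) x) = \<zero>\<^bsub>obj K (i - 1)\<^esub>"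
  shows "chain_complex R K"
proof -
  have "diff K i \<in> mod_hom R (obj K i) (obj K (i - 1))" for i
    using assms(2)[of "i - 1"] by simp
  moreover have "x \<in> carrier (obj K i) \<Longrightarrow> diff K (i - 1) (diff K i x) = \<zero>\<^bsub>obj K (i - 1 - 1)\<^esub>" for i x
    using assms(3)[of x "i - 1"] by simp
  ultimately show ?thesis using assms(1) by (auto simp: chain_complex_def)
qed

lemmas diff_simps = mod_hom_simps[OF chain_complexD(1) chain_complexD(1) chain_complexD(2)]
lemmas diff_up_simps = mod_hom_simps[OF chain_complexD(1) chain_complexD(1) chain_complexD(3)]

lemma cycles_submodule:
  assumes "chain_complex R K" shows "submodule (cycles K i) R (obj K i)"
  unfolding cycles_def using chain_complexD[OF assms] by (intro mod_hom_kernel_submodule)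

lemma boundaries_submodule:
  assumes "chain_complex R K" shows "submodule (boundaries K i) R (obj K i)"
  unfolding boundaries_def
  by (rule mod_hom_image_submodule[OF chain_complexD(1)[OF assms] chain_complexD(1)[OF assms]
        chain_complexD(3)[OF assms] module.carrier_is_submodule[OF chain_complexD(1)[OF assms]]])

lemma boundaries_subset_cycles: "chain_complex R K \<Longrightarrow> boundaries K i \<subseteq> cycles K i"
  by (auto simp: boundaries_def cycles_def diff_up_simps chain_complexD(4))

text \<open>\<open>homology\<close> divides this module by the boundaries. With a name for it, maps
  on cycles can be treated as module homomorphisms.\<close>

definition cycle_mod :: "('a, 'u) mod_complex \<Rightarrow> int \<Rightarrow> ('a, 'u) module" where
  "cycle_mod K i = (obj K i)\<lparr>carrier := cycles K i\<rparr>"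

lemma cycle_module: "chain_complex R K \<Longrightarrow> module R (cycle_mod K i)"
  unfolding cycle_mod_def by (intro module_restrict chain_complexD(1) cycles_submodule)

lemma boundaries_submodule_cycle:
  assumes K: "chain_complex R K" shows "submodule (boundaries K i) R (cycle_mod K i)"
proof (rule module.module_incl_imp_submodule[OF cycle_module[OF K]])
  show "boundaries K i \<subseteq> carrier (cycle_mod K i)"
    by (simp add: cycle_mod_def boundaries_subset_cycles[OF K])
  show "module R ((cycle_mod K i)\<lparr>carrier := boundaries K i\<rparr>)"
    using module_restrict[OF chain_complexD(1)[OF K] boundaries_submodule[OF K], of i]
    by (simp add: cycle_mod_def)
qed

text \<open>One inclusion is enough, as the other holds in every complex.\<close>

definition exact_at :: "('a, 'u) mod_complex \<Rightarrow> int \<Rightarrow> bool" where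
  "exact_at K i \<longleftrightarrow> cycles K i \<subseteq> boundaries K i"

lemma exact_atD:
  assumes "exact_at K i" "x \<in> carrier (obj K i)" "diff K i x = \<zero>\<^bsub>obj K (i - 1)\<^esub>"
  obtains y where "y \<in> carrier (obj K (i + 1))" "diff K (i + 1) y = x"
  using assms by (auto simp: exact_at_def cycles_def boundaries_def)

lemma zero_homology_iff:
  "chain_complex R K \<Longrightarrow> zero_mod (homology K i) \<longleftrightarrow> exact_at K i"
  unfolding homology_def exact_at_def cycle_mod_def[symmetric]
  by (subst zero_quot_iff[OF cycle_module boundaries_submodule_cycle]) (auto simp: cycle_mod_def)

lemma (in abelian_group) minus_zero_iff: "x \<in> carrier G \<Longrightarrow> y \<in> carrier G \<Longrightarrow> x \<ominus> y = \<zero> \<longleftrightarrow> x = y"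
  by (simp add: minus_solve)

text \<open>By the homomorphism theorem an isomorphism out of a quotient is a surjection with the
  right kernel. Homology isomorphisms are handled in this form from here on, as maps on cycles, so
  that cosets do not enter the later arguments.\<close>

lemma quot_iso_iff:
  assumes MM: "module R M" and HH: "submodule H R M" and NN: "module R N"
  shows "mod_iso R (quot_mod M H) N \<longleftrightarrow>
    (\<exists>h\<in>mod_hom R M N. h ` carrier M = carrier N \<and> (\<forall>x\<in>carrier M. h x = \<zero>\<^bsub>N\<^esub> \<longleftrightarrow> x \<in> H))"
proof
  interpret M: module R M by (rule MM)
  interpret N: module R N by (rule NN)
  note Q = quot_module[OF MM HH]
  assume "mod_iso R (quot_mod M H) N"
  then obtain f where f: "f \<in> mod_hom R (quot_mod M H) N"
    and bij: "bij_betw f (carrier (quot_mod M H)) (carrier N)"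
    by (auto simp: mod_iso_def)
  let ?h = "\<lambda>x. f (H +>\<^bsub>M\<^esub> x)"
  have "?h \<in> mod_hom R M N" by (rule mod_hom_comp[OF quot_map_hom[OF MM HH] f])
  moreover have "?h ` carrier M = carrier N"
    using bij by (auto simp: bij_betw_def quot_carrier[OF MM HH])
  moreover have "?h x = \<zero>\<^bsub>N\<^esub> \<longleftrightarrow> x \<in> H" if x: "x \<in> carrier M" for x
  proof -
    have "?h x = \<zero>\<^bsub>N\<^esub> \<longleftrightarrow> f (H +>\<^bsub>M\<^esub> x) = f \<zero>\<^bsub>quot_mod M H\<^esub>"
      by (simp add: mod_hom_zero[OF Q NN f])
    also have "\<dots> \<longleftrightarrow> H +>\<^bsub>M\<^esub> x = \<zero>\<^bsub>quot_mod M H\<^esub>"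
      using bij x by (intro inj_on_eq_iff[of f "carrier (quot_mod M H)"])
        (auto simp: bij_betw_def quot_carrier[OF MM HH] quot_zero[OF MM HH])
    also have "\<dots> \<longleftrightarrow> x \<in> H" using coset_zero_iff[OF MM HH x] by (simp add: quot_mod_def)
    finally show ?thesis .
  qed
  ultimately show "\<exists>h\<in>mod_hom R M N. h ` carrier M = carrier N \<and> (\<forall>x\<in>carrier M. h x = \<zero>\<^bsub>N\<^esub> \<longleftrightarrow> x \<in> H)"
    by blast
next
  interpret M: module R M by (rule MM)
  interpret N: module R N by (rule NN)
  interpret A: abelian_subgroup H M by (rule submodule_abelian_subgroup[OF MM HH])
  assume "\<exists>h\<in>mod_hom R M N. h ` carrier M = carrier N \<and> (\<forall>x\<in>carrier M. h x = \<zero>\<^bsub>N\<^esub> \<longleftrightarrow> x \<in> H)"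
  then obtain h where h: "h \<in> mod_hom R M N" "h ` carrier M = carrier N"
    and ker: "\<And>x. x \<in> carrier M \<Longrightarrow> h x = \<zero>\<^bsub>N\<^esub> \<longleftrightarrow> x \<in> H" by blast
  note [simp] = mod_hom_simps[OF MM NN h(1)]
  \<comment> \<open>\<open>h\<close> takes the same value on congruent elements, so any
    representative will do.\<close>
  define f where "f C = h (SOME x. x \<in> C)" for C
  have eq: "h x = h y \<longleftrightarrow> H +>\<^bsub>M\<^esub> x = H +>\<^bsub>M\<^esub> y" if "x \<in> carrier M" "y \<in> carrier M" for x y
    using that ker[of "x \<ominus>\<^bsub>M\<^esub> y"] N.M.minus_zero_iff[of "h x" "h y"]
    by (simp add: coset_eq_iff[OF MM HH])
  have f: "f (H +>\<^bsub>M\<^esub> x) = h x" if x: "x \<in> carrier M" for x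
  proof -
    have "(SOME y. y \<in> H +>\<^bsub>M\<^esub> x) \<in> H +>\<^bsub>M\<^esub> x" using A.a_rcos_self[OF x] by (rule someI)
    then show ?thesis
      using x A.a_elemrcos_carrier[OF x] A.a_repr_independence' unfolding f_def by (metis eq)
  qed
  show "mod_iso R (quot_mod M H) N" unfolding mod_iso_def
  proof (intro bexI)
    show "f \<in> mod_hom R (quot_mod M H) N"
      by (rule mod_homI)
        (auto simp: quot_carrier[OF MM HH] quot_add[OF MM HH] quot_smult[OF MM HH] f)
    show "bij_betw f (carrier (quot_mod M H)) (carrier N)"
      unfolding bij_betw_def quot_carrier[OF MM HH] image_image h(2)[symmetric]
      by (auto simp: inj_on_def f eq)
  qed
qed

section \<open>Free and projective modules\<close>

lemma regular_module: assumes "cring R" shows "module R (regular_mod R)"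
proof -
  interpret cring R by fact
  show ?thesis
  proof (rule moduleI)
    show "abelian_group (regular_mod R)"
    proof (rule abelian_groupI)
      fix x assume "x \<in> carrier (regular_mod R)"
      then show "\<exists>y\<in>carrier (regular_mod R). y \<oplus>\<^bsub>regular_mod R\<^esub> x = \<zero>\<^bsub>regular_mod R\<^esub>"
        by (intro bexI[of _ "\<ominus>\<^bsub>R\<^esub> x"]) (auto simp: regular_mod_def l_neg)
    qed (auto simp: regular_mod_def a_ac)
  qed (auto simp: regular_mod_def l_distr r_distr m_assoc cring_axioms)
qed

lemma regular_finsum: "finsum (regular_mod R) = finsum R"
proof -
  have "finprod (add_monoid (regular_mod R)) f A = finprod (add_monoid R) f A" for f A
    by (simp add: regular_mod_def finprod_def)
  then show ?thesis by (intro ext) (simp add: finsum_def)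
qed

section \<open>Free modules and linear extensions\<close>

lemma free_module:
  fixes R :: "('a, 'r) ring_scheme" and B :: "'b set"
  assumes "cring R" shows "module R (free_mod R B)"
proof -
  interpret cring R by fact
  have add: "finite {x. f x \<oplus>\<^bsub>R\<^esub> g x \<noteq> \<zero>\<^bsub>R\<^esub>}"
    if "finite {x. f x \<noteq> \<zero>\<^bsub>R\<^esub>}" "finite {x. g x \<noteq> \<zero>\<^bsub>R\<^esub>}"
      "\<And>x. f x \<in> carrier R" "\<And>x. g x \<in> carrier R" for f g :: "'b \<Rightarrow> 'a"
    by (rule finite_subset[OF _ finite_UnI[OF that(1,2)]]) (use that in auto)
  have smult: "finite {x. a \<otimes>\<^bsub>R\<^esub> g x \<noteq> \<zero>\<^bsub>R\<^esub>}" if "a \<in> carrier R" "finite {x. g x \<noteq> \<zero>\<^bsub>R\<^esub>}" for a g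
    using that by (intro finite_subset[OF _ that(2)]) auto
  show ?thesis
  proof (rule moduleI)
    show "abelian_group (free_mod R B)"
    proof (rule abelian_groupI)
      fix f assume f: "f \<in> carrier (free_mod R B)"
      then have "{x. \<ominus>\<^bsub>R\<^esub> f x \<noteq> \<zero>\<^bsub>R\<^esub>} \<subseteq> {x. f x \<noteq> \<zero>\<^bsub>R\<^esub>}" by (auto simp: free_mod_def)
      with f show "\<exists>y\<in>carrier (free_mod R B). y \<oplus>\<^bsub>free_mod R B\<^esub> f = \<zero>\<^bsub>free_mod R B\<^esub>"
        by (intro bexI[of _ "\<lambda>x. \<ominus>\<^bsub>R\<^esub> f x"]) (auto simp: free_mod_def l_neg finite_subset)
    qed (auto simp: free_mod_def fun_eq_iff a_ac intro: add)
  qed (auto simp: free_mod_def fun_eq_iff l_distr r_distr m_assoc smult cring_axioms)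
qed

lemma free_gen_closed: "cring R \<Longrightarrow> b \<in> B \<Longrightarrow> free_gen R b \<in> carrier (free_mod R B)"
  by (auto simp: free_gen_def free_mod_def cring.cring_simprules)

lemma free_eval_hom: "cring R \<Longrightarrow> (\<lambda>\<phi>. \<phi> x) \<in> mod_hom R (free_mod R B) (regular_mod R)"
  by (auto simp: mod_hom_def free_mod_def regular_mod_def)

definition free_ext ::
  "('a, 'r) ring_scheme \<Rightarrow> ('a, 'm, 'x) module_scheme \<Rightarrow> ('b \<Rightarrow> 'm) \<Rightarrow> ('b \<Rightarrow> 'a) \<Rightarrow> 'm" where
  "free_ext R A c \<phi> = finsum A (\<lambda>b. \<phi> b \<odot>\<^bsub>A\<^esub> c b) {b. \<phi> b \<noteq> \<zero>\<^bsub>R\<^esub>}"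

context
  fixes R :: "('a, 'r) ring_scheme" and A :: "('a, 'm, 'x) module_scheme"
    and c :: "'b \<Rightarrow> 'm" and B :: "'b set"
  assumes AA: "module R A" and c: "c \<in> B \<rightarrow> carrier A"
begin

interpretation A: module R A by (rule AA)

text \<open>The support of a sum or a multiple differs from those of its arguments. Padding with
  zero terms up to a common finite set makes such sums comparable.\<close>

lemma free_ext_eq:
  assumes \<phi>: "\<phi> \<in> carrier (free_mod R B)" and S: "finite S" "{b. \<phi> b \<noteq> \<zero>\<^bsub>R\<^esub>} \<subseteq> S" "S \<subseteq> B"
  shows "free_ext R A c \<phi> = finsum A (\<lambda>b. \<phi> b \<odot>\<^bsub>A\<^esub> c b) S"
  unfolding free_ext_def using assms c
  by (intro A.M.add.finprod_mono_neutral_cong_left) (auto simp: free_mod_def subset_iff Pi_iff)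

lemma free_ext_hom: "free_ext R A c \<in> mod_hom R (free_mod R B) A"
proof (rule mod_homI)
  let ?s = "\<lambda>\<phi>. {b. \<phi> b \<noteq> \<zero>\<^bsub>R\<^esub>}"
  have F: "\<phi> b \<in> carrier R" "finite (?s \<phi>)" "?s \<phi> \<subseteq> B" if "\<phi> \<in> carrier (free_mod R B)" for \<phi> b
    using that by (auto simp: free_mod_def)
  have C: "c b \<in> carrier A" if "b \<in> B" for b using that c by auto
  fix \<phi> assume \<phi>: "\<phi> \<in> carrier (free_mod R B)"
  have Pi: "(\<lambda>b. \<psi> b \<odot>\<^bsub>A\<^esub> c b) \<in> S \<rightarrow> carrier A" if "\<psi> \<in> carrier (free_mod R B)" "S \<subseteq> B" for \<psi> S
    using that F(1)[OF that(1)] C by auto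
  show "free_ext R A c \<phi> \<in> carrier A"
    unfolding free_ext_def using F[OF \<phi>] Pi[OF \<phi>] by (intro A.M.finsum_closed)
  show "free_ext R A c (r \<odot>\<^bsub>free_mod R B\<^esub> \<phi>) = r \<odot>\<^bsub>A\<^esub> free_ext R A c \<phi>" if r: "r \<in> carrier R" for r
  proof -
    interpret F: module R "free_mod R B" by (rule free_module[OF A.R.is_cring])
    have "free_ext R A c (r \<odot>\<^bsub>free_mod R B\<^esub> \<phi>) =
        finsum A (\<lambda>b. (r \<odot>\<^bsub>free_mod R B\<^esub> \<phi>) b \<odot>\<^bsub>A\<^esub> c b) (?s \<phi>)"
      using F[OF \<phi>] r \<phi> by (intro free_ext_eq F.smult_closed) (auto simp: free_mod_def)
    also have "\<dots> = finsum A (\<lambda>b. r \<odot>\<^bsub>A\<^esub> (\<phi> b \<odot>\<^bsub>A\<^esub> c b)) (?s \<phi>)"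
      using F[OF \<phi>] r C by (intro A.M.finsum_cong')
        (auto simp: free_mod_def A.smult_assoc1 subset_iff)
    also have "\<dots> = r \<odot>\<^bsub>A\<^esub> free_ext R A c \<phi>"
      unfolding free_ext_def using F[OF \<phi>] r Pi[OF \<phi>] by (intro A.finsum_smult_ldistr[symmetric])
    finally show ?thesis .
  qed
  fix \<psi> assume \<psi>: "\<psi> \<in> carrier (free_mod R B)"
  interpret F: module R "free_mod R B" by (rule free_module[OF A.R.is_cring])
  let ?S = "?s \<phi> \<union> ?s \<psi>"
  have S: "finite ?S" "?S \<subseteq> B" using F[OF \<phi>] F[OF \<psi>] by auto
  have "free_ext R A c (\<phi> \<oplus>\<^bsub>free_mod R B\<^esub> \<psi>) = finsum A (\<lambda>b. (\<phi> \<oplus>\<^bsub>free_mod R B\<^esub> \<psi>) b \<odot>\<^bsub>A\<^esub> c b) ?S"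
    using S \<phi> \<psi> by (intro free_ext_eq F.M.a_closed) (auto simp: free_mod_def)
  also have "\<dots> = finsum A (\<lambda>b. \<phi> b \<odot>\<^bsub>A\<^esub> c b \<oplus>\<^bsub>A\<^esub> \<psi> b \<odot>\<^bsub>A\<^esub> c b) ?S"
    using S F(1)[OF \<phi>] F(1)[OF \<psi>] C by (intro A.M.finsum_cong')
      (auto simp: free_mod_def A.smult_l_distr subset_iff Pi_iff)
  also have "\<dots> = finsum A (\<lambda>b. \<phi> b \<odot>\<^bsub>A\<^esub> c b) ?S \<oplus>\<^bsub>A\<^esub> finsum A (\<lambda>b. \<psi> b \<odot>\<^bsub>A\<^esub> c b) ?S"
    using S Pi[OF \<phi>] Pi[OF \<psi>] by (intro A.M.finsum_addf)
  also have "\<dots> = free_ext R A c \<phi> \<oplus>\<^bsub>A\<^esub> free_ext R A c \<psi>"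
    using S free_ext_eq[OF \<phi>, of ?S] free_ext_eq[OF \<psi>, of ?S] by simp
  finally show "free_ext R A c (\<phi> \<oplus>\<^bsub>free_mod R B\<^esub> \<psi>) = free_ext R A c \<phi> \<oplus>\<^bsub>A\<^esub> free_ext R A c \<psi>" .
qed

lemma free_ext_gen: "b \<in> B \<Longrightarrow> free_ext R A c (free_gen R b) = c b"
  using c free_gen_closed[OF A.R.is_cring, of b B]
  by (subst free_ext_eq[of _ "{b}"]) (auto simp: free_gen_def A.M.finsum_insert Pi_iff)

end

text \<open>Evaluation at a point \<open>x\<close> is linear, and only the term with
  \<open>b = x\<close> survives it.\<close>

lemma free_ext_gen_self:
  assumes R: "cring R" and \<phi>: "\<phi> \<in> carrier (free_mod R B)"
  shows "free_ext R (free_mod R B) (free_gen R) \<phi> = \<phi>"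
proof
  fix x
  interpret cring R by fact
  note F = free_module[OF R, of B]
  let ?s = "{b. \<phi> b \<noteq> \<zero>\<^bsub>R\<^esub>}"
  have s: "finite ?s" "?s \<subseteq> B" using \<phi> by (auto simp: free_mod_def)
  have c: "\<phi> b \<in> carrier R" for b using \<phi> by (auto simp: free_mod_def)
  have g: "(\<lambda>b. \<phi> b \<odot>\<^bsub>free_mod R B\<^esub> free_gen R b) \<in> ?s \<rightarrow> carrier (free_mod R B)"
    using s(2) by (intro Pi_I module.smult_closed[OF F] free_gen_closed[OF R] c) blast
  have "free_ext R (free_mod R B) (free_gen R) \<phi> x =
      finsum R (\<lambda>b. (\<phi> b \<odot>\<^bsub>free_mod R B\<^esub> free_gen R b) x) ?s"
    unfolding free_ext_def
    using mod_hom_finsum[OF F regular_module[OF R] free_eval_hom[OF R] s(1) g]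
    by (simp add: regular_finsum)
  also have "\<dots> = finsum R (\<lambda>b. if x = b then \<phi> b else \<zero>\<^bsub>R\<^esub>) ?s"
    using c by (intro finsum_cong') (auto simp: free_mod_def free_gen_def)
  also have "\<dots> = \<phi> x"
  proof (cases "x \<in> ?s")
    case True
    then show ?thesis using s c by (subst finsum_singleton) auto
  next
    case False
    then show ?thesis by (subst add.finprod_one_eqI) auto
  qed
  finally show "free_ext R (free_mod R B) (free_gen R) \<phi> x = \<phi> x" .
qed

lemma free_hom_expand:
  assumes "module R A" and h: "h \<in> mod_hom R (free_mod R B) A" and \<phi>: "\<phi> \<in> carrier (free_mod R B)"
  shows "h \<phi> = free_ext R A (\<lambda>b. h (free_gen R b)) \<phi>"
proof -
  interpret A: module R A by fact
  note R = A.R.is_cring and F = free_module[OF A.R.is_cring, of B]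
  let ?s = "{b. \<phi> b \<noteq> \<zero>\<^bsub>R\<^esub>}"
  have s: "finite ?s" "?s \<subseteq> B" and c: "\<phi> b \<in> carrier R" for b using \<phi> by (auto simp: free_mod_def)
  have gc: "b \<in> ?s \<Longrightarrow> free_gen R b \<in> carrier (free_mod R B)" for b
    using s(2) free_gen_closed[OF R, of b B] by auto
  have g: "(\<lambda>b. \<phi> b \<odot>\<^bsub>free_mod R B\<^esub> free_gen R b) \<in> ?s \<rightarrow> carrier (free_mod R B)"
    by (intro Pi_I module.smult_closed[OF F] c gc)
  have "h \<phi> = h (free_ext R (free_mod R B) (free_gen R) \<phi>)" by (simp add: free_ext_gen_self[OF R \<phi>])
  also have "\<dots> = finsum A (\<lambda>b. h (\<phi> b \<odot>\<^bsub>free_mod R B\<^esub> free_gen R b)) ?s"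
    unfolding free_ext_def by (rule mod_hom_finsum[OF F assms(1) h s(1) g])
  also have "\<dots> = free_ext R A (\<lambda>b. h (free_gen R b)) \<phi>"
    unfolding free_ext_def using c gc mod_hom_simps[OF F assms(1) h]
    by (intro A.M.finsum_cong') auto
  finally show ?thesis .
qed

lemma free_hom_eq:
  assumes "module R A" "h \<in> mod_hom R (free_mod R B) A" "k \<in> mod_hom R (free_mod R B) A"
    and "\<And>b. b \<in> B \<Longrightarrow> h (free_gen R b) = k (free_gen R b)" and \<phi>: "\<phi> \<in> carrier (free_mod R B)"
  shows "h \<phi> = k \<phi>"
proof -
  interpret A: module R A by fact
  have "b \<in> B" "\<phi> b \<in> carrier R" "h (free_gen R b) \<in> carrier A" if "\<phi> b \<noteq> \<zero>\<^bsub>R\<^esub>" for b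
    using that \<phi> free_gen_closed[OF A.R.is_cring, of b B]
      mod_hom_closed[OF free_module[OF A.R.is_cring] assms(1,2)]
    by (auto simp: free_mod_def)
  then show ?thesis
    unfolding free_hom_expand[OF assms(1,2) \<phi>] free_hom_expand[OF assms(1,3) \<phi>] free_ext_def
    using assms(4) by (intro A.M.finsum_cong') auto
qed

text \<open>Identifies the push-forward, defined by summing over fibres, with a linear extension,
  for which the homomorphism laws are already available.\<close>

lemma free_map_ext:
  assumes R: "cring R" and \<phi>: "\<phi> \<in> carrier (free_mod R B)" and h: "h \<in> B \<rightarrow> C"
  shows "free_map R h \<phi> = free_ext R (free_mod R C) (\<lambda>b. free_gen R (h b)) \<phi>"
proof
  fix y
  interpret cring R by fact
  note F = free_module[OF R, of C]
  let ?s = "{b. \<phi> b \<noteq> \<zero>\<^bsub>R\<^esub>}"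
  have s: "finite ?s" "?s \<subseteq> B" and c: "\<phi> b \<in> carrier R" for b using \<phi> by (auto simp: free_mod_def)
  have g: "(\<lambda>b. \<phi> b \<odot>\<^bsub>free_mod R C\<^esub> free_gen R (h b)) \<in> ?s \<rightarrow> carrier (free_mod R C)"
    using s(2) h by (intro Pi_I module.smult_closed[OF F] free_gen_closed[OF R] c) blast
  have "free_ext R (free_mod R C) (\<lambda>b. free_gen R (h b)) \<phi> y =
      finsum R (\<lambda>b. (\<phi> b \<odot>\<^bsub>free_mod R C\<^esub> free_gen R (h b)) y) ?s"
    unfolding free_ext_def
    using mod_hom_finsum[OF F regular_module[OF R] free_eval_hom[OF R] s(1) g]
    by (simp add: regular_finsum)
  also have "\<dots> = finsum R (\<lambda>b. if h b = y then \<phi> b else \<zero>\<^bsub>R\<^esub>) ?s"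
    using c by (intro finsum_cong') (auto simp: free_mod_def free_gen_def)
  also have "\<dots> = free_map R h \<phi> y"
    unfolding free_map_def using s c by (intro add.finprod_mono_neutral_cong_right) auto
  finally show "free_map R h \<phi> y = free_ext R (free_mod R C) (\<lambda>b. free_gen R (h b)) \<phi> y" ..
qed

lemma free_lift:
  assumes "module R A" "module R C" "p \<in> mod_hom R A C" "f \<in> mod_hom R (free_mod R B) C"
    and sub: "f ` carrier (free_mod R B) \<subseteq> p ` carrier A"
  obtains g where "g \<in> mod_hom R (free_mod R B) A"
    "\<And>x. x \<in> carrier (free_mod R B) \<Longrightarrow> p (g x) = f x"
proof -
  interpret A: module R A by fact
  note R = A.R.is_cring
  have "\<forall>b\<in>B. \<exists>a\<in>carrier A. p a = f (free_gen R b)"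
    using sub free_gen_closed[OF R] by (force simp: image_subset_iff image_iff)
  then obtain c where c: "\<And>b. b \<in> B \<Longrightarrow> c b \<in> carrier A \<and> p (c b) = f (free_gen R b)" by metis
  then have cA: "c \<in> B \<rightarrow> carrier A" by auto
  note h = free_ext_hom[OF assms(1) cA]
  show thesis
  proof
    show "free_ext R A c \<in> mod_hom R (free_mod R B) A" by (rule h)
    show "p (free_ext R A c x) = f x" if "x \<in> carrier (free_mod R B)" for x
      using c by (intro free_hom_eq[OF assms(2) mod_hom_comp[OF h assms(3)] assms(4) _ that])
        (simp add: free_ext_gen[OF assms(1) cA])
  qed
qed

text \<open>The free module on the set \<open>carrier P\<close> has exactly the type of the test
  module \<open>A\<close> in \<open>projective_mod\<close>, so the identity of \<open>P\<close> can
  be lifted along the canonical surjection.\<close>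

lemma projective_section:
  fixes P :: "('a, 'p) module"
  assumes "projective_mod R P"
  obtains \<sigma> where "\<sigma> \<in> mod_hom R P (free_mod R (carrier P))"
    "\<And>x. x \<in> carrier P \<Longrightarrow> free_ext R P (\<lambda>y. y) (\<sigma> x) = x"
proof -
  from assms interpret P: module R P by (simp add: projective_mod_def)
  note PP = P.module_axioms and R = P.R.is_cring
  let ?F = "free_mod R (carrier P)" and ?p = "free_ext R P (\<lambda>y. y)"
  have p: "?p \<in> mod_hom R ?F P" by (intro free_ext_hom PP) auto
  have "?p ` carrier ?F = carrier P"
  proof
    show "?p ` carrier ?F \<subseteq> carrier P" using mod_hom_closed[OF free_module[OF R] PP p] by auto
    have "?p (free_gen R x) = x" if "x \<in> carrier P" for x
      by (rule free_ext_gen[OF PP _ that]) auto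
    then show "carrier P \<subseteq> ?p ` carrier ?F" using free_gen_closed[OF R] by force
  qed
  then have "\<exists>g\<in>mod_hom R P ?F. \<forall>x\<in>carrier P. ?p (g x) = x"
    using assms p PP free_module[OF R] mod_hom_id unfolding projective_mod_def by blast
  then show thesis using that by blast
qed

text \<open>Unlike the definition, this allows the test modules to live in arbitrary types.\<close>

lemma projective_lift:
  fixes P :: "('a, 'p) module"
  assumes P: "projective_mod R P" and A: "module R A" and C: "module R C"
    and p: "p \<in> mod_hom R A C" and f: "f \<in> mod_hom R P C"
    and sub: "f ` carrier P \<subseteq> p ` carrier A"
  obtains g where "g \<in> mod_hom R P A" "\<And>x. x \<in> carrier P \<Longrightarrow> p (g x) = f x"
proof -
  from P interpret P: module R P by (simp add: projective_mod_def)
  note PP = P.module_axioms and R = P.R.is_cring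
  let ?F = "free_mod R (carrier P)" and ?q = "free_ext R P (\<lambda>y. y)"
  obtain \<sigma> where \<sigma>: "\<sigma> \<in> mod_hom R P ?F" "\<And>x. x \<in> carrier P \<Longrightarrow> ?q (\<sigma> x) = x"
    using projective_section[OF P] by metis
  have q: "?q \<in> mod_hom R ?F P" by (intro free_ext_hom PP) auto
  have "(\<lambda>x. f (?q x)) ` carrier ?F \<subseteq> p ` carrier A"
    using sub mod_hom_closed[OF free_module[OF R] PP q] by auto
  then obtain h where h: "h \<in> mod_hom R ?F A" "\<And>x. x \<in> carrier ?F \<Longrightarrow> p (h x) = f (?q x)"
    using free_lift[OF A C p mod_hom_comp[OF q f]] by metis
  show thesis
    using \<sigma> h mod_hom_closed[OF PP free_module[OF R] \<sigma>(1)]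
    by (intro that[of "\<lambda>x. h (\<sigma> x)"] mod_hom_comp[OF \<sigma>(1) h(1)]) simp_all
qed

lemma projectiveD: "projective_mod R P \<Longrightarrow> module R P"
  by (simp add: projective_mod_def)

lemma free_projective:
  fixes R :: "('a, 'r) ring_scheme" and B :: "'b set"
  assumes R: "cring R" shows "projective_mod R (free_mod R B)"
  unfolding projective_mod_def
proof (intro conjI allI impI free_module[OF R]; elim conjE)
  fix A :: "('a, ('b \<Rightarrow> 'a) \<Rightarrow> 'a) module" and C :: "('a, 'b \<Rightarrow> 'a) module" and p f
  assume *: "module R A" "module R C" "p \<in> mod_hom R A C" "p ` carrier A = carrier C"
    "f \<in> mod_hom R (free_mod R B) C"
  have "f ` carrier (free_mod R B) \<subseteq> p ` carrier A"
    using *(4) mod_hom_closed[OF free_module[OF R] *(2,5)] by auto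
  then obtain g where "g \<in> mod_hom R (free_mod R B) A" "\<And>x. x \<in> carrier (free_mod R B) \<Longrightarrow> p (g x) = f x"
    using free_lift[OF *(1,2,3,5)] by metis
  then show "\<exists>g\<in>mod_hom R (free_mod R B) A. \<forall>x\<in>carrier (free_mod R B). p (g x) = f x" by blast
qed

text \<open>Lift \<open>f\<close> composed with \<open>\<alpha>\<close> from \<open>P\<close>, then
  precompose with \<open>\<beta>\<close>. As \<open>P\<close> and \<open>Q\<close> may be carried by
  different types, this moves projectivity from one type to another.\<close>

lemma projective_retract:
  fixes P :: "('a, 'p) module" and Q :: "('a, 'q) module"
  assumes P: "projective_mod R P" and Q: "module R Q"
    and \<alpha>: "\<alpha> \<in> mod_hom R P Q" and \<beta>: "\<beta> \<in> mod_hom R Q P"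
    and ret: "\<And>x. x \<in> carrier Q \<Longrightarrow> \<alpha> (\<beta> x) = x"
  shows "projective_mod R Q"
  unfolding projective_mod_def
proof (intro conjI allI impI Q; elim conjE)
  fix A :: "('a, 'q \<Rightarrow> 'a) module" and C :: "('a, 'q) module" and p f
  assume *: "module R A" "module R C" "p \<in> mod_hom R A C" "p ` carrier A = carrier C"
    "f \<in> mod_hom R Q C"
  have "(\<lambda>x. f (\<alpha> x)) ` carrier P \<subseteq> p ` carrier A"
    using *(4) mod_hom_closed[OF projectiveD[OF P] *(2) mod_hom_comp[OF \<alpha> *(5)]] by auto
  then obtain g where "g \<in> mod_hom R P A" "\<And>x. x \<in> carrier P \<Longrightarrow> p (g x) = f (\<alpha> x)"
    using projective_lift[OF P *(1,2,3) mod_hom_comp[OF \<alpha> *(5)]] by metis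
  then show "\<exists>g\<in>mod_hom R Q A. \<forall>x\<in>carrier Q. p (g x) = f x"
    using ret mod_hom_closed[OF Q projectiveD[OF P] \<beta>]
    by (intro bexI[of _ "\<lambda>x. g (\<beta> x)"] mod_hom_comp[OF \<beta>]) auto
qed

section \<open>Changing the carrier type\<close>

text \<open>A copy of \<open>M\<close> along an encoding of its elements. It brings modules made of
  pairs or functions back into one fixed type.\<close>

definition transport_mod :: "('m \<Rightarrow> 'u) \<Rightarrow> ('a, 'm) module \<Rightarrow> ('a, 'u) module" where
  "transport_mod enc M = (let dec = inv_into (carrier M) enc in
     \<lparr>carrier = enc ` carrier M, monoid.mult = undefined, monoid.one = undefined,
      ring.zero = enc \<zero>\<^bsub>M\<^esub>, ring.add = (\<lambda>u v. enc (dec u \<oplus>\<^bsub>M\<^esub> dec v)),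
      smult = (\<lambda>r u. enc (r \<odot>\<^bsub>M\<^esub> dec u))\<rparr>)"

lemma transport_sel:
  "carrier (transport_mod enc M) = enc ` carrier M"
  "\<zero>\<^bsub>transport_mod enc M\<^esub> = enc \<zero>\<^bsub>M\<^esub>"
  by (simp_all add: transport_mod_def Let_def)

lemma transport_ops:
  assumes "inj_on enc (carrier M)" "x \<in> carrier M"
  shows "y \<in> carrier M \<Longrightarrow> enc x \<oplus>\<^bsub>transport_mod enc M\<^esub> enc y = enc (x \<oplus>\<^bsub>M\<^esub> y)"
    and "r \<odot>\<^bsub>transport_mod enc M\<^esub> enc x = enc (r \<odot>\<^bsub>M\<^esub> x)"
  using assms by (simp_all add: transport_mod_def Let_def)

context
  fixes R :: "('a, 'r) ring_scheme" and M :: "('a, 'm) module" and enc :: "'m \<Rightarrow> 'u"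
  assumes MM: "module R M" and inj: "inj_on enc (carrier M)"
begin

interpretation M: module R M by (rule MM)

lemma transport_module: "module R (transport_mod enc M)"
proof (rule moduleI)
  note [simp] = transport_sel transport_ops[OF inj]
  show "abelian_group (transport_mod enc M)"
  proof (rule abelian_groupI)
    fix x assume "x \<in> carrier (transport_mod enc M)"
    then obtain a where "a \<in> carrier M" "x = enc a" by auto
    then show "\<exists>y\<in>carrier (transport_mod enc M). y \<oplus>\<^bsub>transport_mod enc M\<^esub> x = \<zero>\<^bsub>transport_mod enc M\<^esub>"
      by (intro bexI[of _ "enc (\<ominus>\<^bsub>M\<^esub> a)"]) (auto simp: M.M.l_neg)
  qed (auto simp: M.M.a_ac)
qed (auto simp: transport_sel transport_ops[OF inj] M.smult_l_distr M.smult_r_distr M.smult_assoc1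
    M.R.is_cring)

lemma transport_enc_hom: "enc \<in> mod_hom R M (transport_mod enc M)"
  by (auto simp: mod_hom_def transport_sel transport_ops[OF inj])

lemma transport_dec_hom: "inv_into (carrier M) enc \<in> mod_hom R (transport_mod enc M) M"
  by (rule mod_homI) (auto simp: transport_sel transport_ops[OF inj] inj)

end

lemma transport_projective:
  assumes "projective_mod R M" "inj_on enc (carrier M)"
  shows "projective_mod R (transport_mod enc M)"
  using assms projectiveD[OF assms(1)]
  by (intro projective_retract[OF assms(1) transport_module transport_enc_hom transport_dec_hom])
    (auto simp: transport_sel)

definition transport_complex :: "('m \<Rightarrow> 'u) \<Rightarrow> ('a, 'm) mod_complex \<Rightarrow> ('a, 'u) mod_complex" where
  "transport_complex enc K = \<lparr>obj = (\<lambda>i. transport_mod enc (obj K i)),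
     diff = (\<lambda>i u. enc (diff K i (inv_into (carrier (obj K i)) enc u)))\<rparr>"

definition chain_map ::
  "('a, 'r) ring_scheme \<Rightarrow> ('a, 'u) mod_complex \<Rightarrow> ('a, 'v) mod_complex \<Rightarrow> (int \<Rightarrow> 'u \<Rightarrow> 'v) \<Rightarrow> bool"
where
  "chain_map R V Y f \<longleftrightarrow> (\<forall>i. f i \<in> mod_hom R (obj V i) (obj Y i) \<and>
     (\<forall>x\<in>carrier (obj V (i + 1)). diff Y (i + 1) (f (i + 1) x) = f i (diff V (i + 1) x)))"

lemma chain_mapD:
  assumes "chain_map R V Y f"
  shows "f i \<in> mod_hom R (obj V i) (obj Y i)"
    and "x \<in> carrier (obj V (i + 1)) \<Longrightarrow> diff Y (i + 1) (f (i + 1) x) = f i (diff V (i + 1) x)"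
    and "x \<in> carrier (obj V i) \<Longrightarrow> diff Y i (f i x) = f (i - 1) (diff V i x)"
proof -
  show "f i \<in> mod_hom R (obj V i) (obj Y i)"
    and *: "x \<in> carrier (obj V (i + 1)) \<Longrightarrow> diff Y (i + 1) (f (i + 1) x) = f i (diff V (i + 1) x)"
    for i x using assms by (auto simp: chain_map_def)
  show "x \<in> carrier (obj V i) \<Longrightarrow> diff Y i (f i x) = f (i - 1) (diff V i x)"
    using *[of x "i - 1"] by simp
qed

context
  fixes R :: "('a, 'r) ring_scheme" and K :: "('a, 'm) mod_complex" and enc :: "'m \<Rightarrow> 'u"
  assumes KK: "chain_complex R K" and inj: "\<And>i. inj_on enc (carrier (obj K i))"
begin

abbreviation "dec i \<equiv> inv_into (carrier (obj K i)) enc"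

lemma transport_diff:
  "x \<in> carrier (obj K i) \<Longrightarrow> diff (transport_complex enc K) i (enc x) = enc (diff K i x)"
  using inj by (simp add: transport_complex_def)

lemma transport_obj: "obj (transport_complex enc K) i = transport_mod enc (obj K i)"
  by (simp add: transport_complex_def)

lemma transport_chain_complex: "chain_complex R (transport_complex enc K)"
proof (rule chain_complexI)
  note K = chain_complexD[OF KK] and [simp] = diff_up_simps[OF KK KK KK] diff_simps[OF KK KK KK]
  fix i
  show "module R (obj (transport_complex enc K) i)"
    using transport_module[OF K(1) inj] by (simp add: transport_obj)
  show "diff (transport_complex enc K) (i + 1)
      \<in> mod_hom R (obj (transport_complex enc K) (i + 1)) (obj (transport_complex enc K) i)"
    by (rule mod_homI)
      (auto simp: transport_obj transport_sel transport_ops[OF inj] transport_diff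
        module.smult_closed[OF K(1)] abelian_groupE(1)[OF module.axioms(2)[OF K(1)]])
  show "diff (transport_complex enc K) i (diff (transport_complex enc K) (i + 1) x) =
      \<zero>\<^bsub>obj (transport_complex enc K) (i - 1)\<^esub>"
    if "x \<in> carrier (obj (transport_complex enc K) (i + 1))" for x
    using that by (auto simp: transport_obj transport_sel transport_diff K(4))
qed

lemma transport_enc_chain_map: "chain_map R K (transport_complex enc K) (\<lambda>i. enc)"
  unfolding chain_map_def
  by (auto simp: transport_diff transport_obj intro!: transport_enc_hom chain_complexD(1)[OF KK] inj)

lemma transport_dec_chain_map: "chain_map R (transport_complex enc K) K dec"
  unfolding chain_map_def
  by (auto simp: transport_diff transport_obj transport_sel inj diff_up_simps[OF KK KK KK]
      intro!: transport_dec_hom chain_complexD(1)[OF KK])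

lemma transport_cycles: "cycles (transport_complex enc K) i = enc ` cycles K i"
proof -
  have "enc (diff K i x) = enc \<zero>\<^bsub>obj K (i - 1)\<^esub> \<longleftrightarrow> diff K i x = \<zero>\<^bsub>obj K (i - 1)\<^esub>"
    if "x \<in> carrier (obj K i)" for x
    using that by (intro inj_on_eq_iff[OF inj[of "i - 1"]] diff_simps[OF KK KK KK]
        abelian_groupE(2)[OF module.axioms(2)[OF chain_complexD(1)[OF KK]]])
  then show ?thesis
    unfolding cycles_def by (auto simp: transport_obj transport_sel transport_diff)
qed

lemma transport_boundaries: "boundaries (transport_complex enc K) i = enc ` boundaries K i"
  unfolding boundaries_def transport_obj transport_sel image_image
  by (rule image_cong) (auto simp: transport_diff)

end

lemma transport_zero_mod:
  assumes M: "module R M" and inj: "inj_on enc (carrier M)"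
  shows "zero_mod (transport_mod enc M) \<longleftrightarrow> zero_mod M"
proof -
  have "\<zero>\<^bsub>M\<^esub> \<in> carrier M" by (rule abelian_groupE(2)[OF module.axioms(2)[OF M]])
  then show ?thesis
    using inj_on_image_eq_iff[OF inj subset_refl, of "{\<zero>\<^bsub>M\<^esub>}"]
    by (simp add: zero_mod_def transport_sel)
qed

section \<open>Direct sums of two modules and mapping cones\<close>

definition pair_mod :: "('a, 'm) module \<Rightarrow> ('a, 'n) module \<Rightarrow> ('a, 'm \<times> 'n) module" where
  "pair_mod A B = \<lparr>carrier = carrier A \<times> carrier B, monoid.mult = undefined, monoid.one = undefined,
     ring.zero = (\<zero>\<^bsub>A\<^esub>, \<zero>\<^bsub>B\<^esub>),
     ring.add = (\<lambda>u v. (fst u \<oplus>\<^bsub>A\<^esub> fst v, snd u \<oplus>\<^bsub>B\<^esub> snd v)),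
     smult = (\<lambda>r u. (r \<odot>\<^bsub>A\<^esub> fst u, r \<odot>\<^bsub>B\<^esub> snd u))\<rparr>"

lemma pair_mod_sel [simp]:
  "carrier (pair_mod A B) = carrier A \<times> carrier B"
  "\<zero>\<^bsub>pair_mod A B\<^esub> = (\<zero>\<^bsub>A\<^esub>, \<zero>\<^bsub>B\<^esub>)"
  "u \<oplus>\<^bsub>pair_mod A B\<^esub> v = (fst u \<oplus>\<^bsub>A\<^esub> fst v, snd u \<oplus>\<^bsub>B\<^esub> snd v)"
  "r \<odot>\<^bsub>pair_mod A B\<^esub> u = (r \<odot>\<^bsub>A\<^esub> fst u, r \<odot>\<^bsub>B\<^esub> snd u)"
  by (simp_all add: pair_mod_def)

lemma pair_module:
  assumes "module R A" "module R B" shows "module R (pair_mod A B)"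
proof -
  interpret A: module R A by fact
  interpret B: module R B by fact
  show ?thesis
  proof (rule moduleI)
    show "abelian_group (pair_mod A B)"
    proof (rule abelian_groupI)
      fix x assume "x \<in> carrier (pair_mod A B)"
      then show "\<exists>y\<in>carrier (pair_mod A B). y \<oplus>\<^bsub>pair_mod A B\<^esub> x = \<zero>\<^bsub>pair_mod A B\<^esub>"
        by (intro bexI[of _ "(\<ominus>\<^bsub>A\<^esub> fst x, \<ominus>\<^bsub>B\<^esub> snd x)"]) (auto simp: A.M.l_neg B.M.l_neg)
    qed (auto simp: A.M.a_ac B.M.a_ac)
  qed (auto simp: A.smult_l_distr A.smult_r_distr A.smult_assoc1 B.smult_l_distr B.smult_r_distr
      B.smult_assoc1 A.R.is_cring)
qed

lemma pair_fst_hom: "fst \<in> mod_hom R (pair_mod A B) A"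
  and pair_snd_hom: "snd \<in> mod_hom R (pair_mod A B) B"
  by (auto simp: mod_hom_def)

lemma pair_inl_hom: "module R B \<Longrightarrow> (\<lambda>x. (x, \<zero>\<^bsub>B\<^esub>)) \<in> mod_hom R A (pair_mod A B)"
proof -
  assume "module R B"
  then interpret B: module R B .
  show ?thesis by (auto simp: mod_hom_def)
qed

lemma pair_inr_hom: "module R A \<Longrightarrow> (\<lambda>y. (\<zero>\<^bsub>A\<^esub>, y)) \<in> mod_hom R B (pair_mod A B)"
proof -
  assume "module R A"
  then interpret A: module R A .
  show ?thesis by (auto simp: mod_hom_def)
qed

lemma pair_hom:
  "f \<in> mod_hom R M A \<Longrightarrow> g \<in> mod_hom R M B \<Longrightarrow> (\<lambda>x. (f x, g x)) \<in> mod_hom R M (pair_mod A B)"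
  by (auto simp: mod_hom_def)

text \<open>Lift on each summand separately and add the two lifts.\<close>

lemma pair_projective:
  fixes P :: "('a, 'p) module" and Q :: "('a, 'q) module"
  assumes P: "projective_mod R P" and Q: "projective_mod R Q"
  shows "projective_mod R (pair_mod P Q)"
  unfolding projective_mod_def
proof (intro conjI allI impI; (elim conjE)?)
  note PM = projectiveD[OF P] and QM = projectiveD[OF Q]
  note PQ = pair_module[OF PM QM]
  interpret P: module R P by (rule PM)
  interpret Q: module R Q by (rule QM)
  show "module R (pair_mod P Q)" by (rule PQ)
  fix A :: "('a, 'p \<times> 'q \<Rightarrow> 'a) module" and C :: "('a, 'p \<times> 'q) module" and p f
  assume *: "module R A" "module R C" "p \<in> mod_hom R A C" "p ` carrier A = carrier C"
    "f \<in> mod_hom R (pair_mod P Q) C"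
  note f1 = mod_hom_comp[OF pair_inl_hom[OF QM] *(5)]
    and f2 = mod_hom_comp[OF pair_inr_hom[OF PM] *(5)]
  have "(\<lambda>x. f (x, \<zero>\<^bsub>Q\<^esub>)) ` carrier P \<subseteq> p ` carrier A"
    using *(4) mod_hom_closed[OF PM *(2) f1] by auto
  then obtain g where g: "g \<in> mod_hom R P A" "\<And>x. x \<in> carrier P \<Longrightarrow> p (g x) = f (x, \<zero>\<^bsub>Q\<^esub>)"
    using projective_lift[OF P *(1-3) f1] by metis
  have "(\<lambda>x. f (\<zero>\<^bsub>P\<^esub>, x)) ` carrier Q \<subseteq> p ` carrier A"
    using *(4) mod_hom_closed[OF QM *(2) f2] by auto
  then obtain h where h: "h \<in> mod_hom R Q A" "\<And>x. x \<in> carrier Q \<Longrightarrow> p (h x) = f (\<zero>\<^bsub>P\<^esub>, x)"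
    using projective_lift[OF Q *(1-3) f2] by metis
  have "(\<lambda>u. g (fst u) \<oplus>\<^bsub>A\<^esub> h (snd u)) \<in> mod_hom R (pair_mod P Q) A"
    by (intro mod_hom_add_map PQ *(1) mod_hom_comp[OF pair_fst_hom g(1)] mod_hom_comp[OF pair_snd_hom h(1)])
  moreover have "p (g (fst u) \<oplus>\<^bsub>A\<^esub> h (snd u)) = f u" if u: "u \<in> carrier (pair_mod P Q)" for u
  proof -
    have "p (g (fst u) \<oplus>\<^bsub>A\<^esub> h (snd u)) = f (fst u, \<zero>\<^bsub>Q\<^esub>) \<oplus>\<^bsub>C\<^esub> f (\<zero>\<^bsub>P\<^esub>, snd u)"
      using u g(2) h(2) by (auto simp: mod_hom_add[OF *(1-3)] mod_hom_closed[OF PM *(1) g(1)]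
          mod_hom_closed[OF QM *(1) h(1)])
    also have "\<dots> = f ((fst u, \<zero>\<^bsub>Q\<^esub>) \<oplus>\<^bsub>pair_mod P Q\<^esub> (\<zero>\<^bsub>P\<^esub>, snd u))"
      using u by (subst mod_hom_add[OF PQ *(2,5)]) auto
    also have "\<dots> = f u" using u by (auto simp: mem_Times_iff)
    finally show ?thesis .
  qed
  ultimately show "\<exists>g\<in>mod_hom R (pair_mod P Q) A. \<forall>x\<in>carrier (pair_mod P Q). p (g x) = f x"
    by (intro bexI[of _ "\<lambda>u. g (fst u) \<oplus>\<^bsub>A\<^esub> h (snd u)"] ballI)
qed

text \<open>The desuspended mapping cone, so that it maps onto \<open>V\<close>.\<close>

definition cone :: "('a, 'u) mod_complex \<Rightarrow> ('a, 'v) mod_complex \<Rightarrow> (int \<Rightarrow> 'u \<Rightarrow> 'v) \<Rightarrow>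
    ('a, 'u \<times> 'v) mod_complex" where
  "cone V G f = \<lparr>obj = (\<lambda>i. pair_mod (obj V i) (obj G (i + 1))),
     diff = (\<lambda>i u. (diff V i (fst u), f i (fst u) \<ominus>\<^bsub>obj G i\<^esub> diff G (i + 1) (snd u)))\<rparr>"

lemma cone_sel [simp]:
  "obj (cone V G f) i = pair_mod (obj V i) (obj G (i + 1))"
  "diff (cone V G f) i u = (diff V i (fst u), f i (fst u) \<ominus>\<^bsub>obj G i\<^esub> diff G (i + 1) (snd u))"
  by (simp_all add: cone_def)

lemma cone_chain_complex:
  assumes V: "chain_complex R V" and G: "chain_complex R G" and f: "chain_map R V G f"
  shows "chain_complex R (cone V G f)"
proof (rule chain_complexI)
  note Xm = chain_complexD(1)[OF V] and Gm = chain_complexD(1)[OF G]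
  fix i
  show "module R (obj (cone V G f) i)" using Xm Gm by (simp add: pair_module)
  have h: "(\<lambda>u. (diff V (i+1) (fst u), f (i+1) (fst u) \<ominus>\<^bsub>obj G (i+1)\<^esub> diff G (i+1+1) (snd u)))
      \<in> mod_hom R (pair_mod (obj V (i+1)) (obj G (i+1+1))) (pair_mod (obj V i) (obj G (i + 1)))"
    by (intro pair_hom mod_hom_minus_map pair_module Xm Gm mod_hom_comp[OF pair_fst_hom]
        mod_hom_comp[OF pair_snd_hom] chain_complexD(3)[OF V] chain_complexD(3)[OF G] chain_mapD(1)[OF f])
  then show "diff (cone V G f) (i + 1) \<in> mod_hom R (obj (cone V G f) (i + 1)) (obj (cone V G f) i)"
    by (simp add: cone_def)
  fix u assume u: "u \<in> carrier (obj (cone V G f) (i + 1))"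
  interpret Gi: module R "obj G i" by (rule Gm)
  obtain x g where [simp]: "u = (x, g)" and x: "x \<in> carrier (obj V (i + 1))" and g: "g \<in> carrier (obj G (i + 1 + 1))"
    using u by auto
  have fx: "f (i + 1) x \<in> carrier (obj G (i + 1))" and dg: "diff G (i + 1 + 1) g \<in> carrier (obj G (i + 1))"
    using mod_hom_closed[OF Xm Gm chain_mapD(1)[OF f] x] diff_up_simps(1)[OF G G G g] by auto
  \<comment> \<open>The minus sign in the cone differential is what lets the two occurrences of
    \<open>f i (diff V (i + 1) x)\<close> cancel.\<close>
  have "diff G (i + 1) (f (i + 1) x \<ominus>\<^bsub>obj G (i + 1)\<^esub> diff G (i + 1 + 1) g) = f i (diff V (i + 1) x)"
    using fx dg g x chain_complexD(4)[OF G g] mod_hom_closed[OF Xm Gm chain_mapD(1)[OF f] diff_up_simps(1)[OF V V V x]]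
    by (subst diff_up_simps(6)[OF G G G fx dg]) (simp add: chain_mapD(2)[OF f x] a_minus_def)
  then show "diff (cone V G f) i (diff (cone V G f) (i + 1) u) = \<zero>\<^bsub>obj (cone V G f) (i - 1)\<^esub>"
    using chain_complexD(4)[OF V x] mod_hom_closed[OF Xm Gm chain_mapD(1)[OF f] diff_up_simps(1)[OF V V V x]]
    by (simp add: Gi.M.minus_zero_iff)
qed

text \<open>No sign is put on the differential. The usual suspension carries a factor
  \<open>(-1)^q\<close>, but this changes neither cycles nor boundaries.\<close>

definition shift_complex :: "int \<Rightarrow> ('a, 'u) mod_complex \<Rightarrow> ('a, 'u) mod_complex" where
  "shift_complex q V = \<lparr>obj = (\<lambda>i. obj V (i - q)), diff = (\<lambda>i. diff V (i - q))\<rparr>"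

lemma shift_sel [simp]:
  "obj (shift_complex q V) i = obj V (i - q)" "diff (shift_complex q V) i = diff V (i - q)"
  by (simp_all add: shift_complex_def)

lemma shift_cycles: "cycles (shift_complex q V) i = cycles V (i - q)"
  by (simp add: cycles_def algebra_simps)

lemma shift_boundaries: "boundaries (shift_complex q V) i = boundaries V (i - q)"
proof -
  have "i + 1 - q = i - q + 1" by simp
  then show ?thesis by (simp only: boundaries_def shift_sel)
qed

lemma shift_exact: "exact_at (shift_complex q V) i \<longleftrightarrow> exact_at V (i - q)"
  by (simp add: exact_at_def shift_cycles shift_boundaries)

lemma shift_chain_complex:
  assumes V: "chain_complex R V" shows "chain_complex R (shift_complex q V)"
proof (rule chain_complexI)
  fix i x
  have e: "i + 1 - q = i - q + 1" "i - 1 - q = i - q - 1" by simp_all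
  show "module R (obj (shift_complex q V) i)"
    using chain_complexD(1)[OF V] by simp
  show "diff (shift_complex q V) (i + 1) \<in> mod_hom R (obj (shift_complex q V) (i + 1)) (obj (shift_complex q V) i)"
    unfolding shift_sel e by (rule chain_complexD(3)[OF V])
  show "x \<in> carrier (obj (shift_complex q V) (i + 1)) \<Longrightarrow>
      diff (shift_complex q V) i (diff (shift_complex q V) (i + 1) x) = \<zero>\<^bsub>obj (shift_complex q V) (i - 1)\<^esub>"
    unfolding shift_sel e by (rule chain_complexD(4)[OF V])
qed

section \<open>Lifting along projective complexes\<close>

definition projective_complex :: "('a, 'r) ring_scheme \<Rightarrow> ('a, 'u) mod_complex \<Rightarrow> bool" where
  "projective_complex R V \<longleftrightarrow>
     chain_complex R V \<and> bounded_below V \<and> (\<forall>i. projective_mod R (obj V i))"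

lemma projective_complexD:
  assumes "projective_complex R V"
  shows "chain_complex R V" "bounded_below V" "projective_mod R (obj V i)" "module R (obj V i)"
  using assms projectiveD by (auto simp: projective_complex_def)

text \<open>Since \<open>d \<sigma> d = d\<close>, the element \<open>x - \<sigma> (d x)\<close> is
  a cycle, hence a boundary, and projectivity chooses a preimage linearly in \<open>x\<close>. The
  last conclusion is the hypothesis on \<open>\<sigma>\<close> for the next degree up.\<close>

lemma contraction_step:
  assumes V: "chain_complex R V" and P: "projective_mod R (obj V i)" and ex: "exact_at V i"
    and \<sigma>: "\<sigma> \<in> mod_hom R (obj V (i - 1)) (obj V i)"
    and d\<sigma>d: "\<And>x. x \<in> carrier (obj V i) \<Longrightarrow> diff V i (\<sigma> (diff V i x)) = diff V i x"
  obtains \<tau> where "\<tau> \<in> mod_hom R (obj V i) (obj V (i + 1))"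
    "\<And>x. x \<in> carrier (obj V i) \<Longrightarrow> diff V (i + 1) (\<tau> x) \<oplus>\<^bsub>obj V i\<^esub> \<sigma> (diff V i x) = x"
    "\<And>x. x \<in> carrier (obj V (i + 1)) \<Longrightarrow> diff V (i + 1) (\<tau> (diff V (i + 1) x)) = diff V (i + 1) x"
proof -
  note Vm = chain_complexD(1)[OF V] and dV = chain_complexD(2)[OF V] chain_complexD(3)[OF V]
    and ds = diff_simps[OF V V V] diff_up_simps[OF V V V]
  interpret Vi: module R "obj V i" by (rule Vm)
  interpret Vp: module R "obj V (i - 1)" by (rule Vm)
  let ?f = "\<lambda>x. x \<ominus>\<^bsub>obj V i\<^esub> \<sigma> (diff V i x)"
  have sc: "\<sigma> (diff V i x) \<in> carrier (obj V i)" if "x \<in> carrier (obj V i)" for x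
    by (rule mod_hom_closed[OF Vm Vm \<sigma> ds(1)[OF that]])
  have f: "?f \<in> mod_hom R (obj V i) (obj V i)"
    by (intro mod_hom_minus_map Vm mod_hom_id mod_hom_comp[OF dV(1) \<sigma>])
  have "?f ` carrier (obj V i) \<subseteq> diff V (i + 1) ` carrier (obj V (i + 1))"
  proof
    fix y assume "y \<in> ?f ` carrier (obj V i)"
    then obtain x where x: "x \<in> carrier (obj V i)" "y = ?f x" by auto
    then have "y \<in> carrier (obj V i)" "diff V i y = \<zero>\<^bsub>obj V (i - 1)\<^esub>"
      using sc[OF x(1)] ds(1)[OF x(1)] by (auto simp: ds(6) d\<sigma>d Vp.M.minus_zero_iff)
    then show "y \<in> diff V (i + 1) ` carrier (obj V (i + 1))"
      using exact_atD[OF ex] by blast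
  qed
  then obtain \<tau> where \<tau>: "\<tau> \<in> mod_hom R (obj V i) (obj V (i + 1))"
    "\<And>x. x \<in> carrier (obj V i) \<Longrightarrow> diff V (i + 1) (\<tau> x) = ?f x"
    using projective_lift[OF P Vm Vm dV(2) f] by metis
  show thesis
  proof
    show "\<tau> \<in> mod_hom R (obj V i) (obj V (i + 1))" by (rule \<tau>(1))
    show "diff V (i + 1) (\<tau> x) \<oplus>\<^bsub>obj V i\<^esub> \<sigma> (diff V i x) = x" if "x \<in> carrier (obj V i)" for x
      using that sc[OF that] by (simp add: \<tau>(2) Vi.M.add_minus_cancel)
    show "diff V (i + 1) (\<tau> (diff V (i + 1) x)) = diff V (i + 1) x" if "x \<in> carrier (obj V (i + 1))" for x
      using ds(7)[OF that] by (simp add: \<tau>(2) chain_complexD(4)[OF V that] mod_hom_zero[OF Vm Vm \<sigma>] a_minus_def)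
  qed
qed

lemma zero_modD: "zero_mod M \<Longrightarrow> x \<in> carrier M \<Longrightarrow> x = \<zero>\<^bsub>M\<^esub>"
  by (auto simp: zero_mod_def)

text \<open>The contraction is built upwards from the lowest degree. \<open>Q\<close> is a downward
  closed range of degrees: all of them for an exact complex, or those below \<open>q\<close> when
  the homology begins in degree \<open>q\<close>.\<close>

lemma contraction_exists:
  fixes V :: "('a, 'u) mod_complex" and Q :: "int \<Rightarrow> bool"
  assumes V: "projective_complex R V" and ex: "\<And>i. Q i \<Longrightarrow> exact_at V i"
    and down: "\<And>i j. Q i \<Longrightarrow> j \<le> i \<Longrightarrow> Q j"
  obtains s where "\<And>i. Q i \<Longrightarrow> s i \<in> mod_hom R (obj V i) (obj V (i + 1))"
    "\<And>i x. Q i \<Longrightarrow> x \<in> carrier (obj V i) \<Longrightarrow>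
       diff V (i + 1) (s i x) \<oplus>\<^bsub>obj V i\<^esub> s (i - 1) (diff V i x) = x"
proof -
  note W = projective_complexD(1)[OF V] and Vm = projective_complexD(4)[OF V]
  obtain b where b: "\<And>i. i < b \<Longrightarrow> zero_mod (obj V i)"
    using projective_complexD(2)[OF V] by (auto simp: bounded_below_def)
  \<comment> \<open>The recursion starts one degree below the bound \<open>b\<close>. The module is
    zero there, so the zero map is a legitimate first value.\<close>
  define idx where "idx n = b - 1 + int n" for n
  define I where "I i \<sigma> \<longleftrightarrow> \<sigma> \<in> mod_hom R (obj V i) (obj V (i + 1)) \<and>
    (\<forall>x\<in>carrier (obj V (i + 1)). diff V (i + 1) (\<sigma> (diff V (i + 1) x)) = diff V (i + 1) x)" for i \<sigma>
  define H where "H i \<sigma> \<tau> \<longleftrightarrow>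
    (\<forall>x\<in>carrier (obj V i). diff V (i + 1) (\<tau> x) \<oplus>\<^bsub>obj V i\<^esub> \<sigma> (diff V i x) = x)" for i \<sigma> \<tau>
  have "\<exists>f. \<forall>n. (Q (idx n) \<longrightarrow> I (idx n) (f n)) \<and> (Q (idx (Suc n)) \<longrightarrow> H (idx (Suc n)) (f n) (f (Suc n)))"
  proof (rule dependent_nat_choice)
    have "I (idx 0) (\<lambda>_. \<zero>\<^bsub>obj V b\<^esub>)"
    proof -
      have d0: "diff V b \<zero>\<^bsub>obj V b\<^esub> = \<zero>\<^bsub>obj V (b - 1)\<^esub>" by (rule diff_simps(4)[OF W W W])
      have "diff V b x = \<zero>\<^bsub>obj V (b - 1)\<^esub>" if "x \<in> carrier (obj V b)" for x
        by (rule zero_modD[OF b diff_simps(1)[OF W W W that]]) simp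
      with d0 show ?thesis by (simp add: I_def idx_def mod_hom_zero_map Vm)
    qed
    then show "\<exists>\<sigma>. Q (idx 0) \<longrightarrow> I (idx 0) \<sigma>" by blast
    fix \<sigma> n assume \<sigma>: "Q (idx n) \<longrightarrow> I (idx n) \<sigma>"
    show "\<exists>\<tau>. (Q (idx (Suc n)) \<longrightarrow> I (idx (Suc n)) \<tau>) \<and> (Q (idx (Suc n)) \<longrightarrow> H (idx (Suc n)) \<sigma> \<tau>)"
    proof (cases "Q (idx (Suc n))")
      case True
      have e: "idx (Suc n) - 1 = idx n" "idx n + 1 = idx (Suc n)" by (simp_all add: idx_def)
      have "I (idx n) \<sigma>" using \<sigma> down[OF True, of "idx n"] by (simp add: idx_def)
      then obtain \<tau> where "\<tau> \<in> mod_hom R (obj V (idx (Suc n))) (obj V (idx (Suc n) + 1))"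
        "\<And>x. x \<in> carrier (obj V (idx (Suc n))) \<Longrightarrow>
          diff V (idx (Suc n) + 1) (\<tau> x) \<oplus>\<^bsub>obj V (idx (Suc n))\<^esub> \<sigma> (diff V (idx (Suc n)) x) = x"
        "\<And>x. x \<in> carrier (obj V (idx (Suc n) + 1)) \<Longrightarrow>
          diff V (idx (Suc n) + 1) (\<tau> (diff V (idx (Suc n) + 1) x)) = diff V (idx (Suc n) + 1) x"
        using contraction_step[OF W projective_complexD(3)[OF V] ex[OF True], of \<sigma>] e
        unfolding I_def by metis
      then show ?thesis unfolding I_def H_def by blast
    qed blast
  qed
  then obtain f where f: "\<And>n. Q (idx n) \<Longrightarrow> I (idx n) (f n)"
    "\<And>n. Q (idx (Suc n)) \<Longrightarrow> H (idx (Suc n)) (f n) (f (Suc n))" by blast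
  define s where "s i = (if i < b - 1 then (\<lambda>_. \<zero>\<^bsub>obj V (i + 1)\<^esub>) else f (nat (i - b + 1)))" for i
  have hom: "s i \<in> mod_hom R (obj V i) (obj V (i + 1))" if "Q i" for i
  proof (cases "i < b - 1")
    case False
    then have "idx (nat (i - b + 1)) = i" by (simp add: idx_def)
    with f(1)[of "nat (i - b + 1)"] that False show ?thesis by (simp add: s_def I_def)
  qed (simp add: s_def mod_hom_zero_map Vm)
  show thesis
  proof
    show "s i \<in> mod_hom R (obj V i) (obj V (i + 1))" if "Q i" for i by (rule hom[OF that])
    fix i x assume Q: "Q i" and x: "x \<in> carrier (obj V i)"
    interpret Vi: module R "obj V i" by (rule Vm)
    show "diff V (i + 1) (s i x) \<oplus>\<^bsub>obj V i\<^esub> s (i - 1) (diff V i x) = x"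
    \<comment> \<open>Below \<open>b\<close> the homotopy equation lives in a zero module.\<close>
    proof (cases "i < b")
      case True
      have "s (i - 1) \<in> mod_hom R (obj V (i - 1)) (obj V i)" using hom[of "i - 1"] down[OF Q, of "i - 1"] by simp
      then have "diff V (i + 1) (s i x) \<oplus>\<^bsub>obj V i\<^esub> s (i - 1) (diff V i x) \<in> carrier (obj V i)"
        using x mod_hom_closed[OF Vm Vm hom[OF Q] x]
        by (intro Vi.M.a_closed diff_up_simps[OF W W W] mod_hom_closed[OF Vm Vm, of "s (i - 1)" "i - 1" i]
            diff_simps(1)[OF W W W])
      then show ?thesis using zero_modD[OF b[OF True]] x by metis
    next
      case False
      let ?n = "nat (i - b)"
      have e: "idx (Suc ?n) = i" "nat (i - b + 1) = Suc ?n" using False by (auto simp: idx_def)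
      from f(2)[of ?n] Q x e have "diff V (i + 1) (f (Suc ?n) x) \<oplus>\<^bsub>obj V i\<^esub> f ?n (diff V i x) = x"
        by (simp add: H_def)
      moreover have "s i = f (Suc ?n)" "s (i - 1) = f ?n" using False e(2) by (simp_all add: s_def)
      ultimately show ?thesis by simp
    qed
  qed
qed

text \<open>The comparison theorem, started in degree \<open>q\<close> from a prescribed map. Below
  \<open>q\<close> the target is zero, and above \<open>q\<close> each component is a lift of the
  previous one through the exact complex \<open>G\<close>.\<close>

lemma chain_map_extend:
  fixes V :: "('a, 'u) mod_complex" and G :: "('a, 'v) mod_complex"
  assumes V: "projective_complex R V" and G: "chain_complex R G"
    and G0: "\<And>i. i < q \<Longrightarrow> zero_mod (obj G i)" and ex: "\<And>i. q < i \<Longrightarrow> exact_at G i"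
    and f0: "f0 \<in> mod_hom R (obj V q) (obj G q)"
    and f0b: "\<And>x. x \<in> carrier (obj V (q + 1)) \<Longrightarrow> f0 (diff V (q + 1) x) \<in> boundaries G q"
  obtains f where "chain_map R V G f" "f q = f0"
proof -
  note W = projective_complexD(1)[OF V] and Vm = projective_complexD(4)[OF V]
    and Gm = chain_complexD(1)[OF G] and dV = chain_complexD(3)[OF W] and dG = chain_complexD(3)[OF G]
  define idx where "idx n = q + int n" for n
  have e: "idx (Suc n) = idx n + 1" for n by (simp add: idx_def)
  \<comment> \<open>The invariant is that boundaries go to boundaries. This is all that the lift to
    degree \<open>i + 1\<close> needs, and the exactness of \<open>G\<close> restores it
    there.\<close>
  define I where "I i \<sigma> \<longleftrightarrow> \<sigma> \<in> mod_hom R (obj V i) (obj G i) \<and>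
    (\<forall>x\<in>carrier (obj V (i + 1)). \<sigma> (diff V (i + 1) x) \<in> boundaries G i)" for i \<sigma>
  have "\<exists>F. \<forall>n. (I (idx n) (F n) \<and> (n = 0 \<longrightarrow> F n = f0)) \<and>
      (\<forall>x\<in>carrier (obj V (idx n + 1)). diff G (idx n + 1) (F (Suc n) x) = F n (diff V (idx n + 1) x))"
  proof (rule dependent_nat_choice)
    show "\<exists>\<sigma>. I (idx 0) \<sigma> \<and> (0 = 0 \<longrightarrow> \<sigma> = f0)" using f0 f0b by (auto simp: I_def idx_def)
    fix \<sigma> n assume "I (idx n) \<sigma> \<and> (n = 0 \<longrightarrow> \<sigma> = f0)"
    then have \<sigma>: "\<sigma> \<in> mod_hom R (obj V (idx n)) (obj G (idx n))"
      and \<sigma>b: "\<And>x. x \<in> carrier (obj V (idx n + 1)) \<Longrightarrow> \<sigma> (diff V (idx n + 1) x) \<in> boundaries G (idx n)"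
      by (auto simp: I_def)
    have "(\<lambda>x. \<sigma> (diff V (idx n + 1) x)) ` carrier (obj V (idx n + 1))
        \<subseteq> diff G (idx n + 1) ` carrier (obj G (idx n + 1))"
      using \<sigma>b by (auto simp: boundaries_def)
    then obtain \<tau> where \<tau>: "\<tau> \<in> mod_hom R (obj V (idx n + 1)) (obj G (idx n + 1))"
      "\<And>x. x \<in> carrier (obj V (idx n + 1)) \<Longrightarrow> diff G (idx n + 1) (\<tau> x) = \<sigma> (diff V (idx n + 1) x)"
      using projective_lift[OF projective_complexD(3)[OF V] Gm Gm dG mod_hom_comp[OF dV \<sigma>]] by metis
    have "\<tau> (diff V (idx n + 1 + 1) x) \<in> boundaries G (idx n + 1)"
      if x: "x \<in> carrier (obj V (idx n + 1 + 1))" for x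
    proof -
      have dx: "diff V (idx n + 1 + 1) x \<in> carrier (obj V (idx n + 1))"
        by (rule diff_up_simps(1)[OF W W W x])
      have "diff G (idx n + 1) (\<tau> (diff V (idx n + 1 + 1) x)) = \<zero>\<^bsub>obj G (idx n)\<^esub>"
        using chain_complexD(4)[OF W x] mod_hom_zero[OF Vm Gm \<sigma>]
        by (simp only: \<tau>(2)[OF dx] add_diff_cancel_right')
      then have "\<tau> (diff V (idx n + 1 + 1) x) \<in> cycles G (idx n + 1)"
        using mod_hom_closed[OF Vm Gm \<tau>(1) dx] by (simp add: cycles_def)
      moreover have "exact_at G (idx n + 1)" by (rule ex) (simp add: idx_def)
      ultimately show ?thesis by (auto simp: exact_at_def)
    qed
    then show "\<exists>\<tau>. (I (idx (Suc n)) \<tau> \<and> (Suc n = 0 \<longrightarrow> \<tau> = f0)) \<and>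
       (\<forall>x\<in>carrier (obj V (idx n + 1)). diff G (idx n + 1) (\<tau> x) = \<sigma> (diff V (idx n + 1) x))"
      using \<tau> by (auto simp: I_def e)
  qed
  then obtain F where F: "\<And>n. I (idx n) (F n)" "F 0 = f0"
    "\<And>n x. x \<in> carrier (obj V (idx n + 1)) \<Longrightarrow> diff G (idx n + 1) (F (Suc n) x) = F n (diff V (idx n + 1) x)"
    by metis
  define f where "f i = (if i < q then (\<lambda>_. \<zero>\<^bsub>obj G i\<^esub>) else F (nat (i - q)))" for i
  have hom: "f i \<in> mod_hom R (obj V i) (obj G i)" for i
  proof (cases "i < q")
    case False
    then have "idx (nat (i - q)) = i" by (simp add: idx_def)
    with F(1)[of "nat (i - q)"] False show ?thesis by (simp add: f_def I_def)
  qed (simp add: f_def mod_hom_zero_map Gm)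
  have "diff G (i + 1) (f (i + 1) x) = f i (diff V (i + 1) x)" if x: "x \<in> carrier (obj V (i + 1))" for i x
  proof (cases "i < q")
    case True
    have "diff G (i + 1) (f (i + 1) x) \<in> carrier (obj G i)" "f i (diff V (i + 1) x) \<in> carrier (obj G i)"
      using x by (auto intro!: diff_up_simps[OF G G G] mod_hom_closed[OF Vm Gm hom] diff_up_simps[OF W W W])
    then show ?thesis using zero_modD[OF G0[OF True]] by metis
  next
    case False
    let ?n = "nat (i - q)"
    have "idx ?n = i" "nat (i + 1 - q) = Suc ?n" using False by (auto simp: idx_def)
    then show ?thesis using F(3)[of x ?n] x False by (simp add: f_def)
  qed
  with hom have "chain_map R V G f" by (simp add: chain_map_def)
  moreover have "f q = f0" by (simp add: f_def F(2))
  ultimately show thesis by (rule that)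
qed

section \<open>Killing homology\<close>

text \<open>\<open>homology_rank R N V i a\<close> says that the \<open>i\<close>-th homology of \<open>V\<close> is isomorphic to \<open>N\<^sup>a\<close>; the
  \<open>\<theta> l\<close> are the components of an isomorphism, seen as maps on cycles.\<close>

definition homology_rank ::
  "('a, 'r) ring_scheme \<Rightarrow> ('a, 'n) module \<Rightarrow> ('a, 'u) mod_complex \<Rightarrow> int \<Rightarrow> nat \<Rightarrow> bool"
where
  "homology_rank R N V i a \<longleftrightarrow> (\<exists>\<theta>.
     (\<forall>l<a. \<theta> l \<in> mod_hom R (cycle_mod V i) N) \<and>
     (\<forall>\<nu>. (\<forall>l<a. \<nu> l \<in> carrier N) \<longrightarrow> (\<exists>z\<in>cycles V i. \<forall>l<a. \<theta> l z = \<nu> l)) \<and>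
     (\<forall>z\<in>cycles V i. (\<forall>l<a. \<theta> l z = \<zero>\<^bsub>N\<^esub>) \<longleftrightarrow> z \<in> boundaries V i))"

lemma homology_rank_0: "homology_rank R N V i 0 \<Longrightarrow> exact_at V i"
  by (auto simp: homology_rank_def exact_at_def)

lemma homology_rank_0I:
  assumes "chain_complex R V" "exact_at V i" shows "homology_rank R N V i 0"
proof -
  \<comment> \<open>Even without components, the surjectivity clause of \<open>homology_rank\<close>
    asks for some cycle.\<close>
  have "\<zero>\<^bsub>obj V i\<^esub> \<in> cycles V i"
    using subgroup.one_closed[OF submodule.axioms(1)[OF cycles_submodule[OF assms(1)]]] by simp
  then show ?thesis using assms(2) by (auto simp: homology_rank_def exact_at_def)
qed

text \<open>A cycle of the cone is a cycle \<open>z\<close> of \<open>V\<close> together with a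
  witness \<open>g\<close> that \<open>f i z\<close> is a boundary. By \<open>fb\<close> such a
  \<open>z\<close> exists exactly when its components from \<open>b\<close> on vanish, so the
  components below \<open>b\<close> survive. Exactness of \<open>G\<close> in degree
  \<open>i + 1\<close> makes different witnesses differ by a boundary.\<close>

lemma homology_rank_cone:
  assumes V: "chain_complex R V" and G: "chain_complex R G" and f: "chain_map R V G f"
    and N: "module R N" and exG: "exact_at G (i + 1)" and ba: "b \<le> a"
    and hom: "\<And>l. l < a \<Longrightarrow> \<theta> l \<in> mod_hom R (cycle_mod V i) N"
    and surj: "\<And>\<nu>. (\<And>l. l < a \<Longrightarrow> \<nu> l \<in> carrier N) \<Longrightarrow> \<exists>z\<in>cycles V i. \<forall>l<a. \<theta> l z = \<nu> l"
    and ker: "\<And>z. z \<in> cycles V i \<Longrightarrow> (\<forall>l<a. \<theta> l z = \<zero>\<^bsub>N\<^esub>) \<longleftrightarrow> z \<in> boundaries V i"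
    and fb: "\<And>z. z \<in> cycles V i \<Longrightarrow> f i z \<in> boundaries G i \<longleftrightarrow> (\<forall>l. b \<le> l \<and> l < a \<longrightarrow> \<theta> l z = \<zero>\<^bsub>N\<^esub>)"
  shows "homology_rank R N (cone V G f) i b"
  unfolding homology_rank_def
proof (intro exI[of _ "\<lambda>l u. \<theta> l (fst u)"] conjI allI impI ballI)
  interpret N: module R N by (rule N)
  note Vm = chain_complexD(1)[OF V] and Gm = chain_complexD(1)[OF G]
  interpret Gi: module R "obj G i" by (rule Gm)
  interpret Gj: module R "obj G (i + 1)" by (rule Gm)
  have cyc: "u \<in> cycles (cone V G f) i \<longleftrightarrow> fst u \<in> cycles V i \<and> snd u \<in> carrier (obj G (i + 1)) \<and>
      f i (fst u) = diff G (i + 1) (snd u)" for u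
    using mod_hom_closed[OF Vm Gm chain_mapD(1)[OF f]] diff_up_simps(1)[OF G G G]
    by (cases u) (auto simp: cycles_def Gi.M.minus_zero_iff)
  show "(\<lambda>u. \<theta> l (fst u)) \<in> mod_hom R (cycle_mod (cone V G f) i) N" if "l < b" for l
  proof -
    have "fst \<in> mod_hom R (cycle_mod (cone V G f) i) (cycle_mod V i)"
      using cyc by (auto simp: mod_hom_def cycle_mod_def)
    from mod_hom_comp[OF this hom] that ba show ?thesis by simp
  qed
  show "\<exists>u\<in>cycles (cone V G f) i. \<forall>l<b. \<theta> l (fst u) = \<nu> l" if \<nu>: "\<forall>l<b. \<nu> l \<in> carrier N" for \<nu>
  proof -
    \<comment> \<open>The components detected by \<open>f\<close> are set to zero, so that
      \<open>f i z\<close> is a boundary and \<open>z\<close> lifts to the cone.\<close>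
    have "\<exists>z\<in>cycles V i. \<forall>l<a. \<theta> l z = (if l < b then \<nu> l else \<zero>\<^bsub>N\<^esub>)"
      by (rule surj) (use \<nu> in auto)
    then obtain z where z: "z \<in> cycles V i" "\<And>l. l < a \<Longrightarrow> \<theta> l z = (if l < b then \<nu> l else \<zero>\<^bsub>N\<^esub>)"
      by blast
    then have "f i z \<in> boundaries G i" by (simp add: fb)
    then obtain g where "g \<in> carrier (obj G (i + 1))" "f i z = diff G (i + 1) g" by (auto simp: boundaries_def)
    with z ba show ?thesis by (intro bexI[of _ "(z, g)"]) (auto simp: cyc)
  qed
  fix u assume "u \<in> cycles (cone V G f) i"
  then obtain x g where u: "u = (x, g)" and x: "x \<in> cycles V i" and g: "g \<in> carrier (obj G (i + 1))"
    and fx: "f i x = diff G (i + 1) g" by (cases u) (auto simp: cyc)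
  show "(\<forall>l<b. \<theta> l (fst u) = \<zero>\<^bsub>N\<^esub>) \<longleftrightarrow> u \<in> boundaries (cone V G f) i"
  proof
    assume 0: "\<forall>l<b. \<theta> l (fst u) = \<zero>\<^bsub>N\<^esub>"
    have "f i x \<in> boundaries G i" using fx g by (auto simp: boundaries_def)
    with 0 fb[OF x] have "\<forall>l<a. \<theta> l x = \<zero>\<^bsub>N\<^esub>" by (metis fst_conv not_less u)
    with ker[OF x] obtain y where y: "y \<in> carrier (obj V (i + 1))" "x = diff V (i + 1) y"
      by (auto simp: boundaries_def)
    have fy: "f (i + 1) y \<in> carrier (obj G (i + 1))" by (rule mod_hom_closed[OF Vm Gm chain_mapD(1)[OF f] y(1)])
    \<comment> \<open>\<open>y\<close> bounds \<open>x\<close> but not yet the pair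
      \<open>(x, g)\<close>. The error is a cycle of \<open>G\<close> in degree
      \<open>i + 1\<close>, and \<open>h\<close> corrects it.\<close>
    have "diff G (i + 1) (f (i + 1) y \<ominus>\<^bsub>obj G (i + 1)\<^esub> g) = \<zero>\<^bsub>obj G i\<^esub>"
      using y fx diff_up_simps(1)[OF G G G g]
      by (simp add: diff_up_simps(6)[OF G G G fy g] chain_mapD(2)[OF f] Gi.M.minus_zero_iff)
    then obtain h where h: "h \<in> carrier (obj G (i + 1 + 1))"
      "diff G (i + 1 + 1) h = f (i + 1) y \<ominus>\<^bsub>obj G (i + 1)\<^esub> g"
      using exact_atD[OF exG, of "f (i + 1) y \<ominus>\<^bsub>obj G (i + 1)\<^esub> g"] fy g by auto
    then have "g = f (i + 1) y \<ominus>\<^bsub>obj G (i + 1)\<^esub> diff G (i + 1 + 1) h"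
      using fy g by (simp add: Gj.M.add_minus_cancel)
    with u y h(1) show "u \<in> boundaries (cone V G f) i" by (auto simp: boundaries_def image_iff)
  next
    assume "u \<in> boundaries (cone V G f) i"
    then have "x \<in> boundaries V i" by (auto simp: boundaries_def u)
    then show "\<forall>l<b. \<theta> l (fst u) = \<zero>\<^bsub>N\<^esub>" using ker[OF x] ba u by auto
  qed
qed

lemma (in abelian_group) minus_add_add:
  assumes "x \<in> carrier G" "g \<in> carrier G" "z \<in> carrier G"
  shows "x \<ominus> g \<oplus> z \<oplus> g = x \<oplus> z"
proof -
  have "x \<ominus> g \<oplus> z \<oplus> g = (x \<ominus> g \<oplus> g) \<oplus> z" using assms by (simp add: a_minus_def a_ac)
  then show ?thesis using assms by (simp add: add_minus_cancel)
qed

lemma homology_rankE: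
  assumes "homology_rank R N V i a"
  obtains \<theta> where "\<And>l. l < a \<Longrightarrow> \<theta> l \<in> mod_hom R (cycle_mod V i) N"
    "\<And>\<nu>. (\<And>l. l < a \<Longrightarrow> \<nu> l \<in> carrier N) \<Longrightarrow> \<exists>z\<in>cycles V i. \<forall>l<a. \<theta> l z = \<nu> l"
    "\<And>z. z \<in> cycles V i \<Longrightarrow> (\<forall>l<a. \<theta> l z = \<zero>\<^bsub>N\<^esub>) \<longleftrightarrow> z \<in> boundaries V i"
proof -
  from assms obtain \<theta> where \<theta>: "\<forall>l<a. \<theta> l \<in> mod_hom R (cycle_mod V i) N"
    "\<forall>\<nu>. (\<forall>l<a. \<nu> l \<in> carrier N) \<longrightarrow> (\<exists>z\<in>cycles V i. \<forall>l<a. \<theta> l z = \<nu> l)"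
    "\<forall>z\<in>cycles V i. (\<forall>l<a. \<theta> l z = \<zero>\<^bsub>N\<^esub>) \<longleftrightarrow> z \<in> boundaries V i"
    unfolding homology_rank_def by (elim exE conjE)
  show thesis by (rule that[of \<theta>]) (use \<theta> in blast)+
qed

text \<open>The chain map has to induce one component of the homology in the lowest degree
  \<open>q\<close>. A contraction of \<open>V\<close> below \<open>q\<close> yields a projection
  \<open>\<pi>\<close> onto the cycles, through which the component extends to
  \<open>obj V q\<close>. As \<open>\<epsilon>\<close> presents \<open>N\<close> as the cokernel of
  \<open>G\<close> in degree \<open>q\<close>, the extension lifts to \<open>obj G q\<close> and
  from there to a chain map.\<close>

lemma kill_homology:
  fixes V :: "('a, 'u) mod_complex" and G :: "('a, 'v) mod_complex"
  assumes V: "projective_complex R V" and N: "module R N"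
    and rank: "\<And>i. homology_rank R N V i (a i)" and aq: "a q > 0" and a0: "\<And>i. i < q \<Longrightarrow> a i = 0"
    and G: "chain_complex R G" and G0: "\<And>i. i < q \<Longrightarrow> zero_mod (obj G i)"
    and Gex: "\<And>i. q < i \<Longrightarrow> exact_at G i"
    and \<epsilon>: "\<epsilon> \<in> mod_hom R (obj G q) N" "\<epsilon> ` carrier (obj G q) = carrier N"
      "\<And>x. x \<in> carrier (obj G q) \<Longrightarrow> \<epsilon> x = \<zero>\<^bsub>N\<^esub> \<longleftrightarrow> x \<in> boundaries G q"
  obtains f where "chain_map R V G f"
    "\<And>i. homology_rank R N (cone V G f) i ((a(q := a q - 1)) i)"
proof -
  note W = projective_complexD(1)[OF V] and Vm = projective_complexD(4)[OF V]
    and Gm = chain_complexD(1)[OF G]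
  interpret N: module R N by (rule N)
  interpret Vq: module R "obj V q" by (rule Vm)
  interpret Vp: module R "obj V (q - 1)" by (rule Vm)
  interpret Gq: module R "obj G q" by (rule Gm)
  note Zm = cycle_module[OF W, of q]
  have exV: "exact_at V i" if "i < q" for i using rank[of i] a0[OF that] by (simp add: homology_rank_0)
  obtain s where s: "\<And>i. i < q \<Longrightarrow> s i \<in> mod_hom R (obj V i) (obj V (i + 1))"
    "\<And>i x. i < q \<Longrightarrow> x \<in> carrier (obj V i) \<Longrightarrow>
       diff V (i + 1) (s i x) \<oplus>\<^bsub>obj V i\<^esub> s (i - 1) (diff V i x) = x"
    by (rule contraction_exists[where Q = "\<lambda>i. i < q", OF V exV]) (assumption, simp, blast)
  have sq: "s (q - 1) \<in> mod_hom R (obj V (q - 1)) (obj V q)" using s(1)[of "q - 1"] by simp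
  define \<pi> where "\<pi> x = x \<ominus>\<^bsub>obj V q\<^esub> s (q - 1) (diff V q x)" for x
  have dc: "diff V q x \<in> carrier (obj V (q - 1))" if "x \<in> carrier (obj V q)" for x
    by (rule diff_simps(1)[OF W W W that])
  have sc: "s (q - 1) (diff V q x) \<in> carrier (obj V q)" if "x \<in> carrier (obj V q)" for x
    by (rule mod_hom_closed[OF Vm Vm sq dc[OF that]])
  have dd: "diff V (q - 1) (diff V q x) = \<zero>\<^bsub>obj V (q - 1 - 1)\<^esub>" if "x \<in> carrier (obj V q)" for x
    using chain_complexD(4)[OF W, of x "q - 1"] that by simp
  \<comment> \<open>The homotopy in degree \<open>q - 1\<close> reads
    \<open>d (s y) + s (d y) = y\<close>. For \<open>y = d x\<close> its second term vanishes,
    whence \<open>d s d = d\<close>, and \<open>\<pi> x\<close> is a cycle.\<close>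
  have d\<pi>: "diff V q (\<pi> x) = \<zero>\<^bsub>obj V (q - 1)\<^esub>" if x: "x \<in> carrier (obj V q)" for x
  proof -
    have "s (q - 1 - 1) \<zero>\<^bsub>obj V (q - 1 - 1)\<^esub> = \<zero>\<^bsub>obj V (q - 1)\<^esub>"
      using mod_hom_zero[OF Vm Vm s(1)[of "q - 1 - 1"]] by simp
    moreover have "diff V q (s (q - 1) (diff V q x)) \<in> carrier (obj V (q - 1))" by (rule dc[OF sc[OF x]])
    ultimately have "diff V q (s (q - 1) (diff V q x)) = diff V q x"
      using s(2)[OF _ dc[OF x]] dd[OF x] by simp
    then show ?thesis
      using x dc[OF x] sc[OF x] unfolding \<pi>_def by (subst diff_simps(6)[OF W W W]) (simp_all add: Vp.M.minus_zero_iff)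
  qed
  have \<pi>_hom: "\<pi> \<in> mod_hom R (obj V q) (cycle_mod V q)"
  proof -
    have "\<pi> \<in> mod_hom R (obj V q) (obj V q)"
      unfolding \<pi>_def[abs_def] by (intro mod_hom_minus_map Vm mod_hom_id mod_hom_comp[OF _ sq] chain_complexD(2)[OF W])
    then show ?thesis using d\<pi> by (auto simp: mod_hom_def cycle_mod_def cycles_def)
  qed
  have \<pi>_id: "\<pi> z = z" if z: "z \<in> cycles V q" for z
    using z mod_hom_zero[OF Vm Vm sq] by (simp add: \<pi>_def cycles_def a_minus_def)
  obtain \<theta> where \<theta>: "\<And>l. l < a q \<Longrightarrow> \<theta> l \<in> mod_hom R (cycle_mod V q) N"
    "\<And>\<nu>. (\<And>l. l < a q \<Longrightarrow> \<nu> l \<in> carrier N) \<Longrightarrow> \<exists>z\<in>cycles V q. \<forall>l<a q. \<theta> l z = \<nu> l"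
    "\<And>z. z \<in> cycles V q \<Longrightarrow> (\<forall>l<a q. \<theta> l z = \<zero>\<^bsub>N\<^esub>) \<longleftrightarrow> z \<in> boundaries V q"
    by (rule homology_rankE[OF rank[of q]]) blast
  \<comment> \<open>The last copy of \<open>N\<close> is removed, so the other components keep their
    numbers.\<close>
  define m where "m = a q - 1"
  have m: "m < a q" "a q = Suc m" using aq by (auto simp: m_def)
  note \<phi> = mod_hom_comp[OF \<pi>_hom \<theta>(1)[OF m(1)]]
  have "(\<lambda>x. \<theta> m (\<pi> x)) ` carrier (obj V q) \<subseteq> \<epsilon> ` carrier (obj G q)"
    unfolding \<epsilon>(2) using mod_hom_closed[OF Vm N \<phi>] by auto
  then obtain f0 where f0: "f0 \<in> mod_hom R (obj V q) (obj G q)"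
    "\<And>x. x \<in> carrier (obj V q) \<Longrightarrow> \<epsilon> (f0 x) = \<theta> m (\<pi> x)"
    using projective_lift[OF projective_complexD(3)[OF V] Gm N \<epsilon>(1) \<phi>] by metis
  have f0z: "\<epsilon> (f0 z) = \<theta> m z" if "z \<in> cycles V q" for z
    using that f0(2)[of z] \<pi>_id[OF that] by (simp add: cycles_def)
  have "f0 (diff V (q + 1) x) \<in> boundaries G q" if x: "x \<in> carrier (obj V (q + 1))" for x
  proof -
    have b: "diff V (q + 1) x \<in> boundaries V q" using x by (auto simp: boundaries_def)
    then have z: "diff V (q + 1) x \<in> cycles V q" using boundaries_subset_cycles[OF W] by blast
    have "\<epsilon> (f0 (diff V (q + 1) x)) = \<zero>\<^bsub>N\<^esub>" using \<theta>(3)[OF z] b m(1) by (simp add: f0z[OF z])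
    moreover have "f0 (diff V (q + 1) x) \<in> carrier (obj G q)"
      by (rule mod_hom_closed[OF Vm Gm f0(1) diff_up_simps(1)[OF W W W x]])
    ultimately show ?thesis using \<epsilon>(3) by blast
  qed
  then obtain f where f: "chain_map R V G f" and fq: "f q = f0"
    using chain_map_extend[OF V G G0 Gex f0(1)] by metis
  note fh = chain_mapD(1)[OF f] and fc = mod_hom_closed[OF Vm Gm chain_mapD(1)[OF f]]
  have fz: "f i z \<in> cycles G i" if "z \<in> cycles V i" for i z
    using that chain_mapD(3)[OF f, of z i] fc mod_hom_zero[OF Vm Gm fh] by (auto simp: cycles_def)
  have fq_b: "f q z \<in> boundaries G q \<longleftrightarrow> \<theta> m z = \<zero>\<^bsub>N\<^esub>" if z: "z \<in> cycles V q" for z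
    using \<epsilon>(3)[of "f q z"] fc[of z q] z by (simp add: fq f0z cycles_def)
  have "homology_rank R N (cone V G f) i ((a(q := a q - 1)) i)" for i
  proof -
    \<comment> \<open>Above \<open>q\<close> the map \<open>f\<close> is zero on homology because
      \<open>G\<close> is exact there; in degree \<open>q\<close> it detects precisely component
      \<open>m\<close>; below \<open>q\<close> the cone has to remain exact.\<close>
    consider "i > q" | "i = q" | "i < q" by linarith
    then show ?thesis
    proof cases
      case 1
      obtain \<eta> where \<eta>: "\<And>l. l < a i \<Longrightarrow> \<eta> l \<in> mod_hom R (cycle_mod V i) N"
        "\<And>\<nu>. (\<And>l. l < a i \<Longrightarrow> \<nu> l \<in> carrier N) \<Longrightarrow> \<exists>z\<in>cycles V i. \<forall>l<a i. \<eta> l z = \<nu> l"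
        "\<And>z. z \<in> cycles V i \<Longrightarrow> (\<forall>l<a i. \<eta> l z = \<zero>\<^bsub>N\<^esub>) \<longleftrightarrow> z \<in> boundaries V i"
        by (rule homology_rankE[OF rank[of i]]) blast
      have "f i z \<in> boundaries G i" if "z \<in> cycles V i" for z
        using fz[OF that] Gex[OF 1] by (auto simp: exact_at_def)
      then have "homology_rank R N (cone V G f) i (a i)"
        using Gex[of "i + 1"] 1 by (intro homology_rank_cone[OF W G f N _ _ \<eta>]) auto
      then show ?thesis using 1 by simp
    next
      case 2
      have "homology_rank R N (cone V G f) q m"
        using Gex[of "q + 1"] m fq_b
        by (intro homology_rank_cone[OF W G f N _ _ \<theta>]) (auto simp: less_Suc_eq_le)
      then show ?thesis using 2 by (simp add: m_def)
    next
      case 3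
      interpret Vj: module R "obj V (i + 1)" by (rule Vm)
      interpret Vi: module R "obj V i" by (rule Vm)
      have "exact_at (cone V G f) i"
        unfolding exact_at_def
      proof
        fix u assume u: "u \<in> cycles (cone V G f) i"
        obtain x g where [simp]: "u = (x, g)" by (cases u)
        from u have x: "x \<in> carrier (obj V i)" "diff V i x = \<zero>\<^bsub>obj V (i - 1)\<^esub>" and g: "g \<in> carrier (obj G (i + 1))"
          by (auto simp: cycles_def)
        obtain y where y: "y \<in> carrier (obj V (i + 1))" "diff V (i + 1) y = x"
          using exact_atD[OF exV[OF 3] x] by blast
        have "\<exists>y' h. y' \<in> carrier (obj V (i + 1)) \<and> diff V (i + 1) y' = x \<and> h \<in> carrier (obj G (i + 1 + 1)) \<and>
          g = f (i + 1) y' \<ominus>\<^bsub>obj G (i + 1)\<^esub> diff G (i + 1 + 1) h"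
        proof (cases "i + 1 < q")
          case True
          interpret Gj: module R "obj G (i + 1)" by (rule Gm)
          interpret Gk: module R "obj G (i + 1 + 1)" by (rule Gm)
          have "f (i + 1) y \<ominus>\<^bsub>obj G (i + 1)\<^esub> diff G (i + 1 + 1) \<zero>\<^bsub>obj G (i + 1 + 1)\<^esub> \<in> carrier (obj G (i + 1))"
            using fc[OF y(1)] diff_up_simps(1)[OF G G G Gk.M.zero_closed] by simp
          then have "g = f (i + 1) y \<ominus>\<^bsub>obj G (i + 1)\<^esub> diff G (i + 1 + 1) \<zero>\<^bsub>obj G (i + 1 + 1)\<^esub>"
            using zero_modD[OF G0[OF True]] g by metis
          with y show ?thesis using Gk.M.zero_closed by blast
        next
          case False
          \<comment> \<open>The critical degree: an element of \<open>obj G q\<close> not accounted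
            for by \<open>V\<close> would create homology of the cone in degree
            \<open>q - 1\<close>. This does not happen because \<open>\<theta> m\<close> maps the
            cycles onto \<open>N\<close>.\<close>
          then have iq: "i + 1 = q" using 3 by simp
          note g = g[unfolded iq] and y = y[unfolded iq]
          let ?w = "f q y \<ominus>\<^bsub>obj G q\<^esub> g"
          have w: "?w \<in> carrier (obj G q)" "f q y \<in> carrier (obj G q)" using fc[OF y(1)] g by auto
          have \<epsilon>w: "\<epsilon> ?w \<in> carrier N" by (rule mod_hom_closed[OF Gm N \<epsilon>(1) w(1)])
          \<comment> \<open>\<open>?w\<close> measures how far \<open>y\<close> is from producing
            \<open>g\<close>. The cycle \<open>c\<close> is chosen to cancel the class of
            \<open>?w\<close> in \<open>N\<close>; of its components only number \<open>m\<close> is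
            used.\<close>
          have "\<exists>z\<in>cycles V q. \<forall>l<a q. \<theta> l z = \<ominus>\<^bsub>N\<^esub> \<epsilon> ?w" by (rule \<theta>(2)) (use \<epsilon>w in auto)
          then obtain c where c: "c \<in> cycles V q" "\<theta> m c = \<ominus>\<^bsub>N\<^esub> \<epsilon> ?w" using m(1) by auto
          then have cV: "c \<in> carrier (obj V q)" "diff V q c = \<zero>\<^bsub>obj V (q - 1)\<^esub>" by (auto simp: cycles_def)
          have fcq: "f q c \<in> carrier (obj G q)" by (rule fc[OF cV(1)])
          have "\<epsilon> (?w \<oplus>\<^bsub>obj G q\<^esub> f q c) = \<zero>\<^bsub>N\<^esub>"
          proof -
            have "\<epsilon> (f q c) = \<ominus>\<^bsub>N\<^esub> \<epsilon> ?w" using f0z[OF c(1)] c(2) by (simp add: fq)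
            then show ?thesis by (simp only: mod_hom_add[OF Gm N \<epsilon>(1) w(1) fcq] N.M.r_neg[OF \<epsilon>w])
          qed
          then have "?w \<oplus>\<^bsub>obj G q\<^esub> f q c \<in> boundaries G q"
            using \<epsilon>(3)[of "?w \<oplus>\<^bsub>obj G q\<^esub> f q c"] w fcq by auto
          then obtain h where h: "h \<in> carrier (obj G (q + 1))" "?w \<oplus>\<^bsub>obj G q\<^esub> f q c = diff G (q + 1) h"
            by (auto simp: boundaries_def)
          have "f q (y \<oplus>\<^bsub>obj V q\<^esub> c) = diff G (q + 1) h \<oplus>\<^bsub>obj G q\<^esub> g"
            unfolding h(2)[symmetric] mod_hom_add[OF Vm Gm fh y(1) cV(1)]
            using Gq.M.minus_add_add[OF w(2) g fcq] by simp
          moreover have dh: "diff G (q + 1) h \<in> carrier (obj G q)" by (rule diff_up_simps(1)[OF G G G h(1)])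
          ultimately have "g = f q (y \<oplus>\<^bsub>obj V q\<^esub> c) \<ominus>\<^bsub>obj G q\<^esub> diff G (q + 1) h"
            using g by (simp add: Gq.M.a_comm Gq.M.add_minus_cancel)
          moreover have "diff V q (y \<oplus>\<^bsub>obj V q\<^esub> c) = x"
            using cV y(2) dc[OF y(1)] by (simp add: diff_simps(2)[OF W W W y(1) cV(1)])
          ultimately show ?thesis using h(1) y(1) cV(1) unfolding iq
            by (intro exI[of _ "y \<oplus>\<^bsub>obj V q\<^esub> c"] exI[of _ h]) simp
        qed
        then show "u \<in> boundaries (cone V G f) i" by (force simp: boundaries_def)
      qed
      then show ?thesis
        using 3 a0[OF 3] homology_rank_0I[OF cone_chain_complex[OF W G f]] by simp
    qed
  qed
  with f show thesis by (rule that)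
qed

section \<open>Homology ranks and projectivity under encodings, cones and shifts\<close>

lemma transport_cycle_hom:
  assumes K: "chain_complex R K" and inj: "\<And>i. inj_on enc (carrier (obj K i))"
  shows "inv_into (carrier (obj K i)) enc \<in> mod_hom R (cycle_mod (transport_complex enc K) i) (cycle_mod K i)"
proof -
  let ?dec = "inv_into (carrier (obj K i)) enc"
  have cyc: "cycles K i \<subseteq> carrier (obj K i)" by (auto simp: cycles_def)
  have dc: "?dec (enc z) = z" if "z \<in> cycles K i" for z using that cyc inj by auto
  have "?dec \<in> mod_hom R (obj (transport_complex enc K) i) (obj K i)"
    by (rule chain_mapD(1)[OF transport_dec_chain_map[OF K inj]])
  then show ?thesis
    using cyc by (auto simp: mod_hom_def cycle_mod_def transport_cycles[OF K inj] dc subset_iff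
        transport_obj[OF K inj] transport_sel)
qed

lemma homology_rank_transport:
  assumes K: "chain_complex R K" and inj: "\<And>i. inj_on enc (carrier (obj K i))"
    and "homology_rank R N K i a"
  shows "homology_rank R N (transport_complex enc K) i a"
proof -
  obtain \<theta> where \<theta>: "\<And>l. l < a \<Longrightarrow> \<theta> l \<in> mod_hom R (cycle_mod K i) N"
    "\<And>\<nu>. (\<And>l. l < a \<Longrightarrow> \<nu> l \<in> carrier N) \<Longrightarrow> \<exists>z\<in>cycles K i. \<forall>l<a. \<theta> l z = \<nu> l"
    "\<And>z. z \<in> cycles K i \<Longrightarrow> (\<forall>l<a. \<theta> l z = \<zero>\<^bsub>N\<^esub>) \<longleftrightarrow> z \<in> boundaries K i"
    by (rule homology_rankE[OF assms(3)]) blast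
  let ?T = "transport_complex enc K" and ?dec = "inv_into (carrier (obj K i)) enc"
  have cyc: "cycles K i \<subseteq> carrier (obj K i)" and bd: "boundaries K i \<subseteq> carrier (obj K i)"
    using boundaries_subset_cycles[OF K, of i] by (auto simp: cycles_def)
  have dc: "?dec (enc z) = z" if "z \<in> cycles K i" for z using that cyc inj by auto
  have bi: "enc z \<in> enc ` boundaries K i \<longleftrightarrow> z \<in> boundaries K i" if "z \<in> cycles K i" for z
    using that cyc bd by (intro inj_on_image_mem_iff[OF inj[of i]]) auto
  show ?thesis
    unfolding homology_rank_def transport_cycles[OF K inj] transport_boundaries[OF K inj]
    using mod_hom_comp[OF transport_cycle_hom[OF K inj] \<theta>(1)] \<theta>(2,3)
    by (intro exI[of _ "\<lambda>l u. \<theta> l (?dec u)"]) (auto simp: dc bi)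
qed

lemma transport_projective_complex:
  assumes K: "projective_complex R K" and inj: "\<And>i. inj_on enc (carrier (obj K i))"
  shows "projective_complex R (transport_complex enc K)"
proof -
  note C = projective_complexD(1)[OF K]
  obtain b where "\<And>i. i < b \<Longrightarrow> zero_mod (obj K i)"
    using projective_complexD(2)[OF K] by (auto simp: bounded_below_def)
  then have "bounded_below (transport_complex enc K)"
    unfolding bounded_below_def transport_obj[OF C inj]
    using transport_zero_mod[OF projective_complexD(4)[OF K] inj] by blast
  then show ?thesis
    unfolding projective_complex_def transport_obj[OF C inj]
    using transport_chain_complex[OF C inj] transport_projective[OF projective_complexD(3)[OF K] inj] by blast
qed

lemma cone_projective_complex:
  assumes V: "projective_complex R V" and G: "projective_complex R G" and f: "chain_map R V G f"
  shows "projective_complex R (cone V G f)"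
proof -
  obtain b c where bc: "\<And>i. i < b \<Longrightarrow> zero_mod (obj V i)" "\<And>i. i < c \<Longrightarrow> zero_mod (obj G i)"
    using projective_complexD(2)[OF V] projective_complexD(2)[OF G] by (auto simp: bounded_below_def)
  have "zero_mod (pair_mod (obj V i) (obj G (i + 1)))" if "i < min b (c - 1)" for i
    using that bc(1)[of i] bc(2)[of "i + 1"] by (auto simp: zero_mod_def)
  then show ?thesis
    unfolding projective_complex_def bounded_below_def cone_sel
    using cone_chain_complex[OF projective_complexD(1)[OF V] projective_complexD(1)[OF G] f]
      pair_projective[OF projective_complexD(3)[OF V] projective_complexD(3)[OF G]] by blast
qed

lemma shift_projective_complex: "projective_complex R V \<Longrightarrow> projective_complex R (shift_complex q V)"
  unfolding projective_complex_def bounded_below_def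
  by (auto simp: shift_chain_complex) (metis add.commute less_diff_eq diff_less_eq)

section \<open>Lists as a universal carrier\<close>

text \<open>The type of the chosen resolutions is closed under pairing, so that mapping cones of
  complexes in this type can be formed inside it.\<close>

definition list_pair :: "('x + 'y) list \<Rightarrow> ('x + 'y) list \<Rightarrow> ('x + 'y) list" where
  "list_pair u v = map (\<lambda>_. Inl undefined) u @ Inr undefined # u @ v"

text \<open>The leading block of entries \<open>Inl undefined\<close> ends at the marker
  \<open>Inr undefined\<close>. Its length is that of \<open>u\<close>, and this tells where
  \<open>u\<close> stops and \<open>v\<close> begins.\<close>

lemma list_pair_inject: "list_pair u v = list_pair u' v' \<longleftrightarrow> u = u' \<and> v = v'"
proof
  assume eq: "list_pair u v = list_pair u' v'"
  have t: "takeWhile isl (list_pair u v) = map (\<lambda>_. Inl undefined) u" for u v :: "('x + 'y) list"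
    unfolding list_pair_def by (subst takeWhile_append2) auto
  have "length u = length u'" using arg_cong[OF eq, of "\<lambda>w. length (takeWhile isl w)"] by (simp add: t)
  with eq show "u = u' \<and> v = v'" by (simp add: list_pair_def)
qed simp

lemma list_pair_inj: "inj_on (case_prod list_pair) A"
  by (auto simp: inj_on_def list_pair_inject)

fun list_code :: "('x + 'y) list list \<Rightarrow> ('x + 'y) list" where
  "list_code [] = []"
| "list_code (u # us) = list_pair u (list_code us)"

lemma list_code_inject: "list_code us = list_code vs \<longleftrightarrow> us = vs"
proof (induction us arbitrary: vs)
  case Nil
  then show ?case by (cases vs) (simp_all add: list_pair_def)
next
  case (Cons u us)
  have "list_pair u (list_code us) \<noteq> []" by (simp add: list_pair_def)
  with Cons show ?case by (cases vs) (simp_all add: list_pair_inject)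
qed

text \<open>The graph of a finitely supported function over its support, as a list. The order of the
  support is an arbitrary choice, but one that depends on the support alone. Free modules on sets of
  lists thus fit into the type of lists again.\<close>

definition support_code :: "('a, 'r) ring_scheme \<Rightarrow> (('a + 'y) list \<Rightarrow> 'a) \<Rightarrow> ('a + 'y) list" where
  "support_code R \<phi> = list_code (map (\<lambda>b. list_pair b [Inl (\<phi> b)]) (SOME l. set l = {b. \<phi> b \<noteq> \<zero>\<^bsub>R\<^esub>}))"

lemma support_code_inj:
  fixes B :: "('a + 'y) list set"
  shows "inj_on (support_code R) (carrier (free_mod R B))"
proof (rule inj_onI, rule ext)
  fix \<phi> \<psi> :: "('a + 'y) list \<Rightarrow> 'a" and b
  let ?l = "\<lambda>\<phi>. SOME l. set l = {b. \<phi> b \<noteq> \<zero>\<^bsub>R\<^esub>}"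
  assume *: "\<phi> \<in> carrier (free_mod R B)" "\<psi> \<in> carrier (free_mod R B)" "support_code R \<phi> = support_code R \<psi>"
  have l: "set (?l \<phi>) = {b. \<phi> b \<noteq> \<zero>\<^bsub>R\<^esub>}" if "\<phi> \<in> carrier (free_mod R B)" for \<phi> :: "('a + 'y) list \<Rightarrow> 'a"
    by (rule someI_ex, rule finite_list) (use that in \<open>simp add: free_mod_def\<close>)
  have "map (\<lambda>b. list_pair b [Inl (\<phi> b)]) (?l \<phi>) = map (\<lambda>b. list_pair b [Inl (\<psi> b)]) (?l \<psi>)"
    using *(3) by (simp add: support_code_def list_code_inject)
  from arg_cong[OF this, of set]
  have img: "(\<lambda>b. list_pair b [Inl (\<phi> b)]) ` {b. \<phi> b \<noteq> \<zero>\<^bsub>R\<^esub>} = (\<lambda>b. list_pair b [Inl (\<psi> b)]) ` {b. \<psi> b \<noteq> \<zero>\<^bsub>R\<^esub>}"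
    by (simp only: set_map l[OF *(1)] l[OF *(2)])
  have "\<phi> b = \<psi> b" if "\<phi> b \<noteq> \<zero>\<^bsub>R\<^esub>"
  proof -
    from that have "list_pair b [Inl (\<phi> b)] \<in> (\<lambda>b. list_pair b [Inl (\<psi> b)]) ` {b. \<psi> b \<noteq> \<zero>\<^bsub>R\<^esub>}"
      unfolding img[symmetric] by blast
    then show ?thesis by (auto simp: list_pair_inject)
  qed
  moreover have "\<phi> b = \<psi> b" if "\<psi> b \<noteq> \<zero>\<^bsub>R\<^esub>"
  proof -
    from that have "list_pair b [Inl (\<psi> b)] \<in> (\<lambda>b. list_pair b [Inl (\<phi> b)]) ` {b. \<phi> b \<noteq> \<zero>\<^bsub>R\<^esub>}"
      unfolding img by blast
    then show ?thesis by (auto simp: list_pair_inject)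
  qed
  ultimately show "\<phi> b = \<psi> b" by metis
qed

text \<open>The free module on the set \<open>carrier C\<close>, encoded back into the type of
  \<open>C\<close>; no minimality is meant. Since the type does not change, the construction can be
  iterated on kernels.\<close>

lemma projective_cover_exists:
  fixes C :: "('a, ('a + 'n) list) module"
  assumes C: "module R C"
  obtains P :: "('a, ('a + 'n) list) module" and p where
    "projective_mod R P" "p \<in> mod_hom R P C" "p ` carrier P = carrier C"
proof -
  interpret C: module R C by (rule C)
  note R = C.R.is_cring
  let ?F = "free_mod R (carrier C)" and ?e = "free_ext R C (\<lambda>y. y)"
  let ?dec = "inv_into (carrier ?F) (support_code R)"
  have e: "?e \<in> mod_hom R ?F C" by (intro free_ext_hom C) auto
  note p = mod_hom_comp[OF transport_dec_hom[OF free_module[OF R] support_code_inj, of "carrier C"] e]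
  show thesis
  proof
    show P: "projective_mod R (transport_mod (support_code R) ?F)"
      by (intro transport_projective free_projective R support_code_inj)
    show "(\<lambda>u. ?e (?dec u)) \<in> mod_hom R (transport_mod (support_code R) ?F) C" by (rule p)
    have "?e (free_gen R x) = x" if "x \<in> carrier C" for x
      by (rule free_ext_gen[OF C _ that]) auto
    then have "carrier C \<subseteq> ?e ` carrier ?F" using free_gen_closed[OF R] by force
    then show "(\<lambda>u. ?e (?dec u)) ` carrier (transport_mod (support_code R) ?F) = carrier C"
      using mod_hom_closed[OF free_module[OF R] C e]
      by (auto simp: transport_sel image_image inv_into_f_f[OF support_code_inj])
  qed
qed

lemma homology_iso_iff:
  assumes K: "chain_complex R K" and N: "module R N"
  shows "mod_iso R (homology K i) N \<longleftrightarrow> (\<exists>h\<in>mod_hom R (cycle_mod K i) N.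
    h ` cycles K i = carrier N \<and> (\<forall>x\<in>cycles K i. h x = \<zero>\<^bsub>N\<^esub> \<longleftrightarrow> x \<in> boundaries K i))"
  unfolding homology_def cycle_mod_def[symmetric]
  by (subst quot_iso_iff[OF cycle_module[OF K] boundaries_submodule_cycle[OF K] N])
    (simp add: cycle_mod_def)

text \<open>Cover \<open>N\<close> by a projective module, then cover the kernel of each map
  obtained so far.\<close>

lemma projective_resolution_exists:
  fixes N :: "('a, 'n) module"
  assumes N: "module R N"
  shows "\<exists>K :: ('a, ('a + 'n) list) mod_complex. projective_resolution R N K"
proof -
  interpret N: module R N by (rule N)
  note R = N.R.is_cring
  \<comment> \<open>Singleton lists move \<open>N\<close> into the list type, so that all stages of
    the recursion have the same type.\<close>
  let ?enc = "\<lambda>x :: 'n. [Inr x :: 'a + 'n]"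
  have inj: "inj_on ?enc A" for A by (auto simp: inj_on_def)
  define N' where "N' = transport_mod ?enc N"
  have N': "module R N'" unfolding N'_def by (rule transport_module[OF N inj])
  define Z where "Z = transport_mod (support_code R) (free_mod R ({} :: ('a + 'n) list set))"
  have Zp: "projective_mod R Z"
    unfolding Z_def by (intro transport_projective free_projective R support_code_inj)
  have Z0: "zero_mod Z"
  proof -
    have "zero_mod (free_mod R ({} :: ('a + 'n) list set))"
      by (auto simp: zero_mod_def free_mod_def)
    then show ?thesis
      unfolding Z_def by (subst transport_zero_mod[OF free_module[OF R] support_code_inj])
  qed
  \<comment> \<open>A stage is a triple of a projective module, the target of its map, and the map.
    \<open>I\<close> fixes the target \<open>N'\<close> at stage zero, and \<open>H\<close> says
    that the next map has the kernel of the present one as its image.\<close>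
  define I where "I n x \<longleftrightarrow> projective_mod R (fst x) \<and> module R (fst (snd x)) \<and>
      snd (snd x) \<in> mod_hom R (fst x) (fst (snd x)) \<and>
      (n = 0 \<longrightarrow> fst (snd x) = N' \<and> snd (snd x) ` carrier (fst x) = carrier N')"
    for n :: nat and x :: "('a, ('a + 'n) list) module \<times> ('a, ('a + 'n) list) module \<times> (('a + 'n) list \<Rightarrow> ('a + 'n) list)"
  define H where "H x y \<longleftrightarrow> fst (snd y) = fst x \<and> snd (snd y) ` carrier (fst y) =
      {u \<in> carrier (fst x). snd (snd x) u = \<zero>\<^bsub>fst (snd x)\<^esub>}"
    for x y :: "('a, ('a + 'n) list) module \<times> ('a, ('a + 'n) list) module \<times> (('a + 'n) list \<Rightarrow> ('a + 'n) list)"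
  have "\<exists>f. \<forall>n. I n (f n) \<and> H (f n) (f (Suc n))"
  proof (rule dependent_nat_choice)
    obtain P :: "('a, ('a + 'n) list) module" and p
      where "projective_mod R P" "p \<in> mod_hom R P N'" "p ` carrier P = carrier N'"
      by (rule projective_cover_exists[OF N'])
    then have "I 0 (P, N', p)" using N' by (simp add: I_def)
    then show "\<exists>x. I 0 x" ..
    fix x n
    assume "I n x"
    then have *: "projective_mod R (fst x)" "module R (fst (snd x))" "snd (snd x) \<in> mod_hom R (fst x) (fst (snd x))"
      by (auto simp: I_def)
    let ?k = "{u \<in> carrier (fst x). snd (snd x) u = \<zero>\<^bsub>fst (snd x)\<^esub>}"
    have k: "module R ((fst x)\<lparr>carrier := ?k\<rparr>)"
      by (rule module_restrict[OF projectiveD[OF *(1)] mod_hom_kernel_submodule[OF projectiveD[OF *(1)] *(2,3)]])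
    obtain P' :: "('a, ('a + 'n) list) module" and p where P': "projective_mod R P'"
      "p \<in> mod_hom R P' ((fst x)\<lparr>carrier := ?k\<rparr>)" "p ` carrier P' = carrier ((fst x)\<lparr>carrier := ?k\<rparr>)"
      by (rule projective_cover_exists[OF k])
    then have "p \<in> mod_hom R P' (fst x)" "p ` carrier P' = ?k" by (auto simp: mod_hom_def)
    then have "I (Suc n) (P', fst x, p) \<and> H x (P', fst x, p)"
      using P'(1) projectiveD[OF *(1)] by (simp add: I_def H_def)
    then show "\<exists>y. I (Suc n) y \<and> H x y" ..
  qed
  then obtain f where f: "\<And>n. I n (f n)" "\<And>n. H (f n) (f (Suc n))" by blast
  define P where "P n = fst (f n)" for n
  define D where "D n = fst (snd (f n))" for n
  define d where "d n = snd (snd (f n))" for n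
  have P: "projective_mod R (P n)" "module R (P n)" and dh: "d n \<in> mod_hom R (P n) (D n)" for n
    using f(1)[of n] projectiveD by (auto simp: I_def P_def D_def d_def)
  have D0: "D 0 = N'" "d 0 ` carrier (P 0) = carrier N'"
    using f(1)[of 0] by (auto simp: I_def P_def D_def d_def)
  have DS: "D (Suc n) = P n" "d (Suc n) ` carrier (P (Suc n)) = {x \<in> carrier (P n). d n x = \<zero>\<^bsub>D n\<^esub>}" for n
    using f(2)[of n] by (auto simp: H_def P_def D_def d_def)
  \<comment> \<open>The augmentation \<open>d 0\<close> onto \<open>N'\<close> is not part of the
    complex: from degree 0 downwards the differentials are zero.\<close>
  define K where "K = \<lparr>obj = (\<lambda>i. if i < 0 then Z else P (nat i)),
    diff = (\<lambda>i. if i \<le> 0 then (\<lambda>_. \<zero>\<^bsub>Z\<^esub>) else d (nat i))\<rparr>"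
  have obj: "obj K i = (if i < 0 then Z else P (nat i))"
    and diff: "diff K i = (if i \<le> 0 then (\<lambda>_. \<zero>\<^bsub>Z\<^esub>) else d (nat i))" for i
    by (simp_all add: K_def)
  have nat: "0 \<le> i \<Longrightarrow> nat (i + 1) = Suc (nat i)" for i :: int by simp
  have im: "diff K (i + 1) ` carrier (obj K (i + 1)) = {x \<in> carrier (P (nat i)). d (nat i) x = \<zero>\<^bsub>D (nat i)\<^esub>}"
    if "0 \<le> i" for i using that DS(2)[of "nat i"] by (simp add: obj diff nat)
  have K: "chain_complex R K"
  proof (rule chain_complexI)
    fix i
    show "module R (obj K i)" using P(2) projectiveD[OF Zp] by (simp add: obj)
    show "diff K (i + 1) \<in> mod_hom R (obj K (i + 1)) (obj K i)"
      using mod_hom_zero_map[OF projectiveD[OF Zp], of "obj K (i + 1)"] dh[of "Suc (nat i)"]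
      by (auto simp: obj diff nat DS(1))
    fix x assume x: "x \<in> carrier (obj K (i + 1))"
    show "diff K i (diff K (i + 1) x) = \<zero>\<^bsub>obj K (i - 1)\<^esub>"
    proof (cases "i \<le> 0")
      case False
      then have ge: "0 \<le> i" by simp
      have "diff K (i + 1) x \<in> diff K (i + 1) ` carrier (obj K (i + 1))" using x by (rule imageI)
      then have "d (nat i) (diff K (i + 1) x) = \<zero>\<^bsub>D (nat i)\<^esub>" unfolding im[OF ge] by simp
      moreover have "nat i = Suc (nat (i - 1))" using False by simp
      ultimately show ?thesis using False DS(1)[of "nat (i - 1)"] by (simp add: obj diff)
    qed (simp add: obj diff)
  qed
  have "exact_at K i" if "i > 0" for i
  proof -
    have "nat i = Suc (nat (i - 1))" using that by simp
    then have "D (nat i) = P (nat (i - 1))" using DS(1)[of "nat (i - 1)"] by simp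
    then have "cycles K i = {x \<in> carrier (P (nat i)). d (nat i) x = \<zero>\<^bsub>D (nat i)\<^esub>}"
      using that by (simp add: cycles_def obj diff)
    then show ?thesis using im[of i] that by (simp add: exact_at_def boundaries_def)
  qed
  moreover have "mod_iso R (homology K 0) N"
    unfolding homology_iso_iff[OF K N]
  proof (intro bexI conjI ballI)
    let ?dec = "inv_into (carrier N) ?enc"
    have c0: "cycles K 0 = carrier (P 0)" by (simp add: cycles_def obj diff)
    have b0: "boundaries K 0 = {x \<in> carrier (P 0). d 0 x = \<zero>\<^bsub>N'\<^esub>}" using im[of 0] by (simp add: boundaries_def D0)
    have dec: "?dec \<in> mod_hom R N' N" unfolding N'_def by (rule transport_dec_hom[OF N inj])
    have "(\<lambda>x. ?dec (d 0 x)) \<in> mod_hom R (P 0) N" using mod_hom_comp[OF dh[of 0] dec[folded D0(1)]] .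
    then show "(\<lambda>x. ?dec (d 0 x)) \<in> mod_hom R (cycle_mod K 0) N"
      by (simp add: cycle_mod_def c0 obj mod_hom_def)
    have "?dec ` carrier N' = carrier N" by (simp add: N'_def transport_sel image_image inv_into_f_f[OF inj])
    then show "(\<lambda>x. ?dec (d 0 x)) ` cycles K 0 = carrier N"
      unfolding c0 D0(2)[symmetric] by (simp add: image_image)
    fix x assume "x \<in> cycles K 0"
    then have x: "x \<in> carrier (P 0)" by (simp add: c0)
    have "d 0 x \<in> carrier N'" using D0(2) x by auto
    then obtain y where y: "y \<in> carrier N" "d 0 x = ?enc y" by (auto simp: N'_def transport_sel)
    then have "?dec (d 0 x) = y" using inv_into_f_f[OF inj y(1)] by simp
    moreover have "d 0 x = \<zero>\<^bsub>N'\<^esub> \<longleftrightarrow> y = \<zero>\<^bsub>N\<^esub>" using y by (simp add: N'_def transport_sel)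
    ultimately show "?dec (d 0 x) = \<zero>\<^bsub>N\<^esub> \<longleftrightarrow> x \<in> boundaries K 0" using x by (simp add: b0)
  qed
  ultimately have "projective_resolution R N K"
    using K P(1) Zp Z0 zero_homology_iff[OF K] by (auto simp: projective_resolution_def obj)
  then show ?thesis ..
qed

lemma chosen_resolution: "module R N \<Longrightarrow> projective_resolution R N (chosen_resolution R N)"
  unfolding chosen_resolution_def by (rule someI_ex) (rule projective_resolution_exists)

lemma projective_resolutionD:
  assumes F: "projective_resolution R N F" and N: "module R N"
  shows "projective_complex R F" "i < 0 \<Longrightarrow> zero_mod (obj F i)" "0 < i \<Longrightarrow> exact_at F i"
    "\<exists>\<epsilon>\<in>mod_hom R (obj F 0) N. \<epsilon> ` carrier (obj F 0) = carrier N \<and>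
       (\<forall>x\<in>carrier (obj F 0). \<epsilon> x = \<zero>\<^bsub>N\<^esub> \<longleftrightarrow> x \<in> boundaries F 0)"
proof -
  have K: "chain_complex R F" and neg: "\<And>i. i < 0 \<Longrightarrow> zero_mod (obj F i)"
    using F by (auto simp: projective_resolution_def)
  show "i < 0 \<Longrightarrow> zero_mod (obj F i)" by (rule neg)
  show "projective_complex R F"
    using F neg unfolding projective_complex_def projective_resolution_def bounded_below_def by blast
  show "0 < i \<Longrightarrow> exact_at F i"
    using F zero_homology_iff[OF K] by (auto simp: projective_resolution_def)
  \<comment> \<open>Degree \<open>-1\<close> is zero, so every element of degree 0 is a cycle, and
    the isomorphism of homology becomes an augmentation onto \<open>N\<close>.\<close>
  have "cycles F 0 = carrier (obj F 0)"
    using diff_simps(1)[OF K K K, of _ 0] zero_modD[OF neg[of "-1"]] by (auto simp: cycles_def)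
  moreover have "mod_hom R (cycle_mod F 0) N = mod_hom R (obj F 0) N"
    using calculation by (simp add: cycle_mod_def mod_hom_def)
  ultimately show "\<exists>\<epsilon>\<in>mod_hom R (obj F 0) N. \<epsilon> ` carrier (obj F 0) = carrier N \<and>
       (\<forall>x\<in>carrier (obj F 0). \<epsilon> x = \<zero>\<^bsub>N\<^esub> \<longleftrightarrow> x \<in> boundaries F 0)"
    using F homology_iso_iff[OF K N, of 0] by (simp add: projective_resolution_def)
qed

section \<open>Vanishing theories\<close>

abbreviation list_cone :: "('a, ('x + 'y) list) mod_complex \<Rightarrow> ('a, ('x + 'y) list) mod_complex \<Rightarrow>
    (int \<Rightarrow> ('x + 'y) list \<Rightarrow> ('x + 'y) list) \<Rightarrow> ('a, ('x + 'y) list) mod_complex" where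
  "list_cone V G f \<equiv> transport_complex (case_prod list_pair) (cone V G f)"

text \<open>\<open>E j V\<close> stands for the vanishing of the \<open>j\<close>-th homology of \<open>V \<otimes> M\<close> or of the \<open>j\<close>-th
  cohomology of \<open>Hom(V, M)\<close>.  The two parts of the long exact sequence of the cone that are used
  read the same in both cases.\<close>

locale vanishing_theory =
  fixes R :: "('a, 'r) ring_scheme" and E :: "int \<Rightarrow> ('a, ('x + 'y) list) mod_complex \<Rightarrow> bool"
  assumes shift: "chain_complex R V \<Longrightarrow> E j (shift_complex q V) \<longleftrightarrow> E (j - q) V"
    and contractible: "\<lbrakk>chain_complex R V; \<And>i. s i \<in> mod_hom R (obj V i) (obj V (i + 1));
      \<And>i x. x \<in> carrier (obj V i) \<Longrightarrow> diff V (i + 1) (s i x) \<oplus>\<^bsub>obj V i\<^esub> s (i - 1) (diff V i x) = x\<rbrakk>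
      \<Longrightarrow> E j V"
    and cone_source: "\<lbrakk>chain_complex R V; chain_complex R G; chain_map R V G f;
      E j (list_cone V G f); E j G\<rbrakk> \<Longrightarrow> E j V"
    and cone_target: "\<lbrakk>chain_complex R V; chain_complex R G; chain_map R V G f;
      E j V; E (j - 1) (list_cone V G f)\<rbrakk> \<Longrightarrow> E j G"
begin

context
  fixes N :: "('a, 'n) module" and F :: "('a, ('x + 'y) list) mod_complex"
  assumes F: "projective_resolution R N F" and N: "module R N"
begin

text \<open>\<open>F\<close> moved up by \<open>q\<close> is zero below \<open>q\<close>, exact
  above \<open>q\<close>, and has \<open>N\<close> as its homology in degree \<open>q\<close>, as
  \<open>kill_homology\<close> requires. The cone is encoded into lists at once, so the step can be
  repeated.\<close>

lemma kill_list_cone: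
  fixes V :: "('a, ('x + 'y) list) mod_complex"
  assumes V: "projective_complex R V"
    and rank: "\<And>i. homology_rank R N V i (a i)" and aq: "a q > 0" and a0: "\<And>i. i < q \<Longrightarrow> a i = 0"
  obtains f where "chain_map R V (shift_complex q F) f"
    "projective_complex R (list_cone V (shift_complex q F) f)"
    "\<And>i. homology_rank R N (list_cone V (shift_complex q F) f) i ((a(q := a q - 1)) i)"
proof -
  let ?G = "shift_complex q F"
  note D = projective_resolutionD[OF F N]
  obtain \<epsilon> where \<epsilon>: "\<epsilon> \<in> mod_hom R (obj F 0) N" "\<epsilon> ` carrier (obj F 0) = carrier N"
    "\<And>x. x \<in> carrier (obj F 0) \<Longrightarrow> \<epsilon> x = \<zero>\<^bsub>N\<^esub> \<longleftrightarrow> x \<in> boundaries F 0" using D(4) by blast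
  note G = shift_projective_complex[OF D(1), of q]
  obtain f where f: "chain_map R V ?G f" "\<And>i. homology_rank R N (cone V ?G f) i ((a(q := a q - 1)) i)"
  proof (rule kill_homology[OF V N rank aq a0 projective_complexD(1)[OF G]])
    show "\<epsilon> \<in> mod_hom R (obj ?G q) N" "\<epsilon> ` carrier (obj ?G q) = carrier N" using \<epsilon> by simp_all
    show "x \<in> carrier (obj ?G q) \<Longrightarrow> \<epsilon> x = \<zero>\<^bsub>N\<^esub> \<longleftrightarrow> x \<in> boundaries ?G q" for x
      using \<epsilon>(3) by (simp add: shift_boundaries)
  qed (use D(2,3) in \<open>auto simp: shift_exact\<close>)
  note C = cone_projective_complex[OF V G f(1)]
  show thesis
    by (rule that[OF f(1) transport_projective_complex[OF C list_pair_inj]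
        homology_rank_transport[OF projective_complexD(1)[OF C] list_pair_inj f(2)]])
qed

text \<open>Induction on the total rank. Removing a copy of \<open>N\<close> from degree
  \<open>q\<close> costs the vanishing of \<open>E\<close> at \<open>F\<close> in degree
  \<open>j - q\<close>. At rank zero the complex is exact, hence contractible.\<close>

theorem vanishing_of_homology:
  fixes V :: "('a, ('x + 'y) list) mod_complex"
  assumes "projective_complex R V" "\<And>i. homology_rank R N V i (a i)" "finite {i. a i \<noteq> 0}"
    and "\<And>i. a i \<noteq> 0 \<Longrightarrow> E (j - i) F"
  shows "E j V"
  using assms
proof (induction "sum a {i. a i \<noteq> 0}" arbitrary: V a rule: less_induct)
  case (less a V)
  note V = less.prems(1) and W = projective_complexD(1)[OF less.prems(1)]
  show ?case
  proof (cases "{i. a i \<noteq> 0} = {}")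
    case True
    then have "exact_at V i" for i using less.prems(2)[of i] homology_rank_0 by auto
    then obtain s where "\<And>i. s i \<in> mod_hom R (obj V i) (obj V (i + 1))"
      "\<And>i x. x \<in> carrier (obj V i) \<Longrightarrow> diff V (i + 1) (s i x) \<oplus>\<^bsub>obj V i\<^esub> s (i - 1) (diff V i x) = x"
      by (rule contraction_exists[where Q = "\<lambda>_. True", OF V]) (simp, blast)
    then show ?thesis by (rule contractible[OF W])
  next
    case False
    define q where "q = Min {i. a i \<noteq> 0}"
    have q: "a q > 0" "\<And>i. i < q \<Longrightarrow> a i = 0"
    proof -
      show "a q > 0" using Min_in[OF less.prems(3) False] unfolding q_def by simp
      show "a i = 0" if "i < q" for i using Min_le[OF less.prems(3), of i] that unfolding q_def by fastforce
    qed
    let ?G = "shift_complex q F" and ?b = "a(q := a q - 1)"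
    obtain f where f: "chain_map R V ?G f" "projective_complex R (list_cone V ?G f)"
      "\<And>i. homology_rank R N (list_cone V ?G f) i (?b i)"
      by (rule kill_list_cone[OF V less.prems(2) q]) blast+
    have b: "{i. ?b i \<noteq> 0} \<subseteq> {i. a i \<noteq> 0}" by auto
    have fin: "finite {i. ?b i \<noteq> 0}" by (rule finite_subset[OF b less.prems(3)])
    \<comment> \<open>The support may shrink when a rank drops to zero. Summing over the old support
      makes the two totals comparable.\<close>
    have "sum ?b {i. ?b i \<noteq> 0} = sum ?b {i. a i \<noteq> 0}"
      using b less.prems(3) by (intro sum.mono_neutral_left) auto
    also have "\<dots> < sum a {i. a i \<noteq> 0}"
      using q(1) less.prems(3) by (intro sum_strict_mono_ex1) auto
    finally have "E j (list_cone V ?G f)"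
      using less.prems(4) by (intro less.hyps[OF _ f(2,3) fin]) (auto split: if_splits)
    moreover have "E j ?G"
      using less.prems(4)[of q] q(1) shift[OF projective_complexD(1)[OF projective_resolutionD(1)[OF F N]]] by simp
    ultimately show ?thesis
      using cone_source[OF W shift_chain_complex f(1)] projective_complexD(1)[OF projective_resolutionD(1)[OF F N]]
      by blast
  qed
qed

text \<open>Dimension shifting. A single cone is formed; its vanishing in degree
  \<open>j - 1\<close> is an instance of \<open>vanishing_of_homology\<close>, and
  \<open>cone_target\<close> then passes from \<open>V\<close> to \<open>F\<close> shifted by
  \<open>q\<close>.\<close>

theorem vanishing_of_resolution:
  fixes V :: "('a, ('x + 'y) list) mod_complex"
  assumes V: "projective_complex R V" and rank: "\<And>i. homology_rank R N V i (a i)"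
    and fin: "finite {i. a i \<noteq> 0}" and q: "a q > 0" "\<And>i. i < q \<Longrightarrow> a i = 0"
    and EV: "E j V" and EF: "\<And>i. a i \<noteq> 0 \<Longrightarrow> E (j - 1 - i) F"
  shows "E (j - q) F"
proof -
  let ?G = "shift_complex q F" and ?b = "a(q := a q - 1)"
  note K = projective_complexD(1)[OF projective_resolutionD(1)[OF F N]]
  obtain f where f: "chain_map R V ?G f" "projective_complex R (list_cone V ?G f)"
    "\<And>i. homology_rank R N (list_cone V ?G f) i (?b i)"
    by (rule kill_list_cone[OF V rank q]) blast+
  have "finite {i. ?b i \<noteq> 0}" by (rule finite_subset[OF _ fin]) auto
  then have "E (j - 1) (list_cone V ?G f)"
    using EF by (intro vanishing_of_homology[OF f(2,3)]) (auto split: if_splits)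
  then have "E j ?G"
    by (rule cone_target[OF projective_complexD(1)[OF V] shift_chain_complex[OF K] f(1) EV])
  then show ?thesis by (simp add: shift[OF K])
qed

end

end

section \<open>Vanishing of Ext\<close>

lemma (in abelian_group) minus_zero_right: "x \<in> carrier G \<Longrightarrow> x \<ominus> \<zero> = x"
  by (simp add: minus_solve)

section \<open>Modules of homomorphisms and the complex Hom(V, M)\<close>

lemma hom_mod_sel:
  "carrier (hom_mod R N M) = mod_hom R N M \<inter> extensional (carrier N)"
  "\<zero>\<^bsub>hom_mod R N M\<^esub> = (\<lambda>x\<in>carrier N. \<zero>\<^bsub>M\<^esub>)"
  "f \<oplus>\<^bsub>hom_mod R N M\<^esub> g = (\<lambda>x\<in>carrier N. f x \<oplus>\<^bsub>M\<^esub> g x)"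
  "r \<odot>\<^bsub>hom_mod R N M\<^esub> f = (\<lambda>x\<in>carrier N. r \<odot>\<^bsub>M\<^esub> f x)"
  by (simp_all add: hom_mod_def)

lemma restrict_mod_hom:
  assumes "module R N" "f \<in> mod_hom R N M"
  shows "(\<lambda>x\<in>carrier N. f x) \<in> carrier (hom_mod R N M)"
proof -
  interpret N: module R N by fact
  show ?thesis using assms(2) by (auto simp: hom_mod_sel mod_hom_def)
qed

lemma hom_module:
  assumes N: "module R N" and M: "module R M"
  shows "module R (hom_mod R N M)"
proof (rule moduleI)
  interpret N: module R N by (rule N)
  interpret M: module R M by (rule M)
  note rh = restrict_mod_hom[OF N]
  have c: "f x \<in> carrier M" if "f \<in> carrier (hom_mod R N M)" "x \<in> carrier N" for f x
    using that mod_hom_closed[OF N M] by (auto simp: hom_mod_sel)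
  have ext: "f = g" if "f \<in> carrier (hom_mod R N M)" "g \<in> carrier (hom_mod R N M)"
    "\<And>x. x \<in> carrier N \<Longrightarrow> f x = g x" for f g
    using that by (auto simp: hom_mod_sel intro: extensionalityI)
  have add: "f \<oplus>\<^bsub>hom_mod R N M\<^esub> g \<in> carrier (hom_mod R N M)"
    if "f \<in> carrier (hom_mod R N M)" "g \<in> carrier (hom_mod R N M)" for f g
    unfolding hom_mod_sel(3) using that by (intro rh mod_hom_add_map N M) (auto simp: hom_mod_sel)
  have sm: "r \<odot>\<^bsub>hom_mod R N M\<^esub> f \<in> carrier (hom_mod R N M)"
    if "r \<in> carrier R" "f \<in> carrier (hom_mod R N M)" for r f
  proof -
    have f: "f \<in> mod_hom R N M" using that by (simp add: hom_mod_sel)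
    \<comment> \<open>The commutativity of \<open>R\<close> is what makes a multiple of a linear map
      linear.\<close>
    have "(\<lambda>x. r \<odot>\<^bsub>M\<^esub> f x) \<in> mod_hom R N M"
      using that(1) mod_hom_simps[OF N M f]
      by (intro mod_homI) (auto simp: M.smult_r_distr M.smult_assoc1[symmetric]
          comm_monoid.m_comm[OF cring.axioms(2)[OF N.R.is_cring]])
    then show ?thesis unfolding hom_mod_sel(4) by (rule rh)
  qed
  have z: "\<zero>\<^bsub>hom_mod R N M\<^esub> \<in> carrier (hom_mod R N M)"
    unfolding hom_mod_sel(2) by (intro rh mod_hom_zero_map M)
  show "cring R" by (rule N.R.is_cring)
  show "abelian_group (hom_mod R N M)"
  proof (rule abelian_groupI)
    fix f g h assume f: "f \<in> carrier (hom_mod R N M)"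
    note [simp] = hom_mod_sel(2-4) c[OF f]
    show "\<zero>\<^bsub>hom_mod R N M\<^esub> \<oplus>\<^bsub>hom_mod R N M\<^esub> f = f"
      by (rule ext[OF add[OF z f] f]) simp
    have i: "(\<lambda>x\<in>carrier N. \<ominus>\<^bsub>M\<^esub> f x) \<in> carrier (hom_mod R N M)"
      using f by (intro rh mod_hom_inv_map N M) (simp add: hom_mod_sel)
    show "\<exists>g\<in>carrier (hom_mod R N M). g \<oplus>\<^bsub>hom_mod R N M\<^esub> f = \<zero>\<^bsub>hom_mod R N M\<^esub>"
      by (rule bexI[OF _ i], rule ext[OF add[OF i f] z]) (simp add: M.M.l_neg)
    assume g: "g \<in> carrier (hom_mod R N M)"
    note [simp] = c[OF g]
    show "f \<oplus>\<^bsub>hom_mod R N M\<^esub> g = g \<oplus>\<^bsub>hom_mod R N M\<^esub> f"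
      by (rule ext[OF add[OF f g] add[OF g f]]) (simp add: M.M.a_comm)
    assume h: "h \<in> carrier (hom_mod R N M)"
    note [simp] = c[OF h]
    show "f \<oplus>\<^bsub>hom_mod R N M\<^esub> g \<oplus>\<^bsub>hom_mod R N M\<^esub> h = f \<oplus>\<^bsub>hom_mod R N M\<^esub> (g \<oplus>\<^bsub>hom_mod R N M\<^esub> h)"
      by (rule ext[OF add[OF add[OF f g] h] add[OF f add[OF g h]]]) (simp add: M.M.a_assoc)
  qed (use add z in auto)
  fix f assume f: "f \<in> carrier (hom_mod R N M)"
  note [simp] = hom_mod_sel(2-4) c[OF f]
  show "\<one>\<^bsub>R\<^esub> \<odot>\<^bsub>hom_mod R N M\<^esub> f = f"
    by (rule ext[OF sm[OF N.R.one_closed f] f]) simp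
  fix a assume a: "a \<in> carrier R"
  show "a \<odot>\<^bsub>hom_mod R N M\<^esub> f \<in> carrier (hom_mod R N M)" by (rule sm[OF a f])
  show "a \<odot>\<^bsub>hom_mod R N M\<^esub> (f \<oplus>\<^bsub>hom_mod R N M\<^esub> g) = a \<odot>\<^bsub>hom_mod R N M\<^esub> f \<oplus>\<^bsub>hom_mod R N M\<^esub> a \<odot>\<^bsub>hom_mod R N M\<^esub> g"
    if g: "g \<in> carrier (hom_mod R N M)" for g
    by (rule ext[OF sm[OF a add[OF f g]] add[OF sm[OF a f] sm[OF a g]]])
      (simp add: a c[OF g] M.smult_r_distr)
  fix b assume b: "b \<in> carrier R"
  show "(a \<oplus>\<^bsub>R\<^esub> b) \<odot>\<^bsub>hom_mod R N M\<^esub> f = a \<odot>\<^bsub>hom_mod R N M\<^esub> f \<oplus>\<^bsub>hom_mod R N M\<^esub> b \<odot>\<^bsub>hom_mod R N M\<^esub> f"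
    by (rule ext[OF sm[OF N.R.a_closed[OF a b] f] add[OF sm[OF a f] sm[OF b f]]])
      (simp add: a b M.smult_l_distr)
  show "(a \<otimes>\<^bsub>R\<^esub> b) \<odot>\<^bsub>hom_mod R N M\<^esub> f = a \<odot>\<^bsub>hom_mod R N M\<^esub> (b \<odot>\<^bsub>hom_mod R N M\<^esub> f)"
    by (rule ext[OF sm[OF N.R.m_closed[OF a b] f] sm[OF a sm[OF b f]]])
      (simp add: a b M.smult_assoc1)
qed

lemma hom_chain_complex:
  assumes V: "chain_complex R V" and M: "module R M"
  shows "chain_complex R (hom_complex R V M)"
proof -
  note Vm = chain_complexD(1)[OF V] and dV = chain_complexD(2)[OF V]
  interpret M: module R M by (rule M)
  have dom: "obj V (- i + 1 - 1) = obj V (- i)" for i by simp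
  have dh: "diff (hom_complex R V M) i f \<in> carrier (hom_mod R (obj V (- i + 1)) M)"
    if "f \<in> carrier (hom_mod R (obj V (- i)) M)" for f i
  proof -
    have "f \<in> mod_hom R (obj V (- i)) M" using that by (simp add: hom_mod_sel)
    from mod_hom_comp[OF dV[of "- i + 1", unfolded dom] this] show ?thesis
      unfolding hom_complex_def by (auto intro: restrict_mod_hom[OF Vm])
  qed
  show ?thesis unfolding chain_complex_def
  proof (intro allI conjI ballI)
    fix i :: int
    have e: "- (i - 1) = - i + 1" "- (i - 1 - 1) = - i + 1 + 1" by simp_all
    show "module R (obj (hom_complex R V M) i)" by (simp add: hom_complex_def hom_module Vm M)
    have dc: "diff V (- i + 1) x \<in> carrier (obj V (- i))" if "x \<in> carrier (obj V (- i + 1))" for x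
      using diff_simps(1)[OF V V V that] by simp
    interpret V1: module R "obj V (- i + 1)" by (rule Vm)
    show "diff (hom_complex R V M) i \<in> mod_hom R (obj (hom_complex R V M) i) (obj (hom_complex R V M) (i - 1))"
    proof (rule mod_homI)
      fix f assume f: "f \<in> carrier (obj (hom_complex R V M) i)"
      then show "diff (hom_complex R V M) i f \<in> carrier (obj (hom_complex R V M) (i - 1))"
        using dh[of f i] by (simp add: hom_complex_def e)
    qed (auto simp: hom_complex_def hom_mod_sel e dc dc[simplified] intro!: restrict_ext)
    fix f assume f: "f \<in> carrier (obj (hom_complex R V M) i)"
    then have fh: "f \<in> mod_hom R (obj V (- i)) M" by (simp add: hom_complex_def hom_mod_sel)
    have "f (diff V (- i + 1) (diff V (- i + 1 + 1) x)) = \<zero>\<^bsub>M\<^esub>" if "x \<in> carrier (obj V (- i + 1 + 1))" for x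
      using chain_complexD(4)[OF V that] mod_hom_zero[OF Vm M fh] by (simp only: dom)
    moreover have "diff V (- i + 1 + 1) x \<in> carrier (obj V (- i + 1))" if "x \<in> carrier (obj V (- i + 1 + 1))" for x
      by (rule diff_up_simps(1)[OF V V V that])
    ultimately show "diff (hom_complex R V M) (i - 1) (diff (hom_complex R V M) i f) =
        \<zero>\<^bsub>obj (hom_complex R V M) (i - 1 - 1)\<^esub>"
      unfolding hom_complex_def mod_complex.simps e hom_mod_sel by (intro restrict_ext) simp
  qed
qed

text \<open>Every cocycle on degree \<open>j\<close> is a coboundary, written with plain
  homomorphisms. Values outside the carriers are ignored, which avoids restricting every function to
  its domain.\<close>

definition ext_vanishes ::
  "('a, 'r) ring_scheme \<Rightarrow> ('a, 'm) module \<Rightarrow> int \<Rightarrow> ('a, 'u) mod_complex \<Rightarrow> bool"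
where
  "ext_vanishes R M j V \<longleftrightarrow> (\<forall>\<alpha>\<in>mod_hom R (obj V j) M.
     (\<forall>x\<in>carrier (obj V (j + 1)). \<alpha> (diff V (j + 1) x) = \<zero>\<^bsub>M\<^esub>) \<longrightarrow>
     (\<exists>\<beta>\<in>mod_hom R (obj V (j - 1)) M. \<forall>x\<in>carrier (obj V j). \<alpha> x = \<beta> (diff V j x)))"

lemma ext_vanishesD:
  assumes "ext_vanishes R M j V" "\<alpha> \<in> mod_hom R (obj V j) M"
    and "\<And>x. x \<in> carrier (obj V (j + 1)) \<Longrightarrow> \<alpha> (diff V (j + 1) x) = \<zero>\<^bsub>M\<^esub>"
  shows "\<exists>\<beta>\<in>mod_hom R (obj V (j - 1)) M. \<forall>x\<in>carrier (obj V j). \<alpha> x = \<beta> (diff V j x)"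
  using assms unfolding ext_vanishes_def by (metis (full_types))

text \<open>The work is in passing between homomorphisms and their restrictions, since the elements
  of \<open>hom_mod\<close> are extensional. The degree is \<open>- j\<close> because
  \<open>hom_complex\<close> is graded homologically.\<close>

lemma hom_complex_exact_iff:
  assumes V: "chain_complex R V" and M: "module R M"
  shows "zero_mod (homology (hom_complex R V M) (- j)) \<longleftrightarrow> ext_vanishes R M j V"
proof -
  note Vm = chain_complexD(1)[OF V]
  interpret Vj: module R "obj V j" by (rule Vm)
  have dc: "diff V (j + 1) x \<in> carrier (obj V j)" if "x \<in> carrier (obj V (j + 1))" for x
    by (rule diff_up_simps(1)[OF V V V that])
  have dj: "diff V j x \<in> carrier (obj V (j - 1))" if "x \<in> carrier (obj V j)" for x
    by (rule diff_simps(1)[OF V V V that])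
  have "- (- j + 1) = j - 1" "- (- j - 1) = j + 1" "- (- j + 1) + 1 = j" by simp_all
  then have C: "cycles (hom_complex R V M) (- j) = {f \<in> carrier (hom_mod R (obj V j) M).
      (\<lambda>x\<in>carrier (obj V (j + 1)). f (diff V (j + 1) x)) = (\<lambda>x\<in>carrier (obj V (j + 1)). \<zero>\<^bsub>M\<^esub>)}"
    and B: "boundaries (hom_complex R V M) (- j) =
      (\<lambda>g. \<lambda>x\<in>carrier (obj V j). g (diff V j x)) ` carrier (hom_mod R (obj V (j - 1)) M)"
    by (simp_all only: cycles_def boundaries_def hom_complex_def mod_complex.simps hom_mod_sel minus_minus)
  show ?thesis
    unfolding zero_homology_iff[OF hom_chain_complex[OF V M]] exact_at_def C B ext_vanishes_def
  proof safe
    fix \<alpha> assume sub: "{f \<in> carrier (hom_mod R (obj V j) M).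
      (\<lambda>x\<in>carrier (obj V (j + 1)). f (diff V (j + 1) x)) = (\<lambda>x\<in>carrier (obj V (j + 1)). \<zero>\<^bsub>M\<^esub>)}
      \<subseteq> (\<lambda>g. \<lambda>x\<in>carrier (obj V j). g (diff V j x)) ` carrier (hom_mod R (obj V (j - 1)) M)"
      and \<alpha>: "\<alpha> \<in> mod_hom R (obj V j) M" "\<forall>x\<in>carrier (obj V (j + 1)). \<alpha> (diff V (j + 1) x) = \<zero>\<^bsub>M\<^esub>"
    let ?\<alpha> = "\<lambda>x\<in>carrier (obj V j). \<alpha> x"
    have "?\<alpha> \<in> carrier (hom_mod R (obj V j) M)" by (rule restrict_mod_hom[OF Vm \<alpha>(1)])
    moreover have "(\<lambda>x\<in>carrier (obj V (j + 1)). ?\<alpha> (diff V (j + 1) x)) = (\<lambda>x\<in>carrier (obj V (j + 1)). \<zero>\<^bsub>M\<^esub>)"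
      using \<alpha>(2) dc by (intro restrict_ext) simp
    ultimately obtain g where g: "g \<in> carrier (hom_mod R (obj V (j - 1)) M)"
      "?\<alpha> = (\<lambda>x\<in>carrier (obj V j). g (diff V j x))" using sub by blast
    have "\<alpha> x = g (diff V j x)" if "x \<in> carrier (obj V j)" for x
      using fun_cong[OF g(2), of x] that by simp
    then show "\<exists>\<beta>\<in>mod_hom R (obj V (j - 1)) M. \<forall>x\<in>carrier (obj V j). \<alpha> x = \<beta> (diff V j x)"
      using g(1) by (auto simp: hom_mod_sel)
  next
    fix f assume ev: "\<forall>\<alpha>\<in>mod_hom R (obj V j) M.
       (\<forall>x\<in>carrier (obj V (j + 1)). \<alpha> (diff V (j + 1) x) = \<zero>\<^bsub>M\<^esub>) \<longrightarrow>
       (\<exists>\<beta>\<in>mod_hom R (obj V (j - 1)) M. \<forall>x\<in>carrier (obj V j). \<alpha> x = \<beta> (diff V j x))"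
      and f: "f \<in> carrier (hom_mod R (obj V j) M)"
      "(\<lambda>x\<in>carrier (obj V (j + 1)). f (diff V (j + 1) x)) = (\<lambda>x\<in>carrier (obj V (j + 1)). \<zero>\<^bsub>M\<^esub>)"
    have "f (diff V (j + 1) x) = \<zero>\<^bsub>M\<^esub>" if "x \<in> carrier (obj V (j + 1))" for x
      using fun_cong[OF f(2), of x] that by simp
    then obtain \<beta> where \<beta>: "\<beta> \<in> mod_hom R (obj V (j - 1)) M" "\<And>x. x \<in> carrier (obj V j) \<Longrightarrow> f x = \<beta> (diff V j x)"
      using ev f(1) by (auto simp: hom_mod_sel)
    let ?\<beta> = "\<lambda>x\<in>carrier (obj V (j - 1)). \<beta> x"
    have "f = (\<lambda>x\<in>carrier (obj V j). ?\<beta> (diff V j x))"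
      using f(1) \<beta>(2) dj by (intro extensionalityI[of f "carrier (obj V j)"]) (auto simp: hom_mod_sel)
    then show "f \<in> (\<lambda>g. \<lambda>x\<in>carrier (obj V j). g (diff V j x)) ` carrier (hom_mod R (obj V (j - 1)) M)"
      using restrict_mod_hom[OF Vm \<beta>(1)] by blast
  qed
qed

text \<open>A cocycle on \<open>V\<close> is pulled back along \<open>\<psi>\<close>, and a
  primitive of it found on \<open>W\<close> is pulled back along \<open>\<phi>\<close>. Applied to
  encoding and decoding, this makes the vanishing independent of the carrier type.\<close>

lemma ext_vanishes_retract:
  assumes V: "chain_complex R V" and W: "chain_complex R W"
    and \<phi>: "chain_map R V W \<phi>" and \<psi>: "chain_map R W V \<psi>"
    and id: "\<And>i x. x \<in> carrier (obj V i) \<Longrightarrow> \<psi> i (\<phi> i x) = x"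
    and M: "module R M" and E: "ext_vanishes R M j W"
  shows "ext_vanishes R M j V"
  unfolding ext_vanishes_def
proof (intro ballI impI)
  note Vm = chain_complexD(1)[OF V] and Wm = chain_complexD(1)[OF W]
  fix \<alpha> assume \<alpha>: "\<alpha> \<in> mod_hom R (obj V j) M" "\<forall>x\<in>carrier (obj V (j + 1)). \<alpha> (diff V (j + 1) x) = \<zero>\<^bsub>M\<^esub>"
  have 0: "\<alpha> (\<psi> j (diff W (j + 1) x)) = \<zero>\<^bsub>M\<^esub>" if x: "x \<in> carrier (obj W (j + 1))" for x
    unfolding chain_mapD(2)[OF \<psi> x, symmetric]
    using \<alpha>(2) mod_hom_closed[OF Wm Vm chain_mapD(1)[OF \<psi>] x] by blast
  from ext_vanishesD[OF E mod_hom_comp[OF chain_mapD(1)[OF \<psi>] \<alpha>(1)] 0]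
  obtain \<beta> where \<beta>h: "\<beta> \<in> mod_hom R (obj W (j - 1)) M"
    and \<beta>e: "\<forall>x\<in>carrier (obj W j). \<alpha> (\<psi> j x) = \<beta> (diff W j x)" ..
  note \<beta> = \<beta>h \<beta>e[rule_format]
  have "\<alpha> x = \<beta> (\<phi> (j - 1) (diff V j x))" if x: "x \<in> carrier (obj V j)" for x
    using \<beta>(2)[OF mod_hom_closed[OF Vm Wm chain_mapD(1)[OF \<phi>] x]] id[OF x] chain_mapD(3)[OF \<phi> x] by simp
  then show "\<exists>\<beta>\<in>mod_hom R (obj V (j - 1)) M. \<forall>x\<in>carrier (obj V j). \<alpha> x = \<beta> (diff V j x)"
    by (intro bexI[OF _ mod_hom_comp[OF chain_mapD(1)[OF \<phi>] \<beta>(1)]] ballI)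
qed

lemma ext_vanishes_transport:
  assumes "chain_complex R V" "\<And>i. inj_on enc (carrier (obj V i))" "module R M"
  shows "ext_vanishes R M j (transport_complex enc V) \<longleftrightarrow> ext_vanishes R M j V"
proof
  note T = transport_chain_complex[OF assms(1,2)]
    and \<phi> = transport_enc_chain_map[OF assms(1,2)] and \<psi> = transport_dec_chain_map[OF assms(1,2)]
  show "ext_vanishes R M j V" if "ext_vanishes R M j (transport_complex enc V)"
    using that assms(2) by (intro ext_vanishes_retract[OF assms(1) T \<phi> \<psi> _ assms(3)]) auto
  show "ext_vanishes R M j (transport_complex enc V)" if "ext_vanishes R M j V"
    using that assms(2)
    by (intro ext_vanishes_retract[OF T assms(1) \<psi> \<phi> _ assms(3)])
      (auto simp: transport_obj[OF assms(1,2)] transport_sel)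
qed

text \<open>Pulled back to the cone, \<open>\<alpha>\<close> has a primitive with components
  \<open>\<beta>1\<close> on \<open>V\<close> and \<open>\<gamma>\<close> on \<open>G\<close>. This
  means that \<open>\<alpha> = \<beta>1 d + \<gamma> f\<close> and that \<open>\<gamma>\<close> is a
  cocycle. Then \<open>\<gamma> = \<kappa> d\<close>, and as \<open>f\<close> commutes with
  \<open>d\<close>, the map \<open>\<beta>1 + \<kappa> f\<close> is a primitive of
  \<open>\<alpha>\<close>.\<close>

lemma ext_vanishes_cone_source:
  assumes V: "chain_complex R V" and G: "chain_complex R G" and f: "chain_map R V G f"
    and M: "module R M" and EC: "ext_vanishes R M j (cone V G f)" and EG: "ext_vanishes R M j G"
  shows "ext_vanishes R M j V"
  unfolding ext_vanishes_def
proof (intro ballI impI)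
  interpret M: module R M by (rule M)
  note Vm = chain_complexD(1)[OF V] and Gm = chain_complexD(1)[OF G]
  note Cm = chain_complexD(1)[OF cone_chain_complex[OF V G f]]
  interpret Gj: module R "obj G j" by (rule Gm)
  interpret Gj': module R "obj G (j + 1)" by (rule Gm)
  interpret Vp: module R "obj V (j - 1)" by (rule Vm)
  interpret Vj: module R "obj V j" by (rule Vm)
  fix \<alpha> assume \<alpha>: "\<alpha> \<in> mod_hom R (obj V j) M" "\<forall>x\<in>carrier (obj V (j + 1)). \<alpha> (diff V (j + 1) x) = \<zero>\<^bsub>M\<^esub>"
  have "(\<lambda>u. \<alpha> (fst u)) \<in> mod_hom R (obj (cone V G f) j) M"
    using mod_hom_comp[OF pair_fst_hom \<alpha>(1)] by simp
  moreover have "\<alpha> (fst (diff (cone V G f) (j + 1) u)) = \<zero>\<^bsub>M\<^esub>"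
    if "u \<in> carrier (obj (cone V G f) (j + 1))" for u using that \<alpha>(2) by auto
  ultimately have "\<exists>\<beta>\<in>mod_hom R (obj (cone V G f) (j - 1)) M.
      \<forall>u\<in>carrier (obj (cone V G f) j). \<alpha> (fst u) = \<beta> (diff (cone V G f) j u)"
    by (rule ext_vanishesD[OF EC])
  then obtain \<beta> where \<beta>h: "\<beta> \<in> mod_hom R (obj (cone V G f) (j - 1)) M"
    and \<beta>e: "\<forall>u\<in>carrier (obj (cone V G f) j). \<alpha> (fst u) = \<beta> (diff (cone V G f) j u)" ..
  note \<beta>' = \<beta>h \<beta>e[rule_format]
  have \<beta>: "\<beta> \<in> mod_hom R (pair_mod (obj V (j - 1)) (obj G j)) M"
    "\<And>x g. x \<in> carrier (obj V j) \<Longrightarrow> g \<in> carrier (obj G (j + 1)) \<Longrightarrow>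
      \<alpha> x = \<beta> (diff V j x, f j x \<ominus>\<^bsub>obj G j\<^esub> diff G (j + 1) g)"
    using \<beta>'(1) \<beta>'(2)[of "(_, _)"] by simp_all
  note PM = pair_module[OF Vm Gm, of "j - 1" j]
  define \<beta>1 where "\<beta>1 x = \<beta> (x, \<zero>\<^bsub>obj G j\<^esub>)" for x
  define \<gamma> where "\<gamma> y = \<beta> (\<zero>\<^bsub>obj V (j - 1)\<^esub>, y)" for y
  have \<beta>1: "\<beta>1 \<in> mod_hom R (obj V (j - 1)) M" unfolding \<beta>1_def[abs_def]
    by (rule mod_hom_comp[OF pair_inl_hom[OF Gm] \<beta>(1)])
  have \<gamma>: "\<gamma> \<in> mod_hom R (obj G j) M" unfolding \<gamma>_def[abs_def]
    by (rule mod_hom_comp[OF pair_inr_hom[OF Vm] \<beta>(1)])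
  have split: "\<beta> (x, y) = \<beta>1 x \<oplus>\<^bsub>M\<^esub> \<gamma> y" if "x \<in> carrier (obj V (j - 1))" "y \<in> carrier (obj G j)" for x y
    using that mod_hom_add[OF PM M \<beta>(1), of "(x, \<zero>\<^bsub>obj G j\<^esub>)" "(\<zero>\<^bsub>obj V (j - 1)\<^esub>, y)"]
    by (simp add: \<beta>1_def \<gamma>_def)
  have dV: "diff V j x \<in> carrier (obj V (j - 1))" "f j x \<in> carrier (obj G j)" if "x \<in> carrier (obj V j)" for x
    using diff_simps(1)[OF V V V that] mod_hom_closed[OF Vm Gm chain_mapD(1)[OF f] that] by auto
  have dG: "diff G (j + 1) g \<in> carrier (obj G j)" if "g \<in> carrier (obj G (j + 1))" for g
    by (rule diff_up_simps(1)[OF G G G that])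
  \<comment> \<open>The primitive equation at \<open>g = 0\<close>. At \<open>x = 0\<close> it
    yields the cocycle condition on \<open>\<gamma>\<close> shown below.\<close>
  have \<alpha>_eq: "\<alpha> x = \<beta>1 (diff V j x) \<oplus>\<^bsub>M\<^esub> \<gamma> (f j x)" if x: "x \<in> carrier (obj V j)" for x
    using \<beta>(2)[OF x Gj'.M.zero_closed] dV[OF x] diff_up_simps(4)[OF G G G, of j]
    by (simp add: split Gj.M.minus_zero_right)
  have f0: "f j \<zero>\<^bsub>obj V j\<^esub> = \<zero>\<^bsub>obj G j\<^esub>" by (rule mod_hom_zero[OF Vm Gm chain_mapD(1)[OF f]])
  have 0: "\<gamma> (diff G (j + 1) g) = \<zero>\<^bsub>M\<^esub>" if g: "g \<in> carrier (obj G (j + 1))" for g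
  proof -
    have "\<zero>\<^bsub>M\<^esub> = \<beta>1 \<zero>\<^bsub>obj V (j - 1)\<^esub> \<oplus>\<^bsub>M\<^esub> \<gamma> (\<ominus>\<^bsub>obj G j\<^esub> diff G (j + 1) g)"
      using \<beta>(2)[OF Vj.M.zero_closed g] dG[OF g] mod_hom_zero[OF Vm M \<alpha>(1)] diff_simps(4)[OF V V V, of j]
      by (simp add: a_minus_def split f0)
    then have "\<zero>\<^bsub>M\<^esub> = \<ominus>\<^bsub>M\<^esub> \<gamma> (diff G (j + 1) g)"
      using mod_hom_zero[OF Vm M \<beta>1] mod_hom_inv[OF Gm M \<gamma> dG[OF g]] mod_hom_closed[OF Gm M \<gamma> dG[OF g]] by simp
    then have "\<gamma> (diff G (j + 1) g) \<oplus>\<^bsub>M\<^esub> \<zero>\<^bsub>M\<^esub> = \<zero>\<^bsub>M\<^esub>"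
      using M.M.r_neg[OF mod_hom_closed[OF Gm M \<gamma> dG[OF g]]] by (simp only:)
    then show ?thesis using mod_hom_closed[OF Gm M \<gamma> dG[OF g]] by simp
  qed
  from ext_vanishesD[OF EG \<gamma> 0]
  obtain \<kappa> where \<kappa>h: "\<kappa> \<in> mod_hom R (obj G (j - 1)) M"
    and \<kappa>e: "\<forall>y\<in>carrier (obj G j). \<gamma> y = \<kappa> (diff G j y)" ..
  note \<kappa> = \<kappa>h \<kappa>e[rule_format]
  have bh: "(\<lambda>x. \<beta>1 x \<oplus>\<^bsub>M\<^esub> \<kappa> (f (j - 1) x)) \<in> mod_hom R (obj V (j - 1)) M"
    by (intro mod_hom_add_map Vm M \<beta>1 mod_hom_comp[OF chain_mapD(1)[OF f] \<kappa>(1)])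
  have "\<alpha> x = \<beta>1 (diff V j x) \<oplus>\<^bsub>M\<^esub> \<kappa> (f (j - 1) (diff V j x))" if "x \<in> carrier (obj V j)" for x
    using \<alpha>_eq[OF that] \<kappa>(2)[OF dV(2)[OF that]] chain_mapD(3)[OF f that] by simp
  then show "\<exists>\<beta>\<in>mod_hom R (obj V (j - 1)) M. \<forall>x\<in>carrier (obj V j). \<alpha> x = \<beta> (diff V j x)"
    by (intro bexI[OF _ bh] ballI)
qed

text \<open>The cocycle \<open>\<gamma> f\<close> on \<open>V\<close> has a primitive
  \<open>\<alpha>\<close>. Then \<open>(x, y) \<mapsto> \<gamma> y - \<alpha> x\<close> is a cocycle
  on the cone in degree \<open>j - 1\<close>, and restricting its primitive to the summand from
  \<open>G\<close> gives a primitive of \<open>\<gamma>\<close> up to sign.\<close>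

lemma ext_vanishes_cone_target:
  assumes V: "chain_complex R V" and G: "chain_complex R G" and f: "chain_map R V G f"
    and M: "module R M" and EV: "ext_vanishes R M j V" and EC: "ext_vanishes R M (j - 1) (cone V G f)"
  shows "ext_vanishes R M j G"
  unfolding ext_vanishes_def
proof (intro ballI impI)
  interpret M: module R M by (rule M)
  note Vm = chain_complexD(1)[OF V] and Gm = chain_complexD(1)[OF G]
  interpret Gj: module R "obj G j" by (rule Gm)
  interpret Vp: module R "obj V (j - 1)" by (rule Vm)
  fix \<gamma> assume \<gamma>: "\<gamma> \<in> mod_hom R (obj G j) M" "\<forall>x\<in>carrier (obj G (j + 1)). \<gamma> (diff G (j + 1) x) = \<zero>\<^bsub>M\<^esub>"
  have dV: "diff V j x \<in> carrier (obj V (j - 1))" "f j x \<in> carrier (obj G j)" if "x \<in> carrier (obj V j)" for x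
    using diff_simps(1)[OF V V V that] mod_hom_closed[OF Vm Gm chain_mapD(1)[OF f] that] by auto
  have dG: "diff G (j + 1) g \<in> carrier (obj G j)" if "g \<in> carrier (obj G (j + 1))" for g
    by (rule diff_up_simps(1)[OF G G G that])
  have 0: "\<gamma> (f j (diff V (j + 1) x)) = \<zero>\<^bsub>M\<^esub>" if x: "x \<in> carrier (obj V (j + 1))" for x
    using \<gamma>(2) chain_mapD(2)[OF f x] mod_hom_closed[OF Vm Gm chain_mapD(1)[OF f] x] by (metis)
  from ext_vanishesD[OF EV mod_hom_comp[OF chain_mapD(1)[OF f] \<gamma>(1)] 0]
  obtain \<alpha> where \<alpha>h: "\<alpha> \<in> mod_hom R (obj V (j - 1)) M"
    and \<alpha>e: "\<forall>x\<in>carrier (obj V j). \<gamma> (f j x) = \<alpha> (diff V j x)" ..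
  note \<alpha> = \<alpha>h \<alpha>e[rule_format]
  let ?h = "\<lambda>u. \<gamma> (snd u) \<ominus>\<^bsub>M\<^esub> \<alpha> (fst u)"
  note PM = pair_module[OF Vm Gm, of "j - 1" j]
  have h: "?h \<in> mod_hom R (pair_mod (obj V (j - 1)) (obj G j)) M"
    by (intro mod_hom_minus_map PM M mod_hom_comp[OF pair_fst_hom \<alpha>(1)] mod_hom_comp[OF pair_snd_hom \<gamma>(1)])
  have "?h (diff V j x, f j x \<ominus>\<^bsub>obj G j\<^esub> diff G (j + 1) g) = \<zero>\<^bsub>M\<^esub>"
    if x: "x \<in> carrier (obj V j)" and g: "g \<in> carrier (obj G (j + 1))" for x g
    using x g dV[OF x] dG[OF g] \<gamma>(2) \<alpha>(2)[OF x] mod_hom_closed[OF Gm M \<gamma>(1) dV(2)[OF x]]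
    by (simp add: mod_hom_minus[OF Gm M \<gamma>(1)] M.M.minus_zero_iff) (simp add: a_minus_def)
  then have hd: "?h (diff (cone V G f) (j - 1 + 1) u) = \<zero>\<^bsub>M\<^esub>"
    if "u \<in> carrier (obj (cone V G f) (j - 1 + 1))" for u
    using that by auto
  have h': "?h \<in> mod_hom R (obj (cone V G f) (j - 1)) M" using h by simp
  from ext_vanishesD[OF EC h' hd]
  obtain \<beta> where \<beta>h: "\<beta> \<in> mod_hom R (obj (cone V G f) (j - 1 - 1)) M"
    and \<beta>e: "\<forall>u\<in>carrier (obj (cone V G f) (j - 1)). ?h u = \<beta> (diff (cone V G f) (j - 1) u)" ..
  note \<beta> = \<beta>h \<beta>e[rule_format]
  \<comment> \<open>The sign undoes the minus in the cone differential.\<close>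
  define \<kappa> where "\<kappa> y = \<ominus>\<^bsub>M\<^esub> \<beta> (\<zero>\<^bsub>obj V (j - 1 - 1)\<^esub>, y)" for y
  have ob: "obj (cone V G f) (j - 1 - 1) = pair_mod (obj V (j - 1 - 1)) (obj G (j - 1))" by simp
  note \<beta>h = \<beta>(1)[unfolded ob]
  have \<kappa>: "\<kappa> \<in> mod_hom R (obj G (j - 1)) M" unfolding \<kappa>_def[abs_def]
    by (intro mod_hom_inv_map Gm M mod_hom_comp[OF pair_inr_hom[OF Vm] \<beta>h])
  have "\<gamma> y = \<kappa> (diff G j y)" if y: "y \<in> carrier (obj G j)" for y
  proof -
    interpret Gp: module R "obj G (j - 1)" by (rule Gm)
    interpret Vq: module R "obj V (j - 1 - 1)" by (rule Vm)
    have dy: "diff G j y \<in> carrier (obj G (j - 1))" by (rule diff_simps(1)[OF G G G y])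
    have "\<gamma> y = \<beta> (diff (cone V G f) (j - 1) (\<zero>\<^bsub>obj V (j - 1)\<^esub>, y))"
      using \<beta>(2)[of "(\<zero>\<^bsub>obj V (j - 1)\<^esub>, y)"] y mod_hom_zero[OF Vm M \<alpha>(1)] mod_hom_closed[OF Gm M \<gamma>(1) y]
      by (simp add: M.M.minus_zero_right)
    also have "diff (cone V G f) (j - 1) (\<zero>\<^bsub>obj V (j - 1)\<^esub>, y) = (\<zero>\<^bsub>obj V (j - 1 - 1)\<^esub>, \<ominus>\<^bsub>obj G (j - 1)\<^esub> diff G j y)"
      using dy diff_simps(4)[OF V V V, of "j - 1"] mod_hom_zero[OF Vm Gm chain_mapD(1)[OF f], of "j - 1"]
      by (simp add: a_minus_def)
    also have "\<beta> \<dots> = \<kappa> (diff G j y)"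
      unfolding \<kappa>_def using dy by (subst mod_hom_inv[OF Gm M mod_hom_comp[OF pair_inr_hom[OF Vm] \<beta>h]]) auto
    finally show ?thesis .
  qed
  then show "\<exists>\<beta>\<in>mod_hom R (obj G (j - 1)) M. \<forall>x\<in>carrier (obj G j). \<gamma> x = \<beta> (diff G j x)"
    by (intro bexI[OF _ \<kappa>] ballI)
qed

text \<open>A contraction \<open>s\<close> turns every cocycle \<open>\<alpha>\<close> into
  \<open>(\<alpha> s) d\<close>. The two laws for cones carry over to \<open>list_cone\<close>
  because the vanishing is invariant under encoding.\<close>

lemma ext_vanishing_theory:
  fixes R :: "('a, 'r) ring_scheme" and M :: "('a, 'm) module"
  assumes M: "module R M"
  shows "vanishing_theory R (ext_vanishes R M :: int \<Rightarrow> ('a, ('x + 'y) list) mod_complex \<Rightarrow> bool)"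
proof
  fix V G :: "('a, ('x + 'y) list) mod_complex" and j q :: int and f s
  assume V: "chain_complex R V"
  note Vm = chain_complexD(1)[OF V]
  interpret M: module R M by (rule M)
  have e: "j + 1 - q = j - q + 1" "j - 1 - q = j - q - 1" by simp_all
  show "ext_vanishes R M j (shift_complex q V) \<longleftrightarrow> ext_vanishes R M (j - q) V"
    unfolding ext_vanishes_def shift_sel e ..
  {
    assume s: "\<And>i. s i \<in> mod_hom R (obj V i) (obj V (i + 1))"
      and h: "\<And>i x. x \<in> carrier (obj V i) \<Longrightarrow> diff V (i + 1) (s i x) \<oplus>\<^bsub>obj V i\<^esub> s (i - 1) (diff V i x) = x"
    have sj: "s (j - 1) \<in> mod_hom R (obj V (j - 1)) (obj V j)" using s[of "j - 1"] by simp
    show "ext_vanishes R M j V" unfolding ext_vanishes_def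
    proof (intro ballI impI)
      fix \<alpha> assume \<alpha>: "\<alpha> \<in> mod_hom R (obj V j) M" "\<forall>x\<in>carrier (obj V (j + 1)). \<alpha> (diff V (j + 1) x) = \<zero>\<^bsub>M\<^esub>"
      have "\<alpha> x = \<alpha> (s (j - 1) (diff V j x))" if x: "x \<in> carrier (obj V j)" for x
      proof -
        have sx: "s j x \<in> carrier (obj V (j + 1))" by (rule mod_hom_closed[OF Vm Vm s x])
        have sd: "s (j - 1) (diff V j x) \<in> carrier (obj V j)"
          by (rule mod_hom_closed[OF Vm Vm sj diff_simps(1)[OF V V V x]])
        have "\<alpha> x = \<alpha> (diff V (j + 1) (s j x)) \<oplus>\<^bsub>M\<^esub> \<alpha> (s (j - 1) (diff V j x))"
          using mod_hom_add[OF Vm M \<alpha>(1) diff_up_simps(1)[OF V V V sx] sd] by (simp add: h[OF x])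
        then show ?thesis using \<alpha>(2) sx mod_hom_closed[OF Vm M \<alpha>(1) sd] by simp
      qed
      then show "\<exists>\<beta>\<in>mod_hom R (obj V (j - 1)) M. \<forall>x\<in>carrier (obj V j). \<alpha> x = \<beta> (diff V j x)"
        by (intro bexI[OF _ mod_hom_comp[OF sj \<alpha>(1)]] ballI)
    qed
  }
  assume G: "chain_complex R G" and f: "chain_map R V G f"
  note T = ext_vanishes_transport[OF cone_chain_complex[OF V G f] list_pair_inj M]
  show "ext_vanishes R M j V" if "ext_vanishes R M j (list_cone V G f)" "ext_vanishes R M j G"
    by (rule ext_vanishes_cone_source[OF V G f M that[unfolded T]])
  show "ext_vanishes R M j G" if "ext_vanishes R M j V" "ext_vanishes R M (j - 1) (list_cone V G f)"
    by (rule ext_vanishes_cone_target[OF V G f M that[unfolded T]])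
qed

section \<open>Tensor products\<close>

lemma quot_factor:
  assumes MM: "module R M" and HH: "submodule H R M" and AA: "module R A"
    and h: "h \<in> mod_hom R M A" and kill: "\<And>x. x \<in> H \<Longrightarrow> h x = \<zero>\<^bsub>A\<^esub>"
  shows "\<exists>h'\<in>mod_hom R (quot_mod M H) A. \<forall>x\<in>carrier M. h' (H +>\<^bsub>M\<^esub> x) = h x"
proof -
  interpret M: module R M by (rule MM)
  interpret A: module R A by (rule AA)
  interpret H: abelian_subgroup H M by (rule submodule_abelian_subgroup[OF MM HH])
  note [simp] = mod_hom_simps[OF MM AA h]
  define f where "f C = h (SOME x. x \<in> C)" for C
  have eq: "h x = h y" if "x \<in> carrier M" "y \<in> carrier M" "H +>\<^bsub>M\<^esub> x = H +>\<^bsub>M\<^esub> y" for x y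
  proof -
    have "x \<ominus>\<^bsub>M\<^esub> y \<in> H" using that by (simp add: coset_eq_iff[OF MM HH])
    from kill[OF this] show ?thesis using that by (simp add: A.M.minus_zero_iff)
  qed
  have f: "f (H +>\<^bsub>M\<^esub> x) = h x" if x: "x \<in> carrier M" for x
  proof -
    have *: "(SOME y. y \<in> H +>\<^bsub>M\<^esub> x) \<in> H +>\<^bsub>M\<^esub> x" using H.a_rcos_self[OF x] by (rule someI)
    show ?thesis unfolding f_def
      by (rule eq[OF H.a_elemrcos_carrier[OF x *] x H.a_repr_independence'[OF * x, symmetric]])
  qed
  have "f \<in> mod_hom R (quot_mod M H) A"
    by (rule mod_homI)
      (auto simp: quot_carrier[OF MM HH] quot_add[OF MM HH] quot_smult[OF MM HH] f)
  with f show ?thesis by (intro bexI[of _ f]) auto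
qed

lemma mod_span_submodule:
  assumes M: "module R M" and S: "S \<subseteq> carrier M"
  shows "submodule (mod_span R M S) R M"
proof -
  interpret M: module R M by (rule M)
  have c: "carrier M \<in> {H. submodule H R M \<and> S \<subseteq> H}" using S M.carrier_is_submodule by simp
  have z: "\<zero>\<^bsub>M\<^esub> \<in> H" if "submodule H R M" for H
    using subgroup.one_closed[OF submodule.axioms(1)[OF that]] by simp
  show ?thesis unfolding mod_span_def
    by (rule M.submoduleI) (use c z M.submoduleE in \<open>auto\<close>)
qed

lemma mod_span_subset: "S \<subseteq> mod_span R M S"
  by (auto simp: mod_span_def)

lemma mod_span_least: "submodule H R M \<Longrightarrow> S \<subseteq> H \<Longrightarrow> mod_span R M S \<subseteq> H"
  by (auto simp: mod_span_def)

section \<open>Pure tensors and the universal property of the tensor product\<close>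

definition tens ::
  "('a, 'r) ring_scheme \<Rightarrow> ('a, 'm) module \<Rightarrow> ('a, 'n) module \<Rightarrow> 'm \<Rightarrow> 'n \<Rightarrow> ('m \<times> 'n \<Rightarrow> 'a) set"
where
  "tens R P M x m = tensor_rel R P M +>\<^bsub>free_mod R (carrier P \<times> carrier M)\<^esub> free_gen R (x, m)"

context
  fixes R :: "('a, 'r) ring_scheme" and P :: "('a, 'p) module" and M :: "('a, 'm) module"
  assumes PP: "module R P" and MM: "module R M"
begin

interpretation P: module R P by (rule PP)
interpretation M: module R M by (rule MM)

private abbreviation "F \<equiv> free_mod R (carrier P \<times> carrier M)"
private abbreviation "g \<equiv> free_gen R :: 'p \<times> 'm \<Rightarrow> _"
private abbreviation "T \<equiv> tensor_mod R P M"

private lemma FF: "module R F" by (rule free_module[OF P.R.is_cring])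

interpretation F: module R F by (rule FF)

private lemma gc: "x \<in> carrier P \<Longrightarrow> m \<in> carrier M \<Longrightarrow> g (x, m) \<in> carrier F"
  by (intro free_gen_closed[OF P.R.is_cring]) simp

definition tensor_gens :: "('p \<times> 'm \<Rightarrow> 'a) set" where
  "tensor_gens = {g (x \<oplus>\<^bsub>P\<^esub> x', y) \<ominus>\<^bsub>F\<^esub> (g (x, y) \<oplus>\<^bsub>F\<^esub> g (x', y)) | x x' y.
          x \<in> carrier P \<and> x' \<in> carrier P \<and> y \<in> carrier M} \<union>
       {g (x, y \<oplus>\<^bsub>M\<^esub> y') \<ominus>\<^bsub>F\<^esub> (g (x, y) \<oplus>\<^bsub>F\<^esub> g (x, y')) | x y y'.
          x \<in> carrier P \<and> y \<in> carrier M \<and> y' \<in> carrier M} \<union>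
       {g (r \<odot>\<^bsub>P\<^esub> x, y) \<ominus>\<^bsub>F\<^esub> (r \<odot>\<^bsub>F\<^esub> g (x, y)) | r x y.
          r \<in> carrier R \<and> x \<in> carrier P \<and> y \<in> carrier M} \<union>
       {g (x, r \<odot>\<^bsub>M\<^esub> y) \<ominus>\<^bsub>F\<^esub> (r \<odot>\<^bsub>F\<^esub> g (x, y)) | r x y.
          r \<in> carrier R \<and> x \<in> carrier P \<and> y \<in> carrier M}"

private lemma gens1: "x \<in> carrier P \<Longrightarrow> x' \<in> carrier P \<Longrightarrow> y \<in> carrier M \<Longrightarrow>
    g (x \<oplus>\<^bsub>P\<^esub> x', y) \<ominus>\<^bsub>F\<^esub> (g (x, y) \<oplus>\<^bsub>F\<^esub> g (x', y)) \<in> tensor_gens"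
  unfolding tensor_gens_def Un_iff mem_Collect_eq
  by (rule disjI1, rule disjI1, rule disjI1, intro exI conjI, rule refl)

private lemma gens2: "x \<in> carrier P \<Longrightarrow> y \<in> carrier M \<Longrightarrow> y' \<in> carrier M \<Longrightarrow>
    g (x, y \<oplus>\<^bsub>M\<^esub> y') \<ominus>\<^bsub>F\<^esub> (g (x, y) \<oplus>\<^bsub>F\<^esub> g (x, y')) \<in> tensor_gens"
  unfolding tensor_gens_def Un_iff mem_Collect_eq
  by (rule disjI1, rule disjI1, rule disjI2, intro exI conjI, rule refl)

private lemma gens3: "r \<in> carrier R \<Longrightarrow> x \<in> carrier P \<Longrightarrow> y \<in> carrier M \<Longrightarrow>
    g (r \<odot>\<^bsub>P\<^esub> x, y) \<ominus>\<^bsub>F\<^esub> (r \<odot>\<^bsub>F\<^esub> g (x, y)) \<in> tensor_gens"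
  unfolding tensor_gens_def Un_iff mem_Collect_eq
  by (rule disjI1, rule disjI2, intro exI conjI, rule refl)

private lemma gens4: "r \<in> carrier R \<Longrightarrow> x \<in> carrier P \<Longrightarrow> y \<in> carrier M \<Longrightarrow>
    g (x, r \<odot>\<^bsub>M\<^esub> y) \<ominus>\<^bsub>F\<^esub> (r \<odot>\<^bsub>F\<^esub> g (x, y)) \<in> tensor_gens"
  unfolding tensor_gens_def Un_iff mem_Collect_eq
  by (rule disjI2, intro exI conjI, rule refl)

private lemma tensor_rel_eq: "tensor_rel R P M = mod_span R F tensor_gens"
  by (simp add: tensor_rel_def tensor_gens_def Let_def)

private lemma gens_carrier: "tensor_gens \<subseteq> carrier F"
  unfolding tensor_gens_def by (auto simp: gc)

lemma tensor_rel_submodule: "submodule (tensor_rel R P M) R F"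
  unfolding tensor_rel_eq by (rule mod_span_submodule[OF FF gens_carrier])

lemma tensor_module: "module R T"
  unfolding tensor_mod_def by (rule quot_module[OF FF tensor_rel_submodule])

private lemma gens_rel: "u \<in> tensor_gens \<Longrightarrow> u \<in> tensor_rel R P M"
  unfolding tensor_rel_eq by (rule subsetD[OF mod_span_subset])

private lemma quot_hom: "(\<lambda>\<phi>. tensor_rel R P M +>\<^bsub>F\<^esub> \<phi>) \<in> mod_hom R F T"
  unfolding tensor_mod_def by (rule quot_map_hom[OF FF tensor_rel_submodule])

private lemma coset_eqI:
  "a \<in> carrier F \<Longrightarrow> b \<in> carrier F \<Longrightarrow> a \<ominus>\<^bsub>F\<^esub> b \<in> tensor_gens \<Longrightarrow>
    tensor_rel R P M +>\<^bsub>F\<^esub> a = tensor_rel R P M +>\<^bsub>F\<^esub> b"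
  by (simp add: coset_eq_iff[OF FF tensor_rel_submodule] gens_rel)

lemma tens_closed: "x \<in> carrier P \<Longrightarrow> m \<in> carrier M \<Longrightarrow> tens R P M x m \<in> carrier T"
  unfolding tens_def by (rule mod_hom_closed[OF FF tensor_module quot_hom gc])

lemma tens_add_left:
  assumes "x \<in> carrier P" "x' \<in> carrier P" "m \<in> carrier M"
  shows "tens R P M (x \<oplus>\<^bsub>P\<^esub> x') m = tens R P M x m \<oplus>\<^bsub>T\<^esub> tens R P M x' m"
  unfolding tens_def mod_hom_add[OF FF tensor_module quot_hom gc[OF assms(1,3)] gc[OF assms(2,3)], symmetric]
  by (rule coset_eqI[OF _ _ gens1[OF assms]]) (use assms gc in simp_all)

lemma tens_add_right:
  assumes "x \<in> carrier P" "m \<in> carrier M" "m' \<in> carrier M"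
  shows "tens R P M x (m \<oplus>\<^bsub>M\<^esub> m') = tens R P M x m \<oplus>\<^bsub>T\<^esub> tens R P M x m'"
  unfolding tens_def mod_hom_add[OF FF tensor_module quot_hom gc[OF assms(1,2)] gc[OF assms(1,3)], symmetric]
  by (rule coset_eqI[OF _ _ gens2[OF assms]]) (use assms gc in simp_all)

lemma tens_smult_left:
  assumes "r \<in> carrier R" "x \<in> carrier P" "m \<in> carrier M"
  shows "tens R P M (r \<odot>\<^bsub>P\<^esub> x) m = r \<odot>\<^bsub>T\<^esub> tens R P M x m"
  unfolding tens_def mod_hom_smult[OF FF tensor_module quot_hom assms(1) gc[OF assms(2,3)], symmetric]
  by (rule coset_eqI[OF _ _ gens3[OF assms]]) (use assms gc in simp_all)

lemma tens_smult_right: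
  assumes "r \<in> carrier R" "x \<in> carrier P" "m \<in> carrier M"
  shows "tens R P M x (r \<odot>\<^bsub>M\<^esub> m) = r \<odot>\<^bsub>T\<^esub> tens R P M x m"
  unfolding tens_def mod_hom_smult[OF FF tensor_module quot_hom assms(1) gc[OF assms(2,3)], symmetric]
  by (rule coset_eqI[OF _ _ gens4[OF assms]]) (use assms gc in simp_all)

lemma tens_zero_left:
  assumes "m \<in> carrier M" shows "tens R P M \<zero>\<^bsub>P\<^esub> m = \<zero>\<^bsub>T\<^esub>"
proof -
  interpret T: module R T by (rule tensor_module)
  show ?thesis
    using tens_smult_left[of "\<zero>\<^bsub>R\<^esub>" "\<zero>\<^bsub>P\<^esub>" m] assms tens_closed[of "\<zero>\<^bsub>P\<^esub>" m] by simp
qed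

text \<open>Cosets of free generators are pure tensors, so the two maps already agree on the free
  module before it is divided.\<close>

lemma tensor_hom_eq:
  assumes A: "module R A" and h: "h \<in> mod_hom R T A" and k: "k \<in> mod_hom R T A"
    and eq: "\<And>x m. x \<in> carrier P \<Longrightarrow> m \<in> carrier M \<Longrightarrow> h (tens R P M x m) = k (tens R P M x m)"
    and u: "u \<in> carrier T"
  shows "h u = k u"
proof -
  obtain \<phi> where \<phi>: "\<phi> \<in> carrier F" "u = tensor_rel R P M +>\<^bsub>F\<^esub> \<phi>"
    using u quot_carrier[OF FF tensor_rel_submodule] by (auto simp: tensor_mod_def)
  show ?thesis unfolding \<phi>(2)
    using eq by (intro free_hom_eq[OF A mod_hom_comp[OF quot_hom h] mod_hom_comp[OF quot_hom k] _ \<phi>(1)])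
      (auto simp: tens_def)
qed

text \<open>The universal property. The clause about arbitrary cosets is kept because
  \<open>tensor_map\<close> is given on cosets and has to be compared with the induced map
  there.\<close>

lemma tensor_ext:
  assumes A: "module R A"
    and cl: "\<And>x m. x \<in> carrier P \<Longrightarrow> m \<in> carrier M \<Longrightarrow> \<beta> x m \<in> carrier A"
    and al: "\<And>x x' m. x \<in> carrier P \<Longrightarrow> x' \<in> carrier P \<Longrightarrow> m \<in> carrier M \<Longrightarrow>
      \<beta> (x \<oplus>\<^bsub>P\<^esub> x') m = \<beta> x m \<oplus>\<^bsub>A\<^esub> \<beta> x' m"
    and ar: "\<And>x m m'. x \<in> carrier P \<Longrightarrow> m \<in> carrier M \<Longrightarrow> m' \<in> carrier M \<Longrightarrow>
      \<beta> x (m \<oplus>\<^bsub>M\<^esub> m') = \<beta> x m \<oplus>\<^bsub>A\<^esub> \<beta> x m'"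
    and sl: "\<And>r x m. r \<in> carrier R \<Longrightarrow> x \<in> carrier P \<Longrightarrow> m \<in> carrier M \<Longrightarrow>
      \<beta> (r \<odot>\<^bsub>P\<^esub> x) m = r \<odot>\<^bsub>A\<^esub> \<beta> x m"
    and sr: "\<And>r x m. r \<in> carrier R \<Longrightarrow> x \<in> carrier P \<Longrightarrow> m \<in> carrier M \<Longrightarrow>
      \<beta> x (r \<odot>\<^bsub>M\<^esub> m) = r \<odot>\<^bsub>A\<^esub> \<beta> x m"
  shows "\<exists>h\<in>mod_hom R T A. (\<forall>\<phi>\<in>carrier F. h (tensor_rel R P M +>\<^bsub>F\<^esub> \<phi>) = free_ext R A (case_prod \<beta>) \<phi>) \<and>
    (\<forall>x\<in>carrier P. \<forall>m\<in>carrier M. h (tens R P M x m) = \<beta> x m)"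
proof -
  interpret A: module R A by (rule A)
  have c: "case_prod \<beta> \<in> carrier P \<times> carrier M \<rightarrow> carrier A"
    by (intro Pi_I) (simp add: cl case_prod_beta mem_Times_iff)
  let ?h = "free_ext R A (case_prod \<beta>)"
  note h = free_ext_hom[OF A c]
  have hg: "?h (g (x, m)) = \<beta> x m" if "x \<in> carrier P" "m \<in> carrier M" for x m
    using free_ext_gen[OF A c, of "(x, m)"] that by simp
  have "tensor_gens \<subseteq> {u \<in> carrier F. ?h u = \<zero>\<^bsub>A\<^esub>}"
    unfolding tensor_gens_def
    by (auto simp: gc mod_hom_minus[OF FF A h] mod_hom_add[OF FF A h] mod_hom_smult[OF FF A h] hg
        al ar sl sr cl A.M.minus_zero_iff)
  then have "tensor_rel R P M \<subseteq> {u \<in> carrier F. ?h u = \<zero>\<^bsub>A\<^esub>}"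
    unfolding tensor_rel_eq by (rule mod_span_least[OF mod_hom_kernel_submodule[OF FF A h]])
  then have "\<exists>h'\<in>mod_hom R T A. \<forall>\<phi>\<in>carrier F. h' (tensor_rel R P M +>\<^bsub>F\<^esub> \<phi>) = ?h \<phi>"
    unfolding tensor_mod_def by (intro quot_factor[OF FF tensor_rel_submodule A h]) auto
  then obtain h' where h': "h' \<in> mod_hom R T A"
    and e: "\<forall>\<phi>\<in>carrier F. h' (tensor_rel R P M +>\<^bsub>F\<^esub> \<phi>) = ?h \<phi>" ..
  have "\<forall>x\<in>carrier P. \<forall>m\<in>carrier M. h' (tens R P M x m) = \<beta> x m"
    using e by (simp add: tens_def gc hg)
  with h' e show ?thesis by (intro bexI[of _ h']) auto
qed

end

text \<open>\<open>tensor_map\<close> is identified with the homomorphism \<open>h\<close> that the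
  universal property yields for \<open>tens R Q M (f x) m\<close>, and linearity is inherited from
  \<open>h\<close>. The union over representatives is examined here only; all later facts are
  checked on pure tensors.\<close>

lemma tensor_map_hom:
  assumes P: "module R P" and Q: "module R Q" and M: "module R M" and f: "f \<in> mod_hom R P Q"
  shows "tensor_map R Q M f \<in> mod_hom R (tensor_mod R P M) (tensor_mod R Q M)"
    and "x \<in> carrier P \<Longrightarrow> m \<in> carrier M \<Longrightarrow> tensor_map R Q M f (tens R P M x m) = tens R Q M (f x) m"
proof -
  interpret P: module R P by (rule P)
  note R = P.R.is_cring
  let ?F = "free_mod R (carrier P \<times> carrier M)" and ?G = "free_mod R (carrier Q \<times> carrier M)"
  let ?S = "tensor_rel R P M" and ?S' = "tensor_rel R Q M" and ?B = "tensor_mod R Q M"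
  note F = free_module[OF R, of "carrier P \<times> carrier M"] and G = free_module[OF R, of "carrier Q \<times> carrier M"]
  note fs = mod_hom_simps[OF P Q f] and B = tensor_module[OF Q M]
  have "\<exists>h\<in>mod_hom R (tensor_mod R P M) ?B.
    (\<forall>\<phi>\<in>carrier ?F. h (?S +>\<^bsub>?F\<^esub> \<phi>) = free_ext R ?B (case_prod (\<lambda>x. tens R Q M (f x))) \<phi>) \<and>
    (\<forall>x\<in>carrier P. \<forall>m\<in>carrier M. h (tens R P M x m) = tens R Q M (f x) m)"
    by (rule tensor_ext[OF P M B])
      (simp_all add: fs tens_closed[OF Q M] tens_add_left[OF Q M] tens_add_right[OF Q M]
        tens_smult_left[OF Q M] tens_smult_right[OF Q M])
  then obtain h where h: "h \<in> mod_hom R (tensor_mod R P M) ?B"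
    and he: "\<forall>\<phi>\<in>carrier ?F. h (?S +>\<^bsub>?F\<^esub> \<phi>) = free_ext R ?B (case_prod (\<lambda>x. tens R Q M (f x))) \<phi>"
    and ht: "\<forall>x\<in>carrier P. \<forall>m\<in>carrier M. h (tens R P M x m) = tens R Q M (f x) m" by (elim bexE conjE)
  have mp: "map_prod f id \<in> carrier P \<times> carrier M \<rightarrow> carrier Q \<times> carrier M" using fs(1) by auto
  have fe: "(\<lambda>b. free_gen R (map_prod f id b)) \<in> carrier P \<times> carrier M \<rightarrow> carrier ?G"
    using mp by (intro Pi_I free_gen_closed[OF R]) auto
  note qh = quot_map_hom[OF G tensor_rel_submodule[OF Q M], folded tensor_mod_def]
  have "?S' +>\<^bsub>?G\<^esub> free_map R (map_prod f id) \<phi> = h (?S +>\<^bsub>?F\<^esub> \<phi>)" if \<phi>: "\<phi> \<in> carrier ?F" for \<phi>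
  proof -
    have c: "case_prod (\<lambda>x. tens R Q M (f x)) \<in> carrier P \<times> carrier M \<rightarrow> carrier ?B"
      using fs(1) tens_closed[OF Q M] by auto
    have "?S' +>\<^bsub>?G\<^esub> free_ext R ?G (\<lambda>b. free_gen R (map_prod f id b)) \<phi> =
        free_ext R ?B (case_prod (\<lambda>x. tens R Q M (f x))) \<phi>"
      by (rule free_hom_eq[OF B mod_hom_comp[OF free_ext_hom[OF G fe] qh] free_ext_hom[OF B c] _ \<phi>])
        (auto simp: free_ext_gen[OF G fe] free_ext_gen[OF B c] tens_def)
    then show ?thesis using he \<phi> by (simp add: free_map_ext[OF R \<phi> mp])
  qed
  note fm = this
  have eq: "tensor_map R Q M f (?S +>\<^bsub>?F\<^esub> \<phi>) = h (?S +>\<^bsub>?F\<^esub> \<phi>)" if \<phi>: "\<phi> \<in> carrier ?F" for \<phi>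
    unfolding tensor_map_def fm[OF \<phi>, symmetric]
  proof (rule coset_UN_eqI[OF F tensor_rel_submodule[OF P M] \<phi>])
    fix \<psi> assume \<psi>: "\<psi> \<in> carrier ?F" "\<phi> \<ominus>\<^bsub>?F\<^esub> \<psi> \<in> ?S"
    then have "?S +>\<^bsub>?F\<^esub> \<phi> = ?S +>\<^bsub>?F\<^esub> \<psi>" using \<phi> by (simp add: coset_eq_iff[OF F tensor_rel_submodule[OF P M]])
    then show "?S' +>\<^bsub>?G\<^esub> free_map R (map_prod f id) \<psi> = ?S' +>\<^bsub>?G\<^esub> free_map R (map_prod f id) \<phi>"
      by (simp add: fm \<phi> \<psi>)
  qed
  have car: "carrier (tensor_mod R P M) = (\<lambda>\<phi>. ?S +>\<^bsub>?F\<^esub> \<phi>) ` carrier ?F"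
    unfolding tensor_mod_def by (rule quot_carrier[OF F tensor_rel_submodule[OF P M]])
  have eq': "tensor_map R Q M f u = h u" if "u \<in> carrier (tensor_mod R P M)" for u
    using that eq unfolding car by auto
  interpret T: module R "tensor_mod R P M" by (rule tensor_module[OF P M])
  show "tensor_map R Q M f \<in> mod_hom R (tensor_mod R P M) (tensor_mod R Q M)"
    using mod_hom_simps[OF tensor_module[OF P M] B h] by (intro mod_homI) (simp_all add: eq')
  show "x \<in> carrier P \<Longrightarrow> m \<in> carrier M \<Longrightarrow> tensor_map R Q M f (tens R P M x m) = tens R Q M (f x) m"
    using ht tens_closed[OF P M] by (simp add: eq')
qed

section \<open>Functoriality and additivity of the tensor product in its first factor\<close>

context
  fixes R :: "('a, 'r) ring_scheme" and M :: "('a, 'm) module"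
  assumes MM: "module R M"
begin

lemma tensor_map_closed:
  assumes "module R P" "module R Q" "f \<in> mod_hom R P Q" "u \<in> carrier (tensor_mod R P M)"
  shows "tensor_map R Q M f u \<in> carrier (tensor_mod R Q M)"
  by (rule mod_hom_closed[OF tensor_module[OF assms(1) MM] tensor_module[OF assms(2) MM]
        tensor_map_hom(1)[OF assms(1,2) MM assms(3)] assms(4)])

lemma tensor_map_cong:
  assumes "module R P" "module R Q" "f \<in> mod_hom R P Q" "f' \<in> mod_hom R P Q"
    and "\<And>x. x \<in> carrier P \<Longrightarrow> f x = f' x" and "u \<in> carrier (tensor_mod R P M)"
  shows "tensor_map R Q M f u = tensor_map R Q M f' u"
  by (rule tensor_hom_eq[OF assms(1) MM tensor_module[OF assms(2) MM] tensor_map_hom(1)[OF assms(1,2) MM assms(3)]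
        tensor_map_hom(1)[OF assms(1,2) MM assms(4)] _ assms(6)])
    (simp add: tensor_map_hom(2)[OF assms(1,2) MM] assms(3-5))

lemma tensor_map_id:
  assumes P: "module R P" and u: "u \<in> carrier (tensor_mod R P M)"
    and f: "f \<in> mod_hom R P P" "\<And>x. x \<in> carrier P \<Longrightarrow> f x = x"
  shows "tensor_map R P M f u = u"
  by (rule tensor_hom_eq[OF P MM tensor_module[OF P MM] tensor_map_hom(1)[OF P P MM f(1)] mod_hom_id _ u])
    (simp add: tensor_map_hom(2)[OF P P MM f(1)] f(2))

lemma tensor_map_comp:
  assumes P: "module R P" and Q: "module R Q" and S: "module R S"
    and f: "f \<in> mod_hom R P Q" and g: "g \<in> mod_hom R Q S" and u: "u \<in> carrier (tensor_mod R P M)"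
  shows "tensor_map R S M g (tensor_map R Q M f u) = tensor_map R S M (\<lambda>x. g (f x)) u"
  by (rule tensor_hom_eq[OF P MM tensor_module[OF S MM]
        mod_hom_comp[OF tensor_map_hom(1)[OF P Q MM f] tensor_map_hom(1)[OF Q S MM g]]
        tensor_map_hom(1)[OF P S MM mod_hom_comp[OF f g]] _ u])
    (simp add: tensor_map_hom(2)[OF P Q MM f] tensor_map_hom(2)[OF Q S MM g]
      tensor_map_hom(2)[OF P S MM mod_hom_comp[OF f g]] mod_hom_closed[OF P Q f])

lemma tensor_map_add:
  assumes P: "module R P" and Q: "module R Q"
    and f: "f \<in> mod_hom R P Q" and g: "g \<in> mod_hom R P Q" and u: "u \<in> carrier (tensor_mod R P M)"
  shows "tensor_map R Q M (\<lambda>x. f x \<oplus>\<^bsub>Q\<^esub> g x) u =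
    tensor_map R Q M f u \<oplus>\<^bsub>tensor_mod R Q M\<^esub> tensor_map R Q M g u"
proof -
  note fg = mod_hom_add_map[OF P Q f g]
  show ?thesis
    by (rule tensor_hom_eq[OF P MM tensor_module[OF Q MM] tensor_map_hom(1)[OF P Q MM fg]
          mod_hom_add_map[OF tensor_module[OF P MM] tensor_module[OF Q MM] tensor_map_hom(1)[OF P Q MM f]
            tensor_map_hom(1)[OF P Q MM g]] _ u])
      (simp add: tensor_map_hom(2)[OF P Q MM f] tensor_map_hom(2)[OF P Q MM g] tensor_map_hom(2)[OF P Q MM fg]
        tens_add_left[OF Q MM] mod_hom_closed[OF P Q f] mod_hom_closed[OF P Q g])
qed

lemma tensor_map_zero:
  assumes P: "module R P" and Q: "module R Q" and u: "u \<in> carrier (tensor_mod R P M)"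
    and f: "f \<in> mod_hom R P Q" "\<And>x. x \<in> carrier P \<Longrightarrow> f x = \<zero>\<^bsub>Q\<^esub>"
  shows "tensor_map R Q M f u = \<zero>\<^bsub>tensor_mod R Q M\<^esub>"
  by (rule tensor_hom_eq[OF P MM tensor_module[OF Q MM] tensor_map_hom(1)[OF P Q MM f(1)]
        mod_hom_zero_map[OF tensor_module[OF Q MM]] _ u])
    (simp add: tensor_map_hom(2)[OF P Q MM f(1)] f(2) tens_zero_left[OF Q MM])

text \<open>Follows from additivity, \<open>f\<close> being the sum of \<open>f - g\<close> and
  \<open>g\<close>.\<close>

lemma tensor_map_minus:
  assumes P: "module R P" and Q: "module R Q"
    and f: "f \<in> mod_hom R P Q" and g: "g \<in> mod_hom R P Q" and u: "u \<in> carrier (tensor_mod R P M)"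
  shows "tensor_map R Q M (\<lambda>x. f x \<ominus>\<^bsub>Q\<^esub> g x) u =
    tensor_map R Q M f u \<ominus>\<^bsub>tensor_mod R Q M\<^esub> tensor_map R Q M g u"
proof -
  interpret Q: module R Q by (rule Q)
  interpret T: module R "tensor_mod R Q M" by (rule tensor_module[OF Q MM])
  note fg = mod_hom_minus_map[OF P Q f g]
  have "tensor_map R Q M f u = tensor_map R Q M (\<lambda>x. (f x \<ominus>\<^bsub>Q\<^esub> g x) \<oplus>\<^bsub>Q\<^esub> g x) u"
    by (rule tensor_map_cong[OF P Q f mod_hom_add_map[OF P Q fg g] _ u])
      (simp add: Q.M.add_minus_cancel mod_hom_closed[OF P Q f] mod_hom_closed[OF P Q g])
  then show ?thesis
    using tensor_map_closed[OF P Q f u] tensor_map_closed[OF P Q g u] tensor_map_closed[OF P Q fg u]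
    by (simp add: tensor_map_add[OF P Q fg g u] T.M.add_minus_cancel)
qed

end

section \<open>Vanishing of Tor\<close>

definition tor_vanishes ::
  "('a, 'r) ring_scheme \<Rightarrow> ('a, 'm) module \<Rightarrow> int \<Rightarrow> ('a, 'u) mod_complex \<Rightarrow> bool"
where
  "tor_vanishes R M j V \<longleftrightarrow> exact_at (tensor_complex R V M) j"

lemma tensor_complex_sel:
  "obj (tensor_complex R V M) i = tensor_mod R (obj V i) M"
  "diff (tensor_complex R V M) i = tensor_map R (obj V (i - 1)) M (diff V i)"
  "diff (tensor_complex R V M) (i + 1) = tensor_map R (obj V i) M (diff V (i + 1))"
  by (simp_all add: tensor_complex_def)

lemma tensor_chain_complex:
  assumes V: "chain_complex R V" and M: "module R M"
  shows "chain_complex R (tensor_complex R V M)"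
proof (rule chain_complexI)
  note Vm = chain_complexD(1)[OF V]
  fix i
  show "module R (obj (tensor_complex R V M) i)"
    unfolding tensor_complex_sel by (rule tensor_module[OF Vm M])
  show "diff (tensor_complex R V M) (i + 1) \<in> mod_hom R (obj (tensor_complex R V M) (i + 1)) (obj (tensor_complex R V M) i)"
    unfolding tensor_complex_sel(1,3) by (rule tensor_map_hom(1)[OF Vm Vm M chain_complexD(3)[OF V]])
  fix u assume "u \<in> carrier (obj (tensor_complex R V M) (i + 1))"
  then have u: "u \<in> carrier (tensor_mod R (obj V (i + 1)) M)" by (simp add: tensor_complex_sel)
  note c = mod_hom_comp[OF chain_complexD(3)[OF V, of i] chain_complexD(2)[OF V, of i]]
  show "diff (tensor_complex R V M) i (diff (tensor_complex R V M) (i + 1) u) = \<zero>\<^bsub>obj (tensor_complex R V M) (i - 1)\<^esub>"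
    unfolding tensor_complex_sel(3) unfolding tensor_complex_sel(1,2)
      tensor_map_comp[OF M Vm Vm Vm chain_complexD(3)[OF V, of i] chain_complexD(2)[OF V, of i] u]
    by (rule tensor_map_zero[OF M Vm Vm u c]) (rule chain_complexD(4)[OF V])
qed

lemma tensor_complex_exact_iff:
  "chain_complex R V \<Longrightarrow> module R M \<Longrightarrow>
    zero_mod (homology (tensor_complex R V M) j) \<longleftrightarrow> tor_vanishes R M j V"
  unfolding tor_vanishes_def by (rule zero_homology_iff[OF tensor_chain_complex])

lemma tor_vanishesD:
  assumes "tor_vanishes R M j V" "u \<in> carrier (tensor_mod R (obj V j) M)"
    "tensor_map R (obj V (j - 1)) M (diff V j) u = \<zero>\<^bsub>tensor_mod R (obj V (j - 1)) M\<^esub>"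
  shows "\<exists>v\<in>carrier (tensor_mod R (obj V (j + 1)) M). tensor_map R (obj V j) M (diff V (j + 1)) v = u"
  using exact_atD[OF assms(1)[unfolded tor_vanishes_def], of u] assms(2,3)
  unfolding tensor_complex_sel(3) unfolding tensor_complex_sel(1,2) by blast

lemma tor_vanishesI:
  assumes "\<And>u. u \<in> carrier (tensor_mod R (obj V j) M) \<Longrightarrow>
    tensor_map R (obj V (j - 1)) M (diff V j) u = \<zero>\<^bsub>tensor_mod R (obj V (j - 1)) M\<^esub> \<Longrightarrow>
    \<exists>v\<in>carrier (tensor_mod R (obj V (j + 1)) M). u = tensor_map R (obj V j) M (diff V (j + 1)) v"
  shows "tor_vanishes R M j V"
  using assms unfolding tor_vanishes_def exact_at_def cycles_def boundaries_def tensor_complex_sel(3)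
  unfolding tensor_complex_sel(1,2) by blast

lemma tensor_map_chain_map:
  assumes V: "chain_complex R V" and W: "chain_complex R W" and \<phi>: "chain_map R V W \<phi>" and M: "module R M"
    and u: "u \<in> carrier (tensor_mod R (obj V (i + 1)) M)"
  shows "tensor_map R (obj W i) M (diff W (i + 1)) (tensor_map R (obj W (i + 1)) M (\<phi> (i + 1)) u) =
    tensor_map R (obj W i) M (\<phi> i) (tensor_map R (obj V i) M (diff V (i + 1)) u)"
proof -
  note Vm = chain_complexD(1)[OF V] and Wm = chain_complexD(1)[OF W]
  note h = chain_mapD(1)[OF \<phi>]
  show ?thesis
    unfolding tensor_map_comp[OF M Vm Wm Wm h chain_complexD(3)[OF W] u]
      tensor_map_comp[OF M Vm Vm Wm chain_complexD(3)[OF V] h u]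
    by (rule tensor_map_cong[OF M Vm Wm mod_hom_comp[OF h chain_complexD(3)[OF W]]
          mod_hom_comp[OF chain_complexD(3)[OF V] h] _ u]) (rule chain_mapD(2)[OF \<phi>])
qed

lemma tensor_map_chain_map':
  assumes V: "chain_complex R V" and W: "chain_complex R W" and \<phi>: "chain_map R V W \<phi>" and M: "module R M"
    and u: "u \<in> carrier (tensor_mod R (obj V i) M)"
  shows "tensor_map R (obj W (i - 1)) M (diff W i) (tensor_map R (obj W i) M (\<phi> i) u) =
    tensor_map R (obj W (i - 1)) M (\<phi> (i - 1)) (tensor_map R (obj V (i - 1)) M (diff V i) u)"
  using tensor_map_chain_map[OF V W \<phi> M, of u "i - 1"] u by simp

text \<open>Send a cycle to \<open>W\<close> along \<open>\<phi>\<close>, bound it there, and bring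
  the bounding element back along \<open>\<psi>\<close>.\<close>

lemma tor_vanishes_retract:
  assumes V: "chain_complex R V" and W: "chain_complex R W"
    and \<phi>: "chain_map R V W \<phi>" and \<psi>: "chain_map R W V \<psi>"
    and id: "\<And>i x. x \<in> carrier (obj V i) \<Longrightarrow> \<psi> i (\<phi> i x) = x"
    and M: "module R M" and E: "tor_vanishes R M j W"
  shows "tor_vanishes R M j V"
proof (rule tor_vanishesI)
  note Vm = chain_complexD(1)[OF V] and Wm = chain_complexD(1)[OF W]
  note h = chain_mapD(1)[OF \<phi>] and k = chain_mapD(1)[OF \<psi>]
  fix u assume u: "u \<in> carrier (tensor_mod R (obj V j) M)"
    and z: "tensor_map R (obj V (j - 1)) M (diff V j) u = \<zero>\<^bsub>tensor_mod R (obj V (j - 1)) M\<^esub>"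
  let ?\<phi>u = "tensor_map R (obj W j) M (\<phi> j) u"
  have "tensor_map R (obj W (j - 1)) M (diff W j) ?\<phi>u = \<zero>\<^bsub>tensor_mod R (obj W (j - 1)) M\<^esub>"
    using tensor_map_chain_map'[OF V W \<phi> M u] z
      mod_hom_zero[OF tensor_module[OF Vm M] tensor_module[OF Wm M] tensor_map_hom(1)[OF Vm Wm M h]] by simp
  from tor_vanishesD[OF E tensor_map_closed[OF M Vm Wm h u] this]
  obtain v where v: "v \<in> carrier (tensor_mod R (obj W (j + 1)) M)"
    "tensor_map R (obj W j) M (diff W (j + 1)) v = ?\<phi>u" ..
  have "tensor_map R (obj V j) M (diff V (j + 1)) (tensor_map R (obj V (j + 1)) M (\<psi> (j + 1)) v) =
      tensor_map R (obj V j) M (\<psi> j) ?\<phi>u"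
    using tensor_map_chain_map[OF W V \<psi> M v(1)] v(2) by simp
  also have "\<dots> = u"
    unfolding tensor_map_comp[OF M Vm Wm Vm h k u]
    by (rule tensor_map_id[OF M Vm u mod_hom_comp[OF h k] id])
  finally show "\<exists>v\<in>carrier (tensor_mod R (obj V (j + 1)) M). u = tensor_map R (obj V j) M (diff V (j + 1)) v"
    by (intro bexI[OF _ tensor_map_closed[OF M Wm Vm k v(1)]]) simp
qed

lemma tor_vanishes_transport:
  assumes "chain_complex R V" "\<And>i. inj_on enc (carrier (obj V i))" "module R M"
  shows "tor_vanishes R M j (transport_complex enc V) \<longleftrightarrow> tor_vanishes R M j V"
proof
  note T = transport_chain_complex[OF assms(1,2)]
    and \<phi> = transport_enc_chain_map[OF assms(1,2)] and \<psi> = transport_dec_chain_map[OF assms(1,2)]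
  show "tor_vanishes R M j V" if "tor_vanishes R M j (transport_complex enc V)"
    using that assms(2) by (intro tor_vanishes_retract[OF assms(1) T \<phi> \<psi> _ assms(3)]) auto
  show "tor_vanishes R M j (transport_complex enc V)" if "tor_vanishes R M j V"
    using that assms(2)
    by (intro tor_vanishes_retract[OF T assms(1) \<psi> \<phi> _ assms(3)])
      (auto simp: transport_obj[OF assms(1,2)] transport_sel)
qed

section \<open>The exact sequence of the cone after tensoring with M\<close>

context
  fixes R :: "('a, 'r) ring_scheme" and V :: "('a, 'u) mod_complex" and G :: "('a, 'v) mod_complex"
    and f and M :: "('a, 'm) module"
  assumes V: "chain_complex R V" and G: "chain_complex R G" and f: "chain_map R V G f" and M: "module R M"
begin

private abbreviation "A i \<equiv> tensor_mod R (obj V i) M"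
private abbreviation "B i \<equiv> tensor_mod R (obj G i) M"
private abbreviation "C i \<equiv> tensor_mod R (pair_mod (obj V i) (obj G (i + 1))) M"
private abbreviation "dA i \<equiv> tensor_map R (obj V (i - 1)) M (diff V i)"
private abbreviation "dB i \<equiv> tensor_map R (obj G (i - 1)) M (diff G i)"
private abbreviation "dC i \<equiv> tensor_map R (pair_mod (obj V (i - 1)) (obj G i)) M (diff (cone V G f) i)"
private abbreviation "p i \<equiv> tensor_map R (obj V i) M fst"
private abbreviation "q i \<equiv> tensor_map R (obj G (i + 1)) M snd"
private abbreviation "\<Phi> i \<equiv> tensor_map R (obj G i) M (f i)"

private lemma Vm: "module R (obj V i)" by (rule chain_complexD(1)[OF V])
private lemma Gm: "module R (obj G i)" by (rule chain_complexD(1)[OF G])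
private lemma Pm: "module R (pair_mod (obj V i) (obj G j))" by (rule pair_module[OF Vm Gm])
private lemma Am: "module R (A i)" by (rule tensor_module[OF Vm M])
private lemma Bm: "module R (B i)" by (rule tensor_module[OF Gm M])
private lemma Cm: "module R (C i)" by (rule tensor_module[OF Pm M])
private lemma K: "chain_complex R (cone V G f)" by (rule cone_chain_complex[OF V G f])
private lemma dK: "diff (cone V G f) i \<in> mod_hom R (pair_mod (obj V i) (obj G (i + 1))) (pair_mod (obj V (i - 1)) (obj G i))"
  using chain_complexD(2)[OF K, of i] by simp
private lemma dV: "diff V i \<in> mod_hom R (obj V i) (obj V (i - 1))" by (rule chain_complexD(2)[OF V])
private lemma dG: "diff G (i + 1) \<in> mod_hom R (obj G (i + 1)) (obj G i)" by (rule chain_complexD(3)[OF G])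
private lemma fh: "f i \<in> mod_hom R (obj V i) (obj G i)" by (rule chain_mapD(1)[OF f])

private lemma p_hom: "p i \<in> mod_hom R (C i) (A i)"
  by (rule tensor_map_hom(1)[OF Pm Vm M pair_fst_hom])
private lemma q_hom: "q i \<in> mod_hom R (C i) (B (i + 1))"
  by (rule tensor_map_hom(1)[OF Pm Gm M pair_snd_hom])

text \<open>Tensoring preserves the direct sum underlying the cone. Two facts suffice for the
  diagram chases: elements of \<open>C i\<close> with prescribed projections exist, and by
  \<open>pair_zero\<close> an element with zero projections is zero.\<close>

private lemma pair_exists:
  assumes a: "a \<in> carrier (A i)" and b: "b \<in> carrier (B (i + 1))"
  shows "\<exists>u\<in>carrier (C i). p i u = a \<and> q i u = b"
proof -
  interpret A: module R "A i" by (rule Am)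
  interpret B: module R "B (i + 1)" by (rule Bm)
  interpret C: module R "C i" by (rule Cm)
  let ?I = "tensor_map R (pair_mod (obj V i) (obj G (i + 1))) M (\<lambda>x. (x, \<zero>\<^bsub>obj G (i + 1)\<^esub>))"
  let ?J = "tensor_map R (pair_mod (obj V i) (obj G (i + 1))) M (\<lambda>y. (\<zero>\<^bsub>obj V i\<^esub>, y))"
  have il: "(\<lambda>x. (x, \<zero>\<^bsub>obj G (i + 1)\<^esub>)) \<in> mod_hom R (obj V i) (pair_mod (obj V i) (obj G (i + 1)))"
    by (rule pair_inl_hom[OF Gm])
  have ir: "(\<lambda>y. (\<zero>\<^bsub>obj V i\<^esub>, y)) \<in> mod_hom R (obj G (i + 1)) (pair_mod (obj V i) (obj G (i + 1)))"
    by (rule pair_inr_hom[OF Vm])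
  have I: "?I a \<in> carrier (C i)" by (rule tensor_map_closed[OF M Vm Pm il a])
  have J: "?J b \<in> carrier (C i)" by (rule tensor_map_closed[OF M Gm Pm ir b])
  have "p i (?I a) = a" unfolding tensor_map_comp[OF M Vm Pm Vm il pair_fst_hom a]
    by (rule tensor_map_id[OF M Vm a mod_hom_comp[OF il pair_fst_hom]]) simp
  moreover have "q i (?I a) = \<zero>\<^bsub>B (i + 1)\<^esub>" unfolding tensor_map_comp[OF M Vm Pm Gm il pair_snd_hom a]
    by (rule tensor_map_zero[OF M Vm Gm a mod_hom_comp[OF il pair_snd_hom]]) simp
  moreover have "p i (?J b) = \<zero>\<^bsub>A i\<^esub>" unfolding tensor_map_comp[OF M Gm Pm Vm ir pair_fst_hom b]
    by (rule tensor_map_zero[OF M Gm Vm b mod_hom_comp[OF ir pair_fst_hom]]) simp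
  moreover have "q i (?J b) = b" unfolding tensor_map_comp[OF M Gm Pm Gm ir pair_snd_hom b]
    by (rule tensor_map_id[OF M Gm b mod_hom_comp[OF ir pair_snd_hom]]) simp
  ultimately show ?thesis
    using a b I J mod_hom_add[OF Cm Am p_hom I J] mod_hom_add[OF Cm Bm q_hom I J]
    by (intro bexI[of _ "?I a \<oplus>\<^bsub>C i\<^esub> ?J b"]) simp_all
qed

private lemma pair_zero:
  assumes u: "u \<in> carrier (C i)" and pu: "p i u = \<zero>\<^bsub>A i\<^esub>" and qu: "q i u = \<zero>\<^bsub>B (i + 1)\<^esub>"
  shows "u = \<zero>\<^bsub>C i\<^esub>"
proof -
  interpret C: module R "C i" by (rule Cm)
  interpret Vi: module R "obj V i" by (rule Vm)
  interpret Gi: module R "obj G (i + 1)" by (rule Gm)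
  let ?I = "tensor_map R (pair_mod (obj V i) (obj G (i + 1))) M (\<lambda>x. (x, \<zero>\<^bsub>obj G (i + 1)\<^esub>))"
  let ?J = "tensor_map R (pair_mod (obj V i) (obj G (i + 1))) M (\<lambda>y. (\<zero>\<^bsub>obj V i\<^esub>, y))"
  let ?P = "pair_mod (obj V i) (obj G (i + 1))"
  have il: "(\<lambda>x. (x, \<zero>\<^bsub>obj G (i + 1)\<^esub>)) \<in> mod_hom R (obj V i) (pair_mod (obj V i) (obj G (i + 1)))"
    by (rule pair_inl_hom[OF Gm])
  have ir: "(\<lambda>y. (\<zero>\<^bsub>obj V i\<^esub>, y)) \<in> mod_hom R (obj G (i + 1)) (pair_mod (obj V i) (obj G (i + 1)))"
    by (rule pair_inr_hom[OF Vm])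
  note h1 = mod_hom_comp[OF pair_fst_hom il] and h2 = mod_hom_comp[OF pair_snd_hom ir]
  \<comment> \<open>The identity of the direct sum is the sum of its two projections followed by the
    inclusions.\<close>
  have "u = tensor_map R ?P M (\<lambda>w. (fst w, \<zero>\<^bsub>obj G (i + 1)\<^esub>) \<oplus>\<^bsub>?P\<^esub> (\<zero>\<^bsub>obj V i\<^esub>, snd w)) u"
    by (rule tensor_map_id[OF M Pm u mod_hom_add_map[OF Pm Pm h1 h2], symmetric]) auto
  also have "\<dots> = ?I (p i u) \<oplus>\<^bsub>C i\<^esub> ?J (q i u)"
    unfolding tensor_map_add[OF M Pm Pm h1 h2 u] tensor_map_comp[OF M Pm Vm Pm pair_fst_hom il u]
      tensor_map_comp[OF M Pm Gm Pm pair_snd_hom ir u] ..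
  also have "\<dots> = \<zero>\<^bsub>C i\<^esub>"
    unfolding pu qu using mod_hom_zero[OF Am Cm tensor_map_hom(1)[OF Vm Pm M il]]
      mod_hom_zero[OF Bm Cm tensor_map_hom(1)[OF Gm Pm M ir]] by simp
  finally show ?thesis .
qed

private lemma p_dC: "u \<in> carrier (C i) \<Longrightarrow> p (i - 1) (dC i u) = dA i (p i u)"
  unfolding tensor_map_comp[OF M Pm Pm Vm dK pair_fst_hom] tensor_map_comp[OF M Pm Vm Vm pair_fst_hom dV]
  by (rule tensor_map_cong[OF M Pm Vm mod_hom_comp[OF dK pair_fst_hom] mod_hom_comp[OF pair_fst_hom dV]]) simp_all

private lemma q_dC: "u \<in> carrier (C i) \<Longrightarrow>
    tensor_map R (obj G i) M snd (dC i u) = \<Phi> i (p i u) \<ominus>\<^bsub>B i\<^esub> tensor_map R (obj G i) M (diff G (i + 1)) (q i u)"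
  unfolding tensor_map_comp[OF M Pm Pm Gm dK pair_snd_hom] tensor_map_comp[OF M Pm Vm Gm pair_fst_hom fh]
    tensor_map_comp[OF M Pm Gm Gm pair_snd_hom dG]
    tensor_map_minus[OF M Pm Gm mod_hom_comp[OF pair_fst_hom fh] mod_hom_comp[OF pair_snd_hom dG], symmetric]
  by (rule tensor_map_cong[OF M Pm Gm mod_hom_comp[OF dK pair_snd_hom]
      mod_hom_minus_map[OF Pm Gm mod_hom_comp[OF pair_fst_hom fh] mod_hom_comp[OF pair_snd_hom dG]]]) simp_all

private lemma dC_closed: "u \<in> carrier (C i) \<Longrightarrow> dC i u \<in> carrier (tensor_mod R (pair_mod (obj V (i - 1)) (obj G i)) M)"
  by (rule tensor_map_closed[OF M Pm Pm dK])

private lemma cone_tor: "tor_vanishes R M i (cone V G f) \<Longrightarrow> u \<in> carrier (C i) \<Longrightarrow>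
    dC i u = \<zero>\<^bsub>tensor_mod R (pair_mod (obj V (i - 1)) (obj G i)) M\<^esub> \<Longrightarrow>
    \<exists>v\<in>carrier (C (i + 1)). tensor_map R (pair_mod (obj V i) (obj G (i + 1))) M (diff (cone V G f) (i + 1)) v = u"
  using tor_vanishesD[of R M i "cone V G f" u] by simp

text \<open>A cycle \<open>y\<close> over \<open>V\<close> has an image in \<open>G\<close> that is
  bounded by some \<open>w\<close>. The pair of \<open>y\<close> and \<open>w\<close> is a cycle of
  the cone, and the first projection of an element bounding it bounds \<open>y\<close>.\<close>

lemma tor_vanishes_cone_source:
  assumes EC: "tor_vanishes R M j (cone V G f)" and EG: "tor_vanishes R M j G"
  shows "tor_vanishes R M j V"
proof (rule tor_vanishesI)
  fix y assume y: "y \<in> carrier (A j)" and dy: "dA j y = \<zero>\<^bsub>A (j - 1)\<^esub>"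
  interpret Bj: module R "B j" by (rule Bm)
  have \<Phi>y: "\<Phi> j y \<in> carrier (B j)" by (rule tensor_map_closed[OF M Vm Gm fh y])
  have "dB j (\<Phi> j y) = \<zero>\<^bsub>B (j - 1)\<^esub>"
    using tensor_map_chain_map'[OF V G f M y] dy
      mod_hom_zero[OF Am Bm tensor_map_hom(1)[OF Vm Gm M fh]] by simp
  from tor_vanishesD[OF EG \<Phi>y this] obtain w where w: "w \<in> carrier (B (j + 1))"
    "tensor_map R (obj G j) M (diff G (j + 1)) w = \<Phi> j y" ..
  from pair_exists[OF y w(1)] obtain u where u: "u \<in> carrier (C j)" "p j u = y" "q j u = w" by (elim bexE conjE)
  have "dC j u = \<zero>\<^bsub>tensor_mod R (pair_mod (obj V (j - 1)) (obj G j)) M\<^esub>"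
    using pair_zero[of "dC j u" "j - 1"] dC_closed[OF u(1)] p_dC[OF u(1)] q_dC[OF u(1)] dy w(2) \<Phi>y
    by (simp add: u(2,3) Bj.M.minus_zero_iff)
  from cone_tor[OF EC u(1) this] obtain v where v: "v \<in> carrier (C (j + 1))"
    "tensor_map R (pair_mod (obj V j) (obj G (j + 1))) M (diff (cone V G f) (j + 1)) v = u" ..
  have "y = tensor_map R (obj V j) M (diff V (j + 1)) (p (j + 1) v)"
    using p_dC[OF v(1)] v(2) u(2) by simp
  then show "\<exists>v\<in>carrier (A (j + 1)). y = tensor_map R (obj V j) M (diff V (j + 1)) v"
    by (rule bexI[OF _ mod_hom_closed[OF Cm Am p_hom v(1)]])
qed

text \<open>A cycle \<open>w\<close> over \<open>G\<close> gives the cycle \<open>(0, w)\<close> of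
  the cone in degree \<open>j - 1\<close>. If \<open>v\<close> bounds it, the first projection of
  \<open>v\<close> is a cycle over \<open>V\<close>, bounded by some \<open>a\<close>, and the image
  of \<open>a\<close> minus the second projection of \<open>v\<close> bounds
  \<open>w\<close>.\<close>

lemma tor_vanishes_cone_target:
  assumes EV: "tor_vanishes R M j V" and EC: "tor_vanishes R M (j - 1) (cone V G f)"
  shows "tor_vanishes R M j G"
proof (rule tor_vanishesI)
  fix w assume w: "w \<in> carrier (B j)" and dw: "dB j w = \<zero>\<^bsub>B (j - 1)\<^esub>"
  interpret Ap: module R "A (j - 1)" by (rule Am)
  interpret Bp: module R "B (j - 1)" by (rule Bm)
  interpret Bj: module R "B j" by (rule Bm)
  interpret Bs: module R "B (j + 1)" by (rule Bm)
  have w': "w \<in> carrier (B (j - 1 + 1))" using w by simp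
  from pair_exists[OF Ap.M.zero_closed w'] obtain u where u: "u \<in> carrier (C (j - 1))"
    "p (j - 1) u = \<zero>\<^bsub>A (j - 1)\<^esub>" "q (j - 1) u = w" by (elim bexE conjE)
  have z1: "dA (j - 1) \<zero>\<^bsub>A (j - 1)\<^esub> = \<zero>\<^bsub>A (j - 1 - 1)\<^esub>"
    by (rule mod_hom_zero[OF Am Am tensor_map_hom(1)[OF Vm Vm M dV]])
  have z2: "\<Phi> (j - 1) \<zero>\<^bsub>A (j - 1)\<^esub> = \<zero>\<^bsub>B (j - 1)\<^esub>"
    by (rule mod_hom_zero[OF Am Bm tensor_map_hom(1)[OF Vm Gm M fh]])
  have "p (j - 1 - 1) (dC (j - 1) u) = \<zero>\<^bsub>A (j - 1 - 1)\<^esub>" using p_dC[OF u(1)] z1 by (simp only: u(2))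
  moreover have "tensor_map R (obj G (j - 1)) M snd (dC (j - 1) u) = \<zero>\<^bsub>B (j - 1)\<^esub>"
    using q_dC[OF u(1)] z2 dw u(3) by (simp add: u(2) Bp.M.minus_zero_iff)
  ultimately have "dC (j - 1) u = \<zero>\<^bsub>tensor_mod R (pair_mod (obj V (j - 1 - 1)) (obj G (j - 1))) M\<^esub>"
    using pair_zero[of "dC (j - 1) u" "j - 1 - 1"] dC_closed[OF u(1)] by simp
  from cone_tor[OF EC u(1) this] obtain v where "v \<in> carrier (C (j - 1 + 1))"
    "tensor_map R (pair_mod (obj V (j - 1)) (obj G (j - 1 + 1))) M (diff (cone V G f) (j - 1 + 1)) v = u" ..
  then have v: "v \<in> carrier (C j)" "dC j v = u" by simp_all
  have pv: "p j v \<in> carrier (A j)" and qv: "q j v \<in> carrier (B (j + 1))"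
    by (rule mod_hom_closed[OF Cm Am p_hom v(1)], rule mod_hom_closed[OF Cm Bm q_hom v(1)])
  have "dA j (p j v) = \<zero>\<^bsub>A (j - 1)\<^esub>" using p_dC[OF v(1)] v(2) u(2) by simp
  from tor_vanishesD[OF EV pv this] obtain a where a: "a \<in> carrier (A (j + 1))"
    "tensor_map R (obj V j) M (diff V (j + 1)) a = p j v" ..
  have \<Phi>a: "\<Phi> (j + 1) a \<in> carrier (B (j + 1))" by (rule tensor_map_closed[OF M Vm Gm fh a(1)])
  have "w = \<Phi> j (p j v) \<ominus>\<^bsub>B j\<^esub> tensor_map R (obj G j) M (diff G (j + 1)) (q j v)"
    using q_dC[OF v(1)] v(2) u(3) by simp
  also have "\<Phi> j (p j v) = tensor_map R (obj G j) M (diff G (j + 1)) (\<Phi> (j + 1) a)"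
    using tensor_map_chain_map[OF V G f M a(1)] by (simp add: a(2))
  finally have "w = tensor_map R (obj G j) M (diff G (j + 1)) (\<Phi> (j + 1) a \<ominus>\<^bsub>B (j + 1)\<^esub> q j v)"
    by (simp add: mod_hom_minus[OF Bm Bm tensor_map_hom(1)[OF Gm Gm M dG] \<Phi>a qv])
  then show "\<exists>v\<in>carrier (B (j + 1)). w = tensor_map R (obj G j) M (diff G (j + 1)) v"
    using \<Phi>a qv by (intro bexI[of _ "\<Phi> (j + 1) a \<ominus>\<^bsub>B (j + 1)\<^esub> q j v"]) simp_all
qed

end

lemma tor_vanishing_theory:
  fixes R :: "('a, 'r) ring_scheme" and M :: "('a, 'm) module"
  assumes M: "module R M"
  shows "vanishing_theory R (tor_vanishes R M :: int \<Rightarrow> ('a, ('x + 'y) list) mod_complex \<Rightarrow> bool)"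
proof
  fix V G :: "('a, ('x + 'y) list) mod_complex" and j q :: int and f s
  assume V: "chain_complex R V"
  note Vm = chain_complexD(1)[OF V]
  have e: "i - 1 - q = i - q - 1" for i :: int by simp
  have "tensor_complex R (shift_complex q V) M = shift_complex q (tensor_complex R V M)"
    unfolding tensor_complex_def shift_complex_def mod_complex.simps e ..
  then show "tor_vanishes R M j (shift_complex q V) \<longleftrightarrow> tor_vanishes R M (j - q) V"
    by (simp add: tor_vanishes_def shift_exact)
  {
    assume s: "\<And>i. s i \<in> mod_hom R (obj V i) (obj V (i + 1))"
      and h: "\<And>i x. x \<in> carrier (obj V i) \<Longrightarrow> diff V (i + 1) (s i x) \<oplus>\<^bsub>obj V i\<^esub> s (i - 1) (diff V i x) = x"
    have sj: "s (j - 1) \<in> mod_hom R (obj V (j - 1)) (obj V j)" using s[of "j - 1"] by simp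
    show "tor_vanishes R M j V"
    proof (rule tor_vanishesI)
      fix u assume u: "u \<in> carrier (tensor_mod R (obj V j) M)"
        and z: "tensor_map R (obj V (j - 1)) M (diff V j) u = \<zero>\<^bsub>tensor_mod R (obj V (j - 1)) M\<^esub>"
      interpret T: module R "tensor_mod R (obj V j) M" by (rule tensor_module[OF Vm M])
      note h1 = mod_hom_comp[OF s[of j] chain_complexD(3)[OF V]]
        and h2 = mod_hom_comp[OF chain_complexD(2)[OF V, of j] sj]
      have su: "tensor_map R (obj V (j + 1)) M (s j) u \<in> carrier (tensor_mod R (obj V (j + 1)) M)"
        by (rule tensor_map_closed[OF M Vm Vm s u])
      \<comment> \<open>The homotopy equation tensored with \<open>M\<close>. On a cycle the term
        through \<open>diff V j\<close> drops out, which leaves a boundary.\<close>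
      have "u = tensor_map R (obj V j) M (\<lambda>x. diff V (j + 1) (s j x) \<oplus>\<^bsub>obj V j\<^esub> s (j - 1) (diff V j x)) u"
        by (rule tensor_map_id[OF M Vm u mod_hom_add_map[OF Vm Vm h1 h2], symmetric]) (rule h)
      also have "\<dots> = tensor_map R (obj V j) M (diff V (j + 1)) (tensor_map R (obj V (j + 1)) M (s j) u)
          \<oplus>\<^bsub>tensor_mod R (obj V j) M\<^esub>
          tensor_map R (obj V j) M (s (j - 1)) (tensor_map R (obj V (j - 1)) M (diff V j) u)"
        unfolding tensor_map_add[OF M Vm Vm h1 h2 u] tensor_map_comp[OF M Vm Vm Vm s chain_complexD(3)[OF V] u]
          tensor_map_comp[OF M Vm Vm Vm chain_complexD(2)[OF V] sj u] ..
      also have "\<dots> = tensor_map R (obj V j) M (diff V (j + 1)) (tensor_map R (obj V (j + 1)) M (s j) u)"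
        using tensor_map_closed[OF M Vm Vm chain_complexD(3)[OF V] su]
          mod_hom_zero[OF tensor_module[OF Vm M] tensor_module[OF Vm M] tensor_map_hom(1)[OF Vm Vm M sj]]
        by (simp add: z)
      finally show "\<exists>v\<in>carrier (tensor_mod R (obj V (j + 1)) M). u = tensor_map R (obj V j) M (diff V (j + 1)) v"
        by (rule bexI[OF _ su])
    qed
  }
  assume G: "chain_complex R G" and f: "chain_map R V G f"
  note T = tor_vanishes_transport[OF cone_chain_complex[OF V G f] list_pair_inj M]
  show "tor_vanishes R M j V" if "tor_vanishes R M j (list_cone V G f)" "tor_vanishes R M j G"
    by (rule tor_vanishes_cone_source[OF V G f M that[unfolded T]])
  show "tor_vanishes R M j G" if "tor_vanishes R M j V" "tor_vanishes R M (j - 1) (list_cone V G f)"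
    by (rule tor_vanishes_cone_target[OF V G f M that[unfolded T]])
qed

section \<open>The Koszul complex with coefficients\<close>

text \<open>The format is that of \<open>free_mod\<close>, functions vanishing off \<open>B\<close>,
  so that for \<open>M = R\<close> and finite \<open>B\<close> the carriers coincide
  literally.\<close>

definition fun_mod :: "('a, 'm, 'x) module_scheme \<Rightarrow> 'b set \<Rightarrow> ('a, 'b \<Rightarrow> 'm) module" where
  "fun_mod M B = \<lparr>carrier = {f. (\<forall>x. f x \<in> carrier M) \<and> (\<forall>x. x \<notin> B \<longrightarrow> f x = \<zero>\<^bsub>M\<^esub>)},
     monoid.mult = undefined, monoid.one = undefined, ring.zero = (\<lambda>_. \<zero>\<^bsub>M\<^esub>),
     ring.add = (\<lambda>f g x. f x \<oplus>\<^bsub>M\<^esub> g x), smult = (\<lambda>r f x. r \<odot>\<^bsub>M\<^esub> f x)\<rparr>"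

lemma fun_mod_sel [simp]:
  "f \<in> carrier (fun_mod M B) \<longleftrightarrow> (\<forall>x. f x \<in> carrier M) \<and> (\<forall>x. x \<notin> B \<longrightarrow> f x = \<zero>\<^bsub>M\<^esub>)"
  "\<zero>\<^bsub>fun_mod M B\<^esub> = (\<lambda>_. \<zero>\<^bsub>M\<^esub>)"
  "f \<oplus>\<^bsub>fun_mod M B\<^esub> g = (\<lambda>x. f x \<oplus>\<^bsub>M\<^esub> g x)"
  "r \<odot>\<^bsub>fun_mod M B\<^esub> f = (\<lambda>x. r \<odot>\<^bsub>M\<^esub> f x)"
  by (simp_all add: fun_mod_def)

lemma fun_module:
  assumes "module R M" shows "module R (fun_mod M B)"
proof -
  interpret M: module R M by fact
  show ?thesis
  proof (rule moduleI)
    show "abelian_group (fun_mod M B)"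
    proof (rule abelian_groupI)
      fix f assume "f \<in> carrier (fun_mod M B)"
      then show "\<exists>y\<in>carrier (fun_mod M B). y \<oplus>\<^bsub>fun_mod M B\<^esub> f = \<zero>\<^bsub>fun_mod M B\<^esub>"
        by (intro bexI[of _ "\<lambda>x. \<ominus>\<^bsub>M\<^esub> f x"]) (simp_all add: M.M.l_neg)
    qed (simp_all add: M.M.a_ac)
  qed (simp_all add: M.smult_l_distr M.smult_r_distr M.smult_assoc1 M.R.is_cring)
qed

lemma fun_eval_hom: "(\<lambda>f. f x) \<in> mod_hom R (fun_mod M B) M"
  by (auto simp: mod_hom_def)

lemma smult_hom: assumes "module R M" "m \<in> carrier M" shows "(\<lambda>r. r \<odot>\<^bsub>M\<^esub> m) \<in> mod_hom R (regular_mod R) M"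
proof -
  interpret M: module R M by fact
  show ?thesis using assms(2)
    by (auto simp: mod_hom_def regular_mod_def M.smult_l_distr M.smult_assoc1)
qed

lemma regular_sel:
  "carrier (regular_mod R) = carrier R" "\<zero>\<^bsub>regular_mod R\<^esub> = \<zero>\<^bsub>R\<^esub>"
  "r \<odot>\<^bsub>regular_mod R\<^esub> x = r \<otimes>\<^bsub>R\<^esub> x" "x \<oplus>\<^bsub>regular_mod R\<^esub> y = x \<oplus>\<^bsub>R\<^esub> y"
  by (simp_all add: regular_mod_def)

abbreviation koszul_basis :: "'a list \<Rightarrow> int \<Rightarrow> nat set set" where
  "koszul_basis xs i \<equiv> {S. S \<subseteq> {..<length xs} \<and> int (card S) = i}"

definition sgn_pow :: "('a, 'r) ring_scheme \<Rightarrow> nat \<Rightarrow> 'a" where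
  "sgn_pow R n = (\<ominus>\<^bsub>R\<^esub> \<one>\<^bsub>R\<^esub>) [^]\<^bsub>R\<^esub> n"

text \<open>A model of the Koszul complex tensored with \<open>M\<close> that uses no tensor
  products. Duality and change of coefficients become computations with families of elements of
  \<open>M\<close>.\<close>

definition koszul_on :: "('a, 'r) ring_scheme \<Rightarrow> 'a list \<Rightarrow> ('a, 'm) module \<Rightarrow> ('a, nat set \<Rightarrow> 'm) mod_complex"
where
  "koszul_on R xs M = \<lparr>
     obj = (\<lambda>i. fun_mod M (koszul_basis xs i)),
     diff = (\<lambda>i f T. finsum M
       (\<lambda>j. sgn_pow R (card {k \<in> T. k < j}) \<odot>\<^bsub>M\<^esub> (xs ! j \<odot>\<^bsub>M\<^esub> f (insert j T)))
       ({..<length xs} - T))\<rparr>"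

lemma koszul_on_sel:
  "obj (koszul_on R xs M) i = fun_mod M (koszul_basis xs i)"
  "diff (koszul_on R xs M) i f T = finsum M
       (\<lambda>j. sgn_pow R (card {k \<in> T. k < j}) \<odot>\<^bsub>M\<^esub> (xs ! j \<odot>\<^bsub>M\<^esub> f (insert j T)))
       ({..<length xs} - T)"
  by (simp_all add: koszul_on_def)

lemma finite_koszul_basis: "finite (koszul_basis xs i)"
  by (rule finite_subset[of _ "Pow {..<length xs}"]) auto

lemma free_fun_carrier:
  assumes "finite B" shows "carrier (free_mod R B) = carrier (fun_mod (regular_mod R) B)"
proof -
  have "finite {b. f b \<noteq> \<zero>\<^bsub>R\<^esub>}" if "\<forall>b. b \<notin> B \<longrightarrow> f b = \<zero>\<^bsub>R\<^esub>" for f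
    by (rule finite_subset[OF _ assms]) (use that in blast)
  then show ?thesis by (auto simp: free_mod_def fun_mod_def regular_sel)
qed

lemma koszul_regular:
  "diff (koszul R xs) i = diff (koszul_on R xs (regular_mod R)) i"
  "carrier (obj (koszul R xs) i) = carrier (obj (koszul_on R xs (regular_mod R)) i)"
proof -
  show "diff (koszul R xs) i = diff (koszul_on R xs (regular_mod R)) i"
    by (intro ext) (simp add: koszul_def koszul_on_sel regular_finsum sgn_pow_def regular_sel)
  show "carrier (obj (koszul R xs) i) = carrier (obj (koszul_on R xs (regular_mod R)) i)"
    using free_fun_carrier[OF finite_koszul_basis] by (simp add: koszul_def koszul_on_sel)
qed

lemma koszul_obj: "obj (koszul R xs) i = free_mod R (koszul_basis xs i)"
  by (simp add: koszul_def)

lemma sgn_pow_simps: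
  assumes "cring R"
  shows "sgn_pow R n \<in> carrier R" "sgn_pow R (m + n) = sgn_pow R m \<otimes>\<^bsub>R\<^esub> sgn_pow R n"
    "sgn_pow R n \<otimes>\<^bsub>R\<^esub> sgn_pow R n = \<one>\<^bsub>R\<^esub>"
    "even (m + n) \<Longrightarrow> sgn_pow R m = sgn_pow R n"
proof -
  interpret cring R by fact
  show c: "sgn_pow R n \<in> carrier R" for n by (simp add: sgn_pow_def)
  show mult: "sgn_pow R (m + n) = sgn_pow R m \<otimes>\<^bsub>R\<^esub> sgn_pow R n" for m n
    by (simp add: sgn_pow_def nat_pow_mult)
  have Suc: "sgn_pow R (Suc n) = \<ominus>\<^bsub>R\<^esub> sgn_pow R n" for n
    using c[of n] by (simp add: sgn_pow_def r_minus)
  have par: "sgn_pow R n = (if even n then \<one>\<^bsub>R\<^esub> else \<ominus>\<^bsub>R\<^esub> \<one>\<^bsub>R\<^esub>)" for n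
    by (induction n) (auto simp: Suc, simp add: sgn_pow_def)
  show "sgn_pow R n \<otimes>\<^bsub>R\<^esub> sgn_pow R n = \<one>\<^bsub>R\<^esub>"
    by (subst mult[symmetric]) (simp add: par)
  show "even (m + n) \<Longrightarrow> sgn_pow R m = sgn_pow R n" by (auto simp: par)
qed

context
  fixes R :: "('a, 'r) ring_scheme" and xs :: "'a list" and M :: "('a, 'm) module"
  assumes MM: "module R M" and xs: "set xs \<subseteq> carrier R"
begin

interpretation M: module R M by (rule MM)

private lemma RR: "cring R" by (rule M.R.is_cring)

private lemma x_closed: "j < length xs \<Longrightarrow> xs ! j \<in> carrier R"
  using xs nth_mem by blast

private lemma term_closed:
  "\<lbrakk>j \<in> {..<length xs} - T; \<And>S. f S \<in> carrier M\<rbrakk> \<Longrightarrow>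
    sgn_pow R n \<odot>\<^bsub>M\<^esub> (xs ! j \<odot>\<^bsub>M\<^esub> f S) \<in> carrier M"
  by (intro M.smult_closed sgn_pow_simps(1)[OF RR] x_closed) simp_all

lemma koszul_on_module: "module R (obj (koszul_on R xs M) i)"
  unfolding koszul_on_sel by (rule fun_module[OF MM])

lemma koszul_on_diff_hom:
  "diff (koszul_on R xs M) (i + 1) \<in> mod_hom R (obj (koszul_on R xs M) (i + 1)) (obj (koszul_on R xs M) i)"
proof (rule mod_homI)
  let ?t = "\<lambda>f T j. sgn_pow R (card {k \<in> T. k < j}) \<odot>\<^bsub>M\<^esub> (xs ! j \<odot>\<^bsub>M\<^esub> f (insert j T))"
  fix f assume "f \<in> carrier (obj (koszul_on R xs M) (i + 1))"
  then have f: "\<And>S. f S \<in> carrier M" and f0: "\<And>S. S \<notin> koszul_basis xs (i + 1) \<Longrightarrow> f S = \<zero>\<^bsub>M\<^esub>"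
    by (simp_all add: koszul_on_sel)
  have tf: "?t f T \<in> {..<length xs} - T \<rightarrow> carrier M" for T
    by (intro Pi_I term_closed f)
  have "diff (koszul_on R xs M) (i + 1) f T = \<zero>\<^bsub>M\<^esub>" if T: "T \<notin> koszul_basis xs i" for T
    unfolding koszul_on_sel
  proof (rule M.M.add.finprod_one_eqI)
    fix j assume j: "j \<in> {..<length xs} - T"
    have "insert j T \<notin> koszul_basis xs (i + 1)"
    proof
      assume b: "insert j T \<in> koszul_basis xs (i + 1)"
      then have "finite T" using finite_subset[of "insert j T" "{..<length xs}"] by auto
      with b j T show False by auto
    qed
    then show "?t f T j = \<zero>\<^bsub>M\<^esub>" using j x_closed[of j] by (simp add: f0 sgn_pow_simps(1)[OF RR])
  qed
  moreover have "diff (koszul_on R xs M) (i + 1) f T \<in> carrier M" for T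
    unfolding koszul_on_sel by (rule M.M.finsum_closed[OF tf])
  ultimately show "diff (koszul_on R xs M) (i + 1) f \<in> carrier (obj (koszul_on R xs M) i)"
    unfolding koszul_on_sel(1) fun_mod_sel by blast
  show "diff (koszul_on R xs M) (i + 1) (r \<odot>\<^bsub>obj (koszul_on R xs M) (i + 1)\<^esub> f) =
      r \<odot>\<^bsub>obj (koszul_on R xs M) i\<^esub> diff (koszul_on R xs M) (i + 1) f" if r: "r \<in> carrier R" for r
  proof
    fix T
    have e: "?t (\<lambda>S. r \<odot>\<^bsub>M\<^esub> f S) T j = r \<odot>\<^bsub>M\<^esub> ?t f T j" if j: "j \<in> {..<length xs} - T" for j
      using j r f x_closed[of j] sgn_pow_simps(1)[OF RR]
      by (simp add: M.smult_assoc1[symmetric] M.R.m_closed)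
        (simp add: comm_monoid.m_ac[OF cring.axioms(2)[OF RR]] x_closed)
    have "finsum M (?t (\<lambda>S. r \<odot>\<^bsub>M\<^esub> f S) T) ({..<length xs} - T) =
        finsum M (\<lambda>j. r \<odot>\<^bsub>M\<^esub> ?t f T j) ({..<length xs} - T)"
      by (rule M.M.finsum_cong'[OF refl Pi_I[OF M.smult_closed[OF r funcset_mem[OF tf]]] e])
    also have "\<dots> = r \<odot>\<^bsub>M\<^esub> finsum M (?t f T) ({..<length xs} - T)"
      by (rule M.finsum_smult_ldistr[symmetric, OF _ r tf]) simp
    finally show "diff (koszul_on R xs M) (i + 1) (r \<odot>\<^bsub>obj (koszul_on R xs M) (i + 1)\<^esub> f) T =
      (r \<odot>\<^bsub>obj (koszul_on R xs M) i\<^esub> diff (koszul_on R xs M) (i + 1) f) T"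
      by (simp add: koszul_on_sel)
  qed
  fix g assume "g \<in> carrier (obj (koszul_on R xs M) (i + 1))"
  then have g: "\<And>S. g S \<in> carrier M" by (simp add: koszul_on_sel)
  have tg: "?t g T \<in> {..<length xs} - T \<rightarrow> carrier M" for T
    by (intro Pi_I term_closed g)
  show "diff (koszul_on R xs M) (i + 1) (f \<oplus>\<^bsub>obj (koszul_on R xs M) (i + 1)\<^esub> g) =
      diff (koszul_on R xs M) (i + 1) f \<oplus>\<^bsub>obj (koszul_on R xs M) i\<^esub> diff (koszul_on R xs M) (i + 1) g"
  proof
    fix T
    have e: "?t (\<lambda>S. f S \<oplus>\<^bsub>M\<^esub> g S) T j = ?t f T j \<oplus>\<^bsub>M\<^esub> ?t g T j" if j: "j \<in> {..<length xs} - T" for j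
      using j f g x_closed[of j] by (simp add: M.smult_r_distr sgn_pow_simps(1)[OF RR])
    have "finsum M (?t (\<lambda>S. f S \<oplus>\<^bsub>M\<^esub> g S) T) ({..<length xs} - T) =
        finsum M (\<lambda>j. ?t f T j \<oplus>\<^bsub>M\<^esub> ?t g T j) ({..<length xs} - T)"
      by (rule M.M.finsum_cong'[OF refl Pi_I[OF M.M.a_closed[OF funcset_mem[OF tf] funcset_mem[OF tg]]] e])
    also have "\<dots> = finsum M (?t f T) ({..<length xs} - T) \<oplus>\<^bsub>M\<^esub> finsum M (?t g T) ({..<length xs} - T)"
      by (rule M.M.finsum_addf[OF tf tg])
    finally show "diff (koszul_on R xs M) (i + 1) (f \<oplus>\<^bsub>obj (koszul_on R xs M) (i + 1)\<^esub> g) T =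
      (diff (koszul_on R xs M) (i + 1) f \<oplus>\<^bsub>obj (koszul_on R xs M) i\<^esub> diff (koszul_on R xs M) (i + 1) g) T"
      by (simp add: koszul_on_sel)
  qed
qed

lemma koszul_module: "module R (obj (koszul R xs) i)"
  unfolding koszul_obj by (rule free_module[OF RR])

private lemma Kc: "\<phi> \<in> carrier (obj (koszul R xs) i) \<Longrightarrow> \<phi> S \<in> carrier R"
  "\<phi> \<in> carrier (obj (koszul R xs) i) \<Longrightarrow> S \<notin> koszul_basis xs i \<Longrightarrow> \<phi> S = \<zero>\<^bsub>R\<^esub>"
  by (auto simp: koszul_obj free_mod_def)

private lemma gen_closed: "S \<in> koszul_basis xs i \<Longrightarrow> free_gen R S \<in> carrier (obj (koszul R xs) i)"
  unfolding koszul_obj by (rule free_gen_closed[OF RR])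

section \<open>The isomorphism between the tensored Koszul complex and its model\<close>

private abbreviation "TK i \<equiv> tensor_mod R (obj (koszul R xs) i) M"
private abbreviation "KM i \<equiv> obj (koszul_on R xs M) i"
private abbreviation "tn i \<equiv> tens R (obj (koszul R xs) i) M"

lemma koszul_tensor_hom:
  "\<exists>h\<in>mod_hom R (TK i) (KM i). \<forall>\<phi>\<in>carrier (obj (koszul R xs) i). \<forall>m\<in>carrier M.
     h (tn i \<phi> m) = (\<lambda>S. \<phi> S \<odot>\<^bsub>M\<^esub> m)"
proof -
  have "\<exists>h\<in>mod_hom R (TK i) (KM i).
    (\<forall>\<phi>\<in>carrier (free_mod R (carrier (obj (koszul R xs) i) \<times> carrier M)).
       h (tensor_rel R (obj (koszul R xs) i) M +>\<^bsub>free_mod R (carrier (obj (koszul R xs) i) \<times> carrier M)\<^esub> \<phi>) =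
       free_ext R (KM i) (case_prod (\<lambda>\<phi> m S. \<phi> S \<odot>\<^bsub>M\<^esub> m)) \<phi>) \<and>
    (\<forall>\<phi>\<in>carrier (obj (koszul R xs) i). \<forall>m\<in>carrier M. h (tn i \<phi> m) = (\<lambda>S. \<phi> S \<odot>\<^bsub>M\<^esub> m))"
  proof (rule tensor_ext[OF koszul_module MM koszul_on_module])
    fix \<phi> m assume \<phi>: "\<phi> \<in> carrier (obj (koszul R xs) i)" and m: "m \<in> carrier M"
    note [simp] = Kc(1)[OF \<phi>] m
    show "(\<lambda>S. \<phi> S \<odot>\<^bsub>M\<^esub> m) \<in> carrier (KM i)" using Kc(2)[OF \<phi>] by (simp add: koszul_on_sel)
    show "(\<lambda>S. (r \<odot>\<^bsub>obj (koszul R xs) i\<^esub> \<phi>) S \<odot>\<^bsub>M\<^esub> m) = r \<odot>\<^bsub>KM i\<^esub> (\<lambda>S. \<phi> S \<odot>\<^bsub>M\<^esub> m)"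
      "(\<lambda>S. \<phi> S \<odot>\<^bsub>M\<^esub> (r \<odot>\<^bsub>M\<^esub> m)) = r \<odot>\<^bsub>KM i\<^esub> (\<lambda>S. \<phi> S \<odot>\<^bsub>M\<^esub> m)" if "r \<in> carrier R" for r
      using that by (simp_all add: koszul_on_sel koszul_obj free_mod_def M.smult_assoc1[symmetric]
          comm_monoid.m_comm[OF cring.axioms(2)[OF RR]])
    show "(\<lambda>S. \<phi> S \<odot>\<^bsub>M\<^esub> (m \<oplus>\<^bsub>M\<^esub> m')) = (\<lambda>S. \<phi> S \<odot>\<^bsub>M\<^esub> m) \<oplus>\<^bsub>KM i\<^esub> (\<lambda>S. \<phi> S \<odot>\<^bsub>M\<^esub> m')"
      if "m' \<in> carrier M" for m' using that by (simp add: koszul_on_sel M.smult_r_distr)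
    show "(\<lambda>S. (\<phi> \<oplus>\<^bsub>obj (koszul R xs) i\<^esub> \<phi>') S \<odot>\<^bsub>M\<^esub> m) = (\<lambda>S. \<phi> S \<odot>\<^bsub>M\<^esub> m) \<oplus>\<^bsub>KM i\<^esub> (\<lambda>S. \<phi>' S \<odot>\<^bsub>M\<^esub> m)"
      if "\<phi>' \<in> carrier (obj (koszul R xs) i)" for \<phi>'
      using Kc(1)[OF that] by (simp add: koszul_on_sel koszul_obj free_mod_def M.smult_l_distr)
  qed
  then show ?thesis by (elim bexE conjE) (rule bexI)
qed

definition koszul_tensor :: "int \<Rightarrow> ((nat set \<Rightarrow> 'a) \<times> 'm \<Rightarrow> 'a) set \<Rightarrow> nat set \<Rightarrow> 'm" where
  "koszul_tensor i = (SOME h. h \<in> mod_hom R (TK i) (KM i) \<and>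
     (\<forall>\<phi>\<in>carrier (obj (koszul R xs) i). \<forall>m\<in>carrier M. h (tn i \<phi> m) = (\<lambda>S. \<phi> S \<odot>\<^bsub>M\<^esub> m)))"

private abbreviation "\<Psi> i \<equiv> koszul_tensor i"

lemma koszul_tensor:
  "\<Psi> i \<in> mod_hom R (TK i) (KM i)"
  "\<phi> \<in> carrier (obj (koszul R xs) i) \<Longrightarrow> m \<in> carrier M \<Longrightarrow> \<Psi> i (tn i \<phi> m) = (\<lambda>S. \<phi> S \<odot>\<^bsub>M\<^esub> m)"
  using someI_ex[OF koszul_tensor_hom[of i, unfolded Bex_def]] unfolding koszul_tensor_def[symmetric]
  by blast+

private lemma TKm: "module R (TK i)" by (rule tensor_module[OF koszul_module MM])

text \<open>The inverse of \<open>\<Psi> i\<close>: a family of coefficients becomes a sum of pure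
  tensors over the basis.\<close>

private abbreviation "\<Theta> i f \<equiv> finsum (TK i) (\<lambda>S. tn i (free_gen R S) (f S)) (koszul_basis xs i)"

private lemma \<Theta>_Pi: "f \<in> carrier (KM i) \<Longrightarrow>
    (\<lambda>S. tn i (free_gen R S) (f S)) \<in> koszul_basis xs i \<rightarrow> carrier (TK i)"
  by (intro Pi_I tens_closed[OF koszul_module MM] gen_closed) (simp_all add: koszul_on_sel)

private lemma \<Theta>_closed: "f \<in> carrier (KM i) \<Longrightarrow> \<Theta> i f \<in> carrier (TK i)"
proof -
  interpret T: module R "TK i" by (rule TKm)
  show "f \<in> carrier (KM i) \<Longrightarrow> \<Theta> i f \<in> carrier (TK i)" by (rule T.M.finsum_closed[OF \<Theta>_Pi])
qed

private lemma \<Psi>_\<Theta>: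
  assumes f: "f \<in> carrier (KM i)" shows "\<Psi> i (\<Theta> i f) = f"
proof
  fix S'
  have fM: "f S \<in> carrier M" for S using f by (simp add: koszul_on_sel)
  have "\<Psi> i (\<Theta> i f) = finsum (KM i) (\<lambda>S. \<Psi> i (tn i (free_gen R S) (f S))) (koszul_basis xs i)"
    by (rule mod_hom_finsum[OF TKm koszul_on_module koszul_tensor(1) finite_koszul_basis \<Theta>_Pi[OF f]])
  moreover have Pi: "(\<lambda>S. \<Psi> i (tn i (free_gen R S) (f S))) \<in> koszul_basis xs i \<rightarrow> carrier (fun_mod M (koszul_basis xs i))"
    using \<Theta>_Pi[OF f] mod_hom_closed[OF TKm koszul_on_module koszul_tensor(1), unfolded koszul_on_sel(1)] by blast
  ultimately have "\<Psi> i (\<Theta> i f) S' = finsum M (\<lambda>S. \<Psi> i (tn i (free_gen R S) (f S)) S') (koszul_basis xs i)"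
    using mod_hom_finsum[OF fun_module[OF MM] MM fun_eval_hom finite_koszul_basis Pi, of S'] by (simp add: koszul_on_sel(1))
  also have "\<dots> = finsum M (\<lambda>S. if S' = S then f S else \<zero>\<^bsub>M\<^esub>) (koszul_basis xs i)"
  proof (rule M.M.finsum_cong'[OF refl])
    show "(\<lambda>S. if S' = S then f S else \<zero>\<^bsub>M\<^esub>) \<in> koszul_basis xs i \<rightarrow> carrier M" using fM by auto
    show "\<Psi> i (tn i (free_gen R S) (f S)) S' = (if S' = S then f S else \<zero>\<^bsub>M\<^esub>)" if S: "S \<in> koszul_basis xs i" for S
      unfolding koszul_tensor(2)[OF gen_closed[OF S] fM] using fM by (simp add: free_gen_def)
  qed
  also have "\<dots> = f S'"
  proof (cases "S' \<in> koszul_basis xs i")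
    case True
    show ?thesis by (rule M.M.finsum_singleton[OF True finite_koszul_basis]) (use fM in auto)
  next
    case False
    have "f S' = \<zero>\<^bsub>M\<^esub>" using f False by (simp add: koszul_on_sel)
    then show ?thesis using False by (subst M.M.add.finprod_one_eqI) auto
  qed
  finally show "\<Psi> i (\<Theta> i f) S' = f S'" .
qed

private lemma \<Theta>_hom: "\<Theta> i \<in> mod_hom R (KM i) (TK i)"
proof (rule mod_homI)
  interpret T: module R "TK i" by (rule TKm)
  fix f assume f: "f \<in> carrier (KM i)"
  then have fM: "f S \<in> carrier M" for S by (simp add: koszul_on_sel)
  show "\<Theta> i f \<in> carrier (TK i)" by (rule \<Theta>_closed[OF f])
  note tc = tens_closed[OF koszul_module MM gen_closed]
  show "\<Theta> i (r \<odot>\<^bsub>KM i\<^esub> f) = r \<odot>\<^bsub>TK i\<^esub> \<Theta> i f" if r: "r \<in> carrier R" for r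
  proof -
    have "\<Theta> i (r \<odot>\<^bsub>KM i\<^esub> f) = finsum (TK i) (\<lambda>S. r \<odot>\<^bsub>TK i\<^esub> tn i (free_gen R S) (f S)) (koszul_basis xs i)"
      using r fM by (intro T.M.finsum_cong' refl Pi_I T.smult_closed tc)
        (simp_all add: koszul_on_sel tens_smult_right[OF koszul_module MM r gen_closed])
    also have "\<dots> = r \<odot>\<^bsub>TK i\<^esub> \<Theta> i f"
      by (rule T.finsum_smult_ldistr[symmetric, OF finite_koszul_basis r \<Theta>_Pi[OF f]])
    finally show ?thesis .
  qed
  fix g assume g: "g \<in> carrier (KM i)"
  then have gM: "g S \<in> carrier M" for S by (simp add: koszul_on_sel)
  have "\<Theta> i (f \<oplus>\<^bsub>KM i\<^esub> g) = finsum (TK i) (\<lambda>S. tn i (free_gen R S) (f S) \<oplus>\<^bsub>TK i\<^esub> tn i (free_gen R S) (g S)) (koszul_basis xs i)"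
    using fM gM by (intro T.M.finsum_cong' refl Pi_I T.M.a_closed tc)
      (simp_all add: koszul_on_sel tens_add_right[OF koszul_module MM gen_closed])
  also have "\<dots> = \<Theta> i f \<oplus>\<^bsub>TK i\<^esub> \<Theta> i g"
    by (rule T.M.finsum_addf[OF \<Theta>_Pi[OF f] \<Theta>_Pi[OF g]])
  finally show "\<Theta> i (f \<oplus>\<^bsub>KM i\<^esub> g) = \<Theta> i f \<oplus>\<^bsub>TK i\<^esub> \<Theta> i g" .
qed

text \<open>On a pure tensor the coefficients of \<open>\<phi>\<close> move across the tensor sign,
  and the sum reassembles \<open>\<phi>\<close> from its basis expansion.\<close>

private lemma \<Theta>_\<Psi>:
  assumes u: "u \<in> carrier (TK i)" shows "\<Theta> i (\<Psi> i u) = u"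
proof (rule tensor_hom_eq[OF koszul_module MM TKm mod_hom_comp[OF koszul_tensor(1) \<Theta>_hom] mod_hom_id _ u])
  fix \<phi> m assume \<phi>: "\<phi> \<in> carrier (obj (koszul R xs) i)" and m: "m \<in> carrier M"
  interpret T: module R "TK i" by (rule TKm)
  note tc = tens_closed[OF koszul_module MM gen_closed m]
  have h: "(\<lambda>\<phi>. tn i \<phi> m) \<in> mod_hom R (free_mod R (koszul_basis xs i)) (TK i)"
    using tens_closed[OF koszul_module MM _ m] tens_add_left[OF koszul_module MM _ _ m]
      tens_smult_left[OF koszul_module MM _ _ m] unfolding koszul_obj by (intro mod_homI)
  have \<phi>': "\<phi> \<in> carrier (free_mod R (koszul_basis xs i))" using \<phi> by (simp only: koszul_obj)
  have "\<Theta> i (\<Psi> i (tn i \<phi> m)) = finsum (TK i) (\<lambda>S. \<phi> S \<odot>\<^bsub>TK i\<^esub> tn i (free_gen R S) m) (koszul_basis xs i)"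
    unfolding koszul_tensor(2)[OF \<phi> m] using Kc(1)[OF \<phi>] m
    by (intro T.M.finsum_cong' refl Pi_I T.smult_closed tc)
      (simp_all add: tens_smult_right[OF koszul_module MM _ gen_closed])
  also have "\<dots> = free_ext R (TK i) (\<lambda>S. tn i (free_gen R S) m) \<phi>"
    using Kc(2)[OF \<phi>] by (intro free_ext_eq[symmetric, OF TKm _ \<phi>' finite_koszul_basis] Pi_I tc) auto
  also have "\<dots> = tn i \<phi> m" by (rule free_hom_expand[symmetric, OF TKm h \<phi>'])
  finally show "\<Theta> i (\<Psi> i (tn i \<phi> m)) = tn i \<phi> m" .
qed

context
  assumes K: "chain_complex R (koszul R xs)"
begin

private abbreviation "dT i \<equiv> tensor_map R (obj (koszul R xs) i) M (diff (koszul R xs) (i + 1))"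

private lemma dT_closed: "u \<in> carrier (TK (i + 1)) \<Longrightarrow> dT i u \<in> carrier (TK i)"
  by (rule tensor_map_closed[OF MM koszul_module koszul_module chain_complexD(3)[OF K]])

lemma koszul_tensor_diff:
  assumes u: "u \<in> carrier (TK (i + 1))"
  shows "\<Psi> i (dT i u) = diff (koszul_on R xs M) (i + 1) (\<Psi> (i + 1) u)"
proof (rule tensor_hom_eq[OF koszul_module MM koszul_on_module
      mod_hom_comp[OF tensor_map_hom(1)[OF koszul_module koszul_module MM chain_complexD(3)[OF K]] koszul_tensor(1)]
      mod_hom_comp[OF koszul_tensor(1) koszul_on_diff_hom] _ u])
  fix \<phi> m assume \<phi>: "\<phi> \<in> carrier (obj (koszul R xs) (i + 1))" and m: "m \<in> carrier M"
  note sm = smult_hom[OF MM m]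
  have "diff (koszul R xs) (i + 1) \<phi> T \<odot>\<^bsub>M\<^esub> m = diff (koszul_on R xs M) (i + 1) (\<lambda>S. \<phi> S \<odot>\<^bsub>M\<^esub> m) T" for T
  proof -
    have Pi: "(\<lambda>j. sgn_pow R (card {k \<in> T. k < j}) \<otimes>\<^bsub>R\<^esub> (xs ! j \<otimes>\<^bsub>R\<^esub> \<phi> (insert j T)))
        \<in> {..<length xs} - T \<rightarrow> carrier (regular_mod R)"
      using Kc(1)[OF \<phi>] x_closed sgn_pow_simps(1)[OF RR] by (auto simp: regular_sel intro!: M.R.m_closed)
    have "diff (koszul R xs) (i + 1) \<phi> T \<odot>\<^bsub>M\<^esub> m = finsum M (\<lambda>j. (sgn_pow R (card {k \<in> T. k < j}) \<otimes>\<^bsub>R\<^esub>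
        (xs ! j \<otimes>\<^bsub>R\<^esub> \<phi> (insert j T))) \<odot>\<^bsub>M\<^esub> m) ({..<length xs} - T)"
      unfolding koszul_regular(1) koszul_on_sel regular_sel
      by (rule mod_hom_finsum[OF regular_module[OF RR] MM sm _ Pi]) simp
    also have "\<dots> = diff (koszul_on R xs M) (i + 1) (\<lambda>S. \<phi> S \<odot>\<^bsub>M\<^esub> m) T"
      unfolding koszul_on_sel
    proof (rule M.M.finsum_cong'[OF refl])
      show "(\<lambda>j. sgn_pow R (card {k \<in> T. k < j}) \<odot>\<^bsub>M\<^esub> (xs ! j \<odot>\<^bsub>M\<^esub> (\<phi> (insert j T) \<odot>\<^bsub>M\<^esub> m)))
          \<in> {..<length xs} - T \<rightarrow> carrier M"
        by (intro Pi_I term_closed M.smult_closed Kc(1)[OF \<phi>] m)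
      show "(sgn_pow R (card {k \<in> T. k < j}) \<otimes>\<^bsub>R\<^esub> (xs ! j \<otimes>\<^bsub>R\<^esub> \<phi> (insert j T))) \<odot>\<^bsub>M\<^esub> m =
          sgn_pow R (card {k \<in> T. k < j}) \<odot>\<^bsub>M\<^esub> (xs ! j \<odot>\<^bsub>M\<^esub> (\<phi> (insert j T) \<odot>\<^bsub>M\<^esub> m))"
        if "j \<in> {..<length xs} - T" for j
        using that Kc(1)[OF \<phi>] m x_closed[of j] sgn_pow_simps(1)[OF RR] by (simp add: M.smult_assoc1)
    qed
    finally show ?thesis .
  qed
  then show "\<Psi> i (dT i (tn (i + 1) \<phi> m)) = diff (koszul_on R xs M) (i + 1) (\<Psi> (i + 1) (tn (i + 1) \<phi> m))"
    using \<phi> m diff_up_simps(1)[OF K K K \<phi>]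
    by (simp add: tensor_map_hom(2)[OF koszul_module koszul_module MM chain_complexD(3)[OF K]] koszul_tensor(2))
qed

lemma koszul_tensor_diff':
  "u \<in> carrier (TK i) \<Longrightarrow> \<Psi> (i - 1) (tensor_map R (obj (koszul R xs) (i - 1)) M (diff (koszul R xs) i) u) =
     diff (koszul_on R xs M) i (\<Psi> i u)"
  using koszul_tensor_diff[of u "i - 1"] by simp

text \<open>That the differential squares to zero is not computed with signs but transported along
  \<open>\<Psi>\<close> from the tensor complex. That \<open>koszul R xs\<close> is a complex will
  come from its being a quasi-projective resolution.\<close>

lemma koszul_on_chain_complex: "chain_complex R (koszul_on R xs M)"
proof (rule chain_complexI[OF koszul_on_module koszul_on_diff_hom])
  fix i f assume f: "f \<in> carrier (KM (i + 1))"
  note T = tensor_chain_complex[OF K MM]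
  have c: "\<Theta> (i + 1) f \<in> carrier (TK (i + 1))" by (rule \<Theta>_closed[OF f])
  have "diff (koszul_on R xs M) i (diff (koszul_on R xs M) (i + 1) (\<Psi> (i + 1) (\<Theta> (i + 1) f))) =
      \<Psi> (i - 1) (tensor_map R (obj (koszul R xs) (i - 1)) M (diff (koszul R xs) i) (dT i (\<Theta> (i + 1) f)))"
    by (simp only: koszul_tensor_diff[OF c, symmetric] koszul_tensor_diff'[OF dT_closed[OF c]])
  also have "tensor_map R (obj (koszul R xs) (i - 1)) M (diff (koszul R xs) i) (dT i (\<Theta> (i + 1) f)) = \<zero>\<^bsub>TK (i - 1)\<^esub>"
    using chain_complexD(4)[OF T, of "\<Theta> (i + 1) f" i] c
    unfolding tensor_complex_sel(3) unfolding tensor_complex_sel(1,2) .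
  also have "\<Psi> (i - 1) \<zero>\<^bsub>TK (i - 1)\<^esub> = \<zero>\<^bsub>KM (i - 1)\<^esub>" by (rule mod_hom_zero[OF TKm koszul_on_module koszul_tensor(1)])
  finally show "diff (koszul_on R xs M) i (diff (koszul_on R xs M) (i + 1) f) = \<zero>\<^bsub>KM (i - 1)\<^esub>"
    by (simp only: \<Psi>_\<Theta>[OF f])
qed

lemma tor_vanishes_koszul:
  assumes ex: "exact_at (koszul_on R xs M) j"
  shows "tor_vanishes R M j (koszul R xs)"
proof (rule tor_vanishesI)
  fix u assume u: "u \<in> carrier (TK j)"
    and z: "tensor_map R (obj (koszul R xs) (j - 1)) M (diff (koszul R xs) j) u = \<zero>\<^bsub>TK (j - 1)\<^esub>"
  have "diff (koszul_on R xs M) j (\<Psi> j u) = \<zero>\<^bsub>KM (j - 1)\<^esub>"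
    unfolding koszul_tensor_diff'[OF u, symmetric] z
    by (rule mod_hom_zero[OF TKm koszul_on_module koszul_tensor(1)])
  then obtain f where f: "f \<in> carrier (KM (j + 1))" "diff (koszul_on R xs M) (j + 1) f = \<Psi> j u"
    by (rule exact_atD[OF ex mod_hom_closed[OF TKm koszul_on_module koszul_tensor(1) u]])
  have c: "\<Theta> (j + 1) f \<in> carrier (TK (j + 1))" by (rule \<Theta>_closed[OF f(1)])
  have "\<Psi> j (dT j (\<Theta> (j + 1) f)) = \<Psi> j u"
    by (simp only: koszul_tensor_diff[OF c] \<Psi>_\<Theta>[OF f(1)] f(2))
  then have "\<Theta> j (\<Psi> j (dT j (\<Theta> (j + 1) f))) = \<Theta> j (\<Psi> j u)" by (rule arg_cong)
  then have "u = dT j (\<Theta> (j + 1) f)" unfolding \<Theta>_\<Psi>[OF u] \<Theta>_\<Psi>[OF dT_closed[OF c]] ..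
  then show "\<exists>v\<in>carrier (TK (j + 1)). u = dT j v" by (rule bexI[OF _ c])
qed

end

end

section \<open>Self-duality of the Koszul complex\<close>

context
  fixes R :: "('a, 'r) ring_scheme" and xs :: "'a list" and M :: "('a, 'm) module"
  assumes MM: "module R M" and xs: "set xs \<subseteq> carrier R" and K: "chain_complex R (koszul R xs)"
begin

interpretation M: module R M by (rule MM)

private lemma base_ring: "cring R" by (rule M.R.is_cring)

private lemma seq_closed: "j < length xs \<Longrightarrow> xs ! j \<in> carrier R"
  using xs nth_mem by blast

private abbreviation "Kz i \<equiv> obj (koszul R xs) i"
private abbreviation "KzM i \<equiv> obj (koszul_on R xs M) i"
private abbreviation "e \<equiv> int (length xs)"

private lemma Km: "module R (Kz i)" by (rule chain_complexD(1)[OF K])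
private lemma KMm: "module R (KzM i)" by (rule koszul_on_module[OF MM xs])
private lemma koszul_diff_closed: "diff (koszul R xs) (i + 1) \<in> mod_hom R (Kz (i + 1)) (Kz i)" by (rule chain_complexD(3)[OF K])

private lemma basis_gen_closed: "S \<in> koszul_basis xs i \<Longrightarrow> free_gen R S \<in> carrier (Kz i)"
  unfolding koszul_obj by (rule free_gen_closed[OF base_ring])

private lemma basis_minus: "S \<in> koszul_basis xs (i + 1) \<Longrightarrow> k \<in> S \<Longrightarrow> S - {k} \<in> koszul_basis xs i"
proof -
  assume S: "S \<in> koszul_basis xs (i + 1)" and k: "k \<in> S"
  then have "finite S" using finite_subset[of S "{..<length xs}"] by auto
  then have "card S = Suc (card (S - {k}))" using card.remove[OF _ k] by simp
  with S show ?thesis by auto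
qed

private lemma finite_basis: "S \<in> koszul_basis xs i \<Longrightarrow> finite S"
  using finite_subset[of S "{..<length xs}"] by auto

text \<open>The definition lists the coefficients of the image. Here the image is the alternating
  sum over the elements removed from \<open>S\<close>, a form to which homomorphisms out of the
  Koszul complex can be applied.\<close>

lemma koszul_diff_gen:
  assumes S: "S \<in> koszul_basis xs (i + 1)"
  shows "diff (koszul R xs) (i + 1) (free_gen R S) = finsum (Kz i)
    (\<lambda>k. (sgn_pow R (card {l \<in> S - {k}. l < k}) \<otimes>\<^bsub>R\<^esub> xs ! k) \<odot>\<^bsub>Kz i\<^esub> free_gen R (S - {k})) S"
proof
  fix T
  interpret K: module R "Kz i" by (rule Km)
  let ?a = "\<lambda>k. sgn_pow R (card {l \<in> S - {k}. l < k}) \<otimes>\<^bsub>R\<^esub> xs ! k"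
  let ?t = "\<lambda>j. sgn_pow R (card {k \<in> T. k < j}) \<otimes>\<^bsub>R\<^esub> (xs ! j \<otimes>\<^bsub>R\<^esub> free_gen R S (insert j T))"
  have Sx: "k < length xs" if "k \<in> S" for k using S that by auto
  have ac: "?a k \<in> carrier R" if "k \<in> S" for k
    using sgn_pow_simps(1)[OF base_ring] seq_closed[OF Sx[OF that]] by (intro M.R.m_closed)
  have Pi: "(\<lambda>k. ?a k \<odot>\<^bsub>Kz i\<^esub> free_gen R (S - {k})) \<in> S \<rightarrow> carrier (Kz i)"
    by (intro Pi_I K.smult_closed ac basis_gen_closed basis_minus[OF S])
  have ev: "(\<lambda>\<phi>. \<phi> T) \<in> mod_hom R (Kz i) (regular_mod R)"
    unfolding koszul_obj by (rule free_eval_hom[OF base_ring])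
  have L: "diff (koszul R xs) (i + 1) (free_gen R S) T = finsum R ?t ({..<length xs} - T)"
    by (simp add: koszul_def sgn_pow_def)
  have "finsum (Kz i) (\<lambda>k. ?a k \<odot>\<^bsub>Kz i\<^esub> free_gen R (S - {k})) S T =
      finsum R (\<lambda>k. (?a k \<odot>\<^bsub>Kz i\<^esub> free_gen R (S - {k})) T) S"
    using mod_hom_finsum[OF Km regular_module[OF base_ring] ev finite_basis[OF S] Pi] by (simp add: regular_finsum)
  also have "\<dots> = finsum R (\<lambda>k. ?a k \<otimes>\<^bsub>R\<^esub> free_gen R (S - {k}) T) S"
    by (simp add: koszul_obj free_mod_def)
  finally have Rs: "finsum (Kz i) (\<lambda>k. ?a k \<odot>\<^bsub>Kz i\<^esub> free_gen R (S - {k})) S T =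
    finsum R (\<lambda>k. ?a k \<otimes>\<^bsub>R\<^esub> free_gen R (S - {k}) T) S" .
  show "diff (koszul R xs) (i + 1) (free_gen R S) T =
      finsum (Kz i) (\<lambda>k. ?a k \<odot>\<^bsub>Kz i\<^esub> free_gen R (S - {k})) S T"
    unfolding L Rs
  proof (cases "\<exists>k\<in>S. T = S - {k}")
    \<comment> \<open>Only \<open>k\<close>, the element of \<open>S\<close> missing from
      \<open>T\<close>, contributes on either side.\<close>
    case True
    then obtain k where k: "k \<in> S" "T = S - {k}" by blast
    have iT: "insert j T = S \<longleftrightarrow> j = k" if "j \<in> {..<length xs} - T" for j using k that by auto
    have kT: "k \<in> {..<length xs} - T" using k Sx by auto
    have "finsum R ?t ({..<length xs} - T) = finsum R (\<lambda>j. if k = j then ?a j else \<zero>\<^bsub>R\<^esub>) ({..<length xs} - T)"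
      using iT k seq_closed Sx sgn_pow_simps(1)[OF base_ring]
      by (intro M.R.finsum_cong') (auto simp: free_gen_def ac)
    also have "\<dots> = ?a k"
    proof (subst M.R.add.finprod_mono_neutral_cong_right[of "{..<length xs} - T" "{k}" _ ?a])
      show "finsum R ?a {k} = ?a k" using M.R.finsum_insert[of "{}" k ?a] ac[OF k(1)] by simp
    qed (use kT ac[OF k(1)] in auto)
    also have "\<dots> = finsum R (\<lambda>j. if k = j then ?a j else \<zero>\<^bsub>R\<^esub>) S"
      by (rule M.R.finsum_singleton[symmetric, OF k(1) finite_basis[OF S]]) (use ac in auto)
    also have "\<dots> = finsum R (\<lambda>k. ?a k \<otimes>\<^bsub>R\<^esub> free_gen R (S - {k}) T) S"
      using k ac by (intro M.R.finsum_cong') (auto simp: free_gen_def)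
    finally show "finsum R ?t ({..<length xs} - T) = finsum R (\<lambda>k. ?a k \<otimes>\<^bsub>R\<^esub> free_gen R (S - {k}) T) S" .
  next
    case False
    have "insert j T \<noteq> S" if "j \<in> {..<length xs} - T" for j
    proof
      assume "insert j T = S"
      then have "j \<in> S" "T = S - {j}" using that by auto
      then show False using False by blast
    qed
    then have "finsum R ?t ({..<length xs} - T) = \<zero>\<^bsub>R\<^esub>"
      using seq_closed sgn_pow_simps(1)[OF base_ring] by (intro M.R.add.finprod_one_eqI) (simp add: free_gen_def)
    moreover have "finsum R (\<lambda>k. ?a k \<otimes>\<^bsub>R\<^esub> free_gen R (S - {k}) T) S = \<zero>\<^bsub>R\<^esub>"
      using False ac by (intro M.R.add.finprod_one_eqI) (auto simp: free_gen_def)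
    ultimately show "finsum R ?t ({..<length xs} - T) = finsum R (\<lambda>k. ?a k \<otimes>\<^bsub>R\<^esub> free_gen R (S - {k}) T) S" by simp
  qed
qed

text \<open>The star operator from Hom(K_j, M) to the model in degree \<open>e - j\<close>: the
  value on the basis element of the complement of \<open>T\<close> becomes the coefficient at
  \<open>T\<close>. Up to a factor depending on the degree alone, \<open>(-1)^(\<Sum>T)\<close> is
  the sign of the shuffle of \<open>T\<close> and its complement; in this normalisation
  \<open>D\<close> commutes with the differentials without further signs.\<close>

private definition D :: "int \<Rightarrow> ((nat set \<Rightarrow> 'a) \<Rightarrow> 'm) \<Rightarrow> nat set \<Rightarrow> 'm" where
  "D j \<alpha> T = (if T \<in> koszul_basis xs (e - j)
     then sgn_pow R (\<Sum>T) \<odot>\<^bsub>M\<^esub> \<alpha> (free_gen R ({..<length xs} - T)) else \<zero>\<^bsub>M\<^esub>)"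

private lemma compl_basis: "T \<in> koszul_basis xs (e - j) \<Longrightarrow> {..<length xs} - T \<in> koszul_basis xs j"
proof -
  assume T: "T \<in> koszul_basis xs (e - j)"
  then have "card ({..<length xs} - T) = length xs - card T" "card T \<le> length xs"
    using card_Diff_subset[of T "{..<length xs}"] card_mono[of "{..<length xs}" T] finite_basis[OF T] by auto
  with T show ?thesis by auto
qed

private lemma D_closed: "\<alpha> \<in> mod_hom R (Kz j) M \<Longrightarrow> D j \<alpha> \<in> carrier (KzM (e - j))"
  using mod_hom_closed[OF Km MM _ basis_gen_closed[OF compl_basis]] sgn_pow_simps(1)[OF base_ring]
  by (simp add: koszul_on_sel D_def del: mem_Collect_eq)

text \<open>At \<open>T\<close> both sides are sums over the indices \<open>k\<close> outside
  \<open>T\<close>, because adding \<open>k\<close> to \<open>T\<close> means removing it from the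
  complement. Only the signs have to be compared.\<close>

private lemma D_diff:
  assumes \<alpha>: "\<alpha> \<in> mod_hom R (Kz j) M"
  shows "diff (koszul_on R xs M) (e - j) (D j \<alpha>) = D (j + 1) (\<lambda>\<phi>. \<alpha> (diff (koszul R xs) (j + 1) \<phi>))"
proof
  fix T
  let ?E = "{..<length xs}"
  let ?S = "?E - T"
  show "diff (koszul_on R xs M) (e - j) (D j \<alpha>) T = D (j + 1) (\<lambda>\<phi>. \<alpha> (diff (koszul R xs) (j + 1) \<phi>)) T"
  proof (cases "T \<in> koszul_basis xs (e - (j + 1))")
    case False
    have "diff (koszul_on R xs M) (e - (j + 1) + 1) (D j \<alpha>) \<in> carrier (KzM (e - (j + 1)))"
      using D_closed[OF \<alpha>] by (intro mod_hom_closed[OF KMm KMm koszul_on_diff_hom[OF MM xs]]) (simp add: algebra_simps)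
    then have "diff (koszul_on R xs M) (e - j) (D j \<alpha>) T = \<zero>\<^bsub>M\<^esub>"
      using False by (simp add: koszul_on_sel(1) del: mem_Collect_eq)
    then show ?thesis using False unfolding D_def by (simp only: if_False)
  next
    case True
    note S = compl_basis[OF True]
    have fT: "finite T" and TE: "T \<subseteq> ?E" using finite_basis[OF True] True by auto
    have ac: "\<alpha> (free_gen R (?S - {k})) \<in> carrier M" if "k \<in> ?S" for k
      by (rule mod_hom_closed[OF Km MM \<alpha> basis_gen_closed[OF basis_minus[OF S that]]])
    interpret Kj: module R "Kz j" by (rule Km)
    let ?a = "\<lambda>k. sgn_pow R (card {l \<in> ?S - {k}. l < k})"
    let ?m = "\<lambda>k. \<alpha> (free_gen R (?S - {k}))"
    have Pi: "(\<lambda>k. (?a k \<otimes>\<^bsub>R\<^esub> xs ! k) \<odot>\<^bsub>Kz j\<^esub> free_gen R (?S - {k})) \<in> ?S \<rightarrow> carrier (Kz j)"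
      by (intro Pi_I Kj.smult_closed M.R.m_closed sgn_pow_simps(1)[OF base_ring] seq_closed basis_gen_closed basis_minus[OF S]) auto
    have Pm: "(\<lambda>k. (?a k \<otimes>\<^bsub>R\<^esub> xs ! k) \<odot>\<^bsub>M\<^esub> ?m k) \<in> ?S \<rightarrow> carrier M"
      by (intro Pi_I M.smult_closed M.R.m_closed sgn_pow_simps(1)[OF base_ring] seq_closed ac) auto
    have "\<alpha> (diff (koszul R xs) (j + 1) (free_gen R ?S)) =
        finsum M (\<lambda>k. \<alpha> ((?a k \<otimes>\<^bsub>R\<^esub> xs ! k) \<odot>\<^bsub>Kz j\<^esub> free_gen R (?S - {k}))) ?S"
      unfolding koszul_diff_gen[OF S] by (rule mod_hom_finsum[OF Km MM \<alpha> _ Pi]) simp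
    also have "\<dots> = finsum M (\<lambda>k. (?a k \<otimes>\<^bsub>R\<^esub> xs ! k) \<odot>\<^bsub>M\<^esub> ?m k) ?S"
      by (rule M.M.finsum_cong'[OF refl Pm])
        (auto intro!: mod_hom_smult[OF Km MM \<alpha>] M.R.m_closed sgn_pow_simps(1)[OF base_ring] seq_closed basis_gen_closed basis_minus[OF S])
    finally have "sgn_pow R (\<Sum>T) \<odot>\<^bsub>M\<^esub> \<alpha> (diff (koszul R xs) (j + 1) (free_gen R ?S)) =
        finsum M (\<lambda>k. sgn_pow R (\<Sum>T) \<odot>\<^bsub>M\<^esub> ((?a k \<otimes>\<^bsub>R\<^esub> xs ! k) \<odot>\<^bsub>M\<^esub> ?m k)) ?S"
      using M.finsum_smult_ldistr[OF _ sgn_pow_simps(1)[OF base_ring] Pm, of "\<Sum>T"] by simp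
    also have "\<dots> = finsum M (\<lambda>k. sgn_pow R (card {l \<in> T. l < k}) \<odot>\<^bsub>M\<^esub> (xs ! k \<odot>\<^bsub>M\<^esub> D j \<alpha> (insert k T))) ?S"
    proof (rule M.M.finsum_cong'[OF refl])
      show "(\<lambda>k. sgn_pow R (card {l \<in> T. l < k}) \<odot>\<^bsub>M\<^esub> (xs ! k \<odot>\<^bsub>M\<^esub> D j \<alpha> (insert k T))) \<in> ?S \<rightarrow> carrier M"
        using D_closed[OF \<alpha>] seq_closed sgn_pow_simps(1)[OF base_ring] by (auto simp: koszul_on_sel intro!: M.smult_closed)
      fix k assume k: "k \<in> ?S"
      let ?u = "card {l \<in> T. l < k}" and ?v = "card {l \<in> ?S - {k}. l < k}"
      \<comment> \<open>Each index below \<open>k\<close> lies in \<open>T\<close> or in its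
        complement, so the two positions of \<open>k\<close> add up to \<open>k\<close>. This is
        also the amount by which \<open>\<Sum>T\<close> grows when \<open>k\<close> is
        inserted.\<close>
      have "{l \<in> T. l < k} \<union> {l \<in> ?S - {k}. l < k} = {..<k}" using k by auto
      moreover have "{l \<in> T. l < k} \<inter> {l \<in> ?S - {k}. l < k} = {}" by auto
      ultimately have uv: "?u + ?v = k" using card_Un_disjoint[of "{l \<in> T. l < k}" "{l \<in> ?S - {k}. l < k}"] fT by simp
      have sum: "\<Sum>(insert k T) = k + \<Sum>T" using k fT by simp
      have "insert k T \<in> koszul_basis xs (e - j)" using True k fT by auto
      moreover have "?E - insert k T = ?S - {k}" by auto
      ultimately have Dk: "D j \<alpha> (insert k T) = sgn_pow R (k + \<Sum>T) \<odot>\<^bsub>M\<^esub> ?m k"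
        unfolding D_def sum by (simp only: if_True)
      have xk: "xs ! k \<in> carrier R" using k by (intro seq_closed) simp
      note s = sgn_pow_simps(1)[OF base_ring] and m = ac[OF k]
      have "even (s + b + (a + (k + s)))" if "a + b = k" for a b s :: nat using that by presburger
      from this[OF uv] have "even ((\<Sum>T + ?v) + (?u + (k + \<Sum>T)))" .
      then have sg: "sgn_pow R (\<Sum>T) \<otimes>\<^bsub>R\<^esub> ?a k = sgn_pow R ?u \<otimes>\<^bsub>R\<^esub> sgn_pow R (k + \<Sum>T)"
        unfolding sgn_pow_simps(2)[OF base_ring, symmetric] by (rule sgn_pow_simps(4)[OF base_ring])
      have "sgn_pow R (\<Sum>T) \<odot>\<^bsub>M\<^esub> ((?a k \<otimes>\<^bsub>R\<^esub> xs ! k) \<odot>\<^bsub>M\<^esub> ?m k) =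
          ((sgn_pow R (\<Sum>T) \<otimes>\<^bsub>R\<^esub> ?a k) \<otimes>\<^bsub>R\<^esub> xs ! k) \<odot>\<^bsub>M\<^esub> ?m k"
        using s xk m by (simp add: M.smult_assoc1)
      also have "\<dots> = (sgn_pow R ?u \<otimes>\<^bsub>R\<^esub> (xs ! k \<otimes>\<^bsub>R\<^esub> sgn_pow R (k + \<Sum>T))) \<odot>\<^bsub>M\<^esub> ?m k"
        unfolding sg using s xk
        by (simp add: comm_monoid.m_ac[OF cring.axioms(2)[OF base_ring]])
      also have "\<dots> = sgn_pow R ?u \<odot>\<^bsub>M\<^esub> (xs ! k \<odot>\<^bsub>M\<^esub> D j \<alpha> (insert k T))"
        unfolding Dk using s xk m by (simp add: M.smult_assoc1)
      finally show "sgn_pow R (\<Sum>T) \<odot>\<^bsub>M\<^esub> ((?a k \<otimes>\<^bsub>R\<^esub> xs ! k) \<odot>\<^bsub>M\<^esub> ?m k) =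
        sgn_pow R ?u \<odot>\<^bsub>M\<^esub> (xs ! k \<odot>\<^bsub>M\<^esub> D j \<alpha> (insert k T))" .
    qed
    finally show ?thesis using True by (simp only: koszul_on_sel D_def if_True)
  qed
qed

private lemma D_inj:
  assumes \<alpha>: "\<alpha> \<in> mod_hom R (Kz j) M" and \<beta>: "\<beta> \<in> mod_hom R (Kz j) M" and eq: "D j \<alpha> = D j \<beta>"
    and \<phi>: "\<phi> \<in> carrier (Kz j)"
  shows "\<alpha> \<phi> = \<beta> \<phi>"
proof (rule free_hom_eq[OF MM \<alpha>[unfolded koszul_obj] \<beta>[unfolded koszul_obj] _ \<phi>[unfolded koszul_obj]])
  fix S assume S: "S \<in> koszul_basis xs j"
  let ?T = "{..<length xs} - S"
  have S': "S \<in> koszul_basis xs (e - (e - j))" using S by simp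
  note T = compl_basis[OF S']
  have ST: "{..<length xs} - ?T = S" using S by auto
  have c: "\<alpha> (free_gen R S) \<in> carrier M" "\<beta> (free_gen R S) \<in> carrier M"
    using mod_hom_closed[OF Km MM \<alpha> basis_gen_closed[OF S]] mod_hom_closed[OF Km MM \<beta> basis_gen_closed[OF S]] by auto
  have "sgn_pow R (\<Sum>?T) \<odot>\<^bsub>M\<^esub> \<alpha> (free_gen R S) = sgn_pow R (\<Sum>?T) \<odot>\<^bsub>M\<^esub> \<beta> (free_gen R S)"
    using fun_cong[OF eq, of ?T] T unfolding D_def ST by (simp only: if_True)
  then have "(sgn_pow R (\<Sum>?T) \<otimes>\<^bsub>R\<^esub> sgn_pow R (\<Sum>?T)) \<odot>\<^bsub>M\<^esub> \<alpha> (free_gen R S) =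
      (sgn_pow R (\<Sum>?T) \<otimes>\<^bsub>R\<^esub> sgn_pow R (\<Sum>?T)) \<odot>\<^bsub>M\<^esub> \<beta> (free_gen R S)"
    using c sgn_pow_simps(1)[OF base_ring] by (simp add: M.smult_assoc1)
  then show "\<alpha> (free_gen R S) = \<beta> (free_gen R S)" using c by (simp add: sgn_pow_simps(3)[OF base_ring])
qed

private lemma D_surj:
  assumes f: "f \<in> carrier (KzM (e - j))"
  shows "\<exists>\<alpha>\<in>mod_hom R (Kz j) M. D j \<alpha> = f"
proof -
  have fM: "f T \<in> carrier M" for T using f by (simp add: koszul_on_sel)
  \<comment> \<open>A sign is its own inverse, so the factor from \<open>D\<close> is used once more
    to undo it.\<close>
  let ?c = "\<lambda>S. sgn_pow R (\<Sum>({..<length xs} - S)) \<odot>\<^bsub>M\<^esub> f ({..<length xs} - S)"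
  have c: "?c \<in> koszul_basis xs j \<rightarrow> carrier M" using fM sgn_pow_simps(1)[OF base_ring] by simp
  let ?\<alpha> = "free_ext R M ?c"
  have "D j ?\<alpha> T = f T" for T
  proof (cases "T \<in> koszul_basis xs (e - j)")
    case True
    have TT: "{..<length xs} - ({..<length xs} - T) = T" using True by auto
    have "D j ?\<alpha> T = sgn_pow R (\<Sum>T) \<odot>\<^bsub>M\<^esub> (sgn_pow R (\<Sum>T) \<odot>\<^bsub>M\<^esub> f T)"
      using True unfolding D_def free_ext_gen[OF MM c compl_basis[OF True]] TT by (simp only: if_True)
    then show ?thesis
      using fM by (simp add: M.smult_assoc1[symmetric] sgn_pow_simps(1,3)[OF base_ring])
  next
    case False
    then have "f T = \<zero>\<^bsub>M\<^esub>" using f by (simp add: koszul_on_sel del: mem_Collect_eq)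
    then show ?thesis using False unfolding D_def by (simp only: if_False)
  qed
  then have "D j ?\<alpha> = f" by (rule ext)
  moreover have "?\<alpha> \<in> mod_hom R (Kz j) M" unfolding koszul_obj by (rule free_ext_hom[OF MM c])
  ultimately show ?thesis by (rule bexI[of _ ?\<alpha>])
qed

text \<open>Up to values off the carriers, \<open>D\<close> is bijective in each degree and turns
  composition with the differential into the Koszul differential. Cohomology in degree
  \<open>j\<close> therefore matches homology in degree \<open>e - j\<close>.\<close>

theorem ext_vanishes_koszul: "ext_vanishes R M j (koszul R xs) \<longleftrightarrow> exact_at (koszul_on R xs M) (e - j)"
proof
  have e1: "e - (j - 1) = e - j + 1" "e - j - 1 = e - (j + 1)" by simp_all
  have zd: "D (j + 1) (\<lambda>\<phi>. \<alpha> (diff (koszul R xs) (j + 1) \<phi>)) = \<zero>\<^bsub>KzM (e - (j + 1))\<^esub> \<longleftrightarrow>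
      (\<forall>\<phi>\<in>carrier (Kz (j + 1)). \<alpha> (diff (koszul R xs) (j + 1) \<phi>) = \<zero>\<^bsub>M\<^esub>)"
    if \<alpha>: "\<alpha> \<in> mod_hom R (Kz j) M" for \<alpha>
  proof
    assume *: "D (j + 1) (\<lambda>\<phi>. \<alpha> (diff (koszul R xs) (j + 1) \<phi>)) = \<zero>\<^bsub>KzM (e - (j + 1))\<^esub>"
    have "D (j + 1) (\<lambda>\<phi>. \<zero>\<^bsub>M\<^esub>) = \<zero>\<^bsub>KzM (e - (j + 1))\<^esub>"
      using sgn_pow_simps(1)[OF base_ring] by (intro ext) (simp add: D_def koszul_on_sel(1) del: mem_Collect_eq)
    with * show "\<forall>\<phi>\<in>carrier (Kz (j + 1)). \<alpha> (diff (koszul R xs) (j + 1) \<phi>) = \<zero>\<^bsub>M\<^esub>"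
      by (intro ballI D_inj[OF mod_hom_comp[OF koszul_diff_closed \<alpha>] mod_hom_zero_map[OF MM]]) simp_all
  next
    assume "\<forall>\<phi>\<in>carrier (Kz (j + 1)). \<alpha> (diff (koszul R xs) (j + 1) \<phi>) = \<zero>\<^bsub>M\<^esub>"
    then show "D (j + 1) (\<lambda>\<phi>. \<alpha> (diff (koszul R xs) (j + 1) \<phi>)) = \<zero>\<^bsub>KzM (e - (j + 1))\<^esub>"
      using basis_gen_closed[OF compl_basis, of _ "j + 1"] sgn_pow_simps(1)[OF base_ring]
      by (intro ext) (simp add: D_def koszul_on_sel(1) del: mem_Collect_eq)
  qed
  have cob: "diff (koszul_on R xs M) (e - j + 1) (D (j - 1) \<beta>) = D j (\<lambda>\<phi>. \<beta> (diff (koszul R xs) j \<phi>))"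
    if "\<beta> \<in> mod_hom R (Kz (j - 1)) M" for \<beta>
    using D_diff[OF that] by (simp add: algebra_simps)
  have dj: "diff (koszul R xs) j \<in> mod_hom R (Kz j) (Kz (j - 1))" by (rule chain_complexD(2)[OF K])
  show "exact_at (koszul_on R xs M) (e - j)" if E: "ext_vanishes R M j (koszul R xs)"
    unfolding exact_at_def
  proof
    fix f assume f: "f \<in> cycles (koszul_on R xs M) (e - j)"
    then have fc: "f \<in> carrier (KzM (e - j))" by (simp add: cycles_def)
    from D_surj[OF this] obtain \<alpha> where \<alpha>: "\<alpha> \<in> mod_hom R (Kz j) M" "D j \<alpha> = f" ..
    have "D (j + 1) (\<lambda>\<phi>. \<alpha> (diff (koszul R xs) (j + 1) \<phi>)) = \<zero>\<^bsub>KzM (e - (j + 1))\<^esub>"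
      using f unfolding D_diff[OF \<alpha>(1), symmetric] \<alpha>(2) e1(2)[symmetric] by (simp add: cycles_def)
    then have z: "\<forall>\<phi>\<in>carrier (Kz (j + 1)). \<alpha> (diff (koszul R xs) (j + 1) \<phi>) = \<zero>\<^bsub>M\<^esub>" by (simp only: zd[OF \<alpha>(1)])
    have "\<exists>\<beta>\<in>mod_hom R (Kz (j - 1)) M. \<forall>\<phi>\<in>carrier (Kz j). \<alpha> \<phi> = \<beta> (diff (koszul R xs) j \<phi>)"
      by (rule ext_vanishesD[OF E \<alpha>(1)]) (rule bspec[OF z])
    then obtain \<beta> where \<beta>: "\<beta> \<in> mod_hom R (Kz (j - 1)) M"
      and \<beta>e: "\<forall>\<phi>\<in>carrier (Kz j). \<alpha> \<phi> = \<beta> (diff (koszul R xs) j \<phi>)" ..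
    have "D j \<alpha> = D j (\<lambda>\<phi>. \<beta> (diff (koszul R xs) j \<phi>))"
      using \<beta>e basis_gen_closed[OF compl_basis] by (intro ext) (simp add: D_def del: mem_Collect_eq)
    then have "f = diff (koszul_on R xs M) (e - j + 1) (D (j - 1) \<beta>)" by (simp only: cob[OF \<beta>] \<alpha>(2))
    moreover have "D (j - 1) \<beta> \<in> carrier (KzM (e - j + 1))" using D_closed[OF \<beta>] by (simp only: e1(1))
    ultimately show "f \<in> boundaries (koszul_on R xs M) (e - j)" by (auto simp: boundaries_def)
  qed
  show "ext_vanishes R M j (koszul R xs)" if E: "exact_at (koszul_on R xs M) (e - j)"
    unfolding ext_vanishes_def
  proof (intro ballI impI)
    fix \<alpha> assume \<alpha>: "\<alpha> \<in> mod_hom R (Kz j) M" "\<forall>\<phi>\<in>carrier (Kz (j + 1)). \<alpha> (diff (koszul R xs) (j + 1) \<phi>) = \<zero>\<^bsub>M\<^esub>"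
    have "diff (koszul_on R xs M) (e - j) (D j \<alpha>) = \<zero>\<^bsub>KzM (e - j - 1)\<^esub>"
      unfolding D_diff[OF \<alpha>(1)] e1(2) using \<alpha>(2) by (simp only: zd[OF \<alpha>(1)])
    then obtain f where f: "f \<in> carrier (KzM (e - j + 1))" "diff (koszul_on R xs M) (e - j + 1) f = D j \<alpha>"
      by (rule exact_atD[OF E D_closed[OF \<alpha>(1)]])
    from D_surj[of f "j - 1"] f(1) obtain \<beta> where \<beta>: "\<beta> \<in> mod_hom R (Kz (j - 1)) M" "D (j - 1) \<beta> = f"
      unfolding e1 by blast
    have "D j \<alpha> = D j (\<lambda>\<phi>. \<beta> (diff (koszul R xs) j \<phi>))" using cob[OF \<beta>(1)] f(2) \<beta>(2) by simp
    then have "\<forall>\<phi>\<in>carrier (Kz j). \<alpha> \<phi> = \<beta> (diff (koszul R xs) j \<phi>)"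
      by (intro ballI D_inj[OF \<alpha>(1) mod_hom_comp[OF dj \<beta>(1)]])
    then show "\<exists>\<beta>\<in>mod_hom R (Kz (j - 1)) M. \<forall>\<phi>\<in>carrier (Kz j). \<alpha> \<phi> = \<beta> (diff (koszul R xs) j \<phi>)"
      by (rule bexI[OF _ \<beta>(1)])
  qed
qed

end

section \<open>Change of coefficients\<close>

context
  fixes R :: "('a, 'r) ring_scheme" and xs :: "'a list"
  assumes R: "cring R" and xs: "set xs \<subseteq> carrier R" and K: "chain_complex R (koszul R xs)"
begin

private lemma elem_closed: "j < length xs \<Longrightarrow> xs ! j \<in> carrier R"
  using xs nth_mem by blast

lemma koszul_on_map:
  assumes M: "module R M" and M': "module R M'" and h: "h \<in> mod_hom R M M'" and f: "\<And>S. f S \<in> carrier M"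
  shows "diff (koszul_on R xs M') i (\<lambda>S. h (f S)) T = h (diff (koszul_on R xs M) i f T)"
proof -
  interpret M: module R M by (rule M)
  interpret M': module R M' by (rule M')
  let ?t = "\<lambda>j. sgn_pow R (card {k \<in> T. k < j}) \<odot>\<^bsub>M\<^esub> (xs ! j \<odot>\<^bsub>M\<^esub> f (insert j T))"
  have c: "xs ! j \<odot>\<^bsub>M\<^esub> f S \<in> carrier M" if "j \<in> {..<length xs} - T" for j S
    using that elem_closed[of j] f by simp
  have t: "?t \<in> {..<length xs} - T \<rightarrow> carrier M"
    by (intro Pi_I M.smult_closed[OF sgn_pow_simps(1)[OF R]] c)
  have "h (diff (koszul_on R xs M) i f T) = finsum M' (\<lambda>j. h (?t j)) ({..<length xs} - T)"
    unfolding koszul_on_sel by (rule mod_hom_finsum[OF M M' h _ t]) simp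
  also have "\<dots> = diff (koszul_on R xs M') i (\<lambda>S. h (f S)) T"
    unfolding koszul_on_sel
  proof (rule M'.M.finsum_cong'[OF refl])
    show "(\<lambda>j. sgn_pow R (card {k \<in> T. k < j}) \<odot>\<^bsub>M'\<^esub> (xs ! j \<odot>\<^bsub>M'\<^esub> h (f (insert j T)))) \<in> {..<length xs} - T \<rightarrow> carrier M'"
      using elem_closed by (intro Pi_I M'.smult_closed[OF sgn_pow_simps(1)[OF R]] M'.smult_closed mod_hom_closed[OF M M' h] f) auto
    show "h (?t j) = sgn_pow R (card {k \<in> T. k < j}) \<odot>\<^bsub>M'\<^esub> (xs ! j \<odot>\<^bsub>M'\<^esub> h (f (insert j T)))"
      if j: "j \<in> {..<length xs} - T" for j
      using j elem_closed[of j] f by (simp add: mod_hom_smult[OF M M' h] sgn_pow_simps(1)[OF R] c[OF j])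
  qed
  finally show ?thesis ..
qed

lemma koszul_on_restrict:
  assumes M: "module R M" and H: "submodule H R M" and f: "\<And>S. f S \<in> H"
  shows "diff (koszul_on R xs (M\<lparr>carrier := H\<rparr>)) i f = diff (koszul_on R xs M) i f"
proof
  fix T
  have "(\<lambda>x. x) \<in> mod_hom R (M\<lparr>carrier := H\<rparr>) M"
    using module.submoduleE(1)[OF M H] by (intro mod_hom_restrict_dom mod_hom_id)
  from koszul_on_map[OF module_restrict[OF M H] M this, of f i T] f
  show "diff (koszul_on R xs (M\<lparr>carrier := H\<rparr>)) i f T = diff (koszul_on R xs M) i f T" by simp
qed

lemma koszul_on_exact_zero:
  assumes M: "module R M" and z: "zero_mod M" shows "exact_at (koszul_on R xs M) i"
  unfolding exact_at_def
proof
  fix f assume "f \<in> cycles (koszul_on R xs M) i"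
  then have f: "f = \<zero>\<^bsub>obj (koszul_on R xs M) i\<^esub>"
    using zero_modD[OF z] by (auto simp: cycles_def koszul_on_sel)
  note km = koszul_on_module[OF M xs]
  have "diff (koszul_on R xs M) (i + 1) \<zero>\<^bsub>obj (koszul_on R xs M) (i + 1)\<^esub> = f"
    unfolding f by (rule mod_hom_zero[OF km km koszul_on_diff_hom[OF M xs]])
  then show "f \<in> boundaries (koszul_on R xs M) i"
    unfolding boundaries_def using abelian_groupE(2)[OF module.axioms(2)[OF km]] by blast
qed

text \<open>The segment H_j(M) \<rightarrow> H_j(B) \<rightarrow> H_(j-1)(H) of the long exact
  sequence for 0 \<rightarrow> H \<rightarrow> M \<rightarrow> B \<rightarrow> 0. A cycle over
  \<open>B\<close> lifts to a chain \<open>p\<close> over \<open>M\<close> whose boundary has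
  coefficients in \<open>H\<close>. It is also the boundary of some \<open>b\<close> over
  \<open>H\<close>, and \<open>p - b\<close> is a cycle with the same image.\<close>

lemma koszul_on_exact_ses:
  assumes M: "module R M" and B: "module R B" and H: "submodule H R M"
    and \<pi>: "\<pi> \<in> mod_hom R M B" "\<pi> ` carrier M = carrier B"
      "\<And>x. x \<in> carrier M \<Longrightarrow> \<pi> x = \<zero>\<^bsub>B\<^esub> \<longleftrightarrow> x \<in> H"
    and exH: "exact_at (koszul_on R xs (M\<lparr>carrier := H\<rparr>)) (j - 1)" and exM: "exact_at (koszul_on R xs M) j"
  shows "exact_at (koszul_on R xs B) j"
  unfolding exact_at_def
proof
  interpret M: module R M by (rule M)
  interpret B: module R B by (rule B)
  note Hm = module_restrict[OF M H]
  note KM = koszul_on_chain_complex[OF M xs K] and KB = koszul_on_chain_complex[OF B xs K]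
    and KH = koszul_on_chain_complex[OF Hm xs K]
  have HM: "H \<subseteq> carrier M" by (rule module.submoduleE(1)[OF M H])
  have Hz: "\<zero>\<^bsub>M\<^esub> \<in> H" using subgroup.one_closed[OF submodule.axioms(1)[OF H]] by simp
  fix y assume "y \<in> cycles (koszul_on R xs B) j"
  then have y: "y \<in> carrier (obj (koszul_on R xs B) j)" and dy: "diff (koszul_on R xs B) j y = (\<lambda>_. \<zero>\<^bsub>B\<^esub>)"
    by (auto simp: cycles_def koszul_on_sel(1))
  \<comment> \<open>The lift is taken coefficient by coefficient; off the basis it has to be zero
    for \<open>p\<close> to belong to the complex.\<close>
  have "\<exists>m\<in>carrier M. \<pi> m = y S \<and> (S \<notin> koszul_basis xs j \<longrightarrow> m = \<zero>\<^bsub>M\<^esub>)" for S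
  proof (cases "S \<in> koszul_basis xs j")
    case True
    have "y S \<in> \<pi> ` carrier M" using y unfolding \<pi>(2) by (simp add: koszul_on_sel(1))
    then obtain m where "m \<in> carrier M" "y S = \<pi> m" by blast
    with True show ?thesis by (intro bexI[of _ m]) simp_all
  next
    case False
    then have "y S = \<zero>\<^bsub>B\<^esub>" using y by (simp add: koszul_on_sel(1) del: mem_Collect_eq)
    then show ?thesis using mod_hom_zero[OF M B \<pi>(1)] by (intro bexI[of _ "\<zero>\<^bsub>M\<^esub>"]) simp_all
  qed
  then obtain p where p: "\<And>S. p S \<in> carrier M" "\<And>S. \<pi> (p S) = y S"
    "\<And>S. S \<notin> koszul_basis xs j \<Longrightarrow> p S = \<zero>\<^bsub>M\<^esub>" by metis
  have pc: "p \<in> carrier (obj (koszul_on R xs M) j)"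
    unfolding koszul_on_sel(1) fun_mod_sel using p by blast
  let ?q = "diff (koszul_on R xs M) j p"
  have qc: "?q \<in> carrier (obj (koszul_on R xs M) (j - 1))" by (rule diff_simps(1)[OF KM KM KM pc])
  have "\<pi> (?q T) = \<zero>\<^bsub>B\<^esub>" for T
    using koszul_on_map[OF M B \<pi>(1), of p j T] p dy by simp
  then have qH: "?q T \<in> H" for T using qc \<pi>(3)[of "?q T"] by (simp add: koszul_on_sel(1))
  have qcH: "?q \<in> carrier (obj (koszul_on R xs (M\<lparr>carrier := H\<rparr>)) (j - 1))"
    using qc qH by (simp add: koszul_on_sel(1))
  have pc': "p \<in> carrier (obj (koszul_on R xs M) (j - 1 + 1))" using pc by simp
  have "diff (koszul_on R xs M) (j - 1) ?q = \<zero>\<^bsub>obj (koszul_on R xs M) (j - 1 - 1)\<^esub>"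
    using chain_complexD(4)[OF KM pc'] by simp
  then have "diff (koszul_on R xs (M\<lparr>carrier := H\<rparr>)) (j - 1) ?q = \<zero>\<^bsub>obj (koszul_on R xs (M\<lparr>carrier := H\<rparr>)) (j - 1 - 1)\<^esub>"
    unfolding koszul_on_restrict[OF M H qH] by (simp add: koszul_on_sel(1))
  then obtain b where b: "b \<in> carrier (obj (koszul_on R xs (M\<lparr>carrier := H\<rparr>)) (j - 1 + 1))"
    "diff (koszul_on R xs (M\<lparr>carrier := H\<rparr>)) (j - 1 + 1) b = ?q"
    by (rule exact_atD[OF exH qcH])
  have bH: "b S \<in> H" for S using b(1) by (simp add: koszul_on_sel(1))
  have bc: "b \<in> carrier (obj (koszul_on R xs M) j)"
    using b(1) HM by (auto simp: koszul_on_sel(1))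
  have db: "diff (koszul_on R xs M) j b = ?q" using b(2) unfolding koszul_on_restrict[OF M H bH] by simp
  let ?w = "p \<oplus>\<^bsub>obj (koszul_on R xs M) j\<^esub> (\<ominus>\<^bsub>obj (koszul_on R xs M) j\<^esub> b)"
  interpret Kj: module R "obj (koszul_on R xs M) j" by (rule koszul_on_module[OF M xs])
  interpret Kp: module R "obj (koszul_on R xs M) (j - 1)" by (rule koszul_on_module[OF M xs])
  have nb: "\<ominus>\<^bsub>obj (koszul_on R xs M) j\<^esub> b \<in> carrier (obj (koszul_on R xs M) j)" using bc by simp
  have nbv: "(\<ominus>\<^bsub>obj (koszul_on R xs M) j\<^esub> b) S = \<ominus>\<^bsub>M\<^esub> b S" for S
    using mod_hom_inv[OF koszul_on_module[OF M xs] M fun_eval_hom[of S R M "koszul_basis xs j", folded koszul_on_sel(1)[of R xs M j]] bc] .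
  have wc: "?w \<in> carrier (obj (koszul_on R xs M) j)" using pc nb by simp
  have "diff (koszul_on R xs M) j ?w = \<zero>\<^bsub>obj (koszul_on R xs M) (j - 1)\<^esub>"
    using qc by (simp add: diff_simps(2)[OF KM KM KM pc nb] diff_simps(5)[OF KM KM KM bc] db Kp.M.r_neg)
  then obtain v where v: "v \<in> carrier (obj (koszul_on R xs M) (j + 1))" "diff (koszul_on R xs M) (j + 1) v = ?w"
    by (rule exact_atD[OF exM wc])
  have vM: "v S \<in> carrier M" for S using v(1) by (simp add: koszul_on_sel(1))
  have "diff (koszul_on R xs B) (j + 1) (\<lambda>S. \<pi> (v S)) T = y T" for T
  proof -
    have bM: "b T \<in> carrier M" using bH HM by auto
    have "\<pi> (b T) = \<zero>\<^bsub>B\<^esub>" using bH[of T] \<pi>(3)[OF bM] by simp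
    moreover have "?w T = p T \<oplus>\<^bsub>M\<^esub> (\<ominus>\<^bsub>M\<^esub> b T)" by (simp add: koszul_on_sel(1) nbv[unfolded koszul_on_sel(1)])
    ultimately have "\<pi> (?w T) = y T"
      using p bM mod_hom_closed[OF M B \<pi>(1) p(1)[of T]]
      by (simp add: mod_hom_add[OF M B \<pi>(1)] mod_hom_inv[OF M B \<pi>(1)] B.M.minus_zero_right[unfolded a_minus_def])
    then show ?thesis using koszul_on_map[OF M B \<pi>(1) vM, where i = "j + 1" and T = T] v(2) by simp
  qed
  then have "diff (koszul_on R xs B) (j + 1) (\<lambda>S. \<pi> (v S)) = y" by (rule ext)
  moreover have "(\<lambda>S. \<pi> (v S)) \<in> carrier (obj (koszul_on R xs B) (j + 1))"
    using v(1) mod_hom_closed[OF M B \<pi>(1)] mod_hom_zero[OF M B \<pi>(1)] by (simp add: koszul_on_sel(1))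
  ultimately show "y \<in> boundaries (koszul_on R xs B) j" by (auto simp: boundaries_def)
qed

section \<open>Retracts, free and projective coefficients\<close>

lemma koszul_on_exact_retract:
  assumes P: "module R P" and F: "module R F" and \<sigma>: "\<sigma> \<in> mod_hom R P F" and \<pi>: "\<pi> \<in> mod_hom R F P"
    and id: "\<And>x. x \<in> carrier P \<Longrightarrow> \<pi> (\<sigma> x) = x" and ex: "exact_at (koszul_on R xs F) j"
  shows "exact_at (koszul_on R xs P) j"
  unfolding exact_at_def
proof
  fix f assume "f \<in> cycles (koszul_on R xs P) j"
  then have f: "f \<in> carrier (obj (koszul_on R xs P) j)" "diff (koszul_on R xs P) j f = (\<lambda>_. \<zero>\<^bsub>P\<^esub>)"
    by (auto simp: cycles_def koszul_on_sel(1))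
  have fP: "f S \<in> carrier P" for S using f(1) by (simp add: koszul_on_sel(1))
  have "(\<lambda>S. \<sigma> (f S)) \<in> carrier (obj (koszul_on R xs F) j)"
    using f(1) mod_hom_closed[OF P F \<sigma>] mod_hom_zero[OF P F \<sigma>] by (simp add: koszul_on_sel(1))
  moreover have "diff (koszul_on R xs F) j (\<lambda>S. \<sigma> (f S)) = \<zero>\<^bsub>obj (koszul_on R xs F) (j - 1)\<^esub>"
    using koszul_on_map[OF P F \<sigma> fP] f(2) mod_hom_zero[OF P F \<sigma>] by (intro ext) (simp add: koszul_on_sel(1))
  ultimately obtain g where g: "g \<in> carrier (obj (koszul_on R xs F) (j + 1))"
    "diff (koszul_on R xs F) (j + 1) g = (\<lambda>S. \<sigma> (f S))" by (rule exact_atD[OF ex])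
  have gF: "g S \<in> carrier F" for S using g(1) by (simp add: koszul_on_sel(1))
  have "diff (koszul_on R xs P) (j + 1) (\<lambda>S. \<pi> (g S)) = f"
    using koszul_on_map[OF F P \<pi> gF, where i = "j + 1"] g(2) id fP by (intro ext) simp
  moreover have "(\<lambda>S. \<pi> (g S)) \<in> carrier (obj (koszul_on R xs P) (j + 1))"
    using g(1) mod_hom_closed[OF F P \<pi>] mod_hom_zero[OF F P \<pi>] by (simp add: koszul_on_sel(1))
  ultimately show "f \<in> boundaries (koszul_on R xs P) j" by (auto simp: boundaries_def)
qed

lemma koszul_exact_regular: "exact_at (koszul R xs) j \<longleftrightarrow> exact_at (koszul_on R xs (regular_mod R)) j"
proof -
  have "\<zero>\<^bsub>obj (koszul R xs) i\<^esub> = \<zero>\<^bsub>obj (koszul_on R xs (regular_mod R)) i\<^esub>" for i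
    by (simp add: koszul_obj free_mod_def koszul_on_sel(1) regular_sel)
  then show ?thesis
    by (simp add: exact_at_def cycles_def boundaries_def koszul_regular)
qed

text \<open>The differential acts on each coordinate \<open>b\<close> of the free module separately,
  so exactness over \<open>R\<close> applies to every coordinate. As the rank may be infinite, the
  solutions have to be assembled with finite support.\<close>

lemma koszul_on_exact_free:
  assumes ex: "exact_at (koszul R xs) j"
  shows "exact_at (koszul_on R xs (free_mod R B)) j"
  unfolding exact_at_def
proof
  let ?F = "free_mod R B" and ?M = "regular_mod R"
  note F = free_module[OF R, of B] and M = regular_module[OF R]
  interpret R: cring R by (rule R)
  fix f assume "f \<in> cycles (koszul_on R xs ?F) j"
  then have f: "f \<in> carrier (obj (koszul_on R xs ?F) j)" "diff (koszul_on R xs ?F) j f = (\<lambda>_. \<zero>\<^bsub>?F\<^esub>)"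
    by (auto simp: cycles_def koszul_on_sel(1))
  have fF: "f S \<in> carrier ?F" and f0: "S \<notin> koszul_basis xs j \<Longrightarrow> f S = \<zero>\<^bsub>?F\<^esub>" for S
    using f(1) by (simp_all add: koszul_on_sel(1) del: mem_Collect_eq)
  have F0: "\<zero>\<^bsub>?F\<^esub> = (\<lambda>_. \<zero>\<^bsub>R\<^esub>)" by (simp add: free_mod_def)
  have fv: "f S b \<in> carrier R" for S b using fF[of S] by (simp add: free_mod_def)
  \<comment> \<open>Where the coordinate of \<open>f\<close> vanishes, the solution is required to
    be zero. Since \<open>f\<close> has finitely many coefficients, each of finite support, only
    finitely many coordinates remain.\<close>
  have "\<exists>g\<in>carrier (obj (koszul_on R xs ?M) (j + 1)). diff (koszul_on R xs ?M) (j + 1) g = (\<lambda>S. f S b) \<and>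
      ((\<forall>S. f S b = \<zero>\<^bsub>R\<^esub>) \<longrightarrow> g = (\<lambda>_. \<zero>\<^bsub>R\<^esub>))" for b
  proof (cases "\<forall>S. f S b = \<zero>\<^bsub>R\<^esub>")
    case True
    note km = koszul_on_module[OF M xs]
    have z: "\<zero>\<^bsub>obj (koszul_on R xs ?M) i\<^esub> = (\<lambda>_. \<zero>\<^bsub>R\<^esub>)" for i by (simp add: koszul_on_sel(1) regular_sel)
    have "diff (koszul_on R xs ?M) (j + 1) (\<lambda>_. \<zero>\<^bsub>R\<^esub>) = (\<lambda>_. \<zero>\<^bsub>R\<^esub>)"
      using mod_hom_zero[OF km km koszul_on_diff_hom[OF M xs, of j]] by (simp only: z)
    moreover have "(\<lambda>_. \<zero>\<^bsub>R\<^esub>) \<in> carrier (obj (koszul_on R xs ?M) (j + 1))"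
      by (simp add: koszul_on_sel(1) regular_sel)
    ultimately show ?thesis using True by (intro bexI[of _ "\<lambda>_. \<zero>\<^bsub>R\<^esub>"]) auto
  next
    case False
    have "(\<lambda>S. f S b) \<in> carrier (obj (koszul_on R xs ?M) j)"
      using fv f0 F0 by (simp add: koszul_on_sel(1) regular_sel)
    moreover have "diff (koszul_on R xs ?M) j (\<lambda>S. f S b) = \<zero>\<^bsub>obj (koszul_on R xs ?M) (j - 1)\<^esub>"
      using koszul_on_map[OF F M free_eval_hom[OF R, of b B] fF, where i = j] f(2) F0
      by (intro ext) (simp add: koszul_on_sel(1) regular_sel)
    ultimately obtain g where "g \<in> carrier (obj (koszul_on R xs ?M) (j + 1))"
      "diff (koszul_on R xs ?M) (j + 1) g = (\<lambda>S. f S b)"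
      by (rule exact_atD[OF ex[unfolded koszul_exact_regular]])
    with False show ?thesis by blast
  qed
  then obtain g where g: "\<And>b. g b \<in> carrier (obj (koszul_on R xs ?M) (j + 1))"
    "\<And>b. diff (koszul_on R xs ?M) (j + 1) (g b) = (\<lambda>S. f S b)"
    "\<And>b. \<forall>S. f S b = \<zero>\<^bsub>R\<^esub> \<Longrightarrow> g b = (\<lambda>_. \<zero>\<^bsub>R\<^esub>)" by metis
  have gR: "g b S \<in> carrier R" and g0: "S \<notin> koszul_basis xs (j + 1) \<Longrightarrow> g b S = \<zero>\<^bsub>R\<^esub>" for b S
    using g(1)[of b] by (simp_all add: koszul_on_sel(1) regular_sel del: mem_Collect_eq)
  define G where "G S b = g b S" for S b
  have fin: "finite (\<Union>S\<in>koszul_basis xs j. {b. f S b \<noteq> \<zero>\<^bsub>R\<^esub>})"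
    using fF by (intro finite_UN_I finite_koszul_basis) (simp add: free_mod_def)
  have "{b. G S b \<noteq> \<zero>\<^bsub>R\<^esub>} \<subseteq> (\<Union>S\<in>koszul_basis xs j. {b. f S b \<noteq> \<zero>\<^bsub>R\<^esub>})" for S
  proof
    fix b assume "b \<in> {b. G S b \<noteq> \<zero>\<^bsub>R\<^esub>}"
    then have gb: "g b S \<noteq> \<zero>\<^bsub>R\<^esub>" by (simp add: G_def)
    have "\<not> (\<forall>S. f S b = \<zero>\<^bsub>R\<^esub>)"
    proof
      assume "\<forall>S. f S b = \<zero>\<^bsub>R\<^esub>"
      from fun_cong[OF g(3)[OF this], of S] gb show False by contradiction
    qed
    then obtain S' where S': "f S' b \<noteq> \<zero>\<^bsub>R\<^esub>" by blast
    have "S' \<in> koszul_basis xs j"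
    proof (rule ccontr)
      assume "S' \<notin> koszul_basis xs j"
      from f0[OF this] S' show False by (simp add: F0)
    qed
    with S' show "b \<in> (\<Union>S\<in>koszul_basis xs j. {b. f S b \<noteq> \<zero>\<^bsub>R\<^esub>})" by blast
  qed
  then have finG: "finite {b. G S b \<noteq> \<zero>\<^bsub>R\<^esub>}" for S by (rule finite_subset[OF _ fin])
  have "G S b = \<zero>\<^bsub>R\<^esub>" if "b \<notin> B" for S b
  proof -
    have "f S b = \<zero>\<^bsub>R\<^esub>" for S using fF[of S] that by (simp add: free_mod_def)
    then have "g b = (\<lambda>_. \<zero>\<^bsub>R\<^esub>)" by (intro g(3) allI)
    then show ?thesis by (simp only: G_def)
  qed
  then have GF: "G S \<in> carrier ?F" for S using gR finG by (simp add: free_mod_def G_def)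
  have Gc: "G \<in> carrier (obj (koszul_on R xs ?F) (j + 1))"
  proof -
    have "G S = (\<lambda>_. \<zero>\<^bsub>R\<^esub>)" if "S \<notin> koszul_basis xs (j + 1)" for S
      using g0[OF that] by (intro ext) (simp add: G_def)
    with GF show ?thesis unfolding koszul_on_sel(1) fun_mod_sel F0 by blast
  qed
  have "diff (koszul_on R xs ?F) (j + 1) G = f"
  proof (intro ext)
    fix S b
    have "diff (koszul_on R xs ?M) (j + 1) (\<lambda>S. G S b) S = diff (koszul_on R xs ?F) (j + 1) G S b"
      by (rule koszul_on_map[OF F M free_eval_hom[OF R] GF])
    moreover have "(\<lambda>S. G S b) = g b" by (simp add: G_def)
    ultimately show "diff (koszul_on R xs ?F) (j + 1) G S b = f S b" using g(2)[of b] by simp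
  qed
  with Gc show "f \<in> boundaries (koszul_on R xs ?F) j" by (auto simp: boundaries_def)
qed

text \<open>A projective module is a retract of the free module on its carrier.\<close>

lemma koszul_on_exact_projective:
  fixes P :: "('a, 'p) module"
  assumes P: "projective_mod R P" and ex: "exact_at (koszul R xs) j"
  shows "exact_at (koszul_on R xs P) j"
proof -
  note PM = projectiveD[OF P]
  obtain \<sigma> where \<sigma>: "\<sigma> \<in> mod_hom R P (free_mod R (carrier P))"
    "\<And>x. x \<in> carrier P \<Longrightarrow> free_ext R P (\<lambda>y. y) (\<sigma> x) = x"
    by (rule projective_section[OF P]) blast
  have "free_ext R P (\<lambda>y. y) \<in> mod_hom R (free_mod R (carrier P)) P" by (intro free_ext_hom PM) auto
  then show ?thesis
    by (rule koszul_on_exact_retract[OF PM free_module[OF R] \<sigma>(1) _ \<sigma>(2) koszul_on_exact_free[OF ex]])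
qed

text \<open>Depth counting along the boundaries of \<open>P\<close>, from the top degree \<open>s\<close> downwards.\<close>

lemma boundaries_koszul_exact:
  fixes P :: "('a, 'p) mod_complex"
  assumes P: "projective_complex R P" and exP: "\<And>i. h < i \<Longrightarrow> exact_at P i"
    and zP: "\<And>i. s < i \<Longrightarrow> zero_mod (obj P i)"
    and exK: "\<And>i. c < i \<Longrightarrow> exact_at (koszul R xs) i"
  shows "h \<le> s - int m \<Longrightarrow> c + int m \<le> j \<Longrightarrow>
    exact_at (koszul_on R xs ((obj P (s - int m))\<lparr>carrier := boundaries P (s - int m)\<rparr>)) j"
proof (induction m arbitrary: j)
  case 0
  note C = projective_complexD(1)[OF P] and Pm = projective_complexD(4)[OF P]
  \<comment> \<open>Nothing lies above degree \<open>s\<close>, so the descent starts from the zero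
    submodule.\<close>
  have "boundaries P s = {\<zero>\<^bsub>obj P s\<^esub>}"
    using zP[of "s + 1"] diff_up_simps(4)[OF C C C, of s] by (simp add: boundaries_def zero_mod_def)
  then have "zero_mod ((obj P s)\<lparr>carrier := boundaries P s\<rparr>)" by (simp add: zero_mod_def)
  then show ?case
    using koszul_on_exact_zero[OF module_restrict[OF Pm boundaries_submodule[OF C, of s]]] by simp
next
  case (Suc m)
  note C = projective_complexD(1)[OF P] and Pm = projective_complexD(4)[OF P]
  define i where "i = s - int m"
  have i: "s - int (Suc m) = i - 1" "h < i" using Suc.prems(1) by (auto simp: i_def)
  let ?B = "(obj P (i - 1))\<lparr>carrier := boundaries P (i - 1)\<rparr>"
  note Bm = module_restrict[OF Pm boundaries_submodule[OF C, of "i - 1"]]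
  have bd: "boundaries P (i - 1) = diff P i ` carrier (obj P i)" by (simp add: boundaries_def)
  have \<pi>: "diff P i \<in> mod_hom R (obj P i) ?B"
    by (rule mod_hom_restrict_cod[OF chain_complexD(2)[OF C]]) (simp add: bd)
  \<comment> \<open>Exactness in degree \<open>i\<close> makes 0 \<rightarrow> B_i \<rightarrow> P_i
    \<rightarrow> B_(i-1) \<rightarrow> 0 exact, where B_i are the boundaries. Each passage to the
    cokernel costs one degree of Koszul vanishing.\<close>
  have ker: "diff P i x = \<zero>\<^bsub>?B\<^esub> \<longleftrightarrow> x \<in> boundaries P i" if "x \<in> carrier (obj P i)" for x
    using that exP[OF i(2)] boundaries_subset_cycles[OF C, of i] by (auto simp: exact_at_def cycles_def)
  have 1: "exact_at (koszul_on R xs ((obj P i)\<lparr>carrier := boundaries P i\<rparr>)) (j - 1)"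
    using Suc.IH[of "j - 1"] Suc.prems by (simp add: i_def)
  have 2: "exact_at (koszul_on R xs (obj P i)) j"
    by (rule koszul_on_exact_projective[OF projective_complexD(3)[OF P] exK]) (use Suc.prems in simp)
  have "exact_at (koszul_on R xs ?B) j"
    by (rule koszul_on_exact_ses[OF Pm Bm boundaries_submodule[OF C] \<pi> _ ker 1 2]) (simp_all add: bd)
  then show ?case unfolding i(1) .
qed

text \<open>Koszul homology in the top degree consists of the elements killed by \<open>xs\<close>.
  If \<open>s - h < t\<close>, the counts for \<open>obj P h\<close> and for its boundaries would
  make it vanish for their quotient, but the class of \<open>z\<close> is such an element and is not
  zero. The argument runs with representatives in \<open>obj P h\<close> instead of the
  quotient.\<close>

lemma projective_length_bound:
  fixes P :: "('a, 'p) mod_complex"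
  assumes P: "projective_complex R P" and exP: "\<And>i. h < i \<Longrightarrow> exact_at P i"
    and zP: "\<And>i. s < i \<Longrightarrow> zero_mod (obj P i)" and hs: "h \<le> s"
    and exK: "\<And>i. int (length xs) - t < i \<Longrightarrow> exact_at (koszul R xs) i"
    and z: "z \<in> carrier (obj P h)" "z \<notin> boundaries P h"
    and xz: "\<And>k. k < length xs \<Longrightarrow> xs ! k \<odot>\<^bsub>obj P h\<^esub> z \<in> boundaries P h"
  shows "t \<le> s - h"
proof (rule ccontr)
  assume "\<not> t \<le> s - h"
  then have lt: "s - h < t" by simp
  let ?e = "int (length xs)" and ?E = "{..<length xs}"
  note C = projective_complexD(1)[OF P] and Pm = projective_complexD(4)[OF P]
  let ?M = "obj P h" and ?H = "boundaries P h"
  note M = Pm[of h] and H = boundaries_submodule[OF C, of h]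
  interpret M: module R ?M by (rule M)
  have HM: "?H \<subseteq> carrier ?M" by (rule module.submoduleE(1)[OF M H])
  have Hz: "\<zero>\<^bsub>?M\<^esub> \<in> ?H" using subgroup.one_closed[OF submodule.axioms(1)[OF H]] by simp
  interpret Hm: module R "?M\<lparr>carrier := ?H\<rparr>" by (rule module_restrict[OF M H])
  note KM = koszul_on_chain_complex[OF M xs K]
  \<comment> \<open>There are \<open>s - h\<close> steps from degree \<open>s\<close> down to
    \<open>h\<close>, and \<open>(e - t) + (s - h) \<le> e - 1\<close>, with \<open>e\<close> the
    length of \<open>xs\<close>, says exactly that \<open>s - h < t\<close>.\<close>
  have exH: "exact_at (koszul_on R xs (?M\<lparr>carrier := ?H\<rparr>)) (?e - 1)"
    using boundaries_koszul_exact[where h = h and s = s and c = "?e - t" and m = "nat (s - h)" and j = "?e - 1",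
        OF P exP zP exK] hs lt by simp
  have exM: "exact_at (koszul_on R xs ?M) ?e"
    by (rule koszul_on_exact_projective[OF projective_complexD(3)[OF P] exK]) (use hs lt in simp)
  \<comment> \<open>\<open>z\<close> placed on the top basis element. The coefficients of its
    boundary are zero or, up to sign, \<open>xs ! j\<close> times \<open>z\<close>, so they lie in
    \<open>?H\<close>.\<close>
  define f where "f S = (if S = ?E then z else \<zero>\<^bsub>?M\<^esub>)" for S
  have fc: "f \<in> carrier (obj (koszul_on R xs ?M) ?e)"
    using z(1) by (simp add: koszul_on_sel(1) f_def)
  have fM: "f S \<in> carrier ?M" for S using z(1) by (simp add: f_def)
  let ?q = "diff (koszul_on R xs ?M) ?e f"
  have qH: "?q T \<in> ?H" for T
  proof -
    have t: "(\<lambda>j. sgn_pow R (card {k \<in> T. k < j}) \<odot>\<^bsub>?M\<^esub> (xs ! j \<odot>\<^bsub>?M\<^esub> f (insert j T))) \<in> ?E - T \<rightarrow> carrier (?M\<lparr>carrier := ?H\<rparr>)"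
    proof (intro Pi_I)
      fix j assume j: "j \<in> ?E - T"
      have "xs ! j \<odot>\<^bsub>?M\<^esub> f (insert j T) \<in> ?H"
        using j xz[of j] elem_closed[of j] Hz by (simp add: f_def)
      then show "sgn_pow R (card {k \<in> T. k < j}) \<odot>\<^bsub>?M\<^esub> (xs ! j \<odot>\<^bsub>?M\<^esub> f (insert j T)) \<in> carrier (?M\<lparr>carrier := ?H\<rparr>)"
        using module.submoduleE(4)[OF M H sgn_pow_simps(1)[OF R]] by simp
    qed
    have "(\<lambda>x. x) \<in> mod_hom R (?M\<lparr>carrier := ?H\<rparr>) ?M" using HM by (intro mod_hom_restrict_dom mod_hom_id)
    from mod_hom_finsum[OF module_restrict[OF M H] M this _ t]
    have "?q T = finsum (?M\<lparr>carrier := ?H\<rparr>) (\<lambda>j. sgn_pow R (card {k \<in> T. k < j}) \<odot>\<^bsub>?M\<^esub> (xs ! j \<odot>\<^bsub>?M\<^esub> f (insert j T))) (?E - T)"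
      by (simp add: koszul_on_sel)
    then show ?thesis using Hm.M.finsum_closed[OF t] by simp
  qed
  have qc: "?q \<in> carrier (obj (koszul_on R xs ?M) (?e - 1))" by (rule diff_simps(1)[OF KM KM KM fc])
  have qcH: "?q \<in> carrier (obj (koszul_on R xs (?M\<lparr>carrier := ?H\<rparr>)) (?e - 1))"
    using qc qH by (simp add: koszul_on_sel(1))
  have fc': "f \<in> carrier (obj (koszul_on R xs ?M) (?e - 1 + 1))" using fc by simp
  have "diff (koszul_on R xs ?M) (?e - 1) ?q = \<zero>\<^bsub>obj (koszul_on R xs ?M) (?e - 1 - 1)\<^esub>"
    using chain_complexD(4)[OF KM fc'] by simp
  then have "diff (koszul_on R xs (?M\<lparr>carrier := ?H\<rparr>)) (?e - 1) ?q =
      \<zero>\<^bsub>obj (koszul_on R xs (?M\<lparr>carrier := ?H\<rparr>)) (?e - 1 - 1)\<^esub>"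
    unfolding koszul_on_restrict[OF M H qH] by (simp add: koszul_on_sel(1))
  then obtain b where b: "b \<in> carrier (obj (koszul_on R xs (?M\<lparr>carrier := ?H\<rparr>)) (?e - 1 + 1))"
    "diff (koszul_on R xs (?M\<lparr>carrier := ?H\<rparr>)) (?e - 1 + 1) b = ?q"
    by (rule exact_atD[OF exH qcH])
  have bH: "b S \<in> ?H" for S using b(1) by (simp add: koszul_on_sel(1))
  have bc: "b \<in> carrier (obj (koszul_on R xs ?M) ?e)" using b(1) HM by (auto simp: koszul_on_sel(1))
  have db: "diff (koszul_on R xs ?M) ?e b = ?q" using b(2) unfolding koszul_on_restrict[OF M H bH] by simp
  interpret Ke: module R "obj (koszul_on R xs ?M) ?e" by (rule koszul_on_module[OF M xs])
  interpret Kp: module R "obj (koszul_on R xs ?M) (?e - 1)" by (rule koszul_on_module[OF M xs])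
  let ?w = "f \<ominus>\<^bsub>obj (koszul_on R xs ?M) ?e\<^esub> b"
  have wc: "?w \<in> carrier (obj (koszul_on R xs ?M) ?e)" using fc bc by simp
  have "diff (koszul_on R xs ?M) ?e ?w = \<zero>\<^bsub>obj (koszul_on R xs ?M) (?e - 1)\<^esub>"
    using qc unfolding diff_simps(6)[OF KM KM KM fc bc] db by (simp add: Kp.M.minus_zero_iff)
  then obtain v where v: "v \<in> carrier (obj (koszul_on R xs ?M) (?e + 1))" "diff (koszul_on R xs ?M) (?e + 1) v = ?w"
    by (rule exact_atD[OF exM wc])
  \<comment> \<open>There is nothing above the top degree, so a boundary in that degree is zero and
    \<open>f\<close> equals \<open>b\<close>.\<close>
  have "S \<notin> koszul_basis xs (?e + 1)" for S
  proof
    assume S: "S \<in> koszul_basis xs (?e + 1)"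
    then have "card S \<le> card {..<length xs}" by (intro card_mono) auto
    with S show False by simp
  qed
  then have "v S = \<zero>\<^bsub>?M\<^esub>" for S using v(1) by (simp add: koszul_on_sel(1) del: mem_Collect_eq)
  then have "v = \<zero>\<^bsub>obj (koszul_on R xs ?M) (?e + 1)\<^esub>" by (intro ext) (simp add: koszul_on_sel(1))
  then have "?w = \<zero>\<^bsub>obj (koszul_on R xs ?M) ?e\<^esub>"
    using v(2) mod_hom_zero[OF koszul_on_module[OF M xs] koszul_on_module[OF M xs] koszul_on_diff_hom[OF M xs], of ?e] by simp
  then have "f = b" using fc bc by (simp add: Ke.M.minus_zero_iff)
  then have "f ?E \<in> ?H" using bH[of ?E] by (simp only:)
  then have "z \<in> ?H" by (simp add: f_def)
  with z(2) show False by contradiction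
qed

end

section \<open>Quasi-projective resolutions\<close>

lemma dsum_sel:
  "carrier (dsum_mod M n) = (\<Pi>\<^sub>E i\<in>{..<n}. carrier M)"
  "\<zero>\<^bsub>dsum_mod M n\<^esub> = (\<lambda>i\<in>{..<n}. \<zero>\<^bsub>M\<^esub>)"
  "f \<oplus>\<^bsub>dsum_mod M n\<^esub> g = (\<lambda>i\<in>{..<n}. f i \<oplus>\<^bsub>M\<^esub> g i)"
  "r \<odot>\<^bsub>dsum_mod M n\<^esub> f = (\<lambda>i\<in>{..<n}. r \<odot>\<^bsub>M\<^esub> f i)"
  by (simp_all add: dsum_mod_def)

lemma dsum_module:
  assumes M: "module R M" shows "module R (dsum_mod M n)"
proof -
  interpret M: module R M by (rule M)
  have c: "f i \<in> carrier M" if "f \<in> carrier (dsum_mod M n)" "i < n" for f i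
    using that by (auto simp: dsum_sel PiE_iff)
  have r: "(\<lambda>i\<in>{..<n}. f i) \<in> carrier (dsum_mod M n)" if "\<And>i. i < n \<Longrightarrow> f i \<in> carrier M" for f
    using that by (auto simp: dsum_sel)
  have ext: "f = g" if "f \<in> carrier (dsum_mod M n)" "g \<in> carrier (dsum_mod M n)" "\<And>i. i < n \<Longrightarrow> f i = g i" for f g
    using that by (intro PiE_ext[of f "{..<n}" "\<lambda>_. carrier M" g]) (auto simp: dsum_sel)
  have add: "f \<oplus>\<^bsub>dsum_mod M n\<^esub> g \<in> carrier (dsum_mod M n)"
    if "f \<in> carrier (dsum_mod M n)" "g \<in> carrier (dsum_mod M n)" for f g
    unfolding dsum_sel(3) by (rule r) (simp add: c[OF that(1)] c[OF that(2)])
  have sm: "a \<odot>\<^bsub>dsum_mod M n\<^esub> f \<in> carrier (dsum_mod M n)" if "a \<in> carrier R" "f \<in> carrier (dsum_mod M n)" for a f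
    unfolding dsum_sel(4) by (rule r) (simp add: that(1) c[OF that(2)])
  have z: "\<zero>\<^bsub>dsum_mod M n\<^esub> \<in> carrier (dsum_mod M n)" unfolding dsum_sel(2) by (rule r) simp
  show ?thesis
  proof (rule moduleI)
    show "cring R" by (rule M.R.is_cring)
    show "abelian_group (dsum_mod M n)"
    proof (rule abelian_groupI)
      fix f g h assume f: "f \<in> carrier (dsum_mod M n)"
      show "\<zero>\<^bsub>dsum_mod M n\<^esub> \<oplus>\<^bsub>dsum_mod M n\<^esub> f = f"
        by (rule ext[OF add[OF z f] f]) (simp add: dsum_sel(2,3) c[OF f])
      have i: "(\<lambda>i\<in>{..<n}. \<ominus>\<^bsub>M\<^esub> f i) \<in> carrier (dsum_mod M n)" by (rule r) (simp add: c[OF f])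
      show "\<exists>g\<in>carrier (dsum_mod M n). g \<oplus>\<^bsub>dsum_mod M n\<^esub> f = \<zero>\<^bsub>dsum_mod M n\<^esub>"
        by (rule bexI[OF _ i], rule ext[OF add[OF i f] z]) (simp add: dsum_sel(2,3) c[OF f] M.M.l_neg)
      assume g: "g \<in> carrier (dsum_mod M n)"
      show "f \<oplus>\<^bsub>dsum_mod M n\<^esub> g = g \<oplus>\<^bsub>dsum_mod M n\<^esub> f"
        by (rule ext[OF add[OF f g] add[OF g f]]) (simp add: dsum_sel(3) c[OF f] c[OF g] M.M.a_comm)
      assume h: "h \<in> carrier (dsum_mod M n)"
      show "f \<oplus>\<^bsub>dsum_mod M n\<^esub> g \<oplus>\<^bsub>dsum_mod M n\<^esub> h = f \<oplus>\<^bsub>dsum_mod M n\<^esub> (g \<oplus>\<^bsub>dsum_mod M n\<^esub> h)"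
        by (rule ext[OF add[OF add[OF f g] h] add[OF f add[OF g h]]])
          (simp add: dsum_sel(3) c[OF f] c[OF g] c[OF h] M.M.a_assoc)
    qed (use add z in auto)
    fix f assume f: "f \<in> carrier (dsum_mod M n)"
    show "\<one>\<^bsub>R\<^esub> \<odot>\<^bsub>dsum_mod M n\<^esub> f = f"
      by (rule ext[OF sm[OF M.R.one_closed f] f]) (simp add: dsum_sel(4) c[OF f])
    fix a assume a: "a \<in> carrier R"
    show "a \<odot>\<^bsub>dsum_mod M n\<^esub> f \<in> carrier (dsum_mod M n)" by (rule sm[OF a f])
    show "a \<odot>\<^bsub>dsum_mod M n\<^esub> (f \<oplus>\<^bsub>dsum_mod M n\<^esub> g) = a \<odot>\<^bsub>dsum_mod M n\<^esub> f \<oplus>\<^bsub>dsum_mod M n\<^esub> a \<odot>\<^bsub>dsum_mod M n\<^esub> g"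
      if g: "g \<in> carrier (dsum_mod M n)" for g
      by (rule ext[OF sm[OF a add[OF f g]] add[OF sm[OF a f] sm[OF a g]]])
        (simp add: dsum_sel(3,4) a c[OF f] c[OF g] M.smult_r_distr)
    fix b assume b: "b \<in> carrier R"
    show "(a \<oplus>\<^bsub>R\<^esub> b) \<odot>\<^bsub>dsum_mod M n\<^esub> f = a \<odot>\<^bsub>dsum_mod M n\<^esub> f \<oplus>\<^bsub>dsum_mod M n\<^esub> b \<odot>\<^bsub>dsum_mod M n\<^esub> f"
      by (rule ext[OF sm[OF M.R.a_closed[OF a b] f] add[OF sm[OF a f] sm[OF b f]]])
        (simp add: dsum_sel(3,4) a b c[OF f] M.smult_l_distr)
    show "(a \<otimes>\<^bsub>R\<^esub> b) \<odot>\<^bsub>dsum_mod M n\<^esub> f = a \<odot>\<^bsub>dsum_mod M n\<^esub> (b \<odot>\<^bsub>dsum_mod M n\<^esub> f)"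
      by (rule ext[OF sm[OF M.R.m_closed[OF a b] f] sm[OF a sm[OF b f]]])
        (simp add: dsum_sel(4) a b c[OF f] M.smult_assoc1)
  qed
qed

lemma homology_rank_iso:
  assumes P: "chain_complex R P" and N: "module R N" and iso: "mod_iso R (homology P i) (dsum_mod N a)"
  shows "homology_rank R N P i a"
proof -
  from iso obtain h where h: "h \<in> mod_hom R (cycle_mod P i) (dsum_mod N a)"
    and surj: "h ` cycles P i = carrier (dsum_mod N a)"
    and ker: "\<forall>x\<in>cycles P i. h x = \<zero>\<^bsub>dsum_mod N a\<^esub> \<longleftrightarrow> x \<in> boundaries P i"
    unfolding homology_iso_iff[OF P dsum_module[OF N]] by (elim bexE conjE)
  have cyc: "carrier (cycle_mod P i) = cycles P i" by (simp add: cycle_mod_def)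
  have hc: "h z \<in> carrier (dsum_mod N a)" if "z \<in> cycles P i" for z
    using mod_hom_closed[OF cycle_module[OF P] dsum_module[OF N] h, of z] that by (simp add: cyc)
  have ev: "(\<lambda>f. f l) \<in> mod_hom R (dsum_mod N a) N" if "l < a" for l
    using that by (auto simp: mod_hom_def dsum_sel)
  show ?thesis unfolding homology_rank_def
  proof (intro exI[of _ "\<lambda>l z. h z l"] conjI allI impI ballI)
    show "(\<lambda>z. h z l) \<in> mod_hom R (cycle_mod P i) N" if "l < a" for l
      by (rule mod_hom_comp[OF h ev[OF that]])
    fix \<nu> assume \<nu>: "\<forall>l<a. \<nu> l \<in> carrier N"
    then have "(\<lambda>l\<in>{..<a}. \<nu> l) \<in> h ` cycles P i" unfolding surj dsum_sel by auto
    then obtain z where z: "z \<in> cycles P i" "(\<lambda>l\<in>{..<a}. \<nu> l) = h z" by blast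
    have "h z l = \<nu> l" if "l < a" for l using fun_cong[OF z(2), of l] that by simp
    with z(1) show "\<exists>z\<in>cycles P i. \<forall>l<a. h z l = \<nu> l" by blast
  next
    fix z assume z: "z \<in> cycles P i"
    have "(\<forall>l<a. h z l = \<zero>\<^bsub>N\<^esub>) \<longleftrightarrow> h z = \<zero>\<^bsub>dsum_mod N a\<^esub>"
    proof
      assume "\<forall>l<a. h z l = \<zero>\<^bsub>N\<^esub>"
      then show "h z = \<zero>\<^bsub>dsum_mod N a\<^esub>"
        using hc[OF z] abelian_groupE(2)[OF module.axioms(2)[OF N]]
        by (intro PiE_ext[of "h z" "{..<a}" "\<lambda>_. carrier N"]) (auto simp: dsum_sel)
    next
      assume "h z = \<zero>\<^bsub>dsum_mod N a\<^esub>"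
      then show "\<forall>l<a. h z l = \<zero>\<^bsub>N\<^esub>" by (simp add: dsum_sel)
    qed
    then show "(\<forall>l<a. h z l = \<zero>\<^bsub>N\<^esub>) \<longleftrightarrow> z \<in> boundaries P i" using ker z by blast
  qed
qed

lemma zero_obj_exact:
  assumes "chain_complex R P" "zero_mod (obj P i)" shows "exact_at P i"
  using assms(2) submodule.axioms(1)[OF boundaries_submodule[OF assms(1), of i]] subgroup.one_closed
  by (fastforce simp: exact_at_def cycles_def zero_mod_def)

text \<open>If there were a component, a cycle with constant nonzero value \<open>n\<close> would be
  a boundary, and boundaries have zero components.\<close>

lemma homology_rank_exact:
  assumes r: "homology_rank R N P i a" and N: "module R N" "\<not> zero_mod N" and ex: "exact_at P i"
  shows "a = 0"
proof (rule ccontr)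
  assume "a \<noteq> 0"
  have "\<zero>\<^bsub>N\<^esub> \<in> carrier N" by (rule abelian_groupE(2)[OF module.axioms(2)[OF N(1)]])
  then obtain n where n: "n \<in> carrier N" "n \<noteq> \<zero>\<^bsub>N\<^esub>" using N(2) by (auto simp: zero_mod_def)
  obtain \<theta> where \<theta>: "\<And>\<nu>. (\<And>l. l < a \<Longrightarrow> \<nu> l \<in> carrier N) \<Longrightarrow> \<exists>z\<in>cycles P i. \<forall>l<a. \<theta> l z = \<nu> l"
    "\<And>z. z \<in> cycles P i \<Longrightarrow> (\<forall>l<a. \<theta> l z = \<zero>\<^bsub>N\<^esub>) \<longleftrightarrow> z \<in> boundaries P i"
    by (rule homology_rankE[OF r]) blast
  have "\<exists>z\<in>cycles P i. \<forall>l<a. \<theta> l z = n" by (rule \<theta>(1)) (rule n(1))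
  then obtain z where z: "z \<in> cycles P i" "\<forall>l<a. \<theta> l z = n" ..
  have "z \<in> boundaries P i" using z(1) ex by (auto simp: exact_at_def)
  then have "\<forall>l<a. \<theta> l z = \<zero>\<^bsub>N\<^esub>" using \<theta>(2)[OF z(1)] by blast
  with z(2) n(2) \<open>a \<noteq> 0\<close> show False by auto
qed

lemma quasi_projective_resolutionE:
  assumes P: "quasi_projective_resolution R N P" and N: "module R N"
  obtains a where "projective_complex R P" "\<And>i. homology_rank R N P i (a i)" "\<exists>i. a i \<noteq> 0"
proof -
  have C: "chain_complex R P" and bb: "bounded_below P" and pr: "\<And>i. projective_mod R (obj P i)"
    using P by (auto simp: quasi_projective_resolution_def)
  have PC: "projective_complex R P" using C bb pr by (simp add: projective_complex_def)
  obtain a where a: "\<And>i. cinf P \<le> ereal (of_int i) \<Longrightarrow> mod_iso R (homology P i) (dsum_mod N (a i))"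
    "\<exists>i. cinf P \<le> ereal (of_int i) \<and> a i \<noteq> 0"
    using P unfolding quasi_projective_resolution_def by blast
  \<comment> \<open>The definition constrains only the degrees from \<open>cinf P\<close> on. Below
    it the modules are zero, and the rank is taken to be 0.\<close>
  define b where "b i = (if cinf P \<le> ereal (of_int i) then a i else 0)" for i
  have "homology_rank R N P i (b i)" for i
  proof (cases "cinf P \<le> ereal (of_int i)")
    case True
    then show ?thesis using homology_rank_iso[OF C N a(1)[OF True]] by (simp add: b_def)
  next
    case False
    have "zero_mod (obj P i)"
    proof (rule ccontr)
      assume "\<not> zero_mod (obj P i)"
      then have "cinf P \<le> ereal (of_int i)" unfolding cinf_def by (intro Inf_lower imageI) simp
      with False show False by contradiction
    qed
    then show ?thesis using homology_rank_0I[OF C zero_obj_exact[OF C]] False by (simp add: b_def)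
  qed
  moreover have "\<exists>i. b i \<noteq> 0" using a(2) by (auto simp: b_def)
  ultimately show thesis by (rule that[OF PC])
qed

lemma csup_eqI:
  assumes "\<not> zero_mod (obj K s)" "\<And>i. s < i \<Longrightarrow> zero_mod (obj K i)"
  shows "csup K = ereal (of_int s)"
  unfolding csup_def using assms by (intro cSup_eq_maximum) (auto simp: not_less[symmetric])

lemma hsup_eqI:
  assumes "chain_complex R K" "\<not> exact_at K s" "\<And>i. s < i \<Longrightarrow> exact_at K i"
  shows "hsup K = ereal (of_int s)"
  unfolding hsup_def zero_homology_iff[OF assms(1)] using assms(2,3)
  by (intro cSup_eq_maximum) (auto simp: not_less[symmetric])

lemma transport_exact:
  assumes K: "chain_complex R K" and inj: "\<And>i. inj_on enc (carrier (obj K i))"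
  shows "exact_at (transport_complex enc K) i \<longleftrightarrow> exact_at K i"
proof -
  have "cycles K i \<subseteq> carrier (obj K i)" "boundaries K i \<subseteq> carrier (obj K i)"
    using boundaries_subset_cycles[OF K, of i] by (auto simp: cycles_def)
  then have "enc x \<in> enc ` boundaries K i \<longleftrightarrow> x \<in> boundaries K i" if "x \<in> cycles K i" for x
    using that by (intro inj_on_image_mem_iff[OF inj[of i]]) auto
  then show ?thesis
    unfolding exact_at_def transport_cycles[OF K inj] transport_boundaries[OF K inj] image_subset_iff
    by (simp add: subset_eq)
qed

lemma transport_quasi_projective_resolution:
  assumes P: "quasi_projective_resolution R N P" and N: "module R N"
    and inj: "\<And>i. inj_on enc (carrier (obj P i))"
  shows "quasi_projective_resolution R N (transport_complex enc P)"
proof -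
  let ?T = "transport_complex enc P"
  have C: "chain_complex R P" using P by (simp add: quasi_projective_resolution_def)
  have PC: "projective_complex R P" by (rule quasi_projective_resolutionE[OF P N])
  note T = transport_projective_complex[OF PC inj]
  have z: "zero_mod (obj ?T i) \<longleftrightarrow> zero_mod (obj P i)" for i
    unfolding transport_obj[OF C inj] by (rule transport_zero_mod[OF projective_complexD(4)[OF PC] inj])
  have cinf: "cinf ?T = cinf P" by (simp add: cinf_def z)
  have iso: "mod_iso R (homology ?T i) (dsum_mod N a)" if iso: "mod_iso R (homology P i) (dsum_mod N a)" for i a
  proof -
    let ?dec = "inv_into (carrier (obj P i)) enc"
    from iso obtain h where h: "h \<in> mod_hom R (cycle_mod P i) (dsum_mod N a)"
      and surj: "h ` cycles P i = carrier (dsum_mod N a)"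
      and ker: "\<forall>x\<in>cycles P i. h x = \<zero>\<^bsub>dsum_mod N a\<^esub> \<longleftrightarrow> x \<in> boundaries P i"
      unfolding homology_iso_iff[OF C dsum_module[OF N]] by (elim bexE conjE)
    have cyc: "cycles P i \<subseteq> carrier (obj P i)" and bd: "boundaries P i \<subseteq> carrier (obj P i)"
      using boundaries_subset_cycles[OF C, of i] by (auto simp: cycles_def)
    have dc: "?dec (enc z) = z" if "z \<in> cycles P i" for z using that cyc inj by auto
    have bi: "enc z \<in> enc ` boundaries P i \<longleftrightarrow> z \<in> boundaries P i" if "z \<in> cycles P i" for z
      using that cyc bd by (intro inj_on_image_mem_iff[OF inj[of i]]) auto
    have "(\<lambda>u. h (?dec u)) \<in> mod_hom R (cycle_mod ?T i) (dsum_mod N a)"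
      by (rule mod_hom_comp[OF transport_cycle_hom[OF C inj] h])
    moreover have "(\<lambda>u. h (?dec u)) ` cycles ?T i = carrier (dsum_mod N a)"
      unfolding transport_cycles[OF C inj] surj[symmetric] image_image by (rule image_cong) (simp_all add: dc)
    moreover have "\<forall>u\<in>cycles ?T i. h (?dec u) = \<zero>\<^bsub>dsum_mod N a\<^esub> \<longleftrightarrow> u \<in> boundaries ?T i"
      unfolding transport_cycles[OF C inj] transport_boundaries[OF C inj] using ker by (auto simp: dc bi)
    ultimately show ?thesis
      unfolding homology_iso_iff[OF projective_complexD(1)[OF T] dsum_module[OF N]] by blast
  qed
  show ?thesis
    unfolding quasi_projective_resolution_def cinf
  proof (intro conjI allI)
    show "chain_complex R ?T" "bounded_below ?T" by (rule projective_complexD[OF T])+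
    show "projective_mod R (obj ?T i)" for i by (rule projective_complexD[OF T])
    show "\<exists>a. (\<forall>i. cinf P \<le> ereal (of_int i) \<longrightarrow> mod_iso R (homology ?T i) (dsum_mod N (a i))) \<and>
        (\<exists>i. cinf P \<le> ereal (of_int i) \<and> a i \<noteq> 0)"
      using P iso unfolding quasi_projective_resolution_def by blast
  qed
qed

section \<open>Ideals with free Koszul homology\<close>

lemma regular_minus:
  assumes "cring R" "x \<in> carrier R" shows "\<ominus>\<^bsub>regular_mod R\<^esub> x = \<ominus>\<^bsub>R\<^esub> x"
proof -
  interpret cring R by fact
  interpret M: module R "regular_mod R" by (rule regular_module[OF assms(1)])
  show ?thesis using assms(2) by (intro M.M.minus_equality) (auto simp: regular_sel l_neg)
qed

lemma ideal_submodule: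
  assumes R: "cring R" and I: "ideal I R" shows "submodule I R (regular_mod R)"
proof -
  interpret ideal I R by fact
  show ?thesis
    by (rule module.submoduleI[OF regular_module[OF R]])
      (auto simp: regular_sel regular_minus[OF R a_Hcarr] I_l_closed)
qed

lemma ideal_finsum_closed:
  assumes I: "ideal I R" and A: "finite A" and f: "\<And>j. j \<in> A \<Longrightarrow> f j \<in> I"
  shows "finsum R f A \<in> I"
proof -
  interpret ideal I R by fact
  show ?thesis using A f
  proof (induction A rule: finite_induct)
    case (insert j A)
    then have "f \<in> A \<rightarrow> carrier R" "f j \<in> carrier R" by (auto intro: a_Hcarr)
    with insert show ?case by (subst finsum_insert) auto
  qed simp
qed

lemma cyclic_annihilated:
  assumes R: "cring R" and I: "ideal I R" and r: "r \<in> I" and n: "n \<in> carrier (cyclic_mod R I)"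
  shows "r \<odot>\<^bsub>cyclic_mod R I\<^esub> n = \<zero>\<^bsub>cyclic_mod R I\<^esub>"
proof -
  interpret ideal I R by fact
  note RM = regular_module[OF R] and H = ideal_submodule[OF R I]
  obtain y where y: "y \<in> carrier R" "n = I +>\<^bsub>regular_mod R\<^esub> y"
    using n unfolding cyclic_mod_def quot_carrier[OF RM H] by (auto simp: regular_sel)
  have ry: "r \<otimes>\<^bsub>R\<^esub> y \<in> I" by (rule I_r_closed[OF r y(1)])
  have c: "r \<in> carrier R" "y \<in> carrier (regular_mod R)" "r \<odot>\<^bsub>regular_mod R\<^esub> y \<in> carrier (regular_mod R)"
    using a_Hcarr[OF r] a_Hcarr[OF ry] y(1) by (simp_all only: regular_sel)
  have "I +>\<^bsub>regular_mod R\<^esub> (r \<odot>\<^bsub>regular_mod R\<^esub> y) = I"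
    using coset_zero_iff[OF RM H c(3)] ry by (simp only: regular_sel)
  then show ?thesis
    using quot_smult[OF RM H c(1,2)] by (simp only: y(2) cyclic_mod_def quot_mod_def ring.simps)
qed

lemma koszul_zero_obj:
  assumes R: "cring R" and "i < 0 \<or> int (length xs) < i" shows "zero_mod (obj (koszul R xs) i)"
proof -
  have "card S \<le> length xs" if "S \<subseteq> {..<length xs}" for S
    using card_mono[OF finite_lessThan that] by simp
  then have no: "S \<notin> koszul_basis xs i" for S
    using assms(2) by (metis (mono_tags, lifting) mem_Collect_eq not_less of_nat_0_le_iff of_nat_le_iff)
  show ?thesis
    unfolding koszul_obj zero_mod_def free_mod_def partial_object.simps ring.simps
    using no by (auto simp: cring.cring_simprules[OF R] simp del: mem_Collect_eq)
qed

text \<open>A boundary in degree 0 is a combination of \<open>xs\<close>. If the basis element were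
  one, \<open>1\<close> would belong to the proper ideal \<open>I\<close>.\<close>

lemma koszul_not_exact_0:
  assumes R: "cring R" and I: "ideal I R" "I \<noteq> carrier R" and xs: "set xs \<subseteq> I"
    and K: "chain_complex R (koszul R xs)"
  shows "\<not> exact_at (koszul R xs) 0"
proof
  assume ex: "exact_at (koszul R xs) 0"
  interpret ideal I R by fact
  have c: "free_gen R {} \<in> carrier (obj (koszul R xs) 0)"
    unfolding koszul_obj by (rule free_gen_closed[OF R]) simp
  have "diff (koszul R xs) 0 (free_gen R {}) = \<zero>\<^bsub>obj (koszul R xs) (0 - 1)\<^esub>"
    by (rule zero_modD[OF koszul_zero_obj[OF R] mod_hom_closed[OF chain_complexD(1)[OF K] chain_complexD(1)[OF K]
          chain_complexD(2)[OF K] c]]) simp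
  then obtain y where y: "y \<in> carrier (obj (koszul R xs) 1)" "diff (koszul R xs) 1 y = free_gen R {}"
    using exact_atD[OF ex c] by auto
  have yc: "y S \<in> carrier R" for S using y(1) by (simp add: koszul_obj free_mod_def)
  have "diff (koszul R xs) 1 y {} \<in> I"
    unfolding koszul_def mod_complex.simps
  proof (rule ideal_finsum_closed[OF I(1)])
    fix j assume "j \<in> {..<length xs} - {}"
    then have "xs ! j \<in> I" using xs by auto
    then show "(\<ominus>\<^bsub>R\<^esub> \<one>\<^bsub>R\<^esub>) [^]\<^bsub>R\<^esub> card {k \<in> {}. k < j} \<otimes>\<^bsub>R\<^esub> (xs ! j \<otimes>\<^bsub>R\<^esub> y (insert j {})) \<in> I"
      by (intro I_l_closed I_r_closed yc) auto
  qed simp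
  then have "\<one>\<^bsub>R\<^esub> \<in> I" using y(2) by (simp add: free_gen_def)
  with one_imp_carrier I(2) show False by simp
qed

text \<open>An element of the Koszul complex is determined by its values on the finitely many
  subsets of \<open>{..<length xs}\<close>, listed in a fixed order. This brings the complex into
  the type of the chosen resolutions.\<close>

lemma koszul_encoding:
  obtains enc :: "(nat set \<Rightarrow> 'a) \<Rightarrow> ('a + 'y) list"
  where "\<And>i. inj_on enc (carrier (obj (koszul (R :: ('a, 'r) ring_scheme) xs) i))"
proof -
  obtain l where l: "set l = Pow {..<length xs}" using finite_list[of "Pow {..<length xs}"] by auto
  show thesis
  proof (rule that[of "\<lambda>f. map (\<lambda>S. Inl (f S)) l"], rule inj_onI)
    fix i and f g :: "nat set \<Rightarrow> 'a"
    assume c: "f \<in> carrier (obj (koszul R xs) i)" "g \<in> carrier (obj (koszul R xs) i)"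
      and eq: "map (\<lambda>S. Inl (f S) :: 'a + 'y) l = map (\<lambda>S. Inl (g S)) l"
    show "f = g"
    proof
      fix S show "f S = g S"
      proof (cases "S \<in> set l")
        case True with eq show ?thesis by simp
      next
        case False with c show ?thesis by (auto simp: l koszul_obj free_mod_def)
      qed
    qed
  qed
qed

lemma ext_vanishes_zero_obj:
  assumes V: "chain_complex R V" and M: "module R M" and z: "zero_mod (obj V j)"
  shows "ext_vanishes R M j V"
  unfolding ext_vanishes_def
proof (intro ballI impI)
  fix \<alpha> assume \<alpha>: "\<alpha> \<in> mod_hom R (obj V j) M"
  have "\<alpha> x = \<zero>\<^bsub>M\<^esub>" if "x \<in> carrier (obj V j)" for x
    using zero_modD[OF z that] mod_hom_zero[OF chain_complexD(1)[OF V] M \<alpha>] by simp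
  then show "\<exists>\<beta>\<in>mod_hom R (obj V (j - 1)) M. \<forall>x\<in>carrier (obj V j). \<alpha> x = \<beta> (diff V j x)"
    by (intro bexI[of _ "\<lambda>_. \<zero>\<^bsub>M\<^esub>"] mod_hom_zero_map[OF M]) simp
qed

lemma ext_below_grade: "enat j < grade R I M \<Longrightarrow> zero_mod (Ext R j (cyclic_mod R I) M)"
proof (rule ccontr)
  assume "enat j < grade R I M" "\<not> zero_mod (Ext R j (cyclic_mod R I) M)"
  then have "grade R I M \<le> enat j" unfolding grade_def by (intro Inf_lower) simp
  with \<open>enat j < grade R I M\<close> show False by simp
qed

section \<open>A fixed ideal with free Koszul homology\<close>

context
  fixes R :: "('a, 'r) ring_scheme" and I :: "'a set" and xs :: "'a list"
  assumes R: "cring R" and I: "ideal I R" and proper: "I \<noteq> carrier R"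
    and gen: "generates_ideal R xs I"
    and qpr: "quasi_projective_resolution R (cyclic_mod R I) (koszul R xs)"
begin

private abbreviation "N \<equiv> cyclic_mod R I"
private abbreviation "Q \<equiv> chosen_resolution R N"

private lemma xsR: "set xs \<subseteq> carrier R" using gen by (simp add: generates_ideal_def)

private lemma xsI: "set xs \<subseteq> I"
  using gen ring.genideal_self[OF cring.axioms(1)[OF R] xsR] by (simp add: generates_ideal_def)

private lemma N: "module R N"
  unfolding cyclic_mod_def by (rule quot_module[OF regular_module[OF R] ideal_submodule[OF R I]])

private lemma N_nonzero: "\<not> zero_mod N"
  unfolding cyclic_mod_def zero_quot_iff[OF regular_module[OF R] ideal_submodule[OF R I]]
  using proper additive_subgroup.a_subset[OF ideal.axioms(1)[OF I]] by (auto simp: regular_sel)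

private lemma PK: "projective_complex R (koszul R xs)" by (rule quasi_projective_resolutionE[OF qpr N])
private lemmas CK = projective_complexD(1)[OF PK]
private lemmas resQ = chosen_resolution[OF N]
private lemmas complexQ = projective_complexD(1)[OF projective_resolutionD(1)[OF resQ N]]

text \<open>The lowest nonzero rank is in degree 0, so \<open>vanishing_of_resolution\<close>
  applies with \<open>q = 0\<close> and speaks about the resolution without a shift.\<close>

private lemma koszul_rank:
  obtains a where "\<And>i. homology_rank R N (koszul R xs) i (a i)" "\<And>i. a i \<noteq> 0 \<Longrightarrow> \<not> exact_at (koszul R xs) i"
    "\<And>i. a i \<noteq> 0 \<Longrightarrow> 0 \<le> i" "finite {i. a i \<noteq> 0}" "a 0 > 0"
proof -
  obtain a where "projective_complex R (koszul R xs)" and a: "\<And>i. homology_rank R N (koszul R xs) i (a i)"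
    and "\<exists>i. a i \<noteq> 0"
    by (rule quasi_projective_resolutionE[OF qpr N]) blast
  have ex: "\<not> exact_at (koszul R xs) i" if "a i \<noteq> 0" for i
  proof
    assume "exact_at (koszul R xs) i"
    from homology_rank_exact[OF a N N_nonzero this] that show False by simp
  qed
  have z: "0 \<le> i \<and> i \<le> int (length xs)" if "a i \<noteq> 0" for i
  proof (rule ccontr)
    assume "\<not> (0 \<le> i \<and> i \<le> int (length xs))"
    then have "exact_at (koszul R xs) i" by (intro zero_obj_exact[OF CK] koszul_zero_obj[OF R]) auto
    with ex[OF that] show False by contradiction
  qed
  have "finite {i. a i \<noteq> 0}"
    by (rule finite_subset[of _ "{0..int (length xs)}"]) (use z in auto)
  moreover have "a 0 > 0"
    using homology_rank_0[of R N "koszul R xs" 0] a[of 0] koszul_not_exact_0[OF R I proper xsI CK] by (cases "a 0") auto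
  moreover have "0 \<le> i" if "a i \<noteq> 0" for i using z[OF that] by simp
  ultimately show thesis by (intro that[where a = a] a ex)
qed

text \<open>Both directions of depth sensitivity. The homology of the Koszul complex consists of
  copies of \<open>N\<close> in degrees from 0 on, so vanishing of Ext below \<open>t\<close> passes
  to the Koszul cohomology, and by duality to homology above degree \<open>length xs - t\<close>. As
  degree 0 does contain a copy of \<open>N\<close>, exactness in degree \<open>length xs - t\<close>
  conversely forces Ext in degree \<open>t\<close> to vanish.\<close>

private lemma exact_of_ext:
  fixes M :: "('a, 'm) module"
  assumes M: "module R M" and ext: "\<And>j. j < t \<Longrightarrow> zero_mod (Ext R j N M)"
  shows "int (length xs) - int t < i \<Longrightarrow> exact_at (koszul_on R xs M) i"
    and "exact_at (koszul_on R xs M) (int (length xs) - int t) \<Longrightarrow> zero_mod (Ext R t N M)"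
proof -
  obtain a where a: "\<And>i. homology_rank R N (koszul R xs) i (a i)"
    "\<And>i. a i \<noteq> 0 \<Longrightarrow> 0 \<le> i" "finite {i. a i \<noteq> 0}" "a 0 > 0"
    by (rule koszul_rank) blast
  obtain enc :: "(nat set \<Rightarrow> 'a) \<Rightarrow> ('a + 'a set) list" where
    inj: "\<And>i. inj_on enc (carrier (obj (koszul R xs) i))"
    by (rule koszul_encoding) blast
  let ?V = "transport_complex enc (koszul R xs)"
  note V = transport_projective_complex[OF PK inj] and rV = homology_rank_transport[OF CK inj a(1)]
  note vt = ext_vanishing_theory[OF M]
  have EV: "ext_vanishes R M j ?V \<longleftrightarrow> exact_at (koszul_on R xs M) (int (length xs) - j)" for j
    unfolding ext_vanishes_transport[OF CK inj M] by (rule ext_vanishes_koszul[OF M xsR CK])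
  have EF: "ext_vanishes R M j Q" if "j < int t" for j
  proof (cases "j < 0")
    case True
    show ?thesis by (rule ext_vanishes_zero_obj[OF complexQ M projective_resolutionD(2)[OF resQ N True]])
  next
    case False
    then show ?thesis
      using ext[of "nat j"] that by (simp add: Ext_def hom_complex_exact_iff[OF complexQ M, symmetric])
  qed
  show "exact_at (koszul_on R xs M) i" if i: "int (length xs) - int t < i"
  proof -
    have "ext_vanishes R M (int (length xs) - i) ?V"
    proof (rule vanishing_theory.vanishing_of_homology[OF vt resQ N V rV a(3)])
      show "ext_vanishes R M (int (length xs) - i - k) Q" if "a k \<noteq> 0" for k
        by (rule EF) (use a(2)[OF that] i in linarith)
    qed
    then show ?thesis by (simp add: EV)
  qed
  show "zero_mod (Ext R t N M)" if ex: "exact_at (koszul_on R xs M) (int (length xs) - int t)"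
  proof -
    have "ext_vanishes R M (int t - 0) Q"
    proof (rule vanishing_theory.vanishing_of_resolution[OF vt resQ N V rV a(3) a(4)])
      show "ext_vanishes R M (int t) ?V" using ex by (simp add: EV)
      show "ext_vanishes R M (int t - 1 - i) Q" if "a i \<noteq> 0" for i
        using a(2)[OF that] by (intro EF) simp
      show "a i = 0" if "i < 0" for i using a(2)[of i] that by (cases "a i = 0") auto
    qed
    then show ?thesis by (simp add: Ext_def hom_complex_exact_iff[OF complexQ M])
  qed
qed

text \<open>If Ext vanished up to degree \<open>length xs\<close>, the Koszul complex would be exact
  in degree 0, which it is not. Hence the grade is finite and is the least degree \<open>t\<close>
  of nonvanishing Ext.\<close>

lemma grade_koszul:
  obtains t where "grade R I (regular_mod R) = enat t" "t \<le> length xs"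
    "\<And>i. int (length xs) - int t < i \<Longrightarrow> exact_at (koszul R xs) i"
    "\<not> exact_at (koszul R xs) (int (length xs) - int t)"
proof -
  let ?E = "\<lambda>j. \<not> zero_mod (Ext R j N (regular_mod R))"
  note RM = regular_module[OF R] and iff = koszul_exact_regular[OF R xsR CK]
  have "\<exists>j\<le>length xs. ?E j"
  proof (rule ccontr)
    assume "\<not> (\<exists>j\<le>length xs. ?E j)"
    then have "exact_at (koszul_on R xs (regular_mod R)) 0"
      by (intro exact_of_ext(1)[OF RM, where t = "Suc (length xs)"]) auto
    with koszul_not_exact_0[OF R I proper xsI CK] show False by (simp add: iff)
  qed
  then obtain j where j: "j \<le> length xs" "?E j" by blast
  define t where "t = (LEAST j. ?E j)"
  have t: "?E t" unfolding t_def by (rule LeastI[of ?E, OF j(2)])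
  have least: "t \<le> i" if "?E i" for i unfolding t_def by (rule Least_le[of ?E, OF that])
  have ext: "zero_mod (Ext R i N (regular_mod R))" if "i < t" for i using least[of i] that by (cases "?E i") auto
  show thesis
  proof (rule that[of t])
    show "grade R I (regular_mod R) = enat t"
      unfolding grade_def using t least by (intro antisym Inf_lower Inf_greatest) auto
    show "t \<le> length xs" using least[OF j(2)] j(1) by simp
    show "exact_at (koszul R xs) i" if "int (length xs) - int t < i" for i
      unfolding iff by (rule exact_of_ext(1)[OF RM ext that])
    show "\<not> exact_at (koszul R xs) (int (length xs) - int t)"
      unfolding iff using exact_of_ext(2)[OF RM ext] t by blast
  qed
qed

text \<open>In the highest degree with homology, a class with nonzero components is killed by
  \<open>I\<close> because \<open>N\<close> is. This is the element that
  \<open>projective_length_bound\<close> asks for.\<close>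

lemma qpd_lower_bound:
  fixes P :: "('a, 'u) mod_complex"
  assumes P: "finite_quasi_projective_resolution R N P"
    and exK: "\<And>i. int (length xs) - int t < i \<Longrightarrow> exact_at (koszul R xs) i"
  shows "ereal (real t) \<le> csup P - hsup P"
proof -
  have qP: "quasi_projective_resolution R N P" and "bounded_above P" "bounded_below P"
    using P by (auto simp: finite_quasi_projective_resolution_def quasi_projective_resolution_def)
  then obtain b c where bc: "\<And>i. i < b \<or> c < i \<Longrightarrow> zero_mod (obj P i)"
    unfolding bounded_above_def bounded_below_def by blast
  obtain a where PP: "projective_complex R P" and a: "\<And>i. homology_rank R N P i (a i)" "\<exists>i. a i \<noteq> 0"
    by (rule quasi_projective_resolutionE[OF qP N]) blast
  note CP = projective_complexD(1)[OF PP] and Pm = projective_complexD(4)[OF PP]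
  \<comment> \<open>\<open>P\<close> is bounded on both sides, so both suprema are maxima of finite
    sets. As \<open>N\<close> is nonzero, homology is nonzero precisely where the rank is.\<close>
  define s where "s = Max {i. \<not> zero_mod (obj P i)}"
  define h where "h = Max {i. a i \<noteq> 0}"
  have nz: "\<not> exact_at P i" if "a i \<noteq> 0" for i
  proof
    assume "exact_at P i"
    from homology_rank_exact[OF a(1) N N_nonzero this] that show False by simp
  qed
  have nz': "\<not> zero_mod (obj P i)" if "a i \<noteq> 0" for i using nz[OF that] zero_obj_exact[OF CP, of i] by auto
  then have sub: "{i. a i \<noteq> 0} \<subseteq> {i. \<not> zero_mod (obj P i)}" by auto
  have fin: "finite {i. \<not> zero_mod (obj P i)}"
    by (rule finite_subset[of _ "{b..c}"]) (use bc in \<open>auto simp: not_less[symmetric]\<close>)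
  note fina = finite_subset[OF sub fin]
  have h: "a h \<noteq> 0" using Max_in[OF fina] a(2) unfolding h_def by auto
  have h': "a i = 0" if "h < i" for i
    using Max_ge[OF fina, of i] that unfolding h_def by (cases "a i = 0") auto
  have s: "\<not> zero_mod (obj P s)" using Max_in[OF fin] nz'[OF h] unfolding s_def by auto
  have s': "zero_mod (obj P i)" if "s < i" for i
    using Max_ge[OF fin, of i] that unfolding s_def by (cases "zero_mod (obj P i)") auto
  have exP: "exact_at P i" if "h < i" for i
    by (rule homology_rank_0[of R N]) (use a(1)[of i] h'[OF that] in simp)
  have hs: "h \<le> s" using Max_ge[OF fin, of h] nz'[OF h] unfolding s_def by simp
  have "\<zero>\<^bsub>N\<^esub> \<in> carrier N" by (rule abelian_groupE(2)[OF module.axioms(2)[OF N]])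
  then obtain n where n: "n \<in> carrier N" "n \<noteq> \<zero>\<^bsub>N\<^esub>" using N_nonzero by (auto simp: zero_mod_def)
  obtain \<theta> where \<theta>: "\<And>l. l < a h \<Longrightarrow> \<theta> l \<in> mod_hom R (cycle_mod P h) N"
    "\<And>\<nu>. (\<And>l. l < a h \<Longrightarrow> \<nu> l \<in> carrier N) \<Longrightarrow> \<exists>z\<in>cycles P h. \<forall>l<a h. \<theta> l z = \<nu> l"
    "\<And>z. z \<in> cycles P h \<Longrightarrow> (\<forall>l<a h. \<theta> l z = \<zero>\<^bsub>N\<^esub>) \<longleftrightarrow> z \<in> boundaries P h"
    by (rule homology_rankE[OF a(1)[of h]]) blast
  have "\<exists>z\<in>cycles P h. \<forall>l<a h. \<theta> l z = n" by (rule \<theta>(2)) (rule n(1))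
  then obtain z where z: "z \<in> cycles P h" "\<forall>l<a h. \<theta> l z = n" ..
  have "int t \<le> s - h"
  proof (rule projective_length_bound[OF R xsR CK PP exP s' hs exK])
    show "z \<in> carrier (obj P h)" using z(1) by (simp add: cycles_def)
    show "z \<notin> boundaries P h" using \<theta>(3)[OF z(1)] z(2) n(2) h by auto
    fix k assume k: "k < length xs"
    then have x: "xs ! k \<in> I" "xs ! k \<in> carrier R" using xsI xsR by auto
    have xz: "xs ! k \<odot>\<^bsub>obj P h\<^esub> z \<in> cycles P h"
      by (rule module.submoduleE(4)[OF Pm cycles_submodule[OF CP] x(2) z(1)])
    have "\<theta> l (xs ! k \<odot>\<^bsub>obj P h\<^esub> z) = \<zero>\<^bsub>N\<^esub>" if l: "l < a h" for l
    proof -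
      have "\<theta> l (xs ! k \<odot>\<^bsub>cycle_mod P h\<^esub> z) = xs ! k \<odot>\<^bsub>N\<^esub> \<theta> l z"
        by (rule mod_hom_smult[OF cycle_module[OF CP] N \<theta>(1)[OF l] x(2)]) (simp add: cycle_mod_def z(1))
      also have "\<dots> = \<zero>\<^bsub>N\<^esub>" using z(2) l cyclic_annihilated[OF R I x(1) n(1)] by simp
      finally show ?thesis by (simp add: cycle_mod_def)
    qed
    then show "xs ! k \<odot>\<^bsub>obj P h\<^esub> z \<in> boundaries P h" using \<theta>(3)[OF xz] by blast
  qed
  moreover have "csup P = ereal (of_int s)" by (rule csup_eqI[OF s s'])
  moreover have "hsup P = ereal (of_int h)" by (rule hsup_eqI[OF CP nz[OF h] exP])
  ultimately show ?thesis by simp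
qed

text \<open>The Koszul complex itself, encoded into the summand \<open>('a + 'a set) list\<close>
  that is present for every \<open>'u\<close>. Since \<open>1 \<noteq> 0\<close>, its top degree
  \<open>length xs\<close> is occupied.\<close>

lemma qpd_attained:
  assumes exK: "\<And>i. int (length xs) - int t < i \<Longrightarrow> exact_at (koszul R xs) i"
    and nexK: "\<not> exact_at (koszul R xs) (int (length xs) - int t)"
  obtains P :: "('a, 'u + ('a + 'a set) list) mod_complex"
  where "finite_quasi_projective_resolution R N P" "csup P - hsup P = ereal (real t)"
proof -
  obtain enc :: "(nat set \<Rightarrow> 'a) \<Rightarrow> ('a + 'a set) list" where
    "\<And>i. inj_on enc (carrier (obj (koszul R xs) i))"
    by (rule koszul_encoding) blast
  then have inj: "inj_on (\<lambda>f. Inr (enc f) :: 'u + ('a + 'a set) list) (carrier (obj (koszul R xs) i))" for i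
    by (auto simp: inj_on_def)
  let ?P = "transport_complex (\<lambda>f. Inr (enc f) :: 'u + ('a + 'a set) list) (koszul R xs)"
  have z: "zero_mod (obj ?P i) \<longleftrightarrow> zero_mod (obj (koszul R xs) i)" for i
    unfolding transport_obj[OF CK inj] by (rule transport_zero_mod[OF chain_complexD(1)[OF CK] inj])
  have one: "\<one>\<^bsub>R\<^esub> \<noteq> \<zero>\<^bsub>R\<^esub>"
    using proper ideal.one_imp_carrier[OF I] additive_subgroup.zero_closed[OF ideal.axioms(1)[OF I]] by auto
  have "free_gen R {..<length xs} \<in> carrier (obj (koszul R xs) (int (length xs)))"
    unfolding koszul_obj by (rule free_gen_closed[OF R]) simp
  moreover have "free_gen R {..<length xs} \<noteq> \<zero>\<^bsub>obj (koszul R xs) (int (length xs))\<^esub>"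
    using one by (auto simp: koszul_obj free_mod_def free_gen_def fun_eq_iff)
  ultimately have nz: "\<not> zero_mod (obj (koszul R xs) (int (length xs)))" by (auto simp: zero_mod_def)
  show thesis
  proof (rule that[of ?P])
    have "bounded_above ?P"
      unfolding bounded_above_def z by (intro exI[of _ "int (length xs)"] allI impI koszul_zero_obj[OF R]) simp
    then show "finite_quasi_projective_resolution R N ?P"
      unfolding finite_quasi_projective_resolution_def
      by (intro conjI transport_quasi_projective_resolution[OF qpr N inj])
    have "csup ?P = ereal (of_int (int (length xs)))"
      by (rule csup_eqI) (simp_all add: z nz koszul_zero_obj[OF R])
    moreover have "hsup ?P = ereal (of_int (int (length xs) - int t))"
      by (rule hsup_eqI[OF transport_chain_complex[OF CK inj]])
        (simp_all add: transport_exact[OF CK inj] exK nexK)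
    ultimately show "csup ?P - hsup ?P = ereal (real t)" by simp
  qed
qed

text \<open>The value does not depend on \<open>'u\<close>: the lower bound holds for complexes
  carried by any type, and the bound is attained in the other summand.\<close>

lemma qpd_eq_grade: "qpd TYPE('u) R N = ereal_of_enat (grade R I (regular_mod R))"
proof -
  obtain t where t: "grade R I (regular_mod R) = enat t"
    "\<And>i. int (length xs) - int t < i \<Longrightarrow> exact_at (koszul R xs) i"
    "\<not> exact_at (koszul R xs) (int (length xs) - int t)"
    by (rule grade_koszul) blast
  obtain P :: "('a, 'u + ('a + 'a set) list) mod_complex"
    where P: "finite_quasi_projective_resolution R N P" "csup P - hsup P = ereal (real t)"
    by (rule qpd_attained[OF t(2,3)])
  have "qpd TYPE('u) R N = ereal (real t)"
    unfolding qpd_def if_not_P[OF N_nonzero]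
  proof (rule antisym)
    show "Inf {csup P - hsup P | P :: ('a, 'u + ('a + 'a set) list) mod_complex.
        finite_quasi_projective_resolution R N P} \<le> ereal (real t)"
      unfolding P(2)[symmetric] by (rule Inf_lower) (use P(1) in blast)
    show "ereal (real t) \<le> Inf {csup P - hsup P | P :: ('a, 'u + ('a + 'a set) list) mod_complex.
        finite_quasi_projective_resolution R N P}"
      by (rule Inf_greatest) (use qpd_lower_bound[OF _ t(2)] in blast)
  qed
  with t(1) show ?thesis by simp
qed

text \<open>The number \<open>c\<close> enters twice. For Ext into \<open>M\<close> it makes the
  tensored Koszul complex exact in high degrees, and for the homology of the Koszul complex itself
  it limits how far back the recursion reaches. This is why \<open>g\<close> is a minimum of two
  grades.\<close>

lemma tor_rigidity:
  fixes M :: "('a, 'm) module"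
  assumes M: "module R M" and ext: "\<And>j. j < c \<Longrightarrow> zero_mod (Ext R j N M)"
    and exK: "\<And>i. int (length xs) - int c < i \<Longrightarrow> exact_at (koszul R xs) i"
    and n: "n \<ge> 1" and tor: "\<And>i. n \<le> i \<Longrightarrow> i + c \<le> length xs + n \<Longrightarrow> zero_mod (Tor R i N M)"
  shows "n \<le> i \<Longrightarrow> zero_mod (Tor R i N M)"
proof (induction i rule: less_induct)
  case (less i)
  show ?case
  proof (cases "i + c \<le> length xs + n")
    case True
    with less.prems show ?thesis by (rule tor)
  next
    case False
    obtain a where a: "\<And>i. homology_rank R N (koszul R xs) i (a i)"
      "\<And>i. a i \<noteq> 0 \<Longrightarrow> \<not> exact_at (koszul R xs) i" "\<And>i. a i \<noteq> 0 \<Longrightarrow> 0 \<le> i" "finite {i. a i \<noteq> 0}" "a 0 > 0"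
      by (rule koszul_rank) blast
    obtain enc :: "(nat set \<Rightarrow> 'a) \<Rightarrow> ('a + 'a set) list" where
      inj: "\<And>i. inj_on enc (carrier (obj (koszul R xs) i))"
      by (rule koszul_encoding) blast
    let ?V = "transport_complex enc (koszul R xs)"
    note V = transport_projective_complex[OF PK inj] and rV = homology_rank_transport[OF CK inj a(1)]
    have "tor_vanishes R M (int i - 0) Q"
    proof (rule vanishing_theory.vanishing_of_resolution[OF tor_vanishing_theory[OF M] resQ N V rV a(4) a(5)])
      have "exact_at (koszul_on R xs M) (int i)"
        by (rule exact_of_ext(1)[OF M ext, where t = c]) (use False n in linarith)+
      then show "tor_vanishes R M (int i) ?V"
        unfolding tor_vanishes_transport[OF CK inj M] by (rule tor_vanishes_koszul[OF M xsR CK])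
      show "a q = 0" if "q < 0" for q using a(3)[of q] that by (cases "a q = 0") auto
      fix q assume q: "a q \<noteq> 0"
      \<comment> \<open>\<open>False\<close> means \<open>i \<ge> length xs - c + n + 1\<close>.
        With \<open>q\<close> at most \<open>length xs - c\<close>, the degree
        \<open>i - 1 - q\<close> is still at least \<open>n\<close>, with nothing to spare.\<close>
      have "q \<le> int (length xs) - int c" using a(2)[OF q] exK[of q] by linarith
      with a(3)[OF q] False have "n \<le> nat (int i - 1 - q)" "nat (int i - 1 - q) < i"
        and eq: "int (nat (int i - 1 - q)) = int i - 1 - q"
        using n by linarith+
      then have "zero_mod (Tor R (nat (int i - 1 - q)) N M)" by (intro less.IH)
      then show "tor_vanishes R M (int i - 1 - q) Q"
        by (simp only: Tor_def tensor_complex_exact_iff[OF complexQ M] eq)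
    qed
    then show ?thesis by (simp add: Tor_def tensor_complex_exact_iff[OF complexQ M])
  qed
qed

end

theorem theorem7p4:
  fixes R :: "('a, 'r) ring_scheme"
    and I :: "'a set"
    and xs :: "'a list"
    and M :: "('a, 'm) module"
    and n e :: nat
    and g :: enat
  assumes "cring R" and "noetherian_ring R"
    and "FKH_ideal R I"
    and "generates_ideal R xs I" and "length xs = e"
    and "quasi_projective_resolution R (cyclic_mod R I) (koszul R xs)"
    and "module R M"
    and "n \<ge> 1"
    and "g = min (grade R I (regular_mod R)) (grade R I M)"
  shows "qpd TYPE('u) R (cyclic_mod R I) = ereal_of_enat (grade R I (regular_mod R)) \<and>
    ((\<forall>i. n \<le> i \<and> ereal (real i) \<le> ereal (real e) - ereal_of_enat g + ereal (real n) \<longrightarrow>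
           zero_mod (Tor R i (cyclic_mod R I) M)) \<longrightarrow>
     (\<forall>i\<ge>n. zero_mod (Tor R i (cyclic_mod R I) M)))"
proof -
  have I: "ideal I R" "I \<noteq> carrier R" using assms(3) by (auto simp: FKH_ideal_def)
  obtain t where t: "grade R I (regular_mod R) = enat t"
    "\<And>i. int (length xs) - int t < i \<Longrightarrow> exact_at (koszul R xs) i"
    by (rule grade_koszul[OF assms(1) I assms(4,6)]) blast
  \<comment> \<open>The grade of \<open>I\<close> is finite by \<open>grade_koszul\<close>, so the
    minimum \<open>g\<close> is finite even if \<open>grade R I M\<close> is infinite.\<close>
  have "g \<le> enat t" by (simp add: assms(9) t(1))
  then obtain c where c: "g = enat c" "c \<le> t" by (cases g) auto
  have ext: "zero_mod (Ext R j (cyclic_mod R I) M)" if "j < c" for j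
    by (rule ext_below_grade) (use that c(1) assms(9) in \<open>auto simp: min_def split: if_splits intro: less_le_trans[of _ "enat c"]\<close>)
  have exK: "exact_at (koszul R xs) i" if "int (length xs) - int c < i" for i
    by (rule t(2)) (use that c(2) in linarith)
  show ?thesis
  proof (intro conjI impI allI)
    show "qpd TYPE('u) R (cyclic_mod R I) = ereal_of_enat (grade R I (regular_mod R))"
      by (rule qpd_eq_grade[OF assms(1) I assms(4,6)])
    fix i assume tor: "\<forall>i. n \<le> i \<and> ereal (real i) \<le> ereal (real e) - ereal_of_enat g + ereal (real n) \<longrightarrow>
           zero_mod (Tor R i (cyclic_mod R I) M)" and i: "n \<le> i"
    show "zero_mod (Tor R i (cyclic_mod R I) M)"
    proof (rule tor_rigidity[OF assms(1) I assms(4,6,7) ext exK assms(8) _ i])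
      fix k assume k: "n \<le> k" "k + c \<le> length xs + n"
      then have "ereal (real k) \<le> ereal (real e) - ereal_of_enat g + ereal (real n)"
        by (simp add: c(1) assms(5))
      with tor k(1) show "zero_mod (Tor R k (cyclic_mod R I) M)" by blast
    qed
  qed
qed

end
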